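(* There is a unique strict morphism of right $\mathcal{OS}(q,q^{m-2n})$-modules $\mathbf{R}_{\mathcal{DS}}\colon\mathcal{DS}(q,q^{m-2n})\to \mathrm{U}^\imath_\sigma\text{-tmod}$ such that $$\mathbf 1\mapsto\mathrm{Res}(\mathrm{triv}),\qquad \tau\mapsto\varphi,\qquad\bar\tau\mapsto\varphi^{-1}.$$
   Context: Ground field $k=\mathbb{C}(q)$, $q$ an indeterminate; fix $m,n\in\mathbb{N}$ (nonnegative integers). Composition is written right to left. **Quantum superalgebra.** $I_V=\{1-2n,\dots,m\}$, $I=\{1-2n,\dots,m-1\}$; $p(i)=1$ if $i\le0$, $p(i)=0$ if $i>0$. $P=\bigoplus_{i\in I_V}\mathbb{Z}\epsilon_i$, $P^\vee=\bigoplus\mathbb{Z}\epsilon_i^\vee$, $\langle\epsilon_i^\vee,\epsilon_j\rangle=\delta_{i,j}$; $\alpha_i=\epsilon_i-\epsilon_{i+1}$, $h_i=\epsilon_i^\vee-(-1)^{\delta_{i,0}}\epsilon_{i+1}^\vee$, $a_{ij}=\langle h_i,\alpha_j\rangle$ ($i,j\in I$), $Y=\sum_i\mathbb{Z}h_i$. $d_i=1$ for $i>0$, $d_i=-1$ for $i\le0$, $q_i=q^{d_i}$, $K_i=K_{d_ih_i}$, $[2]=q+q^{-1}$. $[X,Y]_a=XY-(-1)^{\bar X\bar Y}aYX$, $[X,Y]=[X,Y]_1$. $\mathrm{U}=U_q(\mathfrak{gl}(m|2n))$ is the superalgebra generated by $E_i,F_i$ ($i\in I$, odd iff $i=0$)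 and even $K_h$ ($h\in Y$) with relations $K_0=1$, $K_hK_{h'}=K_{h+h'}$, $K_hE_i=q^{\langle h,\alpha_i\rangle}E_iK_h$, $K_hF_i=q^{-\langle h,\alpha_i\rangle}F_iK_h$, $[E_i,F_j]=\delta_{i,j}(K_i-K_i^{-1})/(q_i-q_i^{-1})$; $[E_i,E_j]=[F_i,F_j]=0$ if $a_{ij}=0$; $E_i^2E_j-[2]E_iE_jE_i+E_jE_i^2=0$ and the same for $F$, if $|a_{ij}|=1$, $i\ne0$; $[[[E_{-1},E_0]_{q_0},E_1]_{q_1},E_0]=0$ and the same for $F$ whenever $-1,0,1\in I$. Coproduct: $\Delta(E_i)=E_i\otimes1+K_i\otimes E_i$, $\Delta(F_i)=F_i\otimes K_i^{-1}+1\otimes F_i$, $\Delta(K_h)=K_h\otimes K_h$; counit $E_i,F_i\mapsto0$, $K_h\mapsto1$. $\mathrm{U}_\sigma$ is obtained by adjoining an even element $\sigma$ with $\sigma^2=1$, $\sigma E_i\sigma=sE_i$, $\sigma F_i\sigma=sF_i$ with $s=-1$ if $i=m-1\ge0$ and $s=1$ otherwise, $\sigma K_h\sigma=K_h$, $\Delta(\sigma)=\sigma\otimes\sigma$, counit $\sigma\mapsto1$. Tensor products of modules use the super sign rule. **Natural module and dual.** $V^\pm$ has basis $v_j^\pm$ ($j\in I_V$), of parity $p(j)$, with $E_iv_j^+=\delta_{i+1,j}v_{j-1}^+$, $F_iv_j^+=\delta_{i,j}v_{j+1}^+$, $K_hv_j^+=q^{\langle h,\epsilon_j\rangle}v_j^+$;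 $E_iv_j^-=\delta_{i,j}v_{j+1}^-$, $F_iv_j^-=\delta_{i+1,j}(-1)^{\delta_{i,0}}v_{j-1}^-$, $K_hv_j^-=q^{-\langle h,\epsilon_j\rangle}v_j^-$; $\sigma v_j^\pm=-v_j^\pm$ if $j=m>0$, and $\sigma v_j^\pm=v_j^\pm$ otherwise. $\mathrm{triv}$ is the trivial module. Module maps: $\mathrm{ev}^+(v_i^+\otimes v_j^-)=\delta_{i,j}(-q)^{|i|}$, $\mathrm{ev}^-(v_i^-\otimes v_j^+)=\delta_{i,j}(-1)^{i+p(i)}q^{m+2n-|i-1|}$, $\mathrm{coev}_+(1)=\sum_i(-q)^{-|i|}v_i^-\otimes v_i^+$, $\mathrm{coev}_-(1)=\sum_i(-1)^{i+p(i)}q^{|i-1|-m-2n}v_i^+\otimes v_i^-$, $T_{++}(v_i^+\otimes v_j^+)=(-1)^{p(i)p(j)}q^{p(i,j)}v_j^+\otimes v_i^++\delta_{i<j}(q-q^{-1})v_i^+\otimes v_j^+$, where $p(i,j)=\delta_{i,j}(1-2p(i))$ and $\delta_{i<j}$ is $1$ if $i<j$, else $0$. $\mathrm{U}_\sigma$-tmod is the full subcategory of $\mathrm{U}_\sigma$-modules on finite direct sums of summands of tensor products of $V^+$ and $V^-$. **Coideal subalgebra.** $I_\bullet=\{1-2a:1\le a\le n\}$, $I_\circ=I\setminus I_\bullet$. Fix $\varsigma_i\in\mathbb{C}(q)^\times$, $i\in I_\circ$. $\mathrm{U}^\imath\subseteq\mathrm{U}$ is the subalgebra generated by $B_i=F_i+\varsigma_iE_iK_i^{-1}$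 ($1\le i\le m-1$), $B_0=F_0+\varsigma_0(E_{-1}E_0-qE_0E_{-1})K_0^{-1}$ (when $0\in I$; here $K_0$ is $K_i$ for $i=0$), $B_{2k}=F_{2k}+\varsigma_{2k}(E_{2k-1}E_{2k+1}E_{2k}-qE_{2k-1}E_{2k}E_{2k+1}-qE_{2k+1}E_{2k}E_{2k-1}+q^2E_{2k}E_{2k+1}E_{2k-1})K_{2k}^{-1}$ ($1-n\le k\le-1$), and $E_j,F_j,K_j^{\pm1}$ ($j\in I_\bullet$). $\mathrm{U}^\imath_\sigma$ is the subalgebra of $\mathrm{U}_\sigma$ generated by $\mathrm{U}^\imath$ and $\sigma$; it is a right coideal subalgebra: $\Delta(\mathrm{U}^\imath_\sigma)\subseteq\mathrm{U}^\imath_\sigma\otimes\mathrm{U}_\sigma$. $\mathrm{U}^\imath_\sigma$-tmod is the full subcategory of $\mathrm{U}^\imath_\sigma$-modules whose objects are restrictions $\mathrm{Res}(M)$ of $M\in\mathrm{U}_\sigma$-tmod; it is a right module category over $\mathrm{U}_\sigma$-tmod via $\otimes_k$ and $\Delta$. **The isomorphism $\varphi$.** $\phi(i)=i$ for $i>0$; $\phi(i)=i-1$ for $i\in\{0,-2,\dots,2-2n\}$; $\phi(i)=i+1$ for $i\in\{-1,-3,\dots,1-2n\}$. $\tilde\varsigma_i=\prod_{k=1}^{i-1}(q\varsigma_k)^{-1}$ for $i>0$ and $\tilde\varsigma_i=\prod_{k=\lfloor(i+1)/2\rfloor}^0(-q\varsigma_{2k})$ for $i\le0$. $\varphi\colon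 V^-\to V^+$, $\varphi(v_i^-)=\tilde\varsigma_iv_{\phi(i)}^+$, is an isomorphism of $\mathrm{U}^\imath_\sigma$-modules. **Oriented skein category** (with $t=q^{m-2n}$, $z=q-q^{-1}$, $\delta=(t-t^{-1})/(q-q^{-1})$). $\mathcal{OS}(q,t)$ is the strict $k$-linear monoidal category generated by objects $\uparrow,\downarrow$ and morphisms $X_+,X_-\colon\uparrow\uparrow\to\uparrow\uparrow$, $c\colon\mathbf 1\to\downarrow\uparrow$, $d\colon\uparrow\downarrow\to\mathbf 1$, $c'\colon\mathbf 1\to\uparrow\downarrow$, $d'\colon\downarrow\uparrow\to\mathbf 1$, subject to: $X_+X_-=1=X_-X_+$; $(X_+\otimes1_\uparrow)(1_\uparrow\otimes X_+)(X_+\otimes1_\uparrow)=(1_\uparrow\otimes X_+)(X_+\otimes1_\uparrow)(1_\uparrow\otimes X_+)$; $L_-R_+=1_{\uparrow\downarrow}$; $R_+L_-=1_{\downarrow\uparrow}$; $X_+-X_-=z1_{\uparrow\uparrow}$; $(d'\otimes1_\uparrow)(1_\downarrow\otimes X_+)(c\otimes1_\uparrow)=t1_\uparrow=(1_\uparrow\otimes d)(X_+\otimes1_\downarrow)(1_\uparrow\otimes c')$; $dc'=\delta1_{\mathbf 1}$; $(d\otimes1_\uparrow)(1_\uparrow\otimes c)=1_\uparrow$; $(1_\downarrow\otimes d)(c\otimes1_\downarrow)=1_\downarrow$; where $R_\pm=(1_{\downarrow\uparrow}\otimes d)(1_\downarrow\otimes X_\pm\otimes1_\downarrow)(c\otimes1_{\uparrow\downarrow})$,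 $L_\pm=(d'\otimes1_{\uparrow\downarrow})(1_\downarrow\otimes X_\pm\otimes1_\downarrow)(1_{\downarrow\uparrow}\otimes c')$; put $D_\pm=(1_{\downarrow\downarrow}\otimes d)(1_\downarrow\otimes R_\pm\otimes1_\downarrow)(c\otimes1_{\downarrow\downarrow})$. There is a $k$-linear monoidal functor $\mathbf{R}_{\mathcal{OS}}\colon\mathcal{OS}(q,q^{m-2n})\to\mathrm{U}_\sigma$-tmod with $\uparrow\mapsto V^+$, $\downarrow\mapsto V^-$, $X_\pm\mapsto T_{++}^{\pm1}$, $d\mapsto\mathrm{ev}^+$, $c\mapsto\mathrm{coev}_+$, $d'\mapsto\mathrm{ev}^-$, $c'\mapsto\mathrm{coev}_-$. Through it, $\mathrm{U}^\imath_\sigma$-tmod is a right $\mathcal{OS}(q,q^{m-2n})$-module: $M\otimes C:=M\otimes\mathbf{R}_{\mathcal{OS}}(C)$. **Disoriented skein category.** $\mathcal{DS}(q,t)$ is the strict right $\mathcal{OS}(q,t)$-module generated by morphisms $\tau\colon\downarrow\to\uparrow$, $\bar\tau\colon\uparrow\to\downarrow$: its objects are the words in $\uparrow,\downarrow$; its morphisms are generated, as a $k$-linear category, by the morphisms of $\mathcal{OS}(q,t)$ and morphisms $f\otimes g$ with $f\in\{\tau,\bar\tau\}$, $g\in\mathrm{Mor}(\mathcal{OS}(q,t))$, subject to linearity in $g$, to $(1_Y\otimes g)\circ(f\otimes h)=f\otimes(g\circ h)=(f\otimes g)\circ(1_X\otimes h)$ for $f\colon X\to Y$, and to the following relations and everything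 obtained from them by composition and the right action: $\tau\bar\tau=1_\uparrow$; $\bar\tau\tau=1_\downarrow$; $(\tau\otimes1_\uparrow)R_-(\tau\otimes1_\downarrow)D_+=X_+(\tau\otimes1_\uparrow)R_-(\tau\otimes1_\downarrow)$; $d'(\bar\tau\otimes1_\uparrow)X_+=q\,d'(\bar\tau\otimes1_\uparrow)$; $X_+(\tau\otimes1_\uparrow)c=q(\tau\otimes1_\uparrow)c$. A strict morphism of right modules over $\mathcal{C}$ is a $k$-linear functor $\mathbf H$ with $\mathbf H(M\otimes C)=\mathbf H(M)\otimes C$ on objects and morphisms. *)

theory Defs
  imports
    "Jordan_Normal_Form.Matrix"
    "HOL-Library.Poly_Mapping"
    "HOL-Computational_Algebra.Polynomial"
    "HOL-Computational_Algebra.Fraction_Field"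
    "HOL-Algebra.QuotRing"
    "HOL-Algebra.Generated_Rings"
begin

section \<open>The ground field\<close>

type_synonym kk = "complex poly fract"

definition qq :: kk where
  "qq = Fract [:0, 1:] 1"


section \<open>The quantum superalgebra\<close>

text \<open>With lists under concatenation as the free monoid, \<open>ugen list \<Rightarrow>\<^sub>0 kk\<close> is the free unital
  associative algebra on the type of generators.\<close>

instantiation list :: (type) monoid_add
begin
definition zero_list :: "'a list" where "zero_list = []"
definition plus_list :: "'a list \<Rightarrow> 'a list \<Rightarrow> 'a list" where "plus_list = (@)"
instance by standard (simp_all add: zero_list_def plus_list_def)
end

text \<open>An element of the coweight lattice is given by its coefficients with respect to the basis
  \<open>\<epsilon>\<^sub>i\<^sup>\<or>\<close>, so that its pairing with \<open>\<epsilon>\<^sub>j\<close> is its value at \<open>j\<close>.\<close>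

type_synonym coweight = "int \<Rightarrow> int"

datatype ugen = GE int | GF int | GK coweight | GSigma

type_synonym falg = "ugen list \<Rightarrow>\<^sub>0 kk"

definition gen :: "ugen \<Rightarrow> falg" where
  "gen g = Poly_Mapping.single [g] 1"

definition scal :: "kk \<Rightarrow> falg" where
  "scal c = Poly_Mapping.single [] c"

definition free_alg :: "ugen set \<Rightarrow> falg ring" where
  "free_alg G = \<lparr>carrier = {x. Poly_Mapping.keys x \<subseteq> lists G}, monoid.mult = (*), one = 1,
     ring.zero = 0, add = (+)\<rparr>"

definition I_V :: "nat \<Rightarrow> nat \<Rightarrow> int set" where
  "I_V m n = {1 - 2 * int n .. int m}"

definition I_roots :: "nat \<Rightarrow> nat \<Rightarrow> int set" where
  "I_roots m n = {1 - 2 * int n .. int m - 1}"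

definition I_bullet :: "nat \<Rightarrow> int set" where
  "I_bullet n = {1 - 2 * a | a. 1 \<le> a \<and> a \<le> int n}"

definition I_circ :: "nat \<Rightarrow> nat \<Rightarrow> int set" where
  "I_circ m n = I_roots m n - I_bullet n"

definition hh :: "int \<Rightarrow> coweight" where
  "hh i = (\<lambda>j. (if j = i then 1 else 0) - (if i = 0 then -1 else 1) * (if j = i + 1 then 1 else 0))"

definition pair_alpha :: "coweight \<Rightarrow> int \<Rightarrow> int" where
  "pair_alpha h i = h i - h (i + 1)"

definition cartan :: "int \<Rightarrow> int \<Rightarrow> int" where
  "cartan i j = pair_alpha (hh i) j"

definition lattice_Y :: "nat \<Rightarrow> nat \<Rightarrow> coweight set" where
  "lattice_Y m n = {(\<lambda>j. \<Sum>i\<in>I_roots m n. c i * hh i j) | c. True}"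

definition dd :: "int \<Rightarrow> int" where
  "dd i = (if i > 0 then 1 else -1)"

definition q_i :: "int \<Rightarrow> kk" where
  "q_i i = qq powi dd i"

abbreviation "eE i \<equiv> gen (GE i)"
abbreviation "eF i \<equiv> gen (GF i)"
abbreviation "eK h \<equiv> gen (GK h)"
abbreviation "eSigma \<equiv> gen GSigma"

text \<open>\<open>eKi i\<close> and \<open>eKi' i\<close> are \<open>K\<^sub>i = K_{d\<^sub>i h\<^sub>i}\<close> and its inverse.  In particular \<open>eKi 0\<close> is not the
  element \<open>K\<^sub>h\<close> for \<open>h = 0\<close>.\<close>

definition eKi :: "int \<Rightarrow> falg" where
  "eKi i = eK (\<lambda>j. dd i * hh i j)"

definition eKi' :: "int \<Rightarrow> falg" where
  "eKi' i = eK (\<lambda>j. - dd i * hh i j)"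

text \<open>\<open>scomm s t a x y\<close> is \<open>[x, y]\<^sub>a\<close> for \<open>x\<close>, \<open>y\<close> homogeneous, odd iff \<open>s\<close> resp. \<open>t\<close>.\<close>

definition scomm :: "bool \<Rightarrow> bool \<Rightarrow> kk \<Rightarrow> falg \<Rightarrow> falg \<Rightarrow> falg" where
  "scomm s t a x y = x * y - scal ((if s \<and> t then -1 else 1) * a) * y * x"

definition deg4 :: "(int \<Rightarrow> falg) \<Rightarrow> falg" where
  "deg4 X = scomm True True 1
     (scomm True False (q_i 1) (scomm False True (q_i 0) (X (-1)) (X 0)) (X 1)) (X 0)"

definition serre :: "falg \<Rightarrow> falg \<Rightarrow> falg" where
  "serre x y = x * x * y - scal (qq + inverse qq) * x * y * x + y * x * x"

definition U_gens :: "nat \<Rightarrow> nat \<Rightarrow> ugen set" where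
  "U_gens m n = GE ` I_roots m n \<union> GF ` I_roots m n \<union> GK ` lattice_Y m n"

text \<open>An element \<open>x\<close> of the following two sets stands for the relation \<open>x = 0\<close>.\<close>

definition U_relators :: "nat \<Rightarrow> nat \<Rightarrow> falg set" where
  "U_relators m n =
     {eK (\<lambda>j. 0) - 1}
     \<union> {eK h * eK h' - eK (\<lambda>j. h j + h' j) | h h'. h \<in> lattice_Y m n \<and> h' \<in> lattice_Y m n}
     \<union> {eK h * eE i - scal (qq powi pair_alpha h i) * eE i * eK h
          | h i. h \<in> lattice_Y m n \<and> i \<in> I_roots m n}
     \<union> {eK h * eF i - scal (qq powi (- pair_alpha h i)) * eF i * eK h
          | h i. h \<in> lattice_Y m n \<and> i \<in> I_roots m n}
     \<union> {scomm (i = 0) (j = 0) 1 (eE i) (eF j)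
          - (if i = j then scal (inverse (q_i i - inverse (q_i i))) * (eKi i - eKi' i) else 0)
          | i j. i \<in> I_roots m n \<and> j \<in> I_roots m n}
     \<union> {scomm (i = 0) (j = 0) 1 (X i) (X j)
          | X i j. X \<in> {\<lambda>i. eE i, \<lambda>i. eF i} \<and> i \<in> I_roots m n \<and> j \<in> I_roots m n \<and> cartan i j = 0}
     \<union> {serre (X i) (X j)
          | X i j. X \<in> {\<lambda>i. eE i, \<lambda>i. eF i} \<and> i \<in> I_roots m n \<and> j \<in> I_roots m n
              \<and> \<bar>cartan i j\<bar> = 1 \<and> i \<noteq> 0}
     \<union> {deg4 X | X. X \<in> {\<lambda>i. eE i, \<lambda>i. eF i} \<and> {-1, 0, 1} \<subseteq> I_roots m n}"

definition sigma_sign :: "nat \<Rightarrow> int \<Rightarrow> kk" where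
  "sigma_sign m i = (if i = int m - 1 \<and> i \<ge> 0 then -1 else 1)"

definition sigma_relators :: "nat \<Rightarrow> nat \<Rightarrow> falg set" where
  "sigma_relators m n =
     {eSigma * eSigma - 1}
     \<union> {eSigma * eE i * eSigma - scal (sigma_sign m i) * eE i | i. i \<in> I_roots m n}
     \<union> {eSigma * eF i * eSigma - scal (sigma_sign m i) * eF i | i. i \<in> I_roots m n}
     \<union> {eSigma * eK h * eSigma - eK h | h. h \<in> lattice_Y m n}"

definition free_sigma :: "nat \<Rightarrow> nat \<Rightarrow> falg ring" where
  "free_sigma m n = free_alg (insert GSigma (U_gens m n))"

definition ideal_sigma :: "nat \<Rightarrow> nat \<Rightarrow> falg set" where
  "ideal_sigma m n = genideal (free_sigma m n) (U_relators m n \<union> sigma_relators m n)"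

definition U_sigma :: "nat \<Rightarrow> nat \<Rightarrow> falg set ring" where
  "U_sigma m n = free_sigma m n Quot ideal_sigma m n"

definition ucls :: "nat \<Rightarrow> nat \<Rightarrow> falg \<Rightarrow> falg set" where
  "ucls m n x = ideal_sigma m n +>\<^bsub>free_sigma m n\<^esub> x"

definition word_odd :: "ugen list \<Rightarrow> bool" where
  "word_odd w = odd (length (filter (\<lambda>g. g \<in> {GE 0, GF 0}) w))"

text \<open>The even (\<open>s = False\<close>) or odd (\<open>s = True\<close>) part.\<close>

definition U_homog :: "nat \<Rightarrow> nat \<Rightarrow> bool \<Rightarrow> falg set set" where
  "U_homog m n s = ucls m n `
     {x \<in> carrier (free_sigma m n). \<forall>w\<in>Poly_Mapping.keys x. word_odd w = s}"

text \<open>The coproduct of a generator, as a list of elementary tensors to be added up.\<close>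

fun comult :: "ugen \<Rightarrow> (falg \<times> falg) list" where
  "comult (GE i) = [(eE i, 1), (eKi i, eE i)]"
| "comult (GF i) = [(eF i, eKi' i), (1, eF i)]"
| "comult (GK h) = [(eK h, eK h)]"
| "comult GSigma = [(eSigma, eSigma)]"

fun counit :: "ugen \<Rightarrow> kk" where
  "counit (GE i) = 0"
| "counit (GF i) = 0"
| "counit (GK h) = 1"
| "counit GSigma = 1"


section \<open>The coideal subalgebra\<close>

definition B_gen :: "(int \<Rightarrow> kk) \<Rightarrow> int \<Rightarrow> falg" where
  "B_gen vs i =
     (if i > 0 then eF i + scal (vs i) * eE i * eKi' i
      else if i = 0 then
        eF 0 + scal (vs 0) * (eE (-1) * eE 0 - scal qq * eE 0 * eE (-1)) * eKi' 0
      else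
        eF i + scal (vs i) *
          (eE (i - 1) * eE (i + 1) * eE i - scal qq * eE (i - 1) * eE i * eE (i + 1)
           - scal qq * eE (i + 1) * eE i * eE (i - 1)
           + scal (qq\<^sup>2) * eE i * eE (i + 1) * eE (i - 1)) * eKi' i)"

text \<open>\<open>I_circ m n\<close> consists of the positive elements of \<open>I\<close>, of \<open>0\<close> if it lies in \<open>I\<close>, and of
  the \<open>2k\<close> with \<open>1 - n \<le> k \<le> -1\<close>.\<close>

definition Ui_gens :: "nat \<Rightarrow> nat \<Rightarrow> (int \<Rightarrow> kk) \<Rightarrow> falg set" where
  "Ui_gens m n vs = B_gen vs ` I_circ m n
     \<union> (\<Union>j\<in>I_bullet n. {eE j, eF j, eKi j, eKi' j})"

text \<open>The subalgebra generated by a set is the subring generated by it and the scalars.\<close>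

definition Ui_sigma :: "nat \<Rightarrow> nat \<Rightarrow> (int \<Rightarrow> kk) \<Rightarrow> falg set set" where
  "Ui_sigma m n vs =
     generate_ring (U_sigma m n) (ucls m n ` (range scal \<union> Ui_gens m n vs \<union> {eSigma}))"


section \<open>Modules\<close>

text \<open>To have strict tensor products, all supermodules are given in coordinates: the underlying
  superspace is \<open>kk\<^sup>d\<close> with its standard basis, \<open>mpar\<close> is the list of the parities of the \<open>d\<close> basis
  vectors (\<open>True\<close> for odd), and morphisms are matrices.  The basis of a tensor product is ordered
  lexicographically, which makes the tensor product strictly associative and unital.  The action
  \<open>mact\<close> is a function on the algebra \<open>S\<close> (either the whole of \<open>U_sigma\<close> or the coideal subalgebra)
  and is \<open>undefined\<close> elsewhere.\<close>

record smod =
  mpar :: "bool list"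
  mact :: "falg set \<Rightarrow> kk mat"

definition mdim :: "smod \<Rightarrow> nat" where
  "mdim M = length (mpar M)"

definition is_module :: "nat \<Rightarrow> nat \<Rightarrow> falg set set \<Rightarrow> smod \<Rightarrow> bool" where
  "is_module m n S M \<longleftrightarrow>
     mact M \<in> S \<rightarrow>\<^sub>E carrier_mat (mdim M) (mdim M)
     \<and> (\<forall>x\<in>S. \<forall>y\<in>S. mact M (x \<oplus>\<^bsub>U_sigma m n\<^esub> y) = mact M x + mact M y)
     \<and> (\<forall>x\<in>S. \<forall>y\<in>S. mact M (x \<otimes>\<^bsub>U_sigma m n\<^esub> y) = mact M x * mact M y)
     \<and> (\<forall>c. mact M (ucls m n (scal c)) = c \<cdot>\<^sub>m 1\<^sub>m (mdim M))
     \<and> (\<forall>s. \<forall>x \<in> S \<inter> U_homog m n s. \<forall>i<mdim M. \<forall>j<mdim M.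
          mact M x $$ (i, j) \<noteq> 0 \<longrightarrow> mpar M ! i = (mpar M ! j \<noteq> s))"

text \<open>Morphisms are the even maps commuting with the action of \<open>S\<close>.\<close>

definition mod_hom :: "falg set set \<Rightarrow> smod \<Rightarrow> smod \<Rightarrow> kk mat set" where
  "mod_hom S M N = {f \<in> carrier_mat (mdim N) (mdim M).
     (\<forall>i<mdim N. \<forall>j<mdim M. f $$ (i, j) \<noteq> 0 \<longrightarrow> mpar N ! i = mpar M ! j)
     \<and> (\<forall>x\<in>S. mact N x * f = f * mact M x)}"

definition word_act :: "nat \<Rightarrow> (ugen \<Rightarrow> kk mat) \<Rightarrow> ugen list \<Rightarrow> kk mat" where
  "word_act d A w = foldr (\<lambda>g X. A g * X) w (1\<^sub>m d)"

definition free_act :: "nat \<Rightarrow> (ugen \<Rightarrow> kk mat) \<Rightarrow> falg \<Rightarrow> kk mat" where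
  "free_act d A x =
     mat d d (\<lambda>ij. \<Sum>w\<in>Poly_Mapping.keys x. Poly_Mapping.lookup x w * word_act d A w $$ ij)"

text \<open>The module over \<open>U_sigma\<close> on which the generators act by \<open>A\<close>.  The action of a coset is computed
  on a representative, which is independent of choices when \<open>A\<close> satisfies the relations.\<close>

definition module_of :: "nat \<Rightarrow> nat \<Rightarrow> bool list \<Rightarrow> (ugen \<Rightarrow> kk mat) \<Rightarrow> smod" where
  "module_of m n ps A =
     \<lparr>mpar = ps, mact = (\<lambda>X\<in>carrier (U_sigma m n). free_act (length ps) A (SOME x. x \<in> X))\<rparr>"

text \<open>The tensor product of operators with the super sign rule
  \<open>(A \<otimes> B)(v \<otimes> w) = (-1)^{|B| |v|} A v \<otimes> B w\<close>, where \<open>ps\<close> and \<open>rs\<close> are the parities of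
  the bases of the two factors.\<close>

definition super_kron :: "bool list \<Rightarrow> bool list \<Rightarrow> kk mat \<Rightarrow> kk mat \<Rightarrow> kk mat" where
  "super_kron ps rs A B = (let d = length ps; e = length rs in
     mat (d * e) (d * e) (\<lambda>(x, y).
       (if ps ! (y div e) \<and> rs ! (x mod e) \<noteq> rs ! (y mod e) then -1 else 1)
       * A $$ (x div e, y div e) * B $$ (x mod e, y mod e)))"

definition tensor_mod :: "nat \<Rightarrow> nat \<Rightarrow> smod \<Rightarrow> smod \<Rightarrow> smod" where
  "tensor_mod m n M N =
     module_of m n [p \<noteq> r. p \<leftarrow> mpar M, r \<leftarrow> mpar N]
       (\<lambda>g. foldr (\<lambda>(a, b) X. super_kron (mpar M) (mpar N) (mact M (ucls m n a)) (mact N (ucls m n b)) + X)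
          (comult g) (0\<^sub>m (mdim M * mdim N) (mdim M * mdim N)))"

text \<open>The tensor product of morphisms, on which the sign rule has no effect as they are even.\<close>

definition kron :: "kk mat \<Rightarrow> kk mat \<Rightarrow> kk mat" where
  "kron f g = mat (dim_row f * dim_row g) (dim_col f * dim_col g) (\<lambda>(x, y).
     f $$ (x div dim_row g, y div dim_col g) * g $$ (x mod dim_row g, y mod dim_col g))"

definition triv :: "nat \<Rightarrow> nat \<Rightarrow> smod" where
  "triv m n = module_of m n [False] (\<lambda>g. counit g \<cdot>\<^sub>m 1\<^sub>m 1)"

text \<open>\<open>idx n r\<close> is the element of \<open>I_V\<close> labelling the basis vector number \<open>r\<close>, counted from \<open>0\<close>,
  of the natural module and of its dual.\<close>

definition idx :: "nat \<Rightarrow> nat \<Rightarrow> int" where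
  "idx n r = int r + 1 - 2 * int n"

definition pV :: "int \<Rightarrow> nat" where
  "pV i = (if i \<le> 0 then 1 else 0)"

definition V_par :: "nat \<Rightarrow> nat \<Rightarrow> bool list" where
  "V_par m n = map (\<lambda>r. pV (idx n r) = 1) [0..<m + 2 * n]"

text \<open>\<open>Vplus_coeff m g j k\<close> is the coefficient of \<open>v\<^sub>k\<close> in the image of \<open>v\<^sub>j\<close> under \<open>g\<close>.\<close>

fun Vplus_coeff :: "nat \<Rightarrow> ugen \<Rightarrow> int \<Rightarrow> int \<Rightarrow> kk" where
  "Vplus_coeff m (GE i) j k = (if i + 1 = j \<and> k = j - 1 then 1 else 0)"
| "Vplus_coeff m (GF i) j k = (if i = j \<and> k = j + 1 then 1 else 0)"
| "Vplus_coeff m (GK h) j k = (if k = j then qq powi h j else 0)"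
| "Vplus_coeff m GSigma j k = (if k = j then (if j = int m \<and> m > 0 then -1 else 1) else 0)"

fun Vminus_coeff :: "nat \<Rightarrow> ugen \<Rightarrow> int \<Rightarrow> int \<Rightarrow> kk" where
  "Vminus_coeff m (GE i) j k = (if i = j \<and> k = j + 1 then 1 else 0)"
| "Vminus_coeff m (GF i) j k = (if i + 1 = j \<and> k = j - 1 then (if i = 0 then -1 else 1) else 0)"
| "Vminus_coeff m (GK h) j k = (if k = j then qq powi (- h j) else 0)"
| "Vminus_coeff m GSigma j k = (if k = j then (if j = int m \<and> m > 0 then -1 else 1) else 0)"

definition Vplus :: "nat \<Rightarrow> nat \<Rightarrow> smod" where
  "Vplus m n = module_of m n (V_par m n)
     (\<lambda>g. mat (m + 2 * n) (m + 2 * n) (\<lambda>(r, s). Vplus_coeff m g (idx n s) (idx n r)))"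

definition Vminus :: "nat \<Rightarrow> nat \<Rightarrow> smod" where
  "Vminus m n = module_of m n (V_par m n)
     (\<lambda>g. mat (m + 2 * n) (m + 2 * n) (\<lambda>(r, s). Vminus_coeff m g (idx n s) (idx n r)))"

datatype arrow = Up | Dn

definition V_word :: "nat \<Rightarrow> nat \<Rightarrow> arrow list \<Rightarrow> smod" where
  "V_word m n w = foldr (\<lambda>a M. tensor_mod m n (case a of Up \<Rightarrow> Vplus m n | Dn \<Rightarrow> Vminus m n) M) w (triv m n)"

definition is_summand :: "falg set set \<Rightarrow> smod \<Rightarrow> smod \<Rightarrow> bool" where
  "is_summand S N W \<longleftrightarrow> (\<exists>i\<in>mod_hom S N W. \<exists>p\<in>mod_hom S W N. p * i = 1\<^sub>m (mdim N))"

definition is_direct_sum :: "falg set set \<Rightarrow> smod \<Rightarrow> nat \<Rightarrow> (nat \<Rightarrow> smod) \<Rightarrow> bool" where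
  "is_direct_sum S M r N \<longleftrightarrow> (\<exists>inj prj.
     (\<forall>a<r. inj a \<in> mod_hom S (N a) M \<and> prj a \<in> mod_hom S M (N a))
     \<and> (\<forall>a<r. \<forall>b<r. prj a * inj b = (if a = b then 1\<^sub>m (mdim (N a)) else 0\<^sub>m (mdim (N a)) (mdim (N b))))
     \<and> mat (mdim M) (mdim M) (\<lambda>ij. \<Sum>a<r. (inj a * prj a) $$ ij) = 1\<^sub>m (mdim M))"

definition tmod_objects :: "nat \<Rightarrow> nat \<Rightarrow> smod set" where
  "tmod_objects m n = {M. let S = carrier (U_sigma m n) in is_module m n S M
     \<and> (\<exists>r N. (\<forall>a<r. is_module m n S (N a) \<and> (\<exists>w. is_summand S (N a) (V_word m n w)))
          \<and> is_direct_sum S M r N)}"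

definition Res :: "nat \<Rightarrow> nat \<Rightarrow> (int \<Rightarrow> kk) \<Rightarrow> smod \<Rightarrow> smod" where
  "Res m n vs M = \<lparr>mpar = mpar M, mact = restrict (mact M) (Ui_sigma m n vs)\<rparr>"


section \<open>Linear categories, strict monoidal functors and strict morphisms of right modules\<close>

record ('o, 'm) lincat =
  Ob :: "'o set"
  Hm :: "'o \<Rightarrow> 'o \<Rightarrow> 'm set"
  idn :: "'o \<Rightarrow> 'm"
  cmp :: "'m \<Rightarrow> 'm \<Rightarrow> 'm"
  plus_m :: "'m \<Rightarrow> 'm \<Rightarrow> 'm"
  scale_m :: "kk \<Rightarrow> 'm \<Rightarrow> 'm"

record ('o, 'm) moncat = "('o, 'm) lincat" +
  unit_ob :: 'o
  ten_ob :: "'o \<Rightarrow> 'o \<Rightarrow> 'o"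
  ten_mor :: "'m \<Rightarrow> 'm \<Rightarrow> 'm"

record ('o, 'm, 'c, 'd) modcat = "('o, 'm) lincat" +
  act_ob :: "'o \<Rightarrow> 'c \<Rightarrow> 'o"
  act_mor :: "'m \<Rightarrow> 'd \<Rightarrow> 'm"

definition Mor :: "('o, 'm, 'z) lincat_scheme \<Rightarrow> 'm set" where
  "Mor C = (\<Union>X\<in>Ob C. \<Union>Y\<in>Ob C. Hm C X Y)"

record ('o, 'm, 'p, 'r) fctr =
  on_ob :: "'o \<Rightarrow> 'p"
  on_mor :: "'m \<Rightarrow> 'r"

text \<open>Both components are \<open>undefined\<close> outside the source category, so that functors are equal as soon
  as they agree on its objects and morphisms.\<close>

definition linear_functor ::
  "('o, 'm, 'y) lincat_scheme \<Rightarrow> ('p, 'r, 'z) lincat_scheme \<Rightarrow> ('o, 'm, 'p, 'r) fctr \<Rightarrow> bool" where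
  "linear_functor C D F \<longleftrightarrow>
     on_ob F \<in> Ob C \<rightarrow>\<^sub>E Ob D
     \<and> on_mor F \<in> extensional (Mor C)
     \<and> (\<forall>X\<in>Ob C. \<forall>Y\<in>Ob C. \<forall>f\<in>Hm C X Y. on_mor F f \<in> Hm D (on_ob F X) (on_ob F Y))
     \<and> (\<forall>X\<in>Ob C. on_mor F (idn C X) = idn D (on_ob F X))
     \<and> (\<forall>X\<in>Ob C. \<forall>Y\<in>Ob C. \<forall>Z\<in>Ob C. \<forall>f\<in>Hm C Y Z. \<forall>g\<in>Hm C X Y.
          on_mor F (cmp C f g) = cmp D (on_mor F f) (on_mor F g))
     \<and> (\<forall>X\<in>Ob C. \<forall>Y\<in>Ob C. \<forall>f\<in>Hm C X Y. \<forall>g\<in>Hm C X Y.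
          on_mor F (plus_m C f g) = plus_m D (on_mor F f) (on_mor F g))
     \<and> (\<forall>X\<in>Ob C. \<forall>Y\<in>Ob C. \<forall>c. \<forall>f\<in>Hm C X Y.
          on_mor F (scale_m C c f) = scale_m D c (on_mor F f))"

definition strict_monoidal_functor ::
  "('o, 'm) moncat \<Rightarrow> ('p, 'r) moncat \<Rightarrow> ('o, 'm, 'p, 'r) fctr \<Rightarrow> bool" where
  "strict_monoidal_functor C D F \<longleftrightarrow>
     linear_functor C D F
     \<and> on_ob F (unit_ob C) = unit_ob D
     \<and> (\<forall>X\<in>Ob C. \<forall>Y\<in>Ob C. on_ob F (ten_ob C X Y) = ten_ob D (on_ob F X) (on_ob F Y))
     \<and> (\<forall>f\<in>Mor C. \<forall>g\<in>Mor C. on_mor F (ten_mor C f g) = ten_mor D (on_mor F f) (on_mor F g))"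

definition strict_module_morphism ::
  "('c, 'd) moncat \<Rightarrow> ('o, 'm, 'c, 'd) modcat \<Rightarrow> ('p, 'r, 'c, 'd) modcat
     \<Rightarrow> ('o, 'm, 'p, 'r) fctr \<Rightarrow> bool" where
  "strict_module_morphism A M N H \<longleftrightarrow>
     linear_functor M N H
     \<and> (\<forall>X\<in>Ob M. \<forall>C\<in>Ob A. on_ob H (act_ob M X C) = act_ob N (on_ob H X) C)
     \<and> (\<forall>f\<in>Mor M. \<forall>g\<in>Mor A. on_mor H (act_mor M f g) = act_mor N (on_mor H f) g)"

text \<open>A right module over the target of \<open>F\<close> becomes a right module over the source.\<close>

definition pullback_module ::
  "('c, 'd, 'e, 'g) fctr \<Rightarrow> ('o, 'm, 'e, 'g) modcat \<Rightarrow> ('o, 'm, 'c, 'd) modcat" where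
  "pullback_module F M = \<lparr>Ob = Ob M, Hm = Hm M, idn = idn M, cmp = cmp M, plus_m = plus_m M,
     scale_m = scale_m M, act_ob = (\<lambda>X C. act_ob M X (on_ob F C)),
     act_mor = (\<lambda>f g. act_mor M f (on_mor F g))\<rparr>"


section \<open>The module categories of the two algebras\<close>

definition U_tmod :: "nat \<Rightarrow> nat \<Rightarrow> (smod, kk mat) moncat" where
  "U_tmod m n = \<lparr>Ob = tmod_objects m n, Hm = mod_hom (carrier (U_sigma m n)),
     idn = (\<lambda>M. 1\<^sub>m (mdim M)), cmp = (*), plus_m = (+), scale_m = (\<cdot>\<^sub>m),
     unit_ob = triv m n, ten_ob = tensor_mod m n, ten_mor = kron\<rparr>"

text \<open>Since \<open>Ui_sigma\<close> is a right coideal, the restriction of a tensor product \<open>M \<otimes> N\<close> depends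
  on \<open>M\<close> only through the restriction of \<open>M\<close>.\<close>

definition Ui_tmod :: "nat \<Rightarrow> nat \<Rightarrow> (int \<Rightarrow> kk) \<Rightarrow> (smod, kk mat, smod, kk mat) modcat" where
  "Ui_tmod m n vs = \<lparr>Ob = Res m n vs ` tmod_objects m n, Hm = mod_hom (Ui_sigma m n vs),
     idn = (\<lambda>M. 1\<^sub>m (mdim M)), cmp = (*), plus_m = (+), scale_m = (\<cdot>\<^sub>m),
     act_ob = (\<lambda>X N. THE Y. \<exists>M\<in>tmod_objects m n. Res m n vs M = X \<and> Y = Res m n vs (tensor_mod m n M N)),
     act_mor = kron\<rparr>"


section \<open>The oriented skein category\<close>

text \<open>The generators are \<open>X\<^sub>+\<close>, \<open>X\<^sub>-\<close>, \<open>c\<close>, \<open>d\<close>, \<open>c'\<close>, \<open>d'\<close> in this order.  Morphisms are classes of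
  formal expressions; \<open>OZero u v\<close> is the zero morphism from \<open>u\<close> to \<open>v\<close>, and \<open>OComp f g\<close> is \<open>f\<close>
  after \<open>g\<close>.\<close>

datatype os_gen = Xp | Xm | Cup | Cap | Cup' | Cap'

datatype os =
    OGen os_gen
  | OId "arrow list"
  | OZero "arrow list" "arrow list"
  | OComp os os
  | OTens os os
  | OAdd os os
  | OScale kk os

fun os_gen_dom :: "os_gen \<Rightarrow> arrow list" where
  "os_gen_dom Xp = [Up, Up]"
| "os_gen_dom Xm = [Up, Up]"
| "os_gen_dom Cup = []"
| "os_gen_dom Cap = [Up, Dn]"
| "os_gen_dom Cup' = []"
| "os_gen_dom Cap' = [Dn, Up]"

fun os_gen_cod :: "os_gen \<Rightarrow> arrow list" where
  "os_gen_cod Xp = [Up, Up]"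
| "os_gen_cod Xm = [Up, Up]"
| "os_gen_cod Cup = [Dn, Up]"
| "os_gen_cod Cap = []"
| "os_gen_cod Cup' = [Up, Dn]"
| "os_gen_cod Cap' = []"

fun os_dom :: "os \<Rightarrow> arrow list" where
  "os_dom (OGen g) = os_gen_dom g"
| "os_dom (OId u) = u"
| "os_dom (OZero u v) = u"
| "os_dom (OComp f g) = os_dom g"
| "os_dom (OTens f g) = os_dom f @ os_dom g"
| "os_dom (OAdd f g) = os_dom f"
| "os_dom (OScale c f) = os_dom f"

fun os_cod :: "os \<Rightarrow> arrow list" where
  "os_cod (OGen g) = os_gen_cod g"
| "os_cod (OId u) = u"
| "os_cod (OZero u v) = v"
| "os_cod (OComp f g) = os_cod f"
| "os_cod (OTens f g) = os_cod f @ os_cod g"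
| "os_cod (OAdd f g) = os_cod f"
| "os_cod (OScale c f) = os_cod f"

fun os_wf :: "os \<Rightarrow> bool" where
  "os_wf (OGen g) = True"
| "os_wf (OId u) = True"
| "os_wf (OZero u v) = True"
| "os_wf (OComp f g) = (os_wf f \<and> os_wf g \<and> os_dom f = os_cod g)"
| "os_wf (OTens f g) = (os_wf f \<and> os_wf g)"
| "os_wf (OAdd f g) = (os_wf f \<and> os_wf g \<and> os_dom f = os_dom g \<and> os_cod f = os_cod g)"
| "os_wf (OScale c f) = os_wf f"

text \<open>In the following two definitions \<open>X\<close> is one of the expressions \<open>OGen Xp\<close> and \<open>OGen Xm\<close>, and
  in the third one \<open>R\<close> is \<open>os_R X\<close>.\<close>

definition os_R :: "os \<Rightarrow> os" where
  "os_R X = OComp (OTens (OId [Dn, Up]) (OGen Cap))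
     (OComp (OTens (OTens (OId [Dn]) X) (OId [Dn])) (OTens (OGen Cup) (OId [Up, Dn])))"

definition os_L :: "os \<Rightarrow> os" where
  "os_L X = OComp (OTens (OGen Cap') (OId [Up, Dn]))
     (OComp (OTens (OTens (OId [Dn]) X) (OId [Dn])) (OTens (OId [Dn, Up]) (OGen Cup')))"

definition os_D :: "os \<Rightarrow> os" where
  "os_D R = OComp (OTens (OId [Dn, Dn]) (OGen Cap))
     (OComp (OTens (OTens (OId [Dn]) R) (OId [Dn])) (OTens (OGen Cup) (OId [Dn, Dn])))"

inductive os_rel :: "kk \<Rightarrow> os \<Rightarrow> os \<Rightarrow> bool" for t :: kk where
  Xp_Xm: "os_rel t (OComp (OGen Xp) (OGen Xm)) (OId [Up, Up])"
| Xm_Xp: "os_rel t (OComp (OGen Xm) (OGen Xp)) (OId [Up, Up])"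
| braid: "os_rel t
    (OComp (OTens (OGen Xp) (OId [Up])) (OComp (OTens (OId [Up]) (OGen Xp)) (OTens (OGen Xp) (OId [Up]))))
    (OComp (OTens (OId [Up]) (OGen Xp)) (OComp (OTens (OGen Xp) (OId [Up])) (OTens (OId [Up]) (OGen Xp))))"
| L_R: "os_rel t (OComp (os_L (OGen Xm)) (os_R (OGen Xp))) (OId [Up, Dn])"
| R_L: "os_rel t (OComp (os_R (OGen Xp)) (os_L (OGen Xm))) (OId [Dn, Up])"
| skein: "os_rel t (OAdd (OGen Xp) (OScale (-1) (OGen Xm))) (OScale (qq - inverse qq) (OId [Up, Up]))"
| twist_left: "os_rel t
    (OComp (OTens (OGen Cap') (OId [Up])) (OComp (OTens (OId [Dn]) (OGen Xp)) (OTens (OGen Cup) (OId [Up]))))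
    (OScale t (OId [Up]))"
| twist_right: "os_rel t
    (OComp (OTens (OId [Up]) (OGen Cap)) (OComp (OTens (OGen Xp) (OId [Dn])) (OTens (OId [Up]) (OGen Cup'))))
    (OScale t (OId [Up]))"
| bubble: "os_rel t (OComp (OGen Cap) (OGen Cup'))
    (OScale ((t - inverse t) / (qq - inverse qq)) (OId []))"
| zigzag_up: "os_rel t
    (OComp (OTens (OGen Cap) (OId [Up])) (OTens (OId [Up]) (OGen Cup))) (OId [Up])"
| zigzag_down: "os_rel t
    (OComp (OTens (OId [Dn]) (OGen Cap)) (OTens (OGen Cup) (OId [Dn]))) (OId [Dn])"

text \<open>The least congruence on well-formed expressions that contains \<open>os_rel\<close> and makes the quotient
  a strict linear monoidal category.\<close>

inductive os_eq :: "kk \<Rightarrow> os \<Rightarrow> os \<Rightarrow> bool" for t :: kk where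
  rel: "os_rel t f g \<Longrightarrow> os_eq t f g"
| refl: "os_wf f \<Longrightarrow> os_eq t f f"
| sym: "os_eq t f g \<Longrightarrow> os_eq t g f"
| trans: "os_eq t f g \<Longrightarrow> os_eq t g h \<Longrightarrow> os_eq t f h"
| cong_comp: "os_eq t f f' \<Longrightarrow> os_eq t g g' \<Longrightarrow> os_wf (OComp f g) \<Longrightarrow> os_eq t (OComp f g) (OComp f' g')"
| cong_tens: "os_eq t f f' \<Longrightarrow> os_eq t g g' \<Longrightarrow> os_eq t (OTens f g) (OTens f' g')"
| cong_add: "os_eq t f f' \<Longrightarrow> os_eq t g g' \<Longrightarrow> os_wf (OAdd f g) \<Longrightarrow> os_eq t (OAdd f g) (OAdd f' g')"
| cong_scale: "os_eq t f f' \<Longrightarrow> os_eq t (OScale a f) (OScale a f')"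
| id_left: "os_wf f \<Longrightarrow> os_eq t (OComp (OId (os_cod f)) f) f"
| id_right: "os_wf f \<Longrightarrow> os_eq t (OComp f (OId (os_dom f))) f"
| comp_assoc: "os_wf (OComp f (OComp g h)) \<Longrightarrow> os_eq t (OComp (OComp f g) h) (OComp f (OComp g h))"
| add_assoc: "os_wf (OAdd f (OAdd g h)) \<Longrightarrow> os_eq t (OAdd (OAdd f g) h) (OAdd f (OAdd g h))"
| add_comm: "os_wf (OAdd f g) \<Longrightarrow> os_eq t (OAdd f g) (OAdd g f)"
| add_zero: "os_wf f \<Longrightarrow> os_eq t (OAdd f (OZero (os_dom f) (os_cod f))) f"
| add_neg: "os_wf f \<Longrightarrow> os_eq t (OAdd f (OScale (-1) f)) (OZero (os_dom f) (os_cod f))"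
| scale_one: "os_wf f \<Longrightarrow> os_eq t (OScale 1 f) f"
| scale_scale: "os_wf f \<Longrightarrow> os_eq t (OScale a (OScale b f)) (OScale (a * b) f)"
| scale_add: "os_wf (OAdd f g) \<Longrightarrow> os_eq t (OScale a (OAdd f g)) (OAdd (OScale a f) (OScale a g))"
| add_scale: "os_wf f \<Longrightarrow> os_eq t (OScale (a + b) f) (OAdd (OScale a f) (OScale b f))"
| comp_add_left: "os_wf (OComp (OAdd f g) h) \<Longrightarrow>
    os_eq t (OComp (OAdd f g) h) (OAdd (OComp f h) (OComp g h))"
| comp_add_right: "os_wf (OComp f (OAdd g h)) \<Longrightarrow>
    os_eq t (OComp f (OAdd g h)) (OAdd (OComp f g) (OComp f h))"
| comp_scale_left: "os_wf (OComp f g) \<Longrightarrow> os_eq t (OComp (OScale a f) g) (OScale a (OComp f g))"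
| comp_scale_right: "os_wf (OComp f g) \<Longrightarrow> os_eq t (OComp f (OScale a g)) (OScale a (OComp f g))"
| tens_add_left: "os_wf (OTens (OAdd f g) h) \<Longrightarrow>
    os_eq t (OTens (OAdd f g) h) (OAdd (OTens f h) (OTens g h))"
| tens_add_right: "os_wf (OTens f (OAdd g h)) \<Longrightarrow>
    os_eq t (OTens f (OAdd g h)) (OAdd (OTens f g) (OTens f h))"
| tens_scale_left: "os_wf (OTens f g) \<Longrightarrow> os_eq t (OTens (OScale a f) g) (OScale a (OTens f g))"
| tens_scale_right: "os_wf (OTens f g) \<Longrightarrow> os_eq t (OTens f (OScale a g)) (OScale a (OTens f g))"
| tens_assoc: "os_wf (OTens f (OTens g h)) \<Longrightarrow> os_eq t (OTens (OTens f g) h) (OTens f (OTens g h))"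
| tens_unit_left: "os_wf f \<Longrightarrow> os_eq t (OTens (OId []) f) f"
| tens_unit_right: "os_wf f \<Longrightarrow> os_eq t (OTens f (OId [])) f"
| tens_id: "os_eq t (OTens (OId u) (OId v)) (OId (u @ v))"
| interchange: "os_wf (OComp f g) \<Longrightarrow> os_wf (OComp h k) \<Longrightarrow>
    os_eq t (OComp (OTens f h) (OTens g k)) (OTens (OComp f g) (OComp h k))"

definition os_cls :: "kk \<Rightarrow> os \<Rightarrow> os set" where
  "os_cls t f = {g. os_eq t f g}"

definition OS :: "kk \<Rightarrow> (arrow list, os set) moncat" where
  "OS t = \<lparr>Ob = UNIV,
     Hm = (\<lambda>u v. os_cls t ` {f. os_wf f \<and> os_dom f = u \<and> os_cod f = v}),
     idn = (\<lambda>u. os_cls t (OId u)),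
     cmp = (\<lambda>A B. \<Union>f\<in>A. \<Union>g\<in>B. os_cls t (OComp f g)),
     plus_m = (\<lambda>A B. \<Union>f\<in>A. \<Union>g\<in>B. os_cls t (OAdd f g)),
     scale_m = (\<lambda>c A. \<Union>f\<in>A. os_cls t (OScale c f)),
     unit_ob = [], ten_ob = (@),
     ten_mor = (\<lambda>A B. \<Union>f\<in>A. \<Union>g\<in>B. os_cls t (OTens f g))\<rparr>"


section \<open>The disoriented skein category\<close>

text \<open>\<open>DEmb g\<close> is the morphism \<open>g\<close> of the oriented skein category, regarded as a morphism of the
  disoriented one, and \<open>DGen x g\<close> is \<open>x \<otimes> g\<close> for a generating morphism \<open>x\<close>.\<close>

datatype ds_gen = Tau | TauBar

datatype ds =
    DEmb os
  | DGen ds_gen os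
  | DComp ds ds
  | DAdd ds ds
  | DScale kk ds

fun ds_gen_dom :: "ds_gen \<Rightarrow> arrow list" where
  "ds_gen_dom Tau = [Dn]"
| "ds_gen_dom TauBar = [Up]"

fun ds_gen_cod :: "ds_gen \<Rightarrow> arrow list" where
  "ds_gen_cod Tau = [Up]"
| "ds_gen_cod TauBar = [Dn]"

fun ds_dom :: "ds \<Rightarrow> arrow list" where
  "ds_dom (DEmb g) = os_dom g"
| "ds_dom (DGen x g) = ds_gen_dom x @ os_dom g"
| "ds_dom (DComp f g) = ds_dom g"
| "ds_dom (DAdd f g) = ds_dom f"
| "ds_dom (DScale c f) = ds_dom f"

fun ds_cod :: "ds \<Rightarrow> arrow list" where
  "ds_cod (DEmb g) = os_cod g"
| "ds_cod (DGen x g) = ds_gen_cod x @ os_cod g"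
| "ds_cod (DComp f g) = ds_cod f"
| "ds_cod (DAdd f g) = ds_cod f"
| "ds_cod (DScale c f) = ds_cod f"

fun ds_wf :: "ds \<Rightarrow> bool" where
  "ds_wf (DEmb g) = os_wf g"
| "ds_wf (DGen x g) = os_wf g"
| "ds_wf (DComp f g) = (ds_wf f \<and> ds_wf g \<and> ds_dom f = ds_cod g)"
| "ds_wf (DAdd f g) = (ds_wf f \<and> ds_wf g \<and> ds_dom f = ds_dom g \<and> ds_cod f = ds_cod g)"
| "ds_wf (DScale c f) = ds_wf f"

text \<open>The right action \<open>f \<otimes> h\<close>; for a composite it uses
  \<open>(f \<circ> g) \<otimes> h = (f \<otimes> 1) \<circ> (g \<otimes> h)\<close>.\<close>

fun ds_act :: "ds \<Rightarrow> os \<Rightarrow> ds" where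
  "ds_act (DEmb g) h = DEmb (OTens g h)"
| "ds_act (DGen x g) h = DGen x (OTens g h)"
| "ds_act (DComp f g) h = DComp (ds_act f (OId (os_cod h))) (ds_act g h)"
| "ds_act (DAdd f g) h = DAdd (ds_act f h) (ds_act g h)"
| "ds_act (DScale c f) h = DScale c (ds_act f h)"

text \<open>\<open>d_tau u\<close> and \<open>d_taubar u\<close> are the tensor products of \<open>\<tau>\<close> resp. \<open>\<tau>\<close>-bar with the identity of \<open>u\<close>.\<close>

abbreviation d_tau :: "arrow list \<Rightarrow> ds" where
  "d_tau u \<equiv> DGen Tau (OId u)"

abbreviation d_taubar :: "arrow list \<Rightarrow> ds" where
  "d_taubar u \<equiv> DGen TauBar (OId u)"

inductive ds_rel :: "ds \<Rightarrow> ds \<Rightarrow> bool" where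
  tau_taubar: "ds_rel (DComp (d_tau []) (d_taubar [])) (DEmb (OId [Up]))"
| taubar_tau: "ds_rel (DComp (d_taubar []) (d_tau [])) (DEmb (OId [Dn]))"
| reflection: "ds_rel
    (DComp (d_tau [Up]) (DComp (DEmb (os_R (OGen Xm))) (DComp (d_tau [Dn])
      (DEmb (os_D (os_R (OGen Xp)))))))
    (DComp (DEmb (OGen Xp)) (DComp (d_tau [Up]) (DComp (DEmb (os_R (OGen Xm))) (d_tau [Dn]))))"
| cap: "ds_rel
    (DComp (DEmb (OGen Cap')) (DComp (d_taubar [Up]) (DEmb (OGen Xp))))
    (DScale qq (DComp (DEmb (OGen Cap')) (d_taubar [Up])))"
| cup: "ds_rel
    (DComp (DEmb (OGen Xp)) (DComp (d_tau [Up]) (DEmb (OGen Cup))))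
    (DScale qq (DComp (d_tau [Up]) (DEmb (OGen Cup))))"

inductive ds_eq :: "kk \<Rightarrow> ds \<Rightarrow> ds \<Rightarrow> bool" for t :: kk where
  rel: "ds_rel f g \<Longrightarrow> ds_eq t f g"
| refl: "ds_wf f \<Longrightarrow> ds_eq t f f"
| sym: "ds_eq t f g \<Longrightarrow> ds_eq t g f"
| trans: "ds_eq t f g \<Longrightarrow> ds_eq t g h \<Longrightarrow> ds_eq t f h"
| cong_comp: "ds_eq t f f' \<Longrightarrow> ds_eq t g g' \<Longrightarrow> ds_wf (DComp f g) \<Longrightarrow> ds_eq t (DComp f g) (DComp f' g')"
| cong_add: "ds_eq t f f' \<Longrightarrow> ds_eq t g g' \<Longrightarrow> ds_wf (DAdd f g) \<Longrightarrow> ds_eq t (DAdd f g) (DAdd f' g')"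
| cong_scale: "ds_eq t f f' \<Longrightarrow> ds_eq t (DScale a f) (DScale a f')"
| cong_act: "ds_eq t f f' \<Longrightarrow> os_wf h \<Longrightarrow> ds_eq t (ds_act f h) (ds_act f' h)"
| id_left: "ds_wf f \<Longrightarrow> ds_eq t (DComp (DEmb (OId (ds_cod f))) f) f"
| id_right: "ds_wf f \<Longrightarrow> ds_eq t (DComp f (DEmb (OId (ds_dom f)))) f"
| comp_assoc: "ds_wf (DComp f (DComp g h)) \<Longrightarrow> ds_eq t (DComp (DComp f g) h) (DComp f (DComp g h))"
| add_assoc: "ds_wf (DAdd f (DAdd g h)) \<Longrightarrow> ds_eq t (DAdd (DAdd f g) h) (DAdd f (DAdd g h))"
| add_comm: "ds_wf (DAdd f g) \<Longrightarrow> ds_eq t (DAdd f g) (DAdd g f)"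
| add_zero: "ds_wf f \<Longrightarrow> ds_eq t (DAdd f (DEmb (OZero (ds_dom f) (ds_cod f)))) f"
| add_neg: "ds_wf f \<Longrightarrow> ds_eq t (DAdd f (DScale (-1) f)) (DEmb (OZero (ds_dom f) (ds_cod f)))"
| scale_one: "ds_wf f \<Longrightarrow> ds_eq t (DScale 1 f) f"
| scale_scale: "ds_wf f \<Longrightarrow> ds_eq t (DScale a (DScale b f)) (DScale (a * b) f)"
| scale_add: "ds_wf (DAdd f g) \<Longrightarrow> ds_eq t (DScale a (DAdd f g)) (DAdd (DScale a f) (DScale a g))"
| add_scale: "ds_wf f \<Longrightarrow> ds_eq t (DScale (a + b) f) (DAdd (DScale a f) (DScale b f))"
| comp_add_left: "ds_wf (DComp (DAdd f g) h) \<Longrightarrow>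
    ds_eq t (DComp (DAdd f g) h) (DAdd (DComp f h) (DComp g h))"
| comp_add_right: "ds_wf (DComp f (DAdd g h)) \<Longrightarrow>
    ds_eq t (DComp f (DAdd g h)) (DAdd (DComp f g) (DComp f h))"
| comp_scale_left: "ds_wf (DComp f g) \<Longrightarrow> ds_eq t (DComp (DScale a f) g) (DScale a (DComp f g))"
| comp_scale_right: "ds_wf (DComp f g) \<Longrightarrow> ds_eq t (DComp f (DScale a g)) (DScale a (DComp f g))"
| emb_cong: "os_eq t g h \<Longrightarrow> ds_eq t (DEmb g) (DEmb h)"
| emb_comp: "os_wf (OComp g h) \<Longrightarrow> ds_eq t (DEmb (OComp g h)) (DComp (DEmb g) (DEmb h))"
| emb_add: "os_wf (OAdd g h) \<Longrightarrow> ds_eq t (DEmb (OAdd g h)) (DAdd (DEmb g) (DEmb h))"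
| emb_scale: "os_wf g \<Longrightarrow> ds_eq t (DEmb (OScale a g)) (DScale a (DEmb g))"
| gen_cong: "os_eq t g h \<Longrightarrow> ds_eq t (DGen x g) (DGen x h)"
| gen_add: "os_wf (OAdd g h) \<Longrightarrow> ds_eq t (DGen x (OAdd g h)) (DAdd (DGen x g) (DGen x h))"
| gen_scale: "os_wf g \<Longrightarrow> ds_eq t (DGen x (OScale a g)) (DScale a (DGen x g))"
| gen_left: "os_wf (OComp g h) \<Longrightarrow>
    ds_eq t (DComp (DEmb (OTens (OId (ds_gen_cod x)) g)) (DGen x h)) (DGen x (OComp g h))"
| gen_right: "os_wf (OComp g h) \<Longrightarrow>
    ds_eq t (DComp (DGen x g) (DEmb (OTens (OId (ds_gen_dom x)) h))) (DGen x (OComp g h))"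

definition ds_cls :: "kk \<Rightarrow> ds \<Rightarrow> ds set" where
  "ds_cls t f = {g. ds_eq t f g}"

definition DS :: "kk \<Rightarrow> (arrow list, ds set, arrow list, os set) modcat" where
  "DS t = \<lparr>Ob = UNIV,
     Hm = (\<lambda>u v. ds_cls t ` {f. ds_wf f \<and> ds_dom f = u \<and> ds_cod f = v}),
     idn = (\<lambda>u. ds_cls t (DEmb (OId u))),
     cmp = (\<lambda>A B. \<Union>f\<in>A. \<Union>g\<in>B. ds_cls t (DComp f g)),
     plus_m = (\<lambda>A B. \<Union>f\<in>A. \<Union>g\<in>B. ds_cls t (DAdd f g)),
     scale_m = (\<lambda>c A. \<Union>f\<in>A. ds_cls t (DScale c f)),
     act_ob = (@),
     act_mor = (\<lambda>A B. \<Union>f\<in>A. \<Union>h\<in>B. ds_cls t (ds_act f h))\<rparr>"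

definition ds_tau :: "kk \<Rightarrow> ds set" where
  "ds_tau t = ds_cls t (d_tau [])"

definition ds_taubar :: "kk \<Rightarrow> ds set" where
  "ds_taubar t = ds_cls t (d_taubar [])"


section \<open>The functor on the oriented skein category and the isomorphism \<open>\<phi>\<close>\<close>

definition mat_inv :: "kk mat \<Rightarrow> kk mat" where
  "mat_inv A = (THE B. B \<in> carrier_mat (dim_col A) (dim_row A) \<and> inverts_mat A B \<and> inverts_mat B A)"

definition T_mat :: "nat \<Rightarrow> nat \<Rightarrow> kk mat" where
  "T_mat m n = (let N = m + 2 * n in mat (N * N) (N * N) (\<lambda>(r, s).
     let i = idx n (s div N); j = idx n (s mod N); k = idx n (r div N); l = idx n (r mod N) in
       (if k = j \<and> l = i
        then (-1) ^ (pV i * pV j) * qq powi (if i = j then 1 - 2 * int (pV i) else 0) else 0)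
       + (if k = i \<and> l = j \<and> i < j then qq - inverse qq else 0)))"

definition ev_plus :: "nat \<Rightarrow> nat \<Rightarrow> kk mat" where
  "ev_plus m n = (let N = m + 2 * n in mat 1 (N * N) (\<lambda>(_, s).
     let i = idx n (s div N); j = idx n (s mod N) in
       if i = j then (- qq) powi \<bar>i\<bar> else 0))"

definition ev_minus :: "nat \<Rightarrow> nat \<Rightarrow> kk mat" where
  "ev_minus m n = (let N = m + 2 * n in mat 1 (N * N) (\<lambda>(_, s).
     let i = idx n (s div N); j = idx n (s mod N) in
       if i = j then (-1) powi (i + int (pV i)) * qq powi (int m + 2 * int n - \<bar>i - 1\<bar>) else 0))"

definition coev_plus :: "nat \<Rightarrow> nat \<Rightarrow> kk mat" where
  "coev_plus m n = (let N = m + 2 * n in mat (N * N) 1 (\<lambda>(r, _).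
     let i = idx n (r div N); j = idx n (r mod N) in
       if i = j then (- qq) powi (- \<bar>i\<bar>) else 0))"

definition coev_minus :: "nat \<Rightarrow> nat \<Rightarrow> kk mat" where
  "coev_minus m n = (let N = m + 2 * n in mat (N * N) 1 (\<lambda>(r, _).
     let i = idx n (r div N); j = idx n (r mod N) in
       if i = j then (-1) powi (i + int (pV i)) * qq powi (\<bar>i - 1\<bar> - int m - 2 * int n) else 0))"

definition tt :: "nat \<Rightarrow> nat \<Rightarrow> kk" where
  "tt m n = qq powi (int m - 2 * int n)"

text \<open>At most one functor has the following properties, because the listed data generate the oriented
  skein category.\<close>

definition is_R_OS :: "nat \<Rightarrow> nat \<Rightarrow> (arrow list, os set, smod, kk mat) fctr \<Rightarrow> bool" where
  "is_R_OS m n R \<longleftrightarrow>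
     strict_monoidal_functor (OS (tt m n)) (U_tmod m n) R
     \<and> on_ob R [Up] = Vplus m n
     \<and> on_ob R [Dn] = Vminus m n
     \<and> on_mor R (os_cls (tt m n) (OGen Xp)) = T_mat m n
     \<and> on_mor R (os_cls (tt m n) (OGen Xm)) = mat_inv (T_mat m n)
     \<and> on_mor R (os_cls (tt m n) (OGen Cap)) = ev_plus m n
     \<and> on_mor R (os_cls (tt m n) (OGen Cup)) = coev_plus m n
     \<and> on_mor R (os_cls (tt m n) (OGen Cap')) = ev_minus m n
     \<and> on_mor R (os_cls (tt m n) (OGen Cup')) = coev_minus m n"

definition phi_index :: "int \<Rightarrow> int" where
  "phi_index i = (if i > 0 then i else if even i then i - 1 else i + 1)"

text \<open>For \<open>m = 0 < n\<close> the value \<open>vs 0\<close> occurs in the following formula although \<open>0\<close> is not in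
  \<open>I_circ m n\<close>; it is then a further parameter.\<close>

definition vs_tilde :: "(int \<Rightarrow> kk) \<Rightarrow> int \<Rightarrow> kk" where
  "vs_tilde vs i =
     (if i > 0 then \<Prod>k = 1..i - 1. inverse (qq * vs k)
      else \<Prod>k = (i + 1) div 2..0. - qq * vs (2 * k))"

definition phi :: "nat \<Rightarrow> nat \<Rightarrow> (int \<Rightarrow> kk) \<Rightarrow> kk mat" where
  "phi m n vs = mat (m + 2 * n) (m + 2 * n) (\<lambda>(r, s).
     if idx n r = phi_index (idx n s) then vs_tilde vs (idx n s) else 0)"

end

theory Submission
  imports Defs
begin

text \<open>The functor must send an expression for a morphism of the disoriented skein category to the
  matrix obtained by replacing \<open>\<tau>\<close>, \<open>\<tau>\<close>-bar and the morphisms \<open>g\<close> of the oriented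
  skein category by \<open>\<phi>\<close>, its inverse and the images of the \<open>g\<close>; this gives uniqueness.
  Existence rests on three facts.

  First, \<open>\<phi> \<otimes> g\<close> is a morphism over the coideal subalgebra: \<open>\<phi>\<close> commutes with its
  generators, and the left-hand tensor factors in the coproduct of \<open>B\<^sub>i\<close> lie in the coideal
  subalgebra again.  The coproducts are computed from \<open>\<Delta>(E\<^sub>i) = x\<^sub>i + y\<^sub>i\<close>, where
  \<open>y\<^sub>i x\<^sub>j\<close> is \<open>x\<^sub>j y\<^sub>i\<close> up to a sign and the power of \<open>q\<close> given by the
  symmetrized Cartan matrix, so that iterated \<open>q\<close>-commutators of sums of this kind split into few
  terms.  The same splitting shows that the coproduct respects the Serre relations.

  Second, the action on a coset is defined through an arbitrary representative, so the relations of the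
  algebra have to be checked on the natural module, on its dual, and on tensor products of modules
  before the action of a generator is known.

  Third, the defining relations of the disoriented skein category become matrix identities.  Turning a
  braiding matrix by a right angle only permutes and rescales its entries, which makes
  \<open>R\<^sub>-\<close> and \<open>D\<^sub>+\<close> explicit, and the reflection equation becomes an identity between
  coefficients that can be checked for each pair of blocks \<open>{2k - 1, 2k}\<close>.\<close>

section \<open>Linear endomorphisms\<close>

text \<open>Matrices of varying size form no ring type. All calculations with generators are
  therefore moved to endomorphisms of one space of sequences, where the laws of
  \<open>ring_1\<close> hold without carrier conditions. In dimension 0 the identity matrix would go
  to 0, so that case is split off each time. The weight q of the brackets in B_i, i \<le> 0, is the
  factor by which K_j \<otimes> E_j passes E_i \<otimes> 1 for a neighbour j of i. This kills the
  mixed terms whose left factor contains E_i and leaves on the left only E_j and K_j with j in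
  \<open>I_bullet n\<close>. The scalars \<open>vs_tilde\<close> are forced by the B_i: comparing
  the matrix units by which B_i acts on V^- and V^+ gives their recursion. The skein relations see
  only that they agree on both members of a block. There the scalars of \<open>coev_plus\<close> and
  of \<open>ev_minus\<close> have ratio -1/q, which makes them eigenvectors of the braiding for q.
  Between different blocks \<open>phi_index\<close> preserves the order, so it respects the
  condition i < j in the braiding.\<close>

typedef endo = "{f :: (nat \<Rightarrow> kk) \<Rightarrow> nat \<Rightarrow> kk.
    (\<forall>u v. f (\<lambda>i. u i + v i) = (\<lambda>i. f u i + f v i)) \<and> (\<forall>c u. f (\<lambda>i. c * u i) = (\<lambda>i. c * f u i))}"
  morphisms app Endo
  by (rule exI[of _ "\<lambda>_ _. 0"]) simp

setup_lifting type_definition_endo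

instantiation endo :: ring_1
begin
lift_definition zero_endo :: endo is "\<lambda>v i. 0" by simp
lift_definition one_endo :: endo is "\<lambda>v. v" by simp
lift_definition plus_endo :: "endo \<Rightarrow> endo \<Rightarrow> endo" is "\<lambda>f g v i. f v i + g v i"
  by (auto simp: algebra_simps)
lift_definition uminus_endo :: "endo \<Rightarrow> endo" is "\<lambda>f v i. - f v i"
  by (auto simp: algebra_simps)
lift_definition minus_endo :: "endo \<Rightarrow> endo \<Rightarrow> endo" is "\<lambda>f g v i. f v i - g v i"
  by (auto simp: algebra_simps)
lift_definition times_endo :: "endo \<Rightarrow> endo \<Rightarrow> endo" is "\<lambda>f g v. f (g v)"
  by simp
instance
proof
  show "(0::endo) \<noteq> 1"
  proof
    assume "(0::endo) = 1"
    then have "app 0 (\<lambda>i. 1) 0 = app 1 (\<lambda>i. 1) 0" by simp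
    then show False by (simp add: zero_endo.rep_eq one_endo.rep_eq)
  qed
qed (transfer; auto simp: algebra_simps fun_eq_iff)+
end

definition sk :: "kk \<Rightarrow> endo \<Rightarrow> endo" (infixr "\<odot>" 75) where
  "c \<odot> f = Endo (\<lambda>v i. c * app f v i)"

lemma app_add: "app f (\<lambda>i. u i + v i) = (\<lambda>i. app f u i + app f v i)"
  and app_scale: "app f (\<lambda>i. c * u i) = (\<lambda>i. c * app f u i)"
  using app[of f] by auto

lemma app_sk: "app (c \<odot> f) = (\<lambda>v i. c * app f v i)"
  unfolding sk_def by (rule Endo_inverse) (auto simp: app_add app_scale algebra_simps)

lemmas app_simps = zero_endo.rep_eq one_endo.rep_eq plus_endo.rep_eq uminus_endo.rep_eq
  minus_endo.rep_eq times_endo.rep_eq app_sk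

lemma endo_eqI: "(\<And>v i. app f v i = app g v i) \<Longrightarrow> f = g"
  by (metis app_inject ext)

interpretation sk: Modules.module sk
  by standard (rule endo_eqI; simp add: app_simps algebra_simps)+

lemma sk_mult_left [simp]: "(c \<odot> x) * y = c \<odot> (x * y)"
  by (rule endo_eqI) (simp add: app_simps)

lemma sk_mult_right [simp]: "x * (c \<odot> y) = c \<odot> (x * y)"
  by (rule endo_eqI) (simp add: app_simps app_scale)

lemmas sk_expand = algebra_simps sk.scale_right_distrib sk.scale_right_diff_distrib
  sk.scale_left_distrib sk.scale_left_diff_distrib

text \<open>Products are kept bracketed to the right, where a commutation rule meets its two factors
  with a third one behind them.\<close>

lemma swap_left: "y * x = w \<odot> (x * y) \<Longrightarrow> y * (x * z) = w \<odot> (x * (y * z))" for x y z :: endo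
  by (metis mult.assoc sk_mult_left)

section \<open>q-commutators of sums whose summands q-commute\<close>

definition qc :: "kk \<Rightarrow> endo \<Rightarrow> endo \<Rightarrow> endo" where
  "qc w x y = x * y - w \<odot> (y * x)"

text \<open>Of the two mixed terms, ya xb - w xb ya vanishes, while yb xa = w xa yb turns xa yb - w
  yb xa into (1 - w^2) xa yb.\<close>

lemma qc_split:
  assumes "ya * xb = w \<odot> (xb * ya)" "yb * xa = w \<odot> (xa * yb)"
  shows "qc w (xa + ya) (xb + yb) = qc w xa xb + (1 - w\<^sup>2) \<odot> (xa * yb) + qc w ya yb"
  unfolding qc_def by (simp add: sk_expand assms power2_eq_square)

text \<open>As a nested q-commutator the Serre expression is open to \<open>qc_split\<close>. It is
  symmetric in w and its inverse, so w may be q or 1/q, whichever is the exchange factor at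
  hand.\<close>

lemma serre_eq_qc:
  assumes "w \<noteq> 0"
  shows "x * x * y - (w + inverse w) \<odot> (x * y * x) + y * x * x = qc (inverse w) x (qc w x y)"
  unfolding qc_def using assms by (simp add: sk_expand)

text \<open>Two mixed terms survive, both multiples of \<open>xa * qc w ya yb\<close>; their
  coefficients (1 - w^2) w^-2 and 1 - w^-2 cancel.\<close>

lemma serre_split:
  assumes w: "w \<noteq> 0"
    and sx: "qc (inverse w) xa (qc w xa xb) = 0" and sy: "qc (inverse w) ya (qc w ya yb) = 0"
    and aa: "ya * xa = inverse (w\<^sup>2) \<odot> (xa * ya)"
    and ab: "ya * xb = w \<odot> (xb * ya)" and ba: "yb * xa = w \<odot> (xa * yb)"
  shows "qc (inverse w) (xa + ya) (qc w (xa + ya) (xb + yb)) = 0"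
proof -
  let ?X = "qc w xa xb" and ?Y = "qc w ya yb"
  have wi: "w * (inverse w * t) = t" for t using w by simp
  note sw = wi aa ab ba aa[THEN swap_left] ab[THEN swap_left] ba[THEN swap_left]
  have xY: "qc (inverse w) xa ?Y = (1 - inverse (w\<^sup>2)) \<odot> (xa * ?Y)"
    unfolding qc_def using w by (simp add: sk_expand sw power2_eq_square)
  have yX: "qc (inverse w) ya ?X = 0"
    unfolding qc_def using w by (simp add: sk_expand sw power2_eq_square)
  have x1: "qc (inverse w) xa (xa * yb) = 0"
    unfolding qc_def using w by (simp add: sk_expand sw power2_eq_square)
  have y1: "qc (inverse w) ya (xa * yb) = inverse (w\<^sup>2) \<odot> (xa * ?Y)"
    unfolding qc_def using w by (simp add: sk_expand sw power2_eq_square)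
  have add: "qc v (a + b) (c + d \<odot> e + f)
      = qc v a c + qc v b f + (d \<odot> qc v a e + qc v a f + qc v b c + d \<odot> qc v b e)" for v a b c d e f
    unfolding qc_def by (simp add: sk_expand)
  show ?thesis
    unfolding qc_split[OF ab ba] add sx sy x1 y1 xY yX using w
    by (simp add: sk_expand power2_eq_square)
qed

text \<open>The letters a, b, c stand for the indices -1, 0, 1, so b is odd and the outer bracket is
  an anticommutator. After the bracket with c the mixed part is a multiple of
  \<open>C * ya - xc * Wy\<close>. Its anticommutators with xb and yb are opposite, and each pure
  part anticommutes with the b-summand of the other kind.\<close>

lemma deg4_split:
  assumes w: "w \<noteq> 0"
    and bb: "yb * xb = (- 1) \<odot> (xb * yb)" and ac: "ya * xc = xc * ya" and ca: "yc * xa = xa * yc"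
    and ab: "ya * xb = w \<odot> (xb * ya)" and ba: "yb * xa = w \<odot> (xa * yb)"
    and bc: "yb * xc = inverse w \<odot> (xc * yb)" and cb: "yc * xb = inverse w \<odot> (xb * yc)"
    and bx: "xb * xb = 0" and b_y: "yb * yb = 0" and cy: "yc * ya = ya * yc"
    and sx: "qc (- 1) (qc w (qc (inverse w) xa xb) xc) xb = 0"
    and sy: "qc (- 1) (qc w (qc (inverse w) ya yb) yc) yb = 0"
  shows "qc (- 1) (qc w (qc (inverse w) (xa + ya) (xb + yb)) (xc + yc)) (xb + yb) = 0"
proof -
  define Wx where "Wx = qc (inverse w) xa xb"
  define Wy where "Wy = qc (inverse w) ya yb"
  define C where "C = qc w xb xc"
  define Zx where "Zx = qc w Wx xc"
  define Zy where "Zy = qc w Wy yc"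
  let ?z = "w - inverse w"
  have ac': "ya * xc = 1 \<odot> (xc * ya)" and ca': "yc * xa = 1 \<odot> (xa * yc)"
    using ac ca by simp_all
  have bx': "xb * (xb * t) = 0" and b_y': "yb * (yb * t) = 0" for t
    using bx b_y by (simp_all add: mult.assoc[symmetric])
  have wi: "w * (inverse w * t) = t" for t using w by simp
  note sw = wi bb ac ca ab ba bc cb bx b_y bx' b_y' bb[THEN swap_left] ac'[THEN swap_left] ca'[THEN swap_left]
     ab[THEN swap_left] ba[THEN swap_left] bc[THEN swap_left] cb[THEN swap_left]
  have W: "qc (inverse w) (xa + ya) (xb + yb) = Wx + ?z \<odot> (xb * ya) + Wy"
    unfolding Wx_def Wy_def qc_def using w by (simp add: sk_expand sw)
  have 1: "qc w Wx yc = 0" and 2: "qc w (xb * ya) xc = C * ya" and 3: "qc w (xb * ya) yc = 0"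
    and 4: "qc w Wy xc = (- ?z) \<odot> (xc * Wy)"
    unfolding Wx_def Wy_def C_def qc_def using w by (simp_all add: sk_expand sw cy)
  have add: "qc v (a + d \<odot> b + c) (e + f) = qc v a e + d \<odot> qc v b e + qc v c e + qc v a f + d \<odot> qc v b f + qc v c f"
    for v a b c d e f unfolding qc_def by (simp add: sk_expand)
  have Z: "qc w (Wx + ?z \<odot> (xb * ya) + Wy) (xc + yc) = Zx + ?z \<odot> (C * ya - xc * Wy) + Zy"
    unfolding add 1 2 3 4 Zx_def Zy_def by (simp add: sk_expand)
  have 5: "qc (- 1) Zx yb = 0" and 6: "qc (- 1) (C * ya - xc * Wy) xb = - (C * Wy)"
    and 7: "qc (- 1) (C * ya - xc * Wy) yb = C * Wy" and 8: "qc (- 1) Zy xb = 0"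
    unfolding Zx_def Zy_def Wx_def Wy_def C_def qc_def using w by (simp_all add: sk_expand sw)
  show ?thesis
  proof -
    have "qc (- 1) (Zx + ?z \<odot> (C * ya - xc * Wy) + Zy) (xb + yb) = 0"
      unfolding add using sx sy 5 6 7 8 by (simp add: Zx_def Zy_def Wx_def Wy_def)
    then show ?thesis unfolding W Z .
  qed
qed

section \<open>Evaluating elements of the free algebra\<close>

lemma falg_induct [case_names zero single]:
  fixes x :: falg
  assumes "P 0" "\<And>w c x. P x \<Longrightarrow> P (Poly_Mapping.single w c + x)"
  shows "P x"
proof (induction x rule: update_induct)
  case const
  then show ?case by (rule assms)
next
  case (update f a b)
  then have "Poly_Mapping.update a b f = Poly_Mapping.single a b + f"
    by (intro poly_mapping_eqI) (auto simp: lookup_update lookup_add lookup_single when_def in_keys_iff)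
  then show ?case using assms(2) update by simp
qed

definition word_endo :: "(ugen \<Rightarrow> endo) \<Rightarrow> ugen list \<Rightarrow> endo" where
  "word_endo \<rho> w = foldr (\<lambda>g X. \<rho> g * X) w 1"

definition evalg :: "(ugen \<Rightarrow> endo) \<Rightarrow> falg \<Rightarrow> endo" where
  "evalg \<rho> x = (\<Sum>w\<in>Poly_Mapping.keys x. Poly_Mapping.lookup x w \<odot> word_endo \<rho> w)"

lemma word_endo_append: "word_endo \<rho> (v @ w) = word_endo \<rho> v * word_endo \<rho> w"
  unfolding word_endo_def by (induction v) (simp_all add: mult.assoc)

lemma evalg_zero [simp]: "evalg \<rho> 0 = 0"
  by (simp add: evalg_def)

lemma evalg_add [simp]: "evalg \<rho> (x + y) = evalg \<rho> x + evalg \<rho> y"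
  unfolding evalg_def
  by (rule setsum_keys_plus_distrib[of "\<lambda>w c. c \<odot> word_endo \<rho> w"]) (simp_all add: sk.scale_left_distrib)

lemma evalg_single: "evalg \<rho> (Poly_Mapping.single w c) = c \<odot> word_endo \<rho> w"
  by (simp add: evalg_def)

lemma evalg_mult [simp]: "evalg \<rho> (x * y) = evalg \<rho> x * evalg \<rho> y"
proof (induction x rule: falg_induct)
  case (single w c x)
  have "evalg \<rho> (Poly_Mapping.single w c * y) = c \<odot> word_endo \<rho> w * evalg \<rho> y"
    by (induction y rule: falg_induct)
      (simp_all add: evalg_single distrib_left mult_single plus_list_def word_endo_append
        sk.scale_right_distrib mult.commute)
  with single show ?case by (simp add: evalg_single distrib_right)
qed simp

lemma evalg_uminus [simp]: "evalg \<rho> (- x) = - evalg \<rho> x"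
  using evalg_add[of \<rho> x "- x"] by (simp del: evalg_add add: eq_neg_iff_add_eq_0 add.commute)

lemma evalg_diff [simp]: "evalg \<rho> (x - y) = evalg \<rho> x - evalg \<rho> y"
  using evalg_add[of \<rho> x "- y"] by simp

lemma evalg_gen [simp]: "evalg \<rho> (gen g) = \<rho> g"
  by (simp add: gen_def evalg_single word_endo_def)

lemma evalg_scal [simp]: "evalg \<rho> (scal c) = c \<odot> 1"
  by (simp add: scal_def evalg_single word_endo_def)

lemma scal_1: "scal 1 = 1"
  by (simp add: scal_def flip: zero_list_def single_one)

lemma evalg_one [simp]: "evalg \<rho> 1 = 1"
  by (simp flip: scal_1)

section \<open>Matrices as endomorphisms\<close>

text \<open>The matrix acts blockwise, on each block of \<open>d\<close> coordinates in the same way, so that for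
  \<open>d > 0\<close> the identity matrix is mapped to the identity.\<close>

definition mat_endo :: "nat \<Rightarrow> kk mat \<Rightarrow> endo" where
  "mat_endo d A = Endo (\<lambda>v r. \<Sum>j<d. A $$ (r mod d, j) * v (d * (r div d) + j))"

lemma app_mat_endo: "app (mat_endo d A) v r = (\<Sum>j<d. A $$ (r mod d, j) * v (d * (r div d) + j))"
proof -
  have "app (mat_endo d A) = (\<lambda>v r. \<Sum>j<d. A $$ (r mod d, j) * v (d * (r div d) + j))"
    unfolding mat_endo_def
    by (rule Endo_inverse) (auto simp: distrib_left sum.distrib sum_distrib_left mult.left_commute)
  then show ?thesis by simp
qed

lemma app_sum: "app (\<Sum>x\<in>X. f x) v i = (\<Sum>x\<in>X. app (f x) v i)"
  by (induction X rule: infinite_finite_induct) (simp_all add: app_simps)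

lemma mat_endo_inj:
  assumes "A \<in> carrier_mat d d" "B \<in> carrier_mat d d" "mat_endo d A = mat_endo d B"
  shows "A = B"
proof (rule eq_matI)
  fix i j assume "i < dim_row B" "j < dim_col B"
  then have ij: "i < d" "j < d" using assms by auto
  have e: "app (mat_endo d X) (\<lambda>r. if r = j then 1 else 0) i = X $$ (i, j)" for X
  proof -
    have "app (mat_endo d X) (\<lambda>r. if r = j then 1 else 0) i = (\<Sum>k<d. if j = k then X $$ (i, k) else 0)"
      unfolding app_mat_endo using ij by (intro sum.cong) auto
    then show ?thesis using ij by simp
  qed
  show "A $$ (i, j) = B $$ (i, j)" using e[of A] e[of B] assms(3) by simp
qed (use assms in auto)

lemma mat_endo_add:
  "A \<in> carrier_mat d d \<Longrightarrow> B \<in> carrier_mat d d \<Longrightarrow> mat_endo d (A + B) = mat_endo d A + mat_endo d B"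
  by (cases "d = 0"; rule endo_eqI)
    (auto simp: app_mat_endo app_simps sum.distrib[symmetric] distrib_right intro!: sum.cong)

lemma mat_endo_smult: "A \<in> carrier_mat d d \<Longrightarrow> mat_endo d (c \<cdot>\<^sub>m A) = c \<odot> mat_endo d A"
  by (cases "d = 0"; rule endo_eqI)
    (auto simp: app_mat_endo app_simps sum_distrib_left mult.assoc intro!: sum.cong)

lemma mat_endo_zero: "mat_endo d (0\<^sub>m d d) = 0"
  by (cases "d = 0"; rule endo_eqI) (auto simp: app_mat_endo app_simps)

lemma mat_endo_one: "d > 0 \<Longrightarrow> mat_endo d (1\<^sub>m d) = 1"
proof (rule endo_eqI)
  fix v i assume "d > 0"
  have "app (mat_endo d (1\<^sub>m d)) v i = (\<Sum>j<d. if i mod d = j then v (d * (i div d) + j) else 0)"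
    unfolding app_mat_endo using \<open>d > 0\<close> by (intro sum.cong) auto
  then show "app (mat_endo d (1\<^sub>m d)) v i = app 1 v i"
    using \<open>d > 0\<close> by (simp add: app_simps mult.commute[of d])
qed

lemma mat_endo_mult:
  assumes "A \<in> carrier_mat d d" "B \<in> carrier_mat d d"
  shows "mat_endo d (A * B) = mat_endo d A * mat_endo d B"
proof (rule endo_eqI)
  fix v i
  have "app (mat_endo d (A * B)) v i
      = (\<Sum>j<d. (\<Sum>k<d. A $$ (i mod d, k) * B $$ (k, j)) * v (d * (i div d) + j))"
    unfolding app_mat_endo
  proof (rule sum.cong)
    fix j assume "j \<in> {..<d}"
    then have "j < d" "i mod d < d" by auto
    then show "(A * B) $$ (i mod d, j) * v (d * (i div d) + j)
        = (\<Sum>k<d. A $$ (i mod d, k) * B $$ (k, j)) * v (d * (i div d) + j)"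
      using assms by (simp add: scalar_prod_def atLeast0LessThan)
  qed simp
  also have "\<dots> = (\<Sum>k<d. \<Sum>j<d. A $$ (i mod d, k) * (B $$ (k, j) * v (d * (i div d) + j)))"
    by (subst sum.swap) (simp add: sum_distrib_right sum_distrib_left mult.assoc)
  also have "\<dots> = app (mat_endo d A * mat_endo d B) v i"
    by (auto simp: app_simps app_mat_endo sum_distrib_left intro!: sum.cong)
  finally show "app (mat_endo d (A * B)) v i = app (mat_endo d A * mat_endo d B) v i" .
qed

lemma mat_endo_diff:
  assumes "A \<in> carrier_mat d d" "B \<in> carrier_mat d d"
  shows "mat_endo d (A - B) = mat_endo d A - mat_endo d B"
  using assms by (cases "d = 0"; intro endo_eqI)
    (auto simp: app_mat_endo app_simps sum_subtractf[symmetric] left_diff_distrib intro!: sum.cong)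

lemma word_act_carrier:
  "(\<And>g. A g \<in> carrier_mat d d) \<Longrightarrow> word_act d A w \<in> carrier_mat d d"
  unfolding word_act_def by (induction w) (auto intro!: mult_carrier_mat[of _ d d])

lemma free_act_carrier [simp]: "free_act d A x \<in> carrier_mat d d"
  by (simp add: free_act_def)

lemma mat_endo_free_act:
  assumes d: "d > 0" and A: "\<And>g. A g \<in> carrier_mat d d"
  shows "mat_endo d (free_act d A x) = evalg (\<lambda>g. mat_endo d (A g)) x"
proof -
  have w: "mat_endo d (word_act d A w) = word_endo (\<lambda>g. mat_endo d (A g)) w" for w
    using word_act_carrier[of A, OF A] A unfolding word_act_def word_endo_def
    by (induction w) (simp_all add: mat_endo_one d mat_endo_mult)
  show ?thesis
  proof (rule endo_eqI)
    fix v i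
    have "app (mat_endo d (free_act d A x)) v i = (\<Sum>j<d. \<Sum>w\<in>Poly_Mapping.keys x.
        Poly_Mapping.lookup x w * (word_act d A w $$ (i mod d, j) * v (d * (i div d) + j)))"
      unfolding app_mat_endo free_act_def using d
      by (intro sum.cong) (auto simp: sum_distrib_right mult.assoc)
    also have "\<dots> = app (evalg (\<lambda>g. mat_endo d (A g)) x) v i"
      unfolding evalg_def by (subst sum.swap) (simp add: app_sum app_simps app_mat_endo sum_distrib_left flip: w)
    finally show "app (mat_endo d (free_act d A x)) v i = app (evalg (\<lambda>g. mat_endo d (A g)) x) v i" .
  qed
qed

lemma mat_0_0_eq: "A \<in> carrier_mat 0 n \<Longrightarrow> B \<in> carrier_mat 0 n \<Longrightarrow> A = B"
  "A \<in> carrier_mat n 0 \<Longrightarrow> B \<in> carrier_mat n 0 \<Longrightarrow> A = B"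
  by auto

context
  fixes d :: nat and A :: "ugen \<Rightarrow> kk mat"
  assumes A: "\<And>g. A g \<in> carrier_mat d d"
begin

text \<open>For d > 0 equality of matrices may be tested after the injective map
  \<open>mat_endo d\<close>. That map is unital only for d > 0; for d = 0 all matrices of the given
  size coincide.\<close>

lemma free_act_eqI:
  assumes "X \<in> carrier_mat d d"
    and "d > 0 \<Longrightarrow> evalg (\<lambda>g. mat_endo d (A g)) x = mat_endo d X"
  shows "free_act d A x = X"
proof (cases "d = 0")
  case True
  then show ?thesis using assms(1) free_act_carrier[of d A x] mat_0_0_eq(1) by blast
next
  case False
  then have "mat_endo d (free_act d A x) = mat_endo d X"
    using mat_endo_free_act[of d A x, OF _ A] assms(2) by simp
  then show ?thesis
    using mat_endo_inj[OF _ assms(1)] by simp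
qed

lemma free_act_add: "free_act d A (x + y) = free_act d A x + free_act d A y"
  and free_act_diff: "free_act d A (x - y) = free_act d A x - free_act d A y"
  and free_act_mult: "free_act d A (x * y) = free_act d A x * free_act d A y"
  and free_act_scal: "free_act d A (scal c) = c \<cdot>\<^sub>m 1\<^sub>m d"
  and free_act_zero: "free_act d A 0 = 0\<^sub>m d d"
  using free_act_carrier[of d A x] free_act_carrier[of d A y] A
  by (auto intro!: free_act_eqI minus_carrier_mat mult_carrier_mat[of _ d d]
      simp: mat_endo_add mat_endo_diff mat_endo_mult mat_endo_free_act[OF _ A]
      mat_endo_smult mat_endo_one mat_endo_zero)

end

section \<open>The quotient algebra and its modules\<close>

abbreviation FS :: "nat \<Rightarrow> nat \<Rightarrow> falg set" where
  "FS m n \<equiv> carrier (free_sigma m n)"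

lemma FS_iff: "x \<in> FS m n \<longleftrightarrow> Poly_Mapping.keys x \<subseteq> lists (insert GSigma (U_gens m n))"
  by (simp add: free_sigma_def free_alg_def)

lemma free_sigma_simps [simp]:
  "x \<oplus>\<^bsub>free_sigma m n\<^esub> y = x + y" "x \<otimes>\<^bsub>free_sigma m n\<^esub> y = x * y"
  "\<one>\<^bsub>free_sigma m n\<^esub> = 1" "\<zero>\<^bsub>free_sigma m n\<^esub> = 0"
  by (simp_all add: free_sigma_def free_alg_def)

lemma FS_add: "x \<in> FS m n \<Longrightarrow> y \<in> FS m n \<Longrightarrow> x + y \<in> FS m n"
  unfolding FS_iff using keys_add[of x y] by blast

lemma FS_diff: "x \<in> FS m n \<Longrightarrow> y \<in> FS m n \<Longrightarrow> x - y \<in> FS m n"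
  unfolding FS_iff using keys_diff[of x y] by blast

lemma FS_mult: "x \<in> FS m n \<Longrightarrow> y \<in> FS m n \<Longrightarrow> x * y \<in> FS m n"
  unfolding FS_iff using keys_mult[of x y] by (fastforce simp: plus_list_def)

lemma FS_zero: "0 \<in> FS m n"
  by (simp add: FS_iff)

lemma FS_uminus: "x \<in> FS m n \<Longrightarrow> - x \<in> FS m n"
  by (simp add: FS_iff)

lemma FS_scal: "scal c \<in> FS m n"
  by (simp add: FS_iff scal_def)

lemma FS_one: "1 \<in> FS m n"
  using FS_scal[of 1] by (simp add: scal_1)

lemma FS_gen: "g = GSigma \<or> g \<in> U_gens m n \<Longrightarrow> gen g \<in> FS m n"
  by (auto simp: FS_iff gen_def)

lemma FS_eE: "i \<in> I_roots m n \<Longrightarrow> eE i \<in> FS m n"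
  and FS_eF: "i \<in> I_roots m n \<Longrightarrow> eF i \<in> FS m n"
  and FS_eK: "h \<in> lattice_Y m n \<Longrightarrow> eK h \<in> FS m n"
  and FS_eSigma: "eSigma \<in> FS m n"
  by (auto intro!: FS_gen simp: U_gens_def)

lemma Y_zero: "(\<lambda>j. 0) \<in> lattice_Y m n"
  unfolding lattice_Y_def by (auto intro: exI[of _ "\<lambda>i. 0"])

lemma Y_add: "h \<in> lattice_Y m n \<Longrightarrow> h' \<in> lattice_Y m n \<Longrightarrow> (\<lambda>j. h j + h' j) \<in> lattice_Y m n"
proof -
  assume "h \<in> lattice_Y m n" "h' \<in> lattice_Y m n"
  then obtain c c' where "h = (\<lambda>j. \<Sum>i\<in>I_roots m n. c i * hh i j)" "h' = (\<lambda>j. \<Sum>i\<in>I_roots m n. c' i * hh i j)"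
    by (auto simp: lattice_Y_def)
  then show ?thesis
    unfolding lattice_Y_def
    by (auto intro!: exI[of _ "\<lambda>i. c i + c' i"] simp: distrib_right sum.distrib)
qed

lemma Y_hh: "i \<in> I_roots m n \<Longrightarrow> (\<lambda>j. a * hh i j) \<in> lattice_Y m n"
proof -
  assume i: "i \<in> I_roots m n"
  have "finite (I_roots m n)" by (simp add: I_roots_def)
  then have "(\<Sum>k\<in>I_roots m n. (if k = i then a else 0) * hh k j) = a * hh i j" for j
    using i by (simp add: if_distrib[of "\<lambda>x. x * _"] cong: if_cong)
  then show ?thesis
    unfolding lattice_Y_def by (auto intro!: exI[of _ "\<lambda>k. if k = i then a else 0"])
qed

lemma Y_Ki: "i \<in> I_roots m n \<Longrightarrow> (\<lambda>j. dd i * hh i j) \<in> lattice_Y m n"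
  and Y_Ki': "i \<in> I_roots m n \<Longrightarrow> (\<lambda>j. - dd i * hh i j) \<in> lattice_Y m n"
  by (rule Y_hh, assumption)+

lemma FS_eKi: "i \<in> I_roots m n \<Longrightarrow> eKi i \<in> FS m n"
  and FS_eKi': "i \<in> I_roots m n \<Longrightarrow> eKi' i \<in> FS m n"
  unfolding eKi_def eKi'_def by (simp_all add: FS_eK Y_Ki Y_Ki'[simplified])

lemmas FS_intros = FS_uminus FS_add FS_diff FS_mult FS_zero FS_one FS_scal FS_eE FS_eF FS_eK FS_eSigma
  FS_eKi FS_eKi' Y_zero Y_add

lemma ring_free_sigma: "ring (free_sigma m n)"
proof (rule ringI)
  show "abelian_group (free_sigma m n)"
  proof (rule abelian_groupI)
    fix x assume "x \<in> FS m n"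
    then show "\<exists>y\<in>FS m n. y \<oplus>\<^bsub>free_sigma m n\<^esub> x = \<zero>\<^bsub>free_sigma m n\<^esub>"
      using FS_diff[OF FS_zero] by (intro bexI[of _ "0 - x"]) auto
  qed (auto simp: FS_intros algebra_simps)
  show "Group.monoid (free_sigma m n)"
    by (rule monoidI) (auto simp: FS_intros mult.assoc)
qed (auto simp: algebra_simps)

lemma relators_FS: "U_relators m n \<union> sigma_relators m n \<subseteq> FS m n"
proof -
  have s: "x \<in> FS m n \<Longrightarrow> y \<in> FS m n \<Longrightarrow> scomm a b c x y \<in> FS m n" for a b c x y
    unfolding scomm_def by (intro FS_intros)
  have t: "x \<in> FS m n \<Longrightarrow> y \<in> FS m n \<Longrightarrow> serre x y \<in> FS m n" for x y
    unfolding serre_def by (intro FS_intros)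
  have d: "X (-1) \<in> FS m n \<Longrightarrow> X 0 \<in> FS m n \<Longrightarrow> X 1 \<in> FS m n \<Longrightarrow> deg4 X \<in> FS m n" for X
    unfolding deg4_def by (intro s)
  show ?thesis
    unfolding U_relators_def sigma_relators_def
    by (auto intro!: FS_intros s t d)
qed

lemma ideal_ideal_sigma: "ideal (ideal_sigma m n) (free_sigma m n)"
  unfolding ideal_sigma_def by (rule ring.genideal_ideal[OF ring_free_sigma relators_FS])

lemma relator_in_ideal: "r \<in> U_relators m n \<union> sigma_relators m n \<Longrightarrow> r \<in> ideal_sigma m n"
  unfolding ideal_sigma_def using ring.genideal_self[OF ring_free_sigma relators_FS] by blast

lemma ucls_hom: "ucls m n \<in> ring_hom (free_sigma m n) (U_sigma m n)"
  unfolding ucls_def[abs_def] U_sigma_def by (rule ideal.rcos_ring_hom[OF ideal_ideal_sigma])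

lemma ucls_add: "x \<in> FS m n \<Longrightarrow> y \<in> FS m n \<Longrightarrow> ucls m n (x + y) = ucls m n x \<oplus>\<^bsub>U_sigma m n\<^esub> ucls m n y"
  using ring_hom_add[OF ucls_hom, of x m n y] by simp

lemma ucls_mult: "x \<in> FS m n \<Longrightarrow> y \<in> FS m n \<Longrightarrow> ucls m n (x * y) = ucls m n x \<otimes>\<^bsub>U_sigma m n\<^esub> ucls m n y"
  using ring_hom_mult[OF ucls_hom, of x m n y] by simp

lemma carrier_U_sigma: "carrier (U_sigma m n) = ucls m n ` FS m n"
  unfolding U_sigma_def FactRing_def A_RCOSETS_def RCOSETS_def ucls_def a_r_coset_def by auto

lemma ucls_carrier: "x \<in> FS m n \<Longrightarrow> ucls m n x \<in> carrier (U_sigma m n)"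
  by (simp add: carrier_U_sigma)

lemma ring_U_sigma: "ring (U_sigma m n)"
  unfolding U_sigma_def by (rule ideal.quotient_is_ring[OF ideal_ideal_sigma])

lemma one_U_sigma: "\<one>\<^bsub>U_sigma m n\<^esub> = ucls m n 1"
  using ring_hom_one[OF ucls_hom, of m n] by simp

lemma in_ucls: "z \<in> ucls m n x \<longleftrightarrow> (\<exists>h\<in>ideal_sigma m n. z = h + x)"
  by (auto simp: ucls_def a_r_coset_def r_coset_def)

lemma ucls_ideal: "r \<in> ideal_sigma m n \<Longrightarrow> ucls m n r = ucls m n 0"
proof -
  interpret I: ideal "ideal_sigma m n" "free_sigma m n" by (rule ideal_ideal_sigma)
  assume r: "r \<in> ideal_sigma m n"
  have "0 \<in> ideal_sigma m n"
    using additive_subgroup.zero_closed[OF ideal.axioms(1)[OF ideal_ideal_sigma]] by simp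
  with r show ?thesis
    using I.a_rcos_const[of r] I.a_rcos_const[of 0] by (simp add: ucls_def)
qed

text \<open>The elements acting by zero form a two-sided ideal. Containing the relators, it contains
  \<open>ideal_sigma m n\<close>, so the representative picked by the choice operator acts in the
  same way as x.\<close>

lemma mact_module_of:
  assumes A: "\<And>g. A g \<in> carrier_mat (length ps) (length ps)"
    and rel: "\<And>r. r \<in> U_relators m n \<union> sigma_relators m n \<Longrightarrow> free_act (length ps) A r = 0\<^sub>m (length ps) (length ps)"
    and x: "x \<in> FS m n"
  shows "mact (module_of m n ps A) (ucls m n x) = free_act (length ps) A x"
proof -
  let ?d = "length ps"
  let ?J = "{y \<in> FS m n. free_act ?d A y = 0\<^sub>m ?d ?d}"
  interpret R: ring "free_sigma m n" by (rule ring_free_sigma)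
  have inv: "\<ominus>\<^bsub>free_sigma m n\<^esub> y = 0 - y" if "y \<in> FS m n" for y
    using that by (intro R.minus_equality) (simp_all add: FS_intros)
  have "ideal ?J (free_sigma m n)"
  proof (rule idealI[OF ring_free_sigma])
    show "subgroup ?J (add_monoid (free_sigma m n))"
    proof (rule group.subgroupI[OF R.a_group])
      fix y assume y: "y \<in> ?J"
      then have "free_act ?d A (0 - y) = 0\<^sub>m ?d ?d" "0 - y \<in> FS m n"
        unfolding free_act_diff[OF A] by (auto simp: free_act_zero[OF A] intro: FS_uminus)
      moreover have "inv\<^bsub>add_monoid (free_sigma m n)\<^esub> y = 0 - y"
        using inv y unfolding a_inv_def by blast
      ultimately show "inv\<^bsub>add_monoid (free_sigma m n)\<^esub> y \<in> ?J"
        by (simp only: mem_Collect_eq)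
    qed (auto simp: FS_intros free_act_zero[OF A] free_act_add[OF A])
  next
    fix a y assume "a \<in> ?J" "y \<in> FS m n"
    then show "y \<otimes>\<^bsub>free_sigma m n\<^esub> a \<in> ?J" "a \<otimes>\<^bsub>free_sigma m n\<^esub> y \<in> ?J"
      by (simp_all add: FS_intros free_act_mult[OF A] left_mult_zero_mat[of _ ?d ?d] right_mult_zero_mat[of _ ?d ?d])
  qed
  moreover have "U_relators m n \<union> sigma_relators m n \<subseteq> ?J"
    using rel relators_FS by blast
  ultimately have J: "ideal_sigma m n \<subseteq> ?J"
    unfolding ideal_sigma_def by (rule R.genideal_minimal)
  have "0 \<in> ideal_sigma m n"
    using additive_subgroup.zero_closed[OF ideal.axioms(1)[OF ideal_ideal_sigma]] by simp
  then have "x \<in> ucls m n x"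
    unfolding in_ucls by (auto intro: bexI[of _ 0])
  then have "(SOME z. z \<in> ucls m n x) \<in> ucls m n x"
    by (rule someI)
  then obtain h where "h \<in> ?J" and "(SOME z. z \<in> ucls m n x) = h + x"
    using J unfolding in_ucls by blast
  then have "free_act ?d A (SOME z. z \<in> ucls m n x) = free_act ?d A x"
    by (simp add: free_act_add[OF A])
  then show ?thesis
    using x by (simp add: module_of_def ucls_carrier)
qed

text \<open>The action pulled back to the free algebra, so that calculations use the operations of
  the type \<open>falg\<close> instead of those on cosets.\<close>

definition rp :: "nat \<Rightarrow> nat \<Rightarrow> smod \<Rightarrow> falg \<Rightarrow> kk mat" where
  "rp m n M x = mact M (ucls m n x)"

context
  fixes m n :: nat and M :: smod
  assumes M: "is_module m n (carrier (U_sigma m n)) M"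
begin

lemma rp_carrier: "x \<in> FS m n \<Longrightarrow> rp m n M x \<in> carrier_mat (mdim M) (mdim M)"
  using M ucls_carrier unfolding is_module_def rp_def by auto

lemma rp_add: "x \<in> FS m n \<Longrightarrow> y \<in> FS m n \<Longrightarrow> rp m n M (x + y) = rp m n M x + rp m n M y"
  using M ucls_carrier unfolding is_module_def rp_def by (simp add: ucls_add)

lemma rp_mult: "x \<in> FS m n \<Longrightarrow> y \<in> FS m n \<Longrightarrow> rp m n M (x * y) = rp m n M x * rp m n M y"
  using M ucls_carrier unfolding is_module_def rp_def by (simp add: ucls_mult)

lemma rp_scal: "rp m n M (scal c) = c \<cdot>\<^sub>m 1\<^sub>m (mdim M)"
  using M unfolding is_module_def rp_def by simp

lemma rp_one: "rp m n M 1 = 1\<^sub>m (mdim M)"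
  using rp_scal[of 1] by (auto simp: scal_1)

lemma rp_zero: "rp m n M 0 = 0\<^sub>m (mdim M) (mdim M)"
  using rp_scal[of 0] by (auto simp: scal_def)

lemma rp_diff:
  assumes "x \<in> FS m n" "y \<in> FS m n"
  shows "rp m n M (x - y) = rp m n M x - rp m n M y"
proof -
  have "rp m n M x = rp m n M (x - y) + rp m n M y"
    using assms by (simp add: FS_intros flip: rp_add)
  moreover have "rp m n M (x - y) \<in> carrier_mat (mdim M) (mdim M)" "rp m n M y \<in> carrier_mat (mdim M) (mdim M)"
    using assms by (simp_all add: rp_carrier FS_intros)
  ultimately show ?thesis by auto
qed

lemma rp_relator:
  "r \<in> U_relators m n \<union> sigma_relators m n \<Longrightarrow> rp m n M r = 0\<^sub>m (mdim M) (mdim M)"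
  using rp_zero ucls_ideal[OF relator_in_ideal, of r] by (simp add: rp_def)

lemma rp_parity:
  assumes "x \<in> FS m n" "\<forall>w\<in>Poly_Mapping.keys x. word_odd w = s" "i < mdim M" "j < mdim M"
    "rp m n M x $$ (i, j) \<noteq> 0"
  shows "mpar M ! i = (mpar M ! j \<noteq> s)"
  using M assms ucls_carrier[OF assms(1)] unfolding is_module_def rp_def U_homog_def by blast

end

section \<open>Compatibility of the coproduct with the relations\<close>

lemma qq_nonzero [simp]: "qq \<noteq> 0"
  unfolding qq_def Zero_fract_def by (simp add: eq_fract)

text \<open>The relation [E_0, E_0] = 0 of the odd generator says 2 E_0^2 = 0; dividing by 2 gives
  E_0^2 = 0.\<close>

lemma two_nonzero [simp]: "(2 :: kk) \<noteq> 0"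
proof -
  have "(2 :: kk) = Fract (1 + 1) 1"
    unfolding one_add_one[symmetric] One_fract_def by simp
  moreover have "Fract (1 + 1) 1 \<noteq> (Fract 0 1 :: kk)"
    unfolding eq_fract(1)[OF one_neq_zero one_neq_zero] by simp
  ultimately show ?thesis by (simp only: Zero_fract_def) blast
qed

text \<open>The symmetrized Cartan matrix. Since K_i is K_h for h = d_i h_i, the power of q with
  this exponent is the factor by which K_i passes E_j.\<close>

definition bform :: "int \<Rightarrow> int \<Rightarrow> int" where
  "bform i j = dd i * cartan i j"

lemma cartan_0: "cartan 0 j = (if j = 1 then 1 else if j = -1 then -1 else 0)"
  by (auto simp: cartan_def pair_alpha_def hh_def)

lemma cartan_nonzero: "i \<noteq> 0 \<Longrightarrow> cartan i j = (if j = i then 2 else if j = i + 1 \<or> j = i - 1 then -1 else 0)"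
  by (auto simp: cartan_def pair_alpha_def hh_def)

lemma bform_sym: "bform i j = bform j i"
  unfolding bform_def by (cases "i = 0"; cases "j = 0") (auto simp: cartan_0 cartan_nonzero dd_def)

lemma pair_alpha_scale: "pair_alpha (\<lambda>j. a * hh i j) k = a * cartan i k"
  by (simp add: pair_alpha_def cartan_def algebra_simps)

abbreviation psgn :: "int \<Rightarrow> int \<Rightarrow> kk" where
  "psgn i j \<equiv> (if i = 0 \<and> j = 0 then -1 else 1)"

text \<open>The relations that involve only the E_i, or only the F_i. The weights in the last one
  are q_0 = 1/q and q_1 = q.\<close>

definition pos_rels :: "nat \<Rightarrow> nat \<Rightarrow> (int \<Rightarrow> endo) \<Rightarrow> bool" where
  "pos_rels m n z \<longleftrightarrow>
     (\<forall>i\<in>I_roots m n. \<forall>j\<in>I_roots m n. cartan i j = 0 \<longrightarrow> z i * z j = psgn i j \<odot> (z j * z i)) \<and>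
     (\<forall>i\<in>I_roots m n. \<forall>j\<in>I_roots m n. \<bar>cartan i j\<bar> = 1 \<longrightarrow> i \<noteq> 0 \<longrightarrow>
        z i * z i * z j - (qq + inverse qq) \<odot> (z i * z j * z i) + z j * z i * z i = 0) \<and>
     ({-1, 0, 1} \<subseteq> I_roots m n \<longrightarrow>
        qc (-1) (qc qq (qc (inverse qq) (z (-1)) (z 0)) (z 1)) (z 0) = 0)"

lemma pos_relsD:
  assumes "pos_rels m n z" "i \<in> I_roots m n" "j \<in> I_roots m n"
  shows "cartan i j = 0 \<Longrightarrow> z i * z j = psgn i j \<odot> (z j * z i)"
    and "\<bar>cartan i j\<bar> = 1 \<Longrightarrow> i \<noteq> 0 \<Longrightarrow>
        z i * z i * z j - (qq + inverse qq) \<odot> (z i * z j * z i) + z j * z i * z i = 0"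
  using assms unfolding pos_rels_def by blast+

lemma pos_rels_0_square:
  assumes "pos_rels m n z" "0 \<in> I_roots m n"
  shows "z 0 * z 0 = 0"
proof -
  have "z 0 * z 0 = (-1) \<odot> (z 0 * z 0)"
    using pos_relsD(1)[OF assms assms(2)] by (simp add: cartan_0)
  then have "(1 - (-1)) \<odot> (z 0 * z 0) = 0"
    unfolding sk.scale_left_diff_distrib by simp
  then have "(inverse 2 * (1 - (-1))) \<odot> (z 0 * z 0) = 0"
    by (metis sk.scale_scale sk.scale_zero_right)
  then show ?thesis by simp
qed

text \<open>Each relation is homogeneous in every \<open>z i\<close>, so the mutually commuting
  factors \<open>c i\<close> gather in front of it as one common factor.\<close>

lemma pos_rels_twist:
  assumes z: "pos_rels m n z"
    and cc: "\<And>i j. i \<in> I_roots m n \<Longrightarrow> j \<in> I_roots m n \<Longrightarrow> c i * c j = c j * c i"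
    and cz: "\<And>i j. i \<in> I_roots m n \<Longrightarrow> j \<in> I_roots m n \<Longrightarrow> z i * c j = c j * z i"
  shows "pos_rels m n (\<lambda>i. c i * z i)"
proof -
  have cz': "z i * (c j * x) = c j * (z i * x)" if "i \<in> I_roots m n" "j \<in> I_roots m n" for i j x
    using cz[OF that] by (metis mult.assoc)
  have cc': "c i * (c j * x) = c j * (c i * x)" if "i \<in> I_roots m n" "j \<in> I_roots m n" for i j x
    using cc[OF that] by (metis mult.assoc)
  have two: "c i * z i * (c j * z j) = c i * c j * (z i * z j)"
    if "i \<in> I_roots m n" "j \<in> I_roots m n" for i j
    using that by (simp add: cz' mult.assoc)
  have four: "qc (-1) (qc qq (qc (inverse qq) (c (-1) * z (-1)) (c 0 * z 0)) (c 1 * z 1)) (c 0 * z 0)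
      = c (-1) * c 0 * c 1 * c 0 * qc (-1) (qc qq (qc (inverse qq) (z (-1)) (z 0)) (z 1)) (z 0)"
    if "{-1, 0, 1} \<subseteq> I_roots m n"
  proof -
    have I: "-1 \<in> I_roots m n" "0 \<in> I_roots m n" "1 \<in> I_roots m n" using that by auto
    have r: "c 1 * (c 0 * x) = c 0 * (c 1 * x)" "c 1 * (c (- 1) * x) = c (- 1) * (c 1 * x)"
      "c 0 * (c (- 1) * x) = c (- 1) * (c 0 * x)" for x
      using cc' I by blast+
    show ?thesis unfolding qc_def using I by (simp add: sk_expand cz' r)
  qed
  show ?thesis
    unfolding pos_rels_def
  proof (intro conjI ballI impI)
    fix i j assume ij: "i \<in> I_roots m n" "j \<in> I_roots m n"
    { assume "cartan i j = 0"
      then show "c i * z i * (c j * z j) = psgn i j \<odot> (c j * z j * (c i * z i))"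
        using pos_relsD(1)[OF z ij] ij cc[OF ij] by (simp only: two sk_mult_right)
    next
      assume *: "\<bar>cartan i j\<bar> = 1" "i \<noteq> 0"
      have r: "c j * (c i * x) = c i * (c j * x)" for x using cc' ij by blast
      have "c i * z i * (c i * z i) * (c j * z j) - (qq + inverse qq) \<odot> (c i * z i * (c j * z j) * (c i * z i)) +
         c j * z j * (c i * z i) * (c i * z i)
        = c i * c i * c j * (z i * z i * z j - (qq + inverse qq) \<odot> (z i * z j * z i) + z j * z i * z i)"
        using ij by (simp add: sk_expand cz' r)
      then show "c i * z i * (c i * z i) * (c j * z j) - (qq + inverse qq) \<odot> (c i * z i * (c j * z j) * (c i * z i)) +
         c j * z j * (c i * z i) * (c i * z i) = 0"
        using pos_relsD(2)[OF z ij *] by simp }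
  next
    assume "{-1, 0, 1} \<subseteq> I_roots m n"
    then show "qc (-1) (qc qq (qc (inverse qq) (c (-1) * z (-1)) (c 0 * z 0)) (c 1 * z 1)) (c 0 * z 0) = 0"
      using four z by (simp add: pos_rels_def)
  qed
qed

lemma pos_rels_sum:
  assumes x: "pos_rels m n x" and y: "pos_rels m n y"
    and yx: "\<And>i j. i \<in> I_roots m n \<Longrightarrow> j \<in> I_roots m n \<Longrightarrow>
        y i * x j = (psgn i j * qq powi bform i j) \<odot> (x j * y i)"
  shows "pos_rels m n (\<lambda>i. x i + y i)"
  unfolding pos_rels_def
proof (intro conjI ballI impI)
  fix i j assume ij: "i \<in> I_roots m n" "j \<in> I_roots m n"
  { assume c: "cartan i j = 0"
    then have b: "bform i j = 0" "bform j i = 0" using bform_sym[of i j] by (simp_all add: bform_def)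
    have s: "psgn i j \<odot> (psgn j i \<odot> z) = z" for z by simp
    show "(x i + y i) * (x j + y j) = psgn i j \<odot> ((x j + y j) * (x i + y i))"
      using pos_relsD(1)[OF x ij c] pos_relsD(1)[OF y ij c] yx[OF ij] yx[OF ij(2,1)] b
      by (simp add: distrib_left distrib_right sk.scale_right_distrib)
  next
    assume c: "\<bar>cartan i j\<bar> = 1" "i \<noteq> 0"
    \<comment> \<open>The entry (i, j) of the form is 1 or -1, so w is 1/q or q. As (i, i) = -2 (i,
      j), the exchange factor of y i with x i is w^-2, as \<open>serre_split\<close>
      requires.\<close>
    define w where "w = qq powi bform i j"
    have j: "j = i + 1 \<or> j = i - 1" using c by (auto simp: cartan_nonzero split: if_splits)
    have w: "w \<noteq> 0" "w + inverse w = qq + inverse qq" "qq powi bform i i = inverse (w\<^sup>2)"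
      unfolding w_def bform_def using c j
      by (auto simp: cartan_nonzero dd_def power_int_minus power_int_numeral power_inverse)
    note yx' = yx[OF ij] yx[OF ij(2,1)] yx[OF ij(1,1)]
    have "qc (inverse w) (x i + y i) (qc w (x i + y i) (x j + y j)) = 0"
      by (rule serre_split)
        (use w pos_relsD(2)[OF x ij c] pos_relsD(2)[OF y ij c] yx' c(2) in
          \<open>simp_all add: w_def bform_sym[of j i] flip: serre_eq_qc\<close>)
    then show "(x i + y i) * (x i + y i) * (x j + y j) - (qq + inverse qq) \<odot> ((x i + y i) * (x j + y j) * (x i + y i)) +
       (x j + y j) * (x i + y i) * (x i + y i) = 0"
      using w by (simp flip: serre_eq_qc) }
next
  assume I: "{-1, 0, 1} \<subseteq> I_roots m n"
  then have I': "-1 \<in> I_roots m n" "0 \<in> I_roots m n" "1 \<in> I_roots m n" by auto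
  \<comment> \<open>These values are the exchange factors of \<open>deg4_split\<close> with w =
    q.\<close>
  have b: "bform 0 0 = 0" "bform (-1) 1 = 0" "bform 1 (-1) = 0" "bform (-1) 0 = 1" "bform 0 (-1) = 1"
    "bform 0 1 = -1" "bform 1 0 = -1"
    by (simp_all add: bform_def cartan_0 cartan_nonzero dd_def)
  have cy: "y 1 * y (-1) = y (-1) * y 1"
    using pos_relsD(1)[OF y I'(3,1)] by (simp add: cartan_nonzero)
  show "qc (-1) (qc qq (qc (inverse qq) (x (-1) + y (-1)) (x 0 + y 0)) (x 1 + y 1)) (x 0 + y 0) = 0"
    by (rule deg4_split)
      (use x y I cy pos_rels_0_square[OF x I'(2)] pos_rels_0_square[OF y I'(2)]
        yx[OF I'(2,2)] yx[OF I'(1,3)] yx[OF I'(3,1)] yx[OF I'(1,2)] yx[OF I'(2,1)] yx[OF I'(2,3)] yx[OF I'(3,2)]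
        in \<open>simp_all add: b pos_rels_def power_int_minus\<close>)
qed

text \<open>A representation of \<open>U_sigma m n\<close>, written on the free algebra. The laws
  are restricted to \<open>FS m n\<close> because the type \<open>ugen\<close> also has letters with
  indices outside I and weights outside the lattice.\<close>

locale endo_rep =
  fixes m n :: nat and h :: "falg \<Rightarrow> endo"
  assumes h_add: "x \<in> FS m n \<Longrightarrow> y \<in> FS m n \<Longrightarrow> h (x + y) = h x + h y"
    and h_diff: "x \<in> FS m n \<Longrightarrow> y \<in> FS m n \<Longrightarrow> h (x - y) = h x - h y"
    and h_mult: "x \<in> FS m n \<Longrightarrow> y \<in> FS m n \<Longrightarrow> h (x * y) = h x * h y"
    and h_scal: "h (scal c) = c \<odot> 1"
    and h_rel: "r \<in> U_relators m n \<union> sigma_relators m n \<Longrightarrow> h r = 0"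
begin

lemma h_one: "h 1 = 1"
  using h_scal[of 1] by (simp add: scal_1)

lemmas h_simps = h_add h_diff h_mult h_scal h_one FS_intros

lemma h_K0: "h (eK (\<lambda>j. 0)) = 1"
  using h_rel[of "eK (\<lambda>j. 0) - 1"] by (simp add: U_relators_def h_simps)

lemma h_KK: "a \<in> lattice_Y m n \<Longrightarrow> b \<in> lattice_Y m n \<Longrightarrow> h (eK a) * h (eK b) = h (eK (\<lambda>j. a j + b j))"
  using h_rel[of "eK a * eK b - eK (\<lambda>j. a j + b j)"] by (simp add: U_relators_def h_simps) blast

lemma h_KK_commute: "a \<in> lattice_Y m n \<Longrightarrow> b \<in> lattice_Y m n \<Longrightarrow> h (eK a) * h (eK b) = h (eK b) * h (eK a)"
  by (simp add: h_KK add.commute)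

lemma h_KE:
  assumes "a \<in> lattice_Y m n" "i \<in> I_roots m n"
  shows "h (eK a) * h (eE i) = (qq powi pair_alpha a i) \<odot> (h (eE i) * h (eK a))"
proof -
  have "eK a * eE i - scal (qq powi pair_alpha a i) * eE i * eK a \<in> U_relators m n"
    using assms unfolding U_relators_def by blast
  then have "h (eK a * eE i - scal (qq powi pair_alpha a i) * eE i * eK a) = 0" using h_rel by blast
  then show ?thesis using assms by (simp add: h_simps)
qed

lemma h_KF:
  assumes "a \<in> lattice_Y m n" "i \<in> I_roots m n"
  shows "h (eK a) * h (eF i) = (qq powi (- pair_alpha a i)) \<odot> (h (eF i) * h (eK a))"
proof -
  have "eK a * eF i - scal (qq powi (- pair_alpha a i)) * eF i * eK a \<in> U_relators m n"
    using assms unfolding U_relators_def by blast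
  then have "h (eK a * eF i - scal (qq powi (- pair_alpha a i)) * eF i * eK a) = 0" using h_rel by blast
  then show ?thesis using assms by (simp add: h_simps)
qed

lemma h_KiE:
  assumes "i \<in> I_roots m n" "j \<in> I_roots m n"
  shows "h (eKi i) * h (eE j) = (qq powi bform i j) \<odot> (h (eE j) * h (eKi i))"
    and "h (eKi' i) * h (eE j) = (qq powi (- bform i j)) \<odot> (h (eE j) * h (eKi' i))"
    and "h (eKi i) * h (eF j) = (qq powi (- bform i j)) \<odot> (h (eF j) * h (eKi i))"
    and "h (eKi' i) * h (eF j) = (qq powi bform i j) \<odot> (h (eF j) * h (eKi' i))"
  using h_KE[OF Y_Ki[OF assms(1)] assms(2)] h_KE[OF Y_Ki'[OF assms(1)] assms(2)]
    h_KF[OF Y_Ki[OF assms(1)] assms(2)] h_KF[OF Y_Ki'[OF assms(1)] assms(2)]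
  unfolding pair_alpha_scale eKi_def eKi'_def bform_def by simp_all

lemma h_Ki_inverse:
  assumes "i \<in> I_roots m n"
  shows "h (eKi i) * h (eKi' i) = 1" "h (eKi' i) * h (eKi i) = 1"
  using h_KK[OF Y_Ki[OF assms] Y_Ki'[OF assms]] h_KK[OF Y_Ki'[OF assms] Y_Ki[OF assms]]
  by (simp_all add: eKi_def eKi'_def h_K0)

lemma h_EF:
  assumes "i \<in> I_roots m n" "j \<in> I_roots m n"
  shows "h (eE i) * h (eF j) = psgn i j \<odot> (h (eF j) * h (eE i))
    + (if i = j then inverse (q_i i - inverse (q_i i)) \<odot> (h (eKi i) - h (eKi' i)) else 0)"
proof -
  have "scomm (i = 0) (j = 0) 1 (eE i) (eF j)
          - (if i = j then scal (inverse (q_i i - inverse (q_i i))) * (eKi i - eKi' i) else 0) \<in> U_relators m n"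
    using assms unfolding U_relators_def by blast
  then have "h (scomm (i = 0) (j = 0) 1 (eE i) (eF j)
          - (if i = j then scal (inverse (q_i i - inverse (q_i i))) * (eKi i - eKi' i) else 0)) = 0"
    using h_rel by blast
  then show ?thesis
    using assms by (cases "i = j"; cases "i = 0 \<and> j = 0") (auto simp: scomm_def h_simps algebra_simps)
qed

lemma h_pos_rels:
  assumes X: "X \<in> {\<lambda>i. eE i, \<lambda>i. eF i}"
  shows "pos_rels m n (\<lambda>i. h (X i))"
proof -
  have XF: "X i \<in> FS m n" if "i \<in> I_roots m n" for i
    using X that by (auto intro: FS_intros)
  show ?thesis
    unfolding pos_rels_def
  proof (intro conjI ballI impI)
    fix i j assume ij: "i \<in> I_roots m n" "j \<in> I_roots m n"
    { assume "cartan i j = 0"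
      then have "scomm (i = 0) (j = 0) 1 (X i) (X j) \<in> U_relators m n"
        using X ij unfolding U_relators_def
        by - (rule UnI1, rule UnI1, rule UnI2, intro CollectI exI[of _ X] exI[of _ i] exI[of _ j], simp)
      then have "h (scomm (i = 0) (j = 0) 1 (X i) (X j)) = 0" using h_rel by blast
      then show "h (X i) * h (X j) = psgn i j \<odot> (h (X j) * h (X i))"
        using ij XF by (simp add: scomm_def h_simps)
    next
      assume "\<bar>cartan i j\<bar> = 1" "i \<noteq> 0"
      then have "serre (X i) (X j) \<in> U_relators m n"
        using X ij unfolding U_relators_def
        by - (rule UnI1, rule UnI2, intro CollectI exI[of _ X] exI[of _ i] exI[of _ j], simp)
      then have "h (serre (X i) (X j)) = 0" using h_rel by blast
      then show "h (X i) * h (X i) * h (X j) - (qq + inverse qq) \<odot> (h (X i) * h (X j) * h (X i)) +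
         h (X j) * h (X i) * h (X i) = 0"
        using ij XF by (simp add: serre_def h_simps mult.assoc)
    }
  next
    assume I: "{-1, 0, 1} \<subseteq> I_roots m n"
    then have "X (-1) \<in> FS m n" "X 0 \<in> FS m n" "X 1 \<in> FS m n" using XF by auto
    moreover have "deg4 X \<in> U_relators m n"
      using I X unfolding U_relators_def by - (rule UnI2, intro CollectI exI[of _ X], simp)
    then have "h (deg4 X) = 0" using h_rel by blast
    ultimately show "qc (-1) (qc qq (qc (inverse qq) (h (X (-1))) (h (X 0))) (h (X 1))) (h (X 0)) = 0"
      by (simp add: deg4_def scomm_def h_simps qc_def q_i_def dd_def power_int_minus)
  qed
qed

lemma h_sigma:
  shows "h eSigma * h eSigma = 1"
    and "i \<in> I_roots m n \<Longrightarrow> h eSigma * h (eE i) * h eSigma = sigma_sign m i \<odot> h (eE i)"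
    and "i \<in> I_roots m n \<Longrightarrow> h eSigma * h (eF i) * h eSigma = sigma_sign m i \<odot> h (eF i)"
    and "a \<in> lattice_Y m n \<Longrightarrow> h eSigma * h (eK a) * h eSigma = h (eK a)"
proof -
  have "eSigma * eSigma - 1 \<in> sigma_relators m n" unfolding sigma_relators_def by blast
  then have "h (eSigma * eSigma - 1) = 0" using h_rel by blast
  then show "h eSigma * h eSigma = 1" by (simp add: h_simps)
next
  assume i: "i \<in> I_roots m n"
  then have "eSigma * eE i * eSigma - scal (sigma_sign m i) * eE i \<in> sigma_relators m n"
    "eSigma * eF i * eSigma - scal (sigma_sign m i) * eF i \<in> sigma_relators m n"
    unfolding sigma_relators_def by blast+
  then have "h (eSigma * eE i * eSigma - scal (sigma_sign m i) * eE i) = 0"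
    "h (eSigma * eF i * eSigma - scal (sigma_sign m i) * eF i) = 0" using h_rel by blast+
  then show "h eSigma * h (eE i) * h eSigma = sigma_sign m i \<odot> h (eE i)"
    "h eSigma * h (eF i) * h eSigma = sigma_sign m i \<odot> h (eF i)" using i by (simp_all add: h_simps)
next
  assume a: "a \<in> lattice_Y m n"
  then have "eSigma * eK a * eSigma - eK a \<in> sigma_relators m n" unfolding sigma_relators_def by blast
  then have "h (eSigma * eK a * eSigma - eK a) = 0" using h_rel by blast
  then show "h eSigma * h (eK a) * h eSigma = h (eK a)" using a by (simp add: h_simps)
qed

end

lemma pos_rels_cong: "(\<And>i. i \<in> I_roots m n \<Longrightarrow> z i = z' i) \<Longrightarrow> pos_rels m n z' \<Longrightarrow> pos_rels m n z"
  by (simp add: pos_rels_def)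

text \<open>Two commuting representations \<open>l\<close> and \<open>r\<close> on the same space; \<open>p\<close> is the parity operator
  of the first one, which turns the super sign rule into an ordinary tensor product.\<close>

locale tensor_rep = l: endo_rep m n l + r: endo_rep m n r for m n l r +
  fixes p :: endo
  assumes rl: "x \<in> FS m n \<Longrightarrow> y \<in> FS m n \<Longrightarrow> r y * l x = l x * r y"
    and pp: "p * p = 1"
    and pr: "y \<in> FS m n \<Longrightarrow> r y * p = p * r y"
    and pE: "i \<in> I_roots m n \<Longrightarrow> p * l (eE i) = psgn i i \<odot> (l (eE i) * p)"
    and pF: "i \<in> I_roots m n \<Longrightarrow> p * l (eF i) = psgn i i \<odot> (l (eF i) * p)"
    and pK: "a \<in> lattice_Y m n \<Longrightarrow> p * l (eK a) = l (eK a) * p"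
    and pS: "p * l eSigma = l eSigma * p"
begin

text \<open>The sign operator on the first factor that appears when E_i or F_i acts on the second
  one; only the index 0 is odd.\<close>

definition P :: "int \<Rightarrow> endo" where
  "P i = (if i = 0 then p else 1)"

fun tens :: "ugen \<Rightarrow> endo" where
  "tens (GE i) = l (eE i) + l (eKi i) * P i * r (eE i)"
| "tens (GF i) = l (eF i) * r (eKi' i) + P i * r (eF i)"
| "tens (GK a) = l (eK a) * r (eK a)"
| "tens GSigma = l eSigma * r eSigma"

lemma P_simps:
  shows "P i * P j = P j * P i" "P i * P i = 1"
    and "y \<in> FS m n \<Longrightarrow> r y * P i = P i * r y"
    and "j \<in> I_roots m n \<Longrightarrow> P i * l (eE j) = psgn i j \<odot> (l (eE j) * P i)"
    and "j \<in> I_roots m n \<Longrightarrow> P i * l (eF j) = psgn i j \<odot> (l (eF j) * P i)"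
    and "a \<in> lattice_Y m n \<Longrightarrow> P i * l (eK a) = l (eK a) * P i"
    and "P i * l eSigma = l eSigma * P i"
  by (auto simp: P_def pp pr pE pF pK pS)

lemma P_Ki: "j \<in> I_roots m n \<Longrightarrow> P i * l (eKi j) = l (eKi j) * P i"
  "j \<in> I_roots m n \<Longrightarrow> P i * l (eKi' j) = l (eKi' j) * P i"
  unfolding eKi_def eKi'_def by (simp_all add: P_simps(6) Y_Ki Y_Ki'[simplified])

lemma tens_swap:
  assumes ij: "i \<in> I_roots m n" "j \<in> I_roots m n"
  shows "l (eKi i) * P i * r (eE i) * l (eE j)
      = (psgn i j * qq powi bform i j) \<odot> (l (eE j) * (l (eKi i) * P i * r (eE i)))"
proof -
  have "l (eKi i) * P i * r (eE i) * l (eE j) = l (eKi i) * (P i * l (eE j)) * r (eE i)"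
    using ij by (simp add: mult.assoc rl FS_intros)
  also have "\<dots> = psgn i j \<odot> (l (eKi i) * l (eE j) * P i * r (eE i))"
    using ij by (simp only: P_simps(4) sk_mult_left sk_mult_right mult.assoc)
  also have "\<dots> = (psgn i j * qq powi bform i j) \<odot> (l (eE j) * (l (eKi i) * P i * r (eE i)))"
    unfolding l.h_KiE(1)[OF ij] by (simp add: mult.assoc)
  finally show ?thesis .
qed

lemma tens_E_pos_rels: "pos_rels m n (\<lambda>i. tens (GE i))"
proof -
  have y: "pos_rels m n (\<lambda>i. l (eKi i) * P i * r (eE i))"
  proof (rule pos_rels_twist)
    show "pos_rels m n (\<lambda>i. r (eE i))" using r.h_pos_rels by simp
    fix i j assume ij: "i \<in> I_roots m n" "j \<in> I_roots m n"
    have "l (eKi i) * l (eKi j) = l (eKi j) * l (eKi i)"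
      unfolding eKi_def using ij by (simp add: l.h_KK_commute Y_Ki)
    moreover have "l (eKi i) * P i * (l (eKi j) * P j) = l (eKi i) * l (eKi j) * (P i * P j)"
      if "j \<in> I_roots m n" for i j
    proof -
      have "l (eKi i) * P i * (l (eKi j) * P j) = l (eKi i) * (P i * l (eKi j)) * P j"
        by (simp only: mult.assoc)
      then show ?thesis unfolding P_Ki(1)[OF that] by (simp only: mult.assoc)
    qed
    ultimately show "l (eKi i) * P i * (l (eKi j) * P j) = l (eKi j) * P j * (l (eKi i) * P i)"
      using ij P_simps(1)[of i j] by simp
    have "r (eE i) * (l (eKi j) * P j) = l (eKi j) * (r (eE i) * P j)"
      using ij rl[of "eKi j" "eE i"] by (simp add: FS_intros flip: mult.assoc)
    then show "r (eE i) * (l (eKi j) * P j) = l (eKi j) * P j * r (eE i)"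
      using ij P_simps(3)[of "eE i" j] by (simp add: FS_intros mult.assoc)
  qed
  have "pos_rels m n (\<lambda>i. l (eE i) + l (eKi i) * P i * r (eE i))"
  proof (rule pos_rels_sum[OF _ y])
    show "pos_rels m n (\<lambda>i. l (eE i))" using l.h_pos_rels by simp
  qed (rule tens_swap)
  then show ?thesis by simp
qed

lemma tens_F_pos_rels: "pos_rels m n (\<lambda>i. tens (GF i))"
proof -
  \<comment> \<open>The two summands of \<open>\<Delta>(F\<^sub>i)\<close> are taken in the opposite order, so that they
    \<open>q\<close>-commute in the same way as those of \<open>\<Delta>(E\<^sub>i)\<close>.\<close>
  have x: "pos_rels m n (\<lambda>i. P i * r (eF i))"
  proof (rule pos_rels_twist)
    show "pos_rels m n (\<lambda>i. r (eF i))" using r.h_pos_rels by simp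
  qed (simp_all add: P_simps FS_intros)
  have "pos_rels m n (\<lambda>i. r (eKi' i) * l (eF i))"
  proof (rule pos_rels_twist)
    show "pos_rels m n (\<lambda>i. l (eF i))" using l.h_pos_rels by simp
    fix i j assume ij: "i \<in> I_roots m n" "j \<in> I_roots m n"
    show "r (eKi' i) * r (eKi' j) = r (eKi' j) * r (eKi' i)"
      unfolding eKi'_def using ij by (simp add: r.h_KK_commute Y_Ki'[simplified])
  qed (simp add: rl FS_intros)
  moreover have yx: "r (eKi' i) * l (eF i) * (P j * r (eF j))
      = (psgn i j * qq powi bform i j) \<odot> (P j * r (eF j) * (r (eKi' i) * l (eF i)))"
    if ij: "i \<in> I_roots m n" "j \<in> I_roots m n" for i j
  proof -
    have lP: "l (eF i) * P j = psgn i j \<odot> (P j * l (eF i))"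
      using P_simps(5)[of i j] ij by simp
    have "r (eKi' i) * l (eF i) * (P j * r (eF j)) = r (eKi' i) * (l (eF i) * P j) * r (eF j)"
      by (simp add: mult.assoc)
    also have "\<dots> = psgn i j \<odot> (r (eKi' i) * P j * l (eF i) * r (eF j))"
      unfolding lP by (simp only: sk_mult_left sk_mult_right mult.assoc)
    also have "\<dots> = psgn i j \<odot> (P j * (r (eKi' i) * r (eF j)) * l (eF i))"
      using ij by (simp add: P_simps FS_intros mult.assoc flip: rl)
    also have "\<dots> = (psgn i j * qq powi bform i j) \<odot> (P j * r (eF j) * (r (eKi' i) * l (eF i)))"
      unfolding r.h_KiE(4)[OF ij] by (simp add: mult.assoc)
    finally show ?thesis .
  qed
  ultimately have "pos_rels m n (\<lambda>i. P i * r (eF i) + r (eKi' i) * l (eF i))"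
    by (intro pos_rels_sum[OF x]) simp_all
  moreover have "tens (GF i) = P i * r (eF i) + r (eKi' i) * l (eF i)" if "i \<in> I_roots m n" for i
    using that by (simp add: rl FS_intros add.commute)
  ultimately show ?thesis by (rule pos_rels_cong[rotated])
qed

text \<open>Of the four products of summands, E_i \<otimes> 1 with 1 \<otimes> F_j and K_i \<otimes>
  E_i with F_j \<otimes> K_j^-1 supercommute. For i = j the other two telescope: (K - K^-1)
  \<otimes> K^-1 + K \<otimes> (K - K^-1) = K \<otimes> K - K^-1 \<otimes> K^-1.\<close>

lemma tens_EF:
  assumes ij: "i \<in> I_roots m n" "j \<in> I_roots m n"
  shows "tens (GE i) * tens (GF j) - psgn i j \<odot> (tens (GF j) * tens (GE i))
    = (if i = j then inverse (q_i i - inverse (q_i i)) \<odot> (l (eKi i) * r (eKi i) - l (eKi' i) * r (eKi' i)) else 0)"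
proof -
  define c where "c = inverse (q_i i - inverse (q_i i))"
  let ?a = "l (eE i)" and ?b = "l (eKi i) * P i * r (eE i)"
    and ?f = "l (eF j) * r (eKi' j)" and ?g = "P j * r (eF j)" and ?s = "psgn i j"
  note FS = FS_intros ij
  have ss: "?s \<odot> (?s \<odot> z) = z" for z by simp
  have "?f * ?a = l (eF j) * (r (eKi' j) * l (eE i))" by (simp only: mult.assoc)
  then have "?f * ?a = l (eF j) * l (eE i) * r (eKi' j)"
    using rl[of "eE i" "eKi' j"] by (simp add: FS mult.assoc)
  then have "?a * ?f - ?s \<odot> (?f * ?a) = (l (eE i) * l (eF j) - ?s \<odot> (l (eF j) * l (eE i))) * r (eKi' j)"
    by (simp only: mult.assoc left_diff_distrib sk_mult_left)
  then have 1: "?a * ?f - ?s \<odot> (?f * ?a) = (if i = j then c \<odot> (l (eKi i) * r (eKi' i) - l (eKi' i) * r (eKi' i)) else 0)"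
    unfolding l.h_EF[OF ij] by (auto simp: c_def left_diff_distrib)
  have "P j * l (eE i) = ?s \<odot> (l (eE i) * P j)"
    using P_simps(4)[OF ij(1), of j] by auto
  then have "?a * P j = ?s \<odot> (P j * ?a)" by (simp only: ss)
  moreover have "?a * ?g = (?a * P j) * r (eF j)" "?g * ?a = P j * ?a * r (eF j)"
    using ij by (simp_all add: mult.assoc rl FS)
  ultimately have 2: "?a * ?g - ?s \<odot> (?g * ?a) = 0"
    by (simp only: sk_mult_left diff_self)
  \<comment> \<open>Moving K_i past F_j in the left factor and E_i past K_j^-1 in the right one
    produces inverse powers of q, by symmetry of the form.\<close>
  have 3: "?b * ?f - ?s \<odot> (?f * ?b) = 0"
  proof -
    have "?b * ?f = l (eKi i) * (P i * l (eF j)) * (r (eE i) * r (eKi' j))"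
      using ij by (simp add: mult.assoc FS) (simp add: rl FS flip: mult.assoc)
    also have "\<dots> = ?s \<odot> (l (eKi i) * l (eF j) * P i * (r (eE i) * r (eKi' j)))"
      using ij by (simp only: P_simps(5) sk_mult_left sk_mult_right mult.assoc)
    also have "\<dots> = (?s * qq powi (- bform i j)) \<odot> (l (eF j) * l (eKi i) * P i * (r (eE i) * r (eKi' j)))"
      unfolding l.h_KiE(3)[OF ij] by (simp add: mult.assoc)
    also have "\<dots> = ?s \<odot> (l (eF j) * l (eKi i) * P i * (r (eKi' j) * r (eE i)))"
      unfolding r.h_KiE(2)[OF ij(2,1)] bform_sym[of j i] by (simp add: mult.assoc)
    also have "l (eF j) * l (eKi i) * P i * (r (eKi' j) * r (eE i)) = ?f * ?b"
      using ij by (simp add: mult.assoc FS) (simp add: rl FS P_simps(3) flip: mult.assoc,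
        simp add: mult.assoc FS rl P_simps(3))
    finally show ?thesis by simp
  qed
  have "?b * ?g = l (eKi i) * (P i * P j) * (r (eE i) * r (eF j))"
    using ij by (simp add: mult.assoc FS) (simp add: P_simps(3) FS flip: mult.assoc)
  moreover have "?g * ?b = l (eKi i) * (P i * P j) * (r (eF j) * r (eE i))"
  proof -
    have "?g * ?b = P j * (r (eF j) * l (eKi i)) * P i * r (eE i)" by (simp add: mult.assoc)
    also have "\<dots> = (P j * l (eKi i)) * (r (eF j) * P i) * r (eE i)" using ij by (simp add: rl FS mult.assoc)
    also have "\<dots> = l (eKi i) * (P j * P i) * (r (eF j) * r (eE i))"
      using ij by (simp add: P_Ki P_simps(3) FS mult.assoc)
    finally show ?thesis by (simp only: P_simps(1)[of j i])
  qed
  ultimately have "?b * ?g - ?s \<odot> (?g * ?b)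
      = l (eKi i) * (P i * P j) * (r (eE i) * r (eF j) - ?s \<odot> (r (eF j) * r (eE i)))"
    by (simp only: right_diff_distrib sk_mult_right)
  then have 4: "?b * ?g - ?s \<odot> (?g * ?b) = (if i = j then c \<odot> (l (eKi i) * r (eKi i) - l (eKi i) * r (eKi' i)) else 0)"
    unfolding r.h_EF[OF ij] by (auto simp: c_def right_diff_distrib P_simps(2))
  have "tens (GE i) * tens (GF j) - ?s \<odot> (tens (GF j) * tens (GE i))
    = (?a * ?f - ?s \<odot> (?f * ?a)) + (?a * ?g - ?s \<odot> (?g * ?a)) + (?b * ?f - ?s \<odot> (?f * ?b))
      + (?b * ?g - ?s \<odot> (?g * ?b))"
    by (simp only: tens.simps sk_expand)
  also have "\<dots> = (if i = j then c \<odot> (l (eKi i) * r (eKi i) - l (eKi' i) * r (eKi' i)) else 0)"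
    unfolding 1 2 3 4 by (simp add: sk.scale_right_diff_distrib)
  finally show ?thesis unfolding c_def .
qed

end

text \<open>An element of the tensor square is kept as a list of terms, so that the same list can be
  evaluated on any pair of commuting representations.\<close>

definition csum :: "(falg \<Rightarrow> endo) \<Rightarrow> (falg \<Rightarrow> endo) \<Rightarrow> endo \<Rightarrow> (kk \<times> falg \<times> bool \<times> falg) list \<Rightarrow> endo" where
  "csum l r p L = (\<Sum>(c, u, b, v)\<leftarrow>L. c \<odot> (l u * (if b then p else 1) * r v))"

lemma csum_Nil [simp]: "csum l r p [] = 0"
  and csum_Cons [simp]: "csum l r p ((c, u, b, v) # L) = c \<odot> (l u * (if b then p else 1) * r v) + csum l r p L"
  by (simp_all add: csum_def)

section \<open>The relators vanish on a tensor product\<close>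

context tensor_rep
begin

text \<open>Only the letters that generate \<open>U_sigma m n\<close> are prescribed: on the others
  the action on a tensor product of modules is not under control.\<close>

definition agrees :: "(ugen \<Rightarrow> endo) \<Rightarrow> bool" where
  "agrees \<rho> \<longleftrightarrow> (\<forall>g\<in>insert GSigma (U_gens m n). \<rho> g = tens g)"

context
  fixes \<rho> assumes agrees: "agrees \<rho>"
begin

lemma ag_E: "i \<in> I_roots m n \<Longrightarrow> \<rho> (GE i) = tens (GE i)"
  and ag_F: "i \<in> I_roots m n \<Longrightarrow> \<rho> (GF i) = tens (GF i)"
  and ag_K: "a \<in> lattice_Y m n \<Longrightarrow> \<rho> (GK a) = tens (GK a)"
  and ag_S: "\<rho> GSigma = tens GSigma"
  using agrees unfolding agrees_def U_gens_def by blast+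

lemma ag_Ki: "i \<in> I_roots m n \<Longrightarrow> evalg \<rho> (eKi i) = l (eKi i) * r (eKi i)"
  and ag_Ki': "i \<in> I_roots m n \<Longrightarrow> evalg \<rho> (eKi' i) = l (eKi' i) * r (eKi' i)"
  unfolding eKi_def eKi'_def by (simp_all add: ag_K Y_Ki Y_Ki'[simplified])

lemma tens_GK_mult: "a \<in> lattice_Y m n \<Longrightarrow> b \<in> lattice_Y m n \<Longrightarrow>
    tens (GK a) * tens (GK b) = tens (GK (\<lambda>j. a j + b j))"
proof -
  assume ab: "a \<in> lattice_Y m n" "b \<in> lattice_Y m n"
  have "tens (GK a) * tens (GK b) = l (eK a) * (r (eK a) * l (eK b)) * r (eK b)"
    by (simp add: mult.assoc)
  also have "\<dots> = l (eK a) * l (eK b) * (r (eK a) * r (eK b))"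
    using ab by (simp add: rl FS_intros mult.assoc)
  finally show ?thesis using ab by (simp add: l.h_KK r.h_KK)
qed

text \<open>For an element with \<Delta>(g) = g \<otimes> g that rescales E_i or F_i by the same c
  in both factors. It serves the relations of K_h and of \<sigma> with the generators.\<close>

lemma grouplike:
  assumes g: "g \<in> FS m n" and i: "i \<in> I_roots m n" and Pg: "P i * l g = l g * P i"
    and lK: "l (eKi i) * l g = l g * l (eKi i)" and rK: "r (eKi' i) * r g = r g * r (eKi' i)"
  shows "l g * l (eE i) = c \<odot> (l (eE i) * l g) \<Longrightarrow> r g * r (eE i) = c \<odot> (r (eE i) * r g) \<Longrightarrow>
      l g * r g * tens (GE i) = c \<odot> (tens (GE i) * (l g * r g))"
    and "l g * l (eF i) = c \<odot> (l (eF i) * l g) \<Longrightarrow> r g * r (eF i) = c \<odot> (r (eF i) * r g) \<Longrightarrow>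
      l g * r g * tens (GF i) = c \<odot> (tens (GF i) * (l g * r g))"
proof -
  note FS = FS_intros g i
  have L: "r x * (l y * z) = l y * (r x * z)" if "x \<in> FS m n" "y \<in> FS m n" for x y z
    using rl[OF that(2,1)] by (metis mult.assoc)
  have Lg: "P i * (l g * z) = l g * (P i * z)" "l (eKi i) * (l g * z) = l g * (l (eKi i) * z)"
    "r (eKi' i) * (r g * z) = r g * (r (eKi' i) * z)" for z
    using Pg lK rK by (metis mult.assoc)+
  have rP: "r g * (P i * z) = P i * (r g * z)" for z
    using P_simps(3)[OF g] by (metis mult.assoc)
  { assume "l g * l (eE i) = c \<odot> (l (eE i) * l g)" "r g * r (eE i) = c \<odot> (r (eE i) * r g)"
    note * = this this(1)[THEN swap_left]
    show "l g * r g * tens (GE i) = c \<odot> (tens (GE i) * (l g * r g))"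
      using i by (simp add: mult.assoc distrib_left distrib_right L FS rl * Lg rP sk.scale_right_distrib P_simps(3)) }
  assume "l g * l (eF i) = c \<odot> (l (eF i) * l g)" "r g * r (eF i) = c \<odot> (r (eF i) * r g)"
  note * = this this(1)[THEN swap_left]
  show "l g * r g * tens (GF i) = c \<odot> (tens (GF i) * (l g * r g))"
    using i by (simp add: mult.assoc distrib_left distrib_right L FS rl * Lg rP rK sk.scale_right_distrib P_simps(3))
qed

end

end

text \<open>One case for each family of relators. It is shared by the check on tensor products and
  the check on the natural module and its dual.\<close>

lemma relator_induct [consumes 1]:
  assumes "r \<in> U_relators m n \<union> sigma_relators m n"
    and "Q (eK (\<lambda>j. 0) - 1)"
    and "\<And>h h'. h \<in> lattice_Y m n \<Longrightarrow> h' \<in> lattice_Y m n \<Longrightarrow> Q (eK h * eK h' - eK (\<lambda>j. h j + h' j))"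
    and "\<And>h i. h \<in> lattice_Y m n \<Longrightarrow> i \<in> I_roots m n \<Longrightarrow>
      Q (eK h * eE i - scal (qq powi pair_alpha h i) * eE i * eK h)"
    and "\<And>h i. h \<in> lattice_Y m n \<Longrightarrow> i \<in> I_roots m n \<Longrightarrow>
      Q (eK h * eF i - scal (qq powi (- pair_alpha h i)) * eF i * eK h)"
    and "\<And>i j. i \<in> I_roots m n \<Longrightarrow> j \<in> I_roots m n \<Longrightarrow>
      Q (scomm (i = 0) (j = 0) 1 (eE i) (eF j)
          - (if i = j then scal (inverse (q_i i - inverse (q_i i))) * (eKi i - eKi' i) else 0))"
    and "\<And>X i j. X \<in> {\<lambda>i. eE i, \<lambda>i. eF i} \<Longrightarrow> i \<in> I_roots m n \<Longrightarrow> j \<in> I_roots m n \<Longrightarrow> cartan i j = 0 \<Longrightarrow>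
      Q (scomm (i = 0) (j = 0) 1 (X i) (X j))"
    and "\<And>X i j. X \<in> {\<lambda>i. eE i, \<lambda>i. eF i} \<Longrightarrow> i \<in> I_roots m n \<Longrightarrow> j \<in> I_roots m n \<Longrightarrow>
      \<bar>cartan i j\<bar> = 1 \<Longrightarrow> i \<noteq> 0 \<Longrightarrow> Q (serre (X i) (X j))"
    and "\<And>X. X \<in> {\<lambda>i. eE i, \<lambda>i. eF i} \<Longrightarrow> {-1, 0, 1} \<subseteq> I_roots m n \<Longrightarrow> Q (deg4 X)"
    and "Q (eSigma * eSigma - 1)"
    and "\<And>i. i \<in> I_roots m n \<Longrightarrow> Q (eSigma * eE i * eSigma - scal (sigma_sign m i) * eE i)"
    and "\<And>i. i \<in> I_roots m n \<Longrightarrow> Q (eSigma * eF i * eSigma - scal (sigma_sign m i) * eF i)"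
    and "\<And>h. h \<in> lattice_Y m n \<Longrightarrow> Q (eSigma * eK h * eSigma - eK h)"
  shows "Q r"
  using assms(1) unfolding U_relators_def sigma_relators_def
  apply (elim UnE CollectE exE conjE singletonE; hypsubst)
             apply ((rule assms(2-); assumption)+)[12]
  done

context endo_rep
begin

lemma h_sigma_commute:
  shows "i \<in> I_roots m n \<Longrightarrow> h eSigma * h (eE i) = sigma_sign m i \<odot> (h (eE i) * h eSigma)"
    and "i \<in> I_roots m n \<Longrightarrow> h eSigma * h (eF i) = sigma_sign m i \<odot> (h (eF i) * h eSigma)"
    and "a \<in> lattice_Y m n \<Longrightarrow> h eSigma * h (eK a) = h (eK a) * h eSigma"
proof -
  have *: "h eSigma * x = h eSigma * x * h eSigma * h eSigma" for x
    using h_sigma(1) by (simp add: mult.assoc)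
  show "h eSigma * h (eE i) = sigma_sign m i \<odot> (h (eE i) * h eSigma)" if "i \<in> I_roots m n"
    using *[of "h (eE i)"] unfolding h_sigma(2)[OF that] by simp
  show "h eSigma * h (eF i) = sigma_sign m i \<odot> (h (eF i) * h eSigma)" if "i \<in> I_roots m n"
    using *[of "h (eF i)"] unfolding h_sigma(3)[OF that] by simp
  show "h eSigma * h (eK a) = h (eK a) * h eSigma" if "a \<in> lattice_Y m n"
    using *[of "h (eK a)"] unfolding h_sigma(4)[OF that] by simp
qed

lemma h_sigma_Ki: "i \<in> I_roots m n \<Longrightarrow> h eSigma * h (eKi i) = h (eKi i) * h eSigma"
  "i \<in> I_roots m n \<Longrightarrow> h eSigma * h (eKi' i) = h (eKi' i) * h eSigma"
  unfolding eKi_def eKi'_def by (simp_all add: h_sigma_commute Y_Ki Y_Ki'[simplified])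

lemma h_K_Ki: "a \<in> lattice_Y m n \<Longrightarrow> i \<in> I_roots m n \<Longrightarrow> h (eKi i) * h (eK a) = h (eK a) * h (eKi i)"
  "a \<in> lattice_Y m n \<Longrightarrow> i \<in> I_roots m n \<Longrightarrow> h (eKi' i) * h (eK a) = h (eK a) * h (eKi' i)"
  unfolding eKi_def eKi'_def by (simp_all add: h_KK_commute Y_Ki Y_Ki'[simplified])

lemma h_Ki_Kj: "j \<in> I_roots m n \<Longrightarrow> i \<in> I_roots m n \<Longrightarrow> h (eKi i) * h (eKi j) = h (eKi j) * h (eKi i)"
  "j \<in> I_roots m n \<Longrightarrow> i \<in> I_roots m n \<Longrightarrow> h (eKi' i) * h (eKi j) = h (eKi j) * h (eKi' i)"
  unfolding eKi_def[of j] by (simp_all add: h_K_Ki Y_Ki)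

end

context tensor_rep
begin

context
  fixes \<rho> assumes agrees: "agrees \<rho>"
begin

lemma tens_sigma_square: "tens GSigma * tens GSigma = 1"
proof -
  have "l eSigma * r eSigma * (l eSigma * r eSigma) = l eSigma * (r eSigma * l eSigma) * r eSigma"
    by (simp add: mult.assoc)
  also have "\<dots> = (l eSigma * l eSigma) * (r eSigma * r eSigma)"
    by (simp add: rl FS_intros mult.assoc)
  finally show ?thesis by (simp add: l.h_sigma r.h_sigma)
qed

lemma tens_sigma_K:
  assumes a: "a \<in> lattice_Y m n"
  shows "tens GSigma * tens (GK a) = tens (GK a) * tens GSigma"
proof -
  have "l eSigma * r eSigma * (l (eK a) * r (eK a)) = l eSigma * (r eSigma * l (eK a)) * r (eK a)"
    by (simp add: mult.assoc)
  also have "\<dots> = l eSigma * l (eK a) * (r eSigma * r (eK a))"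
    using a by (simp add: rl FS_intros mult.assoc)
  also have "\<dots> = l (eK a) * (l eSigma * r (eK a)) * r eSigma"
    using a by (simp add: l.h_sigma_commute r.h_sigma_commute mult.assoc)
  also have "l eSigma * r (eK a) = r (eK a) * l eSigma"
    using a by (simp add: rl FS_intros)
  finally show ?thesis by (simp add: mult.assoc)
qed

lemma tens_relator:
  assumes "x \<in> U_relators m n \<union> sigma_relators m n"
  shows "evalg \<rho> x = 0"
  using assms
proof (induction rule: relator_induct)
  case 1
  show ?case by (simp add: ag_K[OF agrees] Y_zero l.h_K0 r.h_K0)
next
  case (2 h h')
  then show ?case using tens_GK_mult[OF agrees, of h h'] by (simp add: ag_K[OF agrees] Y_add del: tens.simps)
next
  case (3 h i)
  then have "tens (GK h) * tens (GE i) = (qq powi pair_alpha h i) \<odot> (tens (GE i) * tens (GK h))"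
    unfolding tens.simps(3)
    by (intro grouplike(1)[OF agrees]) (simp_all add: FS_intros P_simps l.h_K_Ki r.h_K_Ki l.h_KE r.h_KE)
  with 3 show ?case by (simp add: ag_K[OF agrees] ag_E[OF agrees] del: tens.simps)
next
  case (4 h i)
  then have "tens (GK h) * tens (GF i) = (qq powi (- pair_alpha h i)) \<odot> (tens (GF i) * tens (GK h))"
    unfolding tens.simps(3)
    by (intro grouplike(2)[OF agrees]) (simp_all add: FS_intros P_simps l.h_K_Ki r.h_K_Ki l.h_KF r.h_KF)
  with 4 show ?case by (simp add: ag_K[OF agrees] ag_F[OF agrees] del: tens.simps)
next
  case (5 i j)
  then show ?case
    using tens_EF[of i j]
    by (cases "i = j"; cases "i = 0 \<and> j = 0")
      (auto simp: scomm_def ag_E[OF agrees] ag_F[OF agrees] ag_Ki[OF agrees] ag_Ki'[OF agrees] simp del: tens.simps)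
next
  case (6 X i j)
  then show ?case
    using pos_relsD(1)[OF tens_E_pos_rels, of i j] pos_relsD(1)[OF tens_F_pos_rels, of i j]
    by (auto simp: scomm_def ag_E[OF agrees] ag_F[OF agrees] simp del: tens.simps)
next
  case (7 X i j)
  then show ?case
    using pos_relsD(2)[OF tens_E_pos_rels, of i j] pos_relsD(2)[OF tens_F_pos_rels, of i j]
    by (auto simp: serre_def ag_E[OF agrees] ag_F[OF agrees] mult.assoc simp del: tens.simps)
next
  case (8 X)
  then show ?case
    using tens_E_pos_rels tens_F_pos_rels
    by (auto simp: deg4_def scomm_def ag_E[OF agrees] ag_F[OF agrees] pos_rels_def qc_def q_i_def dd_def
        power_int_minus simp del: tens.simps)
next
  case 9
  show ?case using tens_sigma_square by (simp add: ag_S[OF agrees] del: tens.simps)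
next
  case (10 i)
  then have "tens GSigma * tens (GE i) = sigma_sign m i \<odot> (tens (GE i) * tens GSigma)"
    unfolding tens.simps(4)
    by (intro grouplike(1)[OF agrees])
      (simp_all add: FS_intros P_simps l.h_sigma_Ki r.h_sigma_Ki l.h_sigma_commute r.h_sigma_commute)
  from this[THEN swap_left, of "tens GSigma"] show ?case using 10 tens_sigma_square by (simp add: ag_S[OF agrees] ag_E[OF agrees] mult.assoc del: tens.simps)
next
  case (11 i)
  then have "tens GSigma * tens (GF i) = sigma_sign m i \<odot> (tens (GF i) * tens GSigma)"
    unfolding tens.simps(4)
    by (intro grouplike(2)[OF agrees])
      (simp_all add: FS_intros P_simps l.h_sigma_Ki r.h_sigma_Ki l.h_sigma_commute r.h_sigma_commute)
  from this[THEN swap_left, of "tens GSigma"] show ?case using 11 tens_sigma_square by (simp add: ag_S[OF agrees] ag_F[OF agrees] mult.assoc del: tens.simps)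
next
  case (12 a)
  have "tens GSigma * tens (GK a) * tens GSigma = tens (GK a)"
    unfolding tens_sigma_K[OF 12] mult.assoc tens_sigma_square by simp
  then show ?case using 12
    by (simp add: ag_S[OF agrees] ag_K[OF agrees] del: tens.simps)
qed

end
end

text \<open>The coproduct of a generator of the coideal subalgebra: a list of the terms
  \<open>c u \<otimes> v\<close>, together with the parity of \<open>v\<close>.\<close>

abbreviation brac :: "int \<Rightarrow> int \<Rightarrow> falg" where
  "brac a b \<equiv> eE a * eE b - scal qq * eE b * eE a"

text \<open>This is the expanded nested bracket of E_{i-1} with the bracket of E_{i+1} and E_i, both
  of weight q.\<close>

abbreviation brac3 :: "int \<Rightarrow> falg" where
  "brac3 i \<equiv> eE (i - 1) * eE (i + 1) * eE i - scal qq * eE (i - 1) * eE i * eE (i + 1)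
     - scal qq * eE (i + 1) * eE i * eE (i - 1) + scal (qq\<^sup>2) * eE i * eE (i + 1) * eE (i - 1)"

definition cop_B :: "(int \<Rightarrow> kk) \<Rightarrow> int \<Rightarrow> (kk \<times> falg \<times> bool \<times> falg) list" where
  "cop_B vs i =
    (if i > 0 then [(1, B_gen vs i, False, eKi' i), (1, 1, False, B_gen vs i)]
     else if i = 0 then
       [(1, B_gen vs 0, False, eKi' 0), (1, 1, True, eF 0),
        (vs 0 * (1 - qq\<^sup>2), eE (-1), True, eE 0 * eKi' 0),
        (vs 0, eKi (-1), True, brac (-1) 0 * eKi' 0)]
     else
       [(1, B_gen vs i, False, eKi' i), (1, 1, False, eF i),
        (vs i * (1 - qq\<^sup>2)\<^sup>2, eE (i - 1) * eE (i + 1), False, eE i * eKi' i),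
        (vs i * (1 - qq\<^sup>2), eE (i - 1) * eKi (i + 1), False, brac (i + 1) i * eKi' i),
        (vs i * (1 - qq\<^sup>2), eE (i + 1) * eKi (i - 1), False, brac (i - 1) i * eKi' i),
        (vs i, eKi (i - 1) * eKi (i + 1), False, brac3 i * eKi' i)])"

section \<open>Coproducts of the generators B_i\<close>

context tensor_rep
begin

context
  fixes \<rho> assumes agrees: "agrees \<rho>"
begin

lemmas ag = ag_E[OF agrees] ag_F[OF agrees] ag_Ki[OF agrees] ag_Ki'[OF agrees] ag_S[OF agrees]

text \<open>The K_i in the left factor of K_i \<otimes> E_i is cancelled by the K_i^-1 at the end of
  B_i. So no K_i with i in \<open>I_circ m n\<close> is left over in the left factor, where it would
  not lie in the coideal subalgebra.\<close>

lemma yb_kappa: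
  assumes i: "i \<in> I_roots m n" and X: "X \<in> FS m n"
  shows "l (eKi i) * P i * r X * (l (eKi' i) * r (eKi' i)) = P i * r (X * eKi' i)"
proof -
  have "l (eKi i) * P i * r X * (l (eKi' i) * r (eKi' i))
      = l (eKi i) * P i * (r X * l (eKi' i)) * r (eKi' i)" by (simp only: mult.assoc)
  also have "\<dots> = l (eKi i) * (P i * l (eKi' i)) * r X * r (eKi' i)"
    using i X by (simp add: rl FS_intros mult.assoc)
  also have "\<dots> = (l (eKi i) * l (eKi' i)) * P i * (r X * r (eKi' i))"
    using i by (simp add: P_Ki mult.assoc)
  finally show ?thesis using i X by (simp add: l.h_Ki_inverse r.h_simps)
qed

lemma xx_kappa:
  assumes i: "i \<in> I_roots m n" and X: "X \<in> FS m n"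
  shows "l X * (l (eKi' i) * r (eKi' i)) = l (X * eKi' i) * r (eKi' i)"
  using i X by (simp add: l.h_simps mult.assoc)

text \<open>The elements K_i and K_j commute with each other and with all of the second factor, so
  the bracket takes place in the second factor alone. As i is even, at most the one sign operator
  \<open>P j\<close> occurs.\<close>

lemma brac_y:
  assumes ij: "i \<in> I_roots m n" "j \<in> I_roots m n" and i: "i \<noteq> 0"
  shows "qc qq (l (eKi i) * P i * r (eE i)) (l (eKi j) * P j * r (eE j))
    = l (eKi i) * (l (eKi j) * P j * r (brac i j))"
proof -
  have Pi: "P i = 1" using i by (simp add: P_def)
  have "l (eKi i) * r (eE i) * (l (eKi j) * P j * r (eE j))
      = l (eKi i) * (r (eE i) * l (eKi j)) * P j * r (eE j)" by (simp only: mult.assoc)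
  also have "\<dots> = l (eKi i) * l (eKi j) * (r (eE i) * P j) * r (eE j)"
    using ij by (simp add: rl FS_intros mult.assoc)
  finally have 1: "l (eKi i) * r (eE i) * (l (eKi j) * P j * r (eE j))
      = l (eKi i) * (l (eKi j) * (P j * (r (eE i) * r (eE j))))"
    using ij by (simp add: P_simps(3) FS_intros mult.assoc)
  have "l (eKi j) * P j * r (eE j) * (l (eKi i) * r (eE i))
      = l (eKi j) * P j * (r (eE j) * l (eKi i)) * r (eE i)" by (simp only: mult.assoc)
  also have "\<dots> = l (eKi j) * (P j * l (eKi i)) * r (eE j) * r (eE i)"
    using ij by (simp add: rl FS_intros mult.assoc)
  also have "\<dots> = l (eKi i) * l (eKi j) * P j * r (eE j) * r (eE i)"
    using ij by (simp add: P_Ki l.h_Ki_Kj flip: mult.assoc)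
  finally have 2: "l (eKi j) * P j * r (eE j) * (l (eKi i) * r (eE i))
      = l (eKi i) * (l (eKi j) * (P j * (r (eE j) * r (eE i))))" by (simp only: mult.assoc)
  show ?thesis
    unfolding qc_def Pi mult_1_right 1 2 using ij
    by (simp add: r.h_simps right_diff_distrib mult.assoc)
qed

lemma evalg_B_pos:
  assumes i: "i \<in> I_roots m n" "i > 0"
  shows "evalg \<rho> (B_gen vs i) = csum l r p (cop_B vs i)"
proof -
  have "P i = 1" using i by (simp add: P_def)
  then have "l (eKi i) * P i * r (eE i) * (l (eKi' i) * r (eKi' i)) = r (eE i * eKi' i)"
    using yb_kappa[of i "eE i"] i by (simp add: FS_intros)
  moreover have "evalg \<rho> (B_gen vs i) = tens (GF i)
      + vs i \<odot> ((l (eE i) + l (eKi i) * P i * r (eE i)) * (l (eKi' i) * r (eKi' i)))"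
    using i by (simp add: B_gen_def ag mult.assoc)
  ultimately have "evalg \<rho> (B_gen vs i) = tens (GF i)
      + vs i \<odot> (l (eE i * eKi' i) * r (eKi' i) + r (eE i * eKi' i))"
    using i xx_kappa[of i "eE i"] by (simp add: distrib_right FS_intros)
  then show ?thesis
    using i \<open>P i = 1\<close> by (simp add: cop_B_def B_gen_def l.h_simps r.h_simps sk.scale_right_distrib algebra_simps)
qed

text \<open>The bracket in B_0 has as weight the exchange factor q, so by \<open>qc_split\<close>
  the mixed term with E_0 on the left drops out. The remaining one has E_{-1} on the left and
  coefficient 1 - q^2.\<close>

lemma evalg_B_zero:
  assumes i: "0 \<in> I_roots m n" "-1 \<in> I_roots m n"
  shows "evalg \<rho> (B_gen vs 0) = csum l r p (cop_B vs 0)"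
proof -
  let ?y = "\<lambda>i. l (eKi i) * P i * r (eE i)" and ?k = "l (eKi' 0) * r (eKi' 0)"
  have b: "bform (-1) 0 = 1" "bform 0 (-1) = 1" by (simp_all add: bform_def cartan_0 cartan_nonzero dd_def)
  have P: "P (-1) = 1" "P 0 = p" by (simp_all add: P_def)
  have xx: "qc qq (l (eE (-1))) (l (eE 0)) = l (brac (-1) 0)"
    using i by (simp add: qc_def l.h_simps mult.assoc)
  have s: "?y (-1) * l (eE 0) = qq \<odot> (l (eE 0) * ?y (-1))"
    "?y 0 * l (eE (-1)) = qq \<odot> (l (eE (-1)) * ?y 0)"
    using tens_swap[OF i(2,1)] tens_swap[OF i(1,2)] by (simp_all add: b)
  have "evalg \<rho> (B_gen vs 0) = tens (GF 0)
      + vs 0 \<odot> (qc qq (l (eE (-1)) + ?y (-1)) (l (eE 0) + ?y 0) * ?k)"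
    using i by (simp add: B_gen_def ag qc_def mult.assoc)
  also have "qc qq (l (eE (-1)) + ?y (-1)) (l (eE 0) + ?y 0)
      = l (brac (-1) 0) + (1 - qq\<^sup>2) \<odot> (l (eE (-1)) * ?y 0) + l (eKi (-1)) * (l (eKi 0) * P 0 * r (brac (-1) 0))"
    unfolding qc_split[OF s] xx using brac_y[OF i(2,1)] by simp
  also have "\<dots> * ?k = l (brac (-1) 0 * eKi' 0) * r (eKi' 0)
      + (1 - qq\<^sup>2) \<odot> (l (eE (-1)) * (p * r (eE 0 * eKi' 0))) + l (eKi (-1)) * (p * r (brac (-1) 0 * eKi' 0))"
  proof -
    have "l (eE (-1)) * ?y 0 * ?k = l (eE (-1)) * (p * r (eE 0 * eKi' 0))"
      using yb_kappa[OF i(1), of "eE 0"] i by (simp add: FS_intros mult.assoc P)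
    moreover have "l (eKi (-1)) * (l (eKi 0) * P 0 * r (brac (-1) 0)) * ?k
        = l (eKi (-1)) * (p * r (brac (-1) 0 * eKi' 0))"
      using yb_kappa[OF i(1), of "brac (-1) 0"] i by (simp add: FS_intros mult.assoc P)
    moreover have "brac (-1) 0 \<in> FS m n" using i by (intro FS_intros)
    ultimately show ?thesis
      using xx_kappa[OF i(1)] by (simp only: distrib_right sk_mult_left)
  qed
  finally show ?thesis
    using i by (simp add: cop_B_def B_gen_def l.h_simps r.h_simps P sk.scale_right_distrib algebra_simps)
qed

text \<open>The nested bracket is split from the inside outwards. Apart from the term with all three
  E on the left, nothing with E_i on the left survives, and each of E_{i-1}, E_{i+1} that stands
  alone or with the other on the left contributes a factor 1 - q^2.\<close>

lemma evalg_B_neg: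
  assumes i: "i \<in> I_roots m n" "i - 1 \<in> I_roots m n" "i + 1 \<in> I_roots m n" "i < -1"
  shows "evalg \<rho> (B_gen vs i) = csum l r p (cop_B vs i)"
proof -
  let ?k = "l (eKi' i) * r (eKi' i)"
  define a c where "a = i - 1" and "c = i + 1"
  have I: "a \<in> I_roots m n" "c \<in> I_roots m n" using i by (simp_all add: a_def c_def)
  have P: "P i = 1" "P a = 1" "P c = 1" using i by (simp_all add: P_def a_def c_def)
  have b: "bform a i = 1" "bform c i = 1" "bform i a = 1" "bform i c = 1" "bform a c = 0" "bform c a = 0"
    using i by (simp_all add: bform_def cartan_nonzero dd_def a_def c_def)
  have nz: "a \<noteq> 0" "c \<noteq> 0" using i(4) by (simp_all add: a_def c_def)
  define xa xb xc where "xa = l (eE a)" and "xb = l (eE i)" and "xc = l (eE c)"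
  define ya yb yc where "ya = l (eKi a) * r (eE a)" and "yb = l (eKi i) * r (eE i)" and "yc = l (eKi c) * r (eE c)"
  note defs = xa_def xb_def xc_def ya_def yb_def yc_def
  have s: "ya * xb = qq \<odot> (xb * ya)" "yb * xa = qq \<odot> (xa * yb)"
    "yc * xb = qq \<odot> (xb * yc)" "yb * xc = qq \<odot> (xc * yb)"
    "ya * xc = 1 \<odot> (xc * ya)" "yc * xa = 1 \<odot> (xa * yc)"
    using tens_swap[OF I(1) i(1)] tens_swap[OF i(1) I(1)] tens_swap[OF I(2) i(1)] tens_swap[OF i(1) I(2)]
      tens_swap[OF I] tens_swap[OF I(2,1)] i(4) nz
    by (simp_all add: b P defs)
  note sw = s s[THEN swap_left]
  define X Y where "X = qc qq xc xb" and "Y = qc qq yc yb"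
  have 1: "qc qq (xc + yc) (xb + yb) = X + (1 - qq\<^sup>2) \<odot> (xc * yb) + Y"
    unfolding X_def Y_def by (rule qc_split[OF s(3,4)])
  have add: "qc v (e + f) (g + d \<odot> h + k)
      = qc v e g + d \<odot> qc v e h + qc v e k + qc v f g + d \<odot> qc v f h + qc v f k" for v e f g d h k
    unfolding qc_def by (simp add: sk_expand)
  \<comment> \<open>Exchange factors multiply: ya passes the bracket X, and Y passes xa, with total
    factor 1 q = q. Hence the bracket of ya with X vanishes and that of xa with Y is a multiple of
    xa Y.\<close>
  have 2: "qc qq xa (xc * yb) = (1 - qq\<^sup>2) \<odot> (xa * xc * yb)" "qc qq xa Y = (1 - qq\<^sup>2) \<odot> (xa * Y)"
    "qc qq ya X = 0" "qc qq ya (xc * yb) = xc * qc qq ya yb"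
  proof -
    have "xa * xc = xc * xa"
      using pos_relsD(1)[OF l.h_pos_rels[of "\<lambda>i. eE i"] I] i(4)
      by (simp add: cartan_nonzero a_def c_def defs)
    then have xca: "xc * (xa * z) = xa * (xc * z)" for z by (metis mult.assoc)
    show "qc qq xa (xc * yb) = (1 - qq\<^sup>2) \<odot> (xa * xc * yb)" "qc qq xa Y = (1 - qq\<^sup>2) \<odot> (xa * Y)"
      "qc qq ya X = 0" "qc qq ya (xc * yb) = xc * qc qq ya yb"
      unfolding qc_def Y_def X_def by (simp_all add: sk_expand sw xca power2_eq_square)
  qed
  have 3: "qc qq xa X = l (brac3 i)"
    unfolding X_def defs qc_def using i I
    by (simp add: l.h_simps a_def c_def sk_expand power2_eq_square)
  have Yl: "Y = l (eKi c) * (l (eKi i) * r (brac c i))"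
    "qc qq ya yb = l (eKi a) * (l (eKi i) * r (brac a i))"
    using brac_y[OF I(2) i(1)] brac_y[OF I(1) i(1)] by (simp_all add: Y_def yc_def yb_def ya_def P nz)
  have 4: "qc qq ya Y = l (eKi a) * l (eKi c) * (l (eKi i) * r (brac3 i))"
  proof -
    have Z: "brac c i \<in> FS m n" using i I by (intro FS_intros)
    have L: "r x * (l y * z) = l y * (r x * z)" if "x \<in> FS m n" "y \<in> FS m n" for x y z
      using rl[OF that(2,1)] by (metis mult.assoc)
    have K: "l (eKi i) * (l (eKi a) * z) = l (eKi a) * (l (eKi i) * z)"
      "l (eKi c) * (l (eKi a) * z) = l (eKi a) * (l (eKi c) * z)" for z
      using l.h_Ki_Kj(1) I i(1) by (metis mult.assoc)+
    have "ya * Y = l (eKi a) * l (eKi c) * (l (eKi i) * (r (eE a) * r (brac c i)))"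
      unfolding Yl(1) ya_def using I i by (simp add: L FS_intros mult.assoc)
    moreover have "Y * ya = l (eKi a) * l (eKi c) * (l (eKi i) * (r (brac c i) * r (eE a)))"
      unfolding Yl(1) ya_def using I i Z by (simp add: L K FS_eKi mult.assoc)
    moreover have "r (brac3 i) = r (eE a) * r (brac c i) - qq \<odot> (r (brac c i) * r (eE a))"
      using i I by (simp add: r.h_simps a_def c_def sk_expand power2_eq_square)
    ultimately show ?thesis unfolding qc_def by (simp add: right_diff_distrib)
  qed
  have k: "l X' * (l (eKi i) * r X) * ?k = l X' * r (X * eKi' i)" if "X \<in> FS m n" for X X'
    using yb_kappa[OF i(1) that] by (simp add: P mult.assoc)
  have Z: "brac c i \<in> FS m n" "brac a i \<in> FS m n" "brac3 i \<in> FS m n" "eE i \<in> FS m n"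
    using i I by (auto intro!: FS_intros simp: a_def c_def)
  define ea ec eb where "ea = xa + ya" and "ec = xc + yc" and "eb = xb + yb"
  have ev: "\<rho> (GE a) = ea" "\<rho> (GE c) = ec" "\<rho> (GE i) = eb"
    using I i(1) by (simp_all add: ag ea_def ec_def eb_def defs P)
  have "B_gen vs i = eF i + scal (vs i) * (eE a * eE c * eE i - scal qq * eE a * eE i * eE c
     - scal qq * eE c * eE i * eE a + scal (qq\<^sup>2) * eE i * eE c * eE a) * eKi' i"
    using i by (simp add: B_gen_def a_def c_def)
  then have "evalg \<rho> (B_gen vs i) = tens (GF i) + vs i \<odot> ((ea * ec * eb - qq \<odot> (ea * eb * ec)
     - qq \<odot> (ec * eb * ea) + qq\<^sup>2 \<odot> (eb * ec * ea)) * ?k)"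
    using i(1) by (simp add: ev ag_F[OF agrees] ag_Ki'[OF agrees] mult.assoc del: tens.simps)
  moreover have "qc qq ea (qc qq ec eb) = ea * ec * eb - qq \<odot> (ea * eb * ec)
     - qq \<odot> (ec * eb * ea) + qq\<^sup>2 \<odot> (eb * ec * ea)"
    unfolding qc_def by (simp add: sk_expand power2_eq_square)
  ultimately have e0: "evalg \<rho> (B_gen vs i) = tens (GF i)
      + vs i \<odot> (qc qq (xa + ya) (qc qq (xc + yc) (xb + yb)) * ?k)"
    by (simp only: ea_def ec_def eb_def)
  have "qc qq (xa + ya) (qc qq (xc + yc) (xb + yb)) = l (brac3 i)
      + (1 - qq\<^sup>2) \<odot> ((1 - qq\<^sup>2) \<odot> (xa * xc * yb)) + (1 - qq\<^sup>2) \<odot> (xa * Y) + 0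
      + (1 - qq\<^sup>2) \<odot> (xc * qc qq ya yb) + l (eKi a) * l (eKi c) * (l (eKi i) * r (brac3 i))"
    unfolding 1 add 2 3 4 ..
  also have "\<dots> = l (brac3 i)
      + (1 - qq\<^sup>2)\<^sup>2 \<odot> (l (eE a * eE c) * (l (eKi i) * r (eE i)))
      + (1 - qq\<^sup>2) \<odot> (l (eE a * eKi c) * (l (eKi i) * r (brac c i)))
      + (1 - qq\<^sup>2) \<odot> (l (eE c * eKi a) * (l (eKi i) * r (brac a i)))
      + l (eKi a * eKi c) * (l (eKi i) * r (brac3 i))"
    unfolding Yl using I i(1)
    by (simp add: xa_def xc_def yb_def l.h_mult FS_eE FS_eKi mult.assoc power2_eq_square add.assoc)
  finally have e1: "qc qq (xa + ya) (qc qq (xc + yc) (xb + yb)) * ?k = (l (brac3 i)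
      + (1 - qq\<^sup>2)\<^sup>2 \<odot> (l (eE a * eE c) * (l (eKi i) * r (eE i)))
      + (1 - qq\<^sup>2) \<odot> (l (eE a * eKi c) * (l (eKi i) * r (brac c i)))
      + (1 - qq\<^sup>2) \<odot> (l (eE c * eKi a) * (l (eKi i) * r (brac a i)))
      + l (eKi a * eKi c) * (l (eKi i) * r (brac3 i))) * ?k" by (simp only:)
  also have "\<dots> = l (brac3 i * eKi' i) * r (eKi' i)
      + (1 - qq\<^sup>2)\<^sup>2 \<odot> (l (eE a * eE c) * r (eE i * eKi' i))
      + (1 - qq\<^sup>2) \<odot> (l (eE a * eKi c) * r (brac c i * eKi' i))
      + (1 - qq\<^sup>2) \<odot> (l (eE c * eKi a) * r (brac a i * eKi' i))
      + l (eKi a * eKi c) * r (brac3 i * eKi' i)"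
    unfolding distrib_right sk_mult_left k[OF Z(1)] k[OF Z(2)] k[OF Z(3)] k[OF Z(4)] xx_kappa[OF i(1) Z(3)] ..
  finally have e: "evalg \<rho> (B_gen vs i) = tens (GF i) + vs i \<odot> (l (brac3 i * eKi' i) * r (eKi' i)
      + (1 - qq\<^sup>2)\<^sup>2 \<odot> (l (eE a * eE c) * r (eE i * eKi' i))
      + (1 - qq\<^sup>2) \<odot> (l (eE a * eKi c) * r (brac c i * eKi' i))
      + (1 - qq\<^sup>2) \<odot> (l (eE c * eKi a) * r (brac a i * eKi' i))
      + l (eKi a * eKi c) * r (brac3 i * eKi' i))"
    unfolding e0 by (simp only:)
  have B: "l (B_gen vs i) = l (eF i) + vs i \<odot> l (brac3 i * eKi' i)"
  proof -
    have "B_gen vs i = eF i + scal (vs i) * (brac3 i * eKi' i)"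
      using i by (simp add: B_gen_def mult.assoc)
    moreover have "brac3 i * eKi' i \<in> FS m n" using i Z by (intro FS_intros)
    ultimately show ?thesis using i by (simp add: l.h_add l.h_mult l.h_scal FS_mult FS_scal FS_eF)
  qed
  have "csum l r p (cop_B vs i) = tens (GF i) + vs i \<odot> (l (brac3 i * eKi' i) * r (eKi' i)
      + (1 - qq\<^sup>2)\<^sup>2 \<odot> (l (eE a * eE c) * r (eE i * eKi' i))
      + (1 - qq\<^sup>2) \<odot> (l (eE a * eKi c) * r (brac c i * eKi' i))
      + (1 - qq\<^sup>2) \<odot> (l (eE c * eKi a) * r (brac a i * eKi' i))
      + l (eKi a * eKi c) * r (brac3 i * eKi' i))"
    using i P(1) by (simp add: cop_B_def B l.h_one a_def c_def distrib_right sk.scale_right_distrib add_ac)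
  then show ?thesis using e by simp
qed

end
end

section \<open>Kronecker products\<close>

lemma sum_mult_index:
  fixes f :: "nat \<Rightarrow> 'a::comm_monoid_add"
  shows "(\<Sum>k<a * b. f k) = (\<Sum>i<a. \<Sum>j<b. f (i * b + j))"
proof -
  have "sum f {i * b..<i * b + b} = (\<Sum>j<b. f (i * b + j))" for i
  proof -
    have "sum f {i * b..<i * b + b} = sum f {0 + i * b..<b + i * b}" by (simp add: add.commute)
    also have "\<dots> = (\<Sum>j = 0..<b. f (j + i * b))" by (rule sum.shift_bounds_nat_ivl)
    finally show ?thesis by (simp add: add.commute atLeast0LessThan)
  qed
  then have "(\<Sum>i<a. \<Sum>j<b. f (i * b + j)) = (\<Sum>i<a. sum f {i * b..<i * b + b})" by simp
  also have "\<dots> = (\<Sum>k<a * b. f k)" by (rule sum.nat_group)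
  finally show ?thesis by (rule HOL.sym)
qed

lemma div_mod_bounds:
  fixes k :: nat
  assumes "k < a * b"
  shows "k div b < a" "k mod b < b"
proof -
  have "b > 0" using assms by (cases b) auto
  then show "k div b < a" "k mod b < b" using assms by (simp_all add: less_mult_imp_div_less)
qed

lemma index_bound: "i < a \<Longrightarrow> j < b \<Longrightarrow> i * b + j < a * (b::nat)"
proof -
  assume "i < a" "j < b"
  then have "i * b + j < Suc i * b" "Suc i * b \<le> a * b" by (simp_all add: mult_le_mono1 del: mult_Suc) simp
  then show ?thesis by linarith
qed

lemma dim_kron [simp]:
  "dim_row (kron A B) = dim_row A * dim_row B" "dim_col (kron A B) = dim_col A * dim_col B"
  by (simp_all add: kron_def)

lemma index_kron:
  "i < dim_row A * dim_row B \<Longrightarrow> j < dim_col A * dim_col B \<Longrightarrow>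
    kron A B $$ (i, j) = A $$ (i div dim_row B, j div dim_col B) * B $$ (i mod dim_row B, j mod dim_col B)"
  by (simp add: kron_def)

lemma kron_carrier:
  "A \<in> carrier_mat a b \<Longrightarrow> B \<in> carrier_mat c d \<Longrightarrow> kron A B \<in> carrier_mat (a * c) (b * d)"
  by auto

lemma kron_mult:
  assumes "A \<in> carrier_mat a b" "C \<in> carrier_mat b c" "B \<in> carrier_mat a' b'" "D \<in> carrier_mat b' c'"
  shows "kron A B * kron C D = kron (A * C) (B * D)"
proof (rule eq_matI)
  fix i j
  assume "i < dim_row (kron (A * C) (B * D))" "j < dim_col (kron (A * C) (B * D))"
  then have ij: "i < a * a'" "j < c * c'" using assms by auto
  note b = div_mod_bounds[OF ij(1)] div_mod_bounds[OF ij(2)]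
  have "(kron A B * kron C D) $$ (i, j)
      = (\<Sum>k<b * b'. A $$ (i div a', k div b') * B $$ (i mod a', k mod b')
          * (C $$ (k div b', j div c') * D $$ (k mod b', j mod c')))"
    using assms ij by (simp add: scalar_prod_def index_kron atLeast0LessThan)
  also have "\<dots> = (\<Sum>x<b. \<Sum>y<b'. A $$ (i div a', x) * B $$ (i mod a', y) * (C $$ (x, j div c') * D $$ (y, j mod c')))"
    unfolding sum_mult_index by (intro sum.cong) auto
  also have "\<dots> = (\<Sum>x<b. A $$ (i div a', x) * C $$ (x, j div c')) * (\<Sum>y<b'. B $$ (i mod a', y) * D $$ (y, j mod c'))"
    by (simp add: sum_product algebra_simps)
  also have "\<dots> = kron (A * C) (B * D) $$ (i, j)"
    using assms ij b by (simp add: scalar_prod_def index_kron atLeast0LessThan)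
  finally show "(kron A B * kron C D) $$ (i, j) = kron (A * C) (B * D) $$ (i, j)" .
qed (use assms in auto)

lemma kron_one: "kron (1\<^sub>m a) (1\<^sub>m b) = 1\<^sub>m (a * b)"
proof (rule eq_matI)
  fix i j assume "i < dim_row (1\<^sub>m (a * b) :: kk mat)" "j < dim_col (1\<^sub>m (a * b) :: kk mat)"
  then have ij: "i < a * b" "j < a * b" by auto
  have "i = j \<longleftrightarrow> i div b = j div b \<and> i mod b = j mod b"
    by (metis div_mult_mod_eq)
  then show "kron (1\<^sub>m a) (1\<^sub>m b) $$ (i, j) = 1\<^sub>m (a * b) $$ (i, j)"
    using ij div_mod_bounds[OF ij(1)] div_mod_bounds[OF ij(2)] by (simp add: index_kron)
qed auto

lemma kron_add_left:
  assumes "A \<in> carrier_mat a b" "A' \<in> carrier_mat a b"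
  shows "kron (A + A') B = kron A B + kron A' B"
  using assms by (intro eq_matI) (auto simp: index_kron distrib_right div_mod_bounds)

lemma kron_add_right:
  assumes "B \<in> carrier_mat a b" "B' \<in> carrier_mat a b"
  shows "kron A (B + B') = kron A B + kron A B'"
  using assms by (intro eq_matI) (auto simp: index_kron distrib_left div_mod_bounds)

lemma kron_diff_left:
  assumes "A \<in> carrier_mat a b" "A' \<in> carrier_mat a b"
  shows "kron (A - A') B = kron A B - kron A' B"
  using assms by (intro eq_matI) (auto simp: index_kron left_diff_distrib div_mod_bounds)

lemma kron_diff_right:
  assumes "B \<in> carrier_mat a b" "B' \<in> carrier_mat a b"
  shows "kron A (B - B') = kron A B - kron A B'"
  using assms by (intro eq_matI) (auto simp: index_kron right_diff_distrib div_mod_bounds)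

lemma kron_smult_left: "kron (c \<cdot>\<^sub>m A) B = c \<cdot>\<^sub>m kron A B"
  by (intro eq_matI) (auto simp: index_kron div_mod_bounds)

lemma kron_smult_right: "kron A (c \<cdot>\<^sub>m B) = c \<cdot>\<^sub>m kron A B"
  by (intro eq_matI) (auto simp: index_kron div_mod_bounds)

lemma kron_zero_left: "kron (0\<^sub>m a b) B = 0\<^sub>m (a * dim_row B) (b * dim_col B)"
  by (intro eq_matI) (auto simp: index_kron div_mod_bounds)

lemma kron_zero_right: "kron A (0\<^sub>m a b) = 0\<^sub>m (dim_row A * a) (dim_col A * b)"
  by (intro eq_matI) (auto simp: index_kron div_mod_bounds)

lemma kron_assoc: "kron (kron A B) C = kron A (kron B C)"
proof (rule eq_matI)
  fix i j assume "i < dim_row (kron A (kron B C))" "j < dim_col (kron A (kron B C))"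
  then have i: "i < (dim_row A * dim_row B) * dim_row C" and j: "j < (dim_col A * dim_col B) * dim_col C"
    by (auto simp: mult.assoc)
  have d: "x div (c * d) = x div d div c" "x mod (c * d) mod d = x mod d"
    "x mod (c * d) div d = x div d mod c" for x c d :: nat
    by (cases "d = 0"; simp add: div_mult2_eq mod_mult2_eq mult.commute[of c d])+
  have ii: "i < dim_row A * (dim_row B * dim_row C)" and jj: "j < dim_col A * (dim_col B * dim_col C)"
    using i j by (simp_all add: mult.assoc)
  show "kron (kron A B) C $$ (i, j) = kron A (kron B C) $$ (i, j)"
    using i j ii jj div_mod_bounds[OF i] div_mod_bounds[OF j] div_mod_bounds[OF ii] div_mod_bounds[OF jj]
    by (simp add: index_kron mult.assoc d)
qed (auto simp: mult.assoc)

lemma kron_one_left: "kron (1\<^sub>m 1) A = A"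
  by (intro eq_matI) (auto simp: index_kron)

lemma kron_one_right: "kron A (1\<^sub>m 1) = A"
  by (intro eq_matI) (auto simp: index_kron)

section \<open>Tensor products of modules\<close>

definition par_mat :: "bool list \<Rightarrow> bool \<Rightarrow> kk mat" where
  "par_mat ps b = mat (length ps) (length ps) (\<lambda>(i, j). if i = j then (if b \<and> ps ! i then -1 else 1) else 0)"

lemma par_mat_carrier [simp]: "par_mat ps b \<in> carrier_mat (length ps) (length ps)"
  by (simp add: par_mat_def)

lemma dim_par_mat [simp]: "dim_row (par_mat ps b) = length ps" "dim_col (par_mat ps b) = length ps"
  by (simp_all add: par_mat_def)

lemma par_mat_False: "par_mat ps False = 1\<^sub>m (length ps)"
  by (intro eq_matI) (auto simp: par_mat_def)

definition has_parity :: "bool list \<Rightarrow> bool list \<Rightarrow> bool \<Rightarrow> kk mat \<Rightarrow> bool" where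
  "has_parity rs ps s A \<longleftrightarrow> (\<forall>i<length rs. \<forall>j<length ps. A $$ (i, j) \<noteq> 0 \<longrightarrow> rs ! i = (ps ! j \<noteq> s))"

lemma index_mult_par_mat:
  assumes "A \<in> carrier_mat a (length ps)" "i < a" "j < length ps"
  shows "(A * par_mat ps b) $$ (i, j) = (if b \<and> ps ! j then - A $$ (i, j) else A $$ (i, j))"
proof -
  have "(A * par_mat ps b) $$ (i, j) = (\<Sum>k<length ps. A $$ (i, k) * par_mat ps b $$ (k, j))"
    using assms by (simp add: scalar_prod_def atLeast0LessThan)
  also have "\<dots> = (\<Sum>k<length ps. if k = j then A $$ (i, k) * (if b \<and> ps ! k then -1 else 1) else 0)"
    using assms by (intro sum.cong) (auto simp: par_mat_def)
  finally show ?thesis using assms by simp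
qed

lemma index_par_mat_mult:
  assumes "A \<in> carrier_mat (length rs) b" "i < length rs" "j < b"
  shows "(par_mat rs s * A) $$ (i, j) = (if s \<and> rs ! i then - A $$ (i, j) else A $$ (i, j))"
proof -
  have "(par_mat rs s * A) $$ (i, j) = (\<Sum>k<length rs. par_mat rs s $$ (i, k) * A $$ (k, j))"
    using assms by (simp add: scalar_prod_def atLeast0LessThan)
  also have "\<dots> = (\<Sum>k<length rs. if k = i then (if s \<and> rs ! k then -1 else 1) * A $$ (k, j) else 0)"
    using assms by (intro sum.cong) (auto simp: par_mat_def)
  finally show ?thesis using assms by simp
qed

lemma par_mat_commute:
  assumes "A \<in> carrier_mat (length rs) (length ps)" "has_parity rs ps s A"
  shows "par_mat rs b * A = (if b \<and> s then -1 else 1) \<cdot>\<^sub>m (A * par_mat ps b)"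
  using assms
  by (intro eq_matI)
    (auto simp: index_par_mat_mult index_mult_par_mat has_parity_def simp del: index_mult_mat(1))

lemma par_mat_square: "par_mat ps b * par_mat ps b = 1\<^sub>m (length ps)"
  by (intro eq_matI)
    (auto simp: index_mult_par_mat[OF par_mat_carrier] simp del: index_mult_mat(1), auto simp: par_mat_def)

text \<open>For homogeneous B the sign depends only on the parity of the vector in the first factor.
  Composing A with the parity operator absorbs it, and the ordinary Kronecker calculus
  applies.\<close>

lemma super_kron_eq:
  assumes "A \<in> carrier_mat (length ps) (length ps)" "B \<in> carrier_mat (length rs) (length rs)"
    and "has_parity rs rs s B"
  shows "super_kron ps rs A B = kron (A * par_mat ps s) B"
proof (rule eq_matI)
  fix i j assume "i < dim_row (kron (A * par_mat ps s) B)" "j < dim_col (kron (A * par_mat ps s) B)"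
  then have ij: "i < length ps * length rs" "j < length ps * length rs" using assms by auto
  note b = div_mod_bounds[OF ij(1)] div_mod_bounds[OF ij(2)]
  show "super_kron ps rs A B $$ (i, j) = kron (A * par_mat ps s) B $$ (i, j)"
    using assms ij b
    by (cases "B $$ (i mod length rs, j mod length rs) = 0")
      (auto simp: super_kron_def Let_def index_kron index_mult_par_mat has_parity_def simp del: index_mult_mat(1))
qed (use assms in \<open>auto simp: super_kron_def Let_def par_mat_def\<close>)

definition tgen :: "nat \<Rightarrow> nat \<Rightarrow> smod \<Rightarrow> smod \<Rightarrow> ugen \<Rightarrow> kk mat" where
  "tgen m n M N g = foldr (\<lambda>(a, b) X. super_kron (mpar M) (mpar N) (mact M (ucls m n a)) (mact N (ucls m n b)) + X)
          (comult g) (0\<^sub>m (mdim M * mdim N) (mdim M * mdim N))"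

definition tpar :: "bool list \<Rightarrow> bool list \<Rightarrow> bool list" where
  "tpar ps rs = [p \<noteq> r. p \<leftarrow> ps, r \<leftarrow> rs]"

lemma length_tpar [simp]: "length (tpar ps rs) = length ps * length rs"
  by (simp add: tpar_def length_concat o_def sum_list_triv)

lemma nth_concat_map:
  assumes "i < length ps * length rs"
  shows "concat (map (\<lambda>p. map (f p) rs) ps) ! i = f (ps ! (i div length rs)) (rs ! (i mod length rs))"
  using assms
proof (induction ps arbitrary: i)
  case (Cons a ps)
  show ?case
  proof (cases "i < length rs")
    case False
    then have "i - length rs < length ps * length rs" using Cons.prems by auto
    moreover have "i div length rs = Suc ((i - length rs) div length rs)"
      using False Cons.prems by (metis le_div_geq length_greater_0_conv list.size(3) mult_0_right not_less not_less0)
    moreover have "i mod length rs = (i - length rs) mod length rs"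
      using False by (simp add: le_mod_geq)
    ultimately show ?thesis using False Cons.IH by (simp add: nth_append)
  qed (simp add: nth_append)
qed simp

lemma nth_tpar: "i < length ps * length rs \<Longrightarrow> tpar ps rs ! i = (ps ! (i div length rs) \<noteq> rs ! (i mod length rs))"
  unfolding tpar_def using nth_concat_map[of i ps rs "\<lambda>p r. p \<noteq> r"] by simp

lemma tensor_mod_eq: "tensor_mod m n M N = module_of m n (tpar (mpar M) (mpar N)) (tgen m n M N)"
  by (simp add: tensor_mod_def tpar_def tgen_def[abs_def])

lemma mpar_tensor_mod [simp]: "mpar (tensor_mod m n M N) = tpar (mpar M) (mpar N)"
  by (simp add: tensor_mod_eq module_of_def)

lemma mdim_tensor_mod [simp]: "mdim (tensor_mod m n M N) = mdim M * mdim N"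
  by (simp add: mdim_def)

lemma tgen_carrier: "tgen m n M N g \<in> carrier_mat (mdim M * mdim N) (mdim M * mdim N)"
proof -
  have "foldr (\<lambda>(a, b) X. super_kron (mpar M) (mpar N) (mact M (ucls m n a)) (mact N (ucls m n b)) + X)
          L (0\<^sub>m (mdim M * mdim N) (mdim M * mdim N)) \<in> carrier_mat (mdim M * mdim N) (mdim M * mdim N)" for L
    by (induction L) auto
  then show ?thesis unfolding tgen_def by blast
qed

lemma rp_has_parity:
  assumes "is_module m n (carrier (U_sigma m n)) M" "x \<in> FS m n" "\<forall>w\<in>Poly_Mapping.keys x. word_odd w = s"
  shows "has_parity (mpar M) (mpar M) s (rp m n M x)"
  using rp_parity[OF assms(1) assms(2)] assms(3) unfolding has_parity_def mdim_def by blast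

lemma gen_parity: "\<forall>w\<in>Poly_Mapping.keys (gen g). word_odd w = (g \<in> {GE 0, GF 0})"
  by (simp add: gen_def word_odd_def)

lemma one_parity: "\<forall>w\<in>Poly_Mapping.keys (1::falg). word_odd w = False"
  by (simp add: word_odd_def zero_list_def)

context
  fixes m n :: nat and M N :: smod
  assumes M: "is_module m n (carrier (U_sigma m n)) M" and N: "is_module m n (carrier (U_sigma m n)) N"
begin

lemma tgen_simps:
  shows "i \<in> I_roots m n \<Longrightarrow> tgen m n M N (GE i) = kron (rp m n M (eE i)) (1\<^sub>m (mdim N))
      + kron (rp m n M (eKi i) * par_mat (mpar M) (i = 0)) (rp m n N (eE i))"
    and "i \<in> I_roots m n \<Longrightarrow> tgen m n M N (GF i) = kron (rp m n M (eF i)) (rp m n N (eKi' i))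
      + kron (par_mat (mpar M) (i = 0)) (rp m n N (eF i))"
    and "a \<in> lattice_Y m n \<Longrightarrow> tgen m n M N (GK a) = kron (rp m n M (eK a)) (rp m n N (eK a))"
    and "tgen m n M N GSigma = kron (rp m n M eSigma) (rp m n N eSigma)"
proof -
  have c: "rp m n M x \<in> carrier_mat (length (mpar M)) (length (mpar M))"
    "rp m n N x \<in> carrier_mat (length (mpar N)) (length (mpar N))" if "x \<in> FS m n" for x
    using rp_carrier[OF M that] rp_carrier[OF N that] by (simp_all add: mdim_def)
  have s: "super_kron (mpar M) (mpar N) (mact M (ucls m n x)) (mact N (ucls m n (gen g)))
      = kron (rp m n M x * par_mat (mpar M) (g \<in> {GE 0, GF 0})) (rp m n N (gen g))"
    if "x \<in> FS m n" "gen g \<in> FS m n" for x g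
    using super_kron_eq[OF c(1)[OF that(1)] c(2)[OF that(2)] rp_has_parity[OF N that(2) gen_parity]]
    unfolding rp_def .
  have s1: "super_kron (mpar M) (mpar N) (mact M (ucls m n x)) (mact N (ucls m n 1))
      = kron (rp m n M x) (rp m n N 1)" if "x \<in> FS m n" for x
    using super_kron_eq[OF c(1)[OF that(1)] c(2)[OF FS_one] rp_has_parity[OF N FS_one one_parity]] c(1)[OF that]
    unfolding rp_def par_mat_False by simp
  have p1: "rp m n M x * par_mat (mpar M) False = rp m n M x" if "x \<in> FS m n" for x
    using c(1)[OF that] by (simp add: par_mat_False)
  have pp: "rp m n M 1 * par_mat (mpar M) b = par_mat (mpar M) b" for b
    unfolding rp_one[OF M] mdim_def by simp
  have z: "A \<in> carrier_mat (mdim M) (mdim M) \<Longrightarrow> B \<in> carrier_mat (mdim N) (mdim N) \<Longrightarrow>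
      kron A B + 0\<^sub>m (mdim M * mdim N) (mdim M * mdim N) = kron A B" for A B
    using kron_carrier by (intro right_add_zero_mat)
  note c' = c[folded mdim_def]
  have pc: "par_mat (mpar M) b \<in> carrier_mat (mdim M) (mdim M)" for b by (simp add: mdim_def)
  show "i \<in> I_roots m n \<Longrightarrow> tgen m n M N (GE i) = kron (rp m n M (eE i)) (1\<^sub>m (mdim N))
      + kron (rp m n M (eKi i) * par_mat (mpar M) (i = 0)) (rp m n N (eE i))"
    unfolding tgen_def
    by (simp add: s s1 FS_intros z c' pc mult_carrier_mat[of _ "mdim M" "mdim M"] rp_one[OF N])
  show "i \<in> I_roots m n \<Longrightarrow> tgen m n M N (GF i) = kron (rp m n M (eF i)) (rp m n N (eKi' i))
      + kron (par_mat (mpar M) (i = 0)) (rp m n N (eF i))"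
    unfolding tgen_def
    by (simp add: s[of _ "GK _", folded eKi'_def] s FS_intros p1 z c' pc pp eKi'_def Y_Ki'[simplified])
  show "a \<in> lattice_Y m n \<Longrightarrow> tgen m n M N (GK a) = kron (rp m n M (eK a)) (rp m n N (eK a))"
    "tgen m n M N GSigma = kron (rp m n M eSigma) (rp m n N eSigma)"
    unfolding tgen_def by (simp_all add: s FS_intros p1 z c')
qed

definition lrep :: "falg \<Rightarrow> endo" where
  "lrep x = mat_endo (mdim M * mdim N) (kron (rp m n M x) (1\<^sub>m (mdim N)))"

definition rrep :: "falg \<Rightarrow> endo" where
  "rrep x = mat_endo (mdim M * mdim N) (kron (1\<^sub>m (mdim M)) (rp m n N x))"

definition ppar :: endo where
  "ppar = mat_endo (mdim M * mdim N) (kron (par_mat (mpar M) True) (1\<^sub>m (mdim N)))"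

end

lemma mat_endo_kron:
  assumes "A \<in> carrier_mat a a" "B \<in> carrier_mat b b"
  shows "mat_endo (a * b) (kron A B) = mat_endo (a * b) (kron A (1\<^sub>m b)) * mat_endo (a * b) (kron (1\<^sub>m a) B)"
  using assms by (simp add: kron_mult[of _ a a _ a _ b b _ b] kron_carrier flip: mat_endo_mult)

context
  fixes m n :: nat and M N :: smod
  assumes M: "is_module m n (carrier (U_sigma m n)) M" and N: "is_module m n (carrier (U_sigma m n)) N"
begin

lemma rp_carriers:
  "x \<in> FS m n \<Longrightarrow> rp m n M x \<in> carrier_mat (mdim M) (mdim M)"
  "x \<in> FS m n \<Longrightarrow> rp m n N x \<in> carrier_mat (mdim N) (mdim N)"
  "par_mat (mpar M) b \<in> carrier_mat (mdim M) (mdim M)"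
  using rp_carrier[OF M] rp_carrier[OF N] by (simp_all add: mdim_def)

section \<open>Tensor products of nonzero dimension as instances of
  \<open>tensor_rep\<close>\<close>

context
  assumes D: "mdim M * mdim N > 0"
begin

lemma lrep_endo_rep: "endo_rep m n (lrep m n M N)"
proof
  show "lrep m n M N (x + y) = lrep m n M N x + lrep m n M N y" if "x \<in> FS m n" "y \<in> FS m n" for x y
    unfolding lrep_def[OF M N] rp_add[OF M that] using rp_carriers that
    by (simp add: kron_add_left[of _ "mdim M" "mdim M"] mat_endo_add kron_carrier)
  show "lrep m n M N (x - y) = lrep m n M N x - lrep m n M N y" if "x \<in> FS m n" "y \<in> FS m n" for x y
    unfolding lrep_def[OF M N] rp_diff[OF M that] using rp_carriers that
    by (simp add: kron_diff_left[of _ "mdim M" "mdim M"] mat_endo_diff kron_carrier)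
  show "lrep m n M N (x * y) = lrep m n M N x * lrep m n M N y" if "x \<in> FS m n" "y \<in> FS m n" for x y
    unfolding lrep_def[OF M N] rp_mult[OF M that] using rp_carriers that
    by (simp add: kron_mult[of _ "mdim M" "mdim M" _ "mdim M" _ "mdim N" "mdim N" _ "mdim N"] kron_carrier
        flip: mat_endo_mult)
  show "lrep m n M N (scal c) = c \<odot> 1" for c
    unfolding lrep_def[OF M N] rp_scal[OF M] using D
    by (simp add: kron_smult_left kron_one mat_endo_smult mat_endo_one)
  show "lrep m n M N r = 0" if "r \<in> U_relators m n \<union> sigma_relators m n" for r
    unfolding lrep_def[OF M N] rp_relator[OF M that] by (simp add: kron_zero_left mat_endo_zero)
qed

lemma rrep_endo_rep: "endo_rep m n (rrep m n M N)"
proof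
  show "rrep m n M N (x + y) = rrep m n M N x + rrep m n M N y" if "x \<in> FS m n" "y \<in> FS m n" for x y
    unfolding rrep_def[OF M N] rp_add[OF N that] using rp_carriers that
    by (simp add: kron_add_right[of _ "mdim N" "mdim N"] mat_endo_add kron_carrier)
  show "rrep m n M N (x - y) = rrep m n M N x - rrep m n M N y" if "x \<in> FS m n" "y \<in> FS m n" for x y
    unfolding rrep_def[OF M N] rp_diff[OF N that] using rp_carriers that
    by (simp add: kron_diff_right[of _ "mdim N" "mdim N"] mat_endo_diff kron_carrier)
  show "rrep m n M N (x * y) = rrep m n M N x * rrep m n M N y" if "x \<in> FS m n" "y \<in> FS m n" for x y
    unfolding rrep_def[OF M N] rp_mult[OF N that] using rp_carriers that
    by (simp add: kron_mult[of _ "mdim M" "mdim M" _ "mdim M" _ "mdim N" "mdim N" _ "mdim N"] kron_carrier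
        flip: mat_endo_mult)
  show "rrep m n M N (scal c) = c \<odot> 1" for c
    unfolding rrep_def[OF M N] rp_scal[OF N] using D
    by (simp add: kron_smult_right kron_one mat_endo_smult mat_endo_one)
  show "rrep m n M N r = 0" if "r \<in> U_relators m n \<union> sigma_relators m n" for r
    unfolding rrep_def[OF M N] rp_relator[OF N that] by (simp add: kron_zero_right mat_endo_zero)
qed

lemma par_rp:
  assumes "gen g \<in> FS m n"
  shows "ppar M N * lrep m n M N (gen g)
      = (if g \<in> {GE 0, GF 0} then -1 else 1) \<odot> (lrep m n M N (gen g) * ppar M N)"
proof -
  have "par_mat (mpar M) True * rp m n M (gen g)
      = (if g \<in> {GE 0, GF 0} then -1 else 1) \<cdot>\<^sub>m (rp m n M (gen g) * par_mat (mpar M) True)"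
    using par_mat_commute[OF _ rp_has_parity[OF M assms gen_parity], of True] rp_carriers(1)[OF assms]
    by (simp add: mdim_def)
  then show ?thesis
    using rp_carriers(1)[OF assms] rp_carriers(3)[of True]
    by (simp add: lrep_def[OF M N] ppar_def[OF M N] kron_carrier kron_smult_left mat_endo_smult
        kron_mult[of _ "mdim M" "mdim M" _ "mdim M" _ "mdim N" "mdim N" _ "mdim N"] mult_carrier_mat[of _ "mdim M" "mdim M"]
        flip: mat_endo_mult)
qed

lemma tensor_rep_modules: "tensor_rep m n (lrep m n M N) (rrep m n M N) (ppar M N)"
proof (intro tensor_rep.intro lrep_endo_rep rrep_endo_rep tensor_rep_axioms.intro)
  show "rrep m n M N y * lrep m n M N x = lrep m n M N x * rrep m n M N y"
    if "x \<in> FS m n" "y \<in> FS m n" for x y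
    using rp_carriers that
    by (simp add: lrep_def[OF M N] rrep_def[OF M N] kron_carrier
        left_mult_one_mat[of _ "mdim M" "mdim M"] right_mult_one_mat[of _ "mdim M" "mdim M"]
        left_mult_one_mat[of _ "mdim N" "mdim N"] right_mult_one_mat[of _ "mdim N" "mdim N"] 
        kron_mult[of _ "mdim M" "mdim M" _ "mdim M" _ "mdim N" "mdim N" _ "mdim N"] flip: mat_endo_mult)
  show "ppar M N * ppar M N = 1"
    using rp_carriers(3) D par_mat_square[of "mpar M" True]
    by (simp add: ppar_def[OF M N] kron_carrier kron_one mat_endo_one mdim_def
        kron_mult[of _ "length (mpar M)" "length (mpar M)" _ "length (mpar M)" _ "length (mpar N)" "length (mpar N)" _ "length (mpar N)"]
        flip: mat_endo_mult)
  show "rrep m n M N y * ppar M N = ppar M N * rrep m n M N y" if "y \<in> FS m n" for y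
    using rp_carriers that
    by (simp add: ppar_def[OF M N] rrep_def[OF M N] kron_carrier
        left_mult_one_mat[of _ "mdim M" "mdim M"] right_mult_one_mat[of _ "mdim M" "mdim M"]
        left_mult_one_mat[of _ "mdim N" "mdim N"] right_mult_one_mat[of _ "mdim N" "mdim N"] 
        kron_mult[of _ "mdim M" "mdim M" _ "mdim M" _ "mdim N" "mdim N" _ "mdim N"] flip: mat_endo_mult)
qed (use par_rp[OF FS_eE] par_rp[OF FS_eF] par_rp[OF FS_eK] par_rp[OF FS_eSigma] in simp_all)

lemma tgen_agrees: "tensor_rep.agrees m n (lrep m n M N) (rrep m n M N) (ppar M N)
    (\<lambda>g. mat_endo (mdim M * mdim N) (tgen m n M N g))"
proof -
  interpret T: tensor_rep m n "lrep m n M N" "rrep m n M N" "ppar M N"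
    by (rule tensor_rep_modules)
  let ?D = "mdim M * mdim N"
  have pr: "mat_endo ?D (kron (par_mat (mpar M) (i = 0)) (1\<^sub>m (mdim N))) = T.P i" for i :: int
    unfolding T.P_def by (simp add: ppar_def[OF M N] par_mat_False kron_one mat_endo_one[OF D] flip: mdim_def)
  have kp: "mat_endo ?D (kron (rp m n M x * par_mat (mpar M) b) (1\<^sub>m (mdim N)))
      = lrep m n M N x * mat_endo ?D (kron (par_mat (mpar M) b) (1\<^sub>m (mdim N)))" if "x \<in> FS m n" for x b
    using rp_carriers(1)[OF that] rp_carriers(3)
    by (simp add: lrep_def[OF M N] kron_carrier
        kron_mult[of _ "mdim M" "mdim M" _ "mdim M" _ "mdim N" "mdim N" _ "mdim N"] flip: mat_endo_mult)
  have kk: "mat_endo ?D (kron A (rp m n N y)) = mat_endo ?D (kron A (1\<^sub>m (mdim N))) * rrep m n M N y"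
    if "A \<in> carrier_mat (mdim M) (mdim M)" "y \<in> FS m n" for A y
    unfolding rrep_def[OF M N] using mat_endo_kron[OF that(1) rp_carriers(2)[OF that(2)]] .
  note c = rp_carriers kron_carrier mult_carrier_mat[of _ "mdim M" "mdim M"]
  show ?thesis
    unfolding T.agrees_def
  proof
    fix g assume g: "g \<in> insert GSigma (U_gens m n)"
    show "mat_endo ?D (tgen m n M N g) = T.tens g"
    proof (cases g)
      case (GE i)
      then have i: "i \<in> I_roots m n" using g by (auto simp: U_gens_def)
      show ?thesis
        unfolding GE tgen_simps(1)[OF M N i] using i
        by (simp add: mat_endo_add c FS_intros kk kp pr) (simp add: lrep_def[OF M N])
    next
      case (GF i)
      then have i: "i \<in> I_roots m n" using g by (auto simp: U_gens_def)
      show ?thesis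
        unfolding GF tgen_simps(2)[OF M N i] using i
        by (simp add: mat_endo_add c FS_intros kk kp pr) (simp add: lrep_def[OF M N])
    next
      case (GK a)
      then have a: "a \<in> lattice_Y m n" using g by (auto simp: U_gens_def)
      show ?thesis
        unfolding GK tgen_simps(3)[OF M N a] using a
        by (simp add: c FS_intros kk) (simp add: lrep_def[OF M N])
    next
      case GSigma
      show ?thesis
        unfolding GSigma tgen_simps(4)[OF M N]
        by (simp add: c FS_intros kk) (simp add: lrep_def[OF M N])
    qed
  qed
qed

end

lemma tgen_relator:
  assumes "r \<in> U_relators m n \<union> sigma_relators m n"
  shows "free_act (mdim M * mdim N) (tgen m n M N) r = 0\<^sub>m (mdim M * mdim N) (mdim M * mdim N)"
  using tensor_rep.tens_relator[OF tensor_rep_modules tgen_agrees assms]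
  by (intro free_act_eqI tgen_carrier) (simp_all add: mat_endo_zero)

lemma rp_tensor_mod:
  assumes "x \<in> FS m n"
  shows "rp m n (tensor_mod m n M N) x = free_act (mdim M * mdim N) (tgen m n M N) x"
  unfolding rp_def tensor_mod_eq
  using mact_module_of[of "tgen m n M N" "tpar (mpar M) (mpar N)" m n x] assms tgen_carrier tgen_relator
  by (simp add: mdim_def)

text \<open>The matrix counterpart of \<open>csum\<close>. It makes sense in every dimension, and it
  is the form in which f \<otimes> g can be moved through the terms one by one.\<close>

definition msum :: "(kk \<times> falg \<times> bool \<times> falg) list \<Rightarrow> kk mat" where
  "msum L = foldr (\<lambda>(c, u, b, v) X. c \<cdot>\<^sub>m kron (rp m n M u * par_mat (mpar M) b) (rp m n N v) + X) L
     (0\<^sub>m (mdim M * mdim N) (mdim M * mdim N))"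

lemma msum_simps:
  "msum [] = 0\<^sub>m (mdim M * mdim N) (mdim M * mdim N)"
  "msum ((c, u, b, v) # L) = c \<cdot>\<^sub>m kron (rp m n M u * par_mat (mpar M) b) (rp m n N v) + msum L"
  by (simp_all add: msum_def)

lemma msum_carrier: "msum L \<in> carrier_mat (mdim M * mdim N) (mdim M * mdim N)"
proof (induction L)
  case (Cons a L)
  then show ?case by (cases a) (auto simp: msum_simps)
qed (simp add: msum_simps)

lemma mat_endo_msum:
  assumes D: "mdim M * mdim N > 0" and L: "\<forall>(c, u, b, v)\<in>set L. u \<in> FS m n \<and> v \<in> FS m n"
  shows "mat_endo (mdim M * mdim N) (msum L) = csum (lrep m n M N) (rrep m n M N) (ppar M N) L"
  using L
proof (induction L)
  case Nil
  show ?case by (simp add: msum_simps mat_endo_zero)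
next
  case (Cons a L)
  obtain c u b v where a: "a = (c, u, b, v)" by (cases a)
  have uv: "u \<in> FS m n" "v \<in> FS m n" using Cons.prems by (auto simp: a)
  note ca = rp_carriers kron_carrier mult_carrier_mat[of _ "mdim M" "mdim M"] uv
  let ?D = "mdim M * mdim N"
  have "mat_endo ?D (kron (rp m n M u * par_mat (mpar M) b) (rp m n N v))
      = mat_endo ?D (kron (rp m n M u * par_mat (mpar M) b) (1\<^sub>m (mdim N))) * rrep m n M N v"
    unfolding rrep_def[OF M N]
    by (rule mat_endo_kron[OF mult_carrier_mat[OF rp_carriers(1)[OF uv(1)] rp_carriers(3)] rp_carriers(2)[OF uv(2)]])
  also have "mat_endo ?D (kron (rp m n M u * par_mat (mpar M) b) (1\<^sub>m (mdim N)))
      = lrep m n M N u * mat_endo ?D (kron (par_mat (mpar M) b) (1\<^sub>m (mdim N)))"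
    using ca by (simp add: lrep_def[OF M N]
        kron_mult[of _ "mdim M" "mdim M" _ "mdim M" _ "mdim N" "mdim N" _ "mdim N"] flip: mat_endo_mult)
  also have "mat_endo ?D (kron (par_mat (mpar M) b) (1\<^sub>m (mdim N))) = (if b then ppar M N else 1)"
    using D by (cases b) (simp_all add: ppar_def[OF M N] par_mat_False kron_one mat_endo_one flip: mdim_def)
  finally have e: "mat_endo ?D (kron (rp m n M u * par_mat (mpar M) b) (rp m n N v))
      = lrep m n M N u * (if b then ppar M N else 1) * rrep m n M N v" .
  have kc: "kron (rp m n M u * par_mat (mpar M) b) (rp m n N v) \<in> carrier_mat ?D ?D"
    by (rule kron_carrier[OF mult_carrier_mat[OF rp_carriers(1)[OF uv(1)] rp_carriers(3)] rp_carriers(2)[OF uv(2)]])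
  have "mat_endo ?D (msum L) = csum (lrep m n M N) (rrep m n M N) (ppar M N) L"
    using Cons by (auto simp: a)
  then show ?case
    unfolding a msum_simps csum_Cons mat_endo_add[OF smult_carrier_mat[OF kc] msum_carrier]
      mat_endo_smult[OF kc] e by simp
qed

end

section \<open>The coideal property\<close>

abbreviation Ui_pre :: "nat \<Rightarrow> nat \<Rightarrow> (int \<Rightarrow> kk) \<Rightarrow> falg set" where
  "Ui_pre m n vs \<equiv> {x \<in> FS m n. ucls m n x \<in> Ui_sigma m n vs}"

lemma I_bullet_iff: "i \<in> I_bullet n \<longleftrightarrow> odd i \<and> 1 - 2 * int n \<le> i \<and> i < 0"
  unfolding I_bullet_def
  by (auto elim!: oddE intro!: exI[of _ "(1 - i) div 2"])

lemma bullet_roots: "i \<in> I_bullet n \<Longrightarrow> i \<in> I_roots m n"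
  by (auto simp: I_bullet_iff I_roots_def)

text \<open>A nonpositive index outside \<open>I_bullet n\<close> is even. Its neighbours below 0
  are then odd and belong to \<open>I_bullet n\<close>, which puts the E_{i-1} and E_{i+1} occurring
  in B_i for i < 0, and E_{-1} for i = 0, into the coideal subalgebra.\<close>

lemma circ_cases:
  assumes "i \<in> I_circ m n"
  obtains "i > 0" "i \<in> I_roots m n"
  | "i = 0" "0 \<in> I_roots m n" "-1 \<in> I_bullet n"
  | "i < -1" "i \<in> I_roots m n" "i - 1 \<in> I_bullet n" "i + 1 \<in> I_bullet n"
proof -
  have i: "i \<in> I_roots m n" "i \<notin> I_bullet n" using assms by (auto simp: I_circ_def)
  then have *: "1 - 2 * int n \<le> i" "i \<le> int m - 1" "i > 0 \<or> even i"
    by (auto simp: I_roots_def I_bullet_iff not_less) (metis dvd_0_right order_le_less)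
  consider "i > 0" | "i = 0" | "i < 0" by linarith
  then show thesis
  proof cases
    case 1
    then show ?thesis using i that by blast
  next
    case 2
    then show ?thesis using i that * by (auto simp: I_bullet_iff)
  next
    case 3
    then have "even i" using * by simp
    then have "i \<noteq> -1" "i \<noteq> 1 - 2 * int n" by auto
    with 3 * have "1 - 2 * int n \<le> i - 1" "i + 1 < 0" "i < -1" by linarith+
    then show ?thesis using i that(3) \<open>even i\<close> by (auto simp: I_bullet_iff)
  qed
qed

lemma Ui_gens_FS: "Ui_gens m n vs \<subseteq> FS m n"
proof -
  have "B_gen vs i \<in> FS m n" if "i \<in> I_circ m n" for i
    using that
  proof (cases rule: circ_cases)
    case 1
    then show ?thesis by (simp add: B_gen_def FS_intros)
  next
    case 2
    then show ?thesis using bullet_roots[of "-1" n m] by (simp add: B_gen_def FS_intros)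
  next
    case 3
    then show ?thesis using bullet_roots[of "i - 1" n m] bullet_roots[of "i + 1" n m]
      by (simp add: B_gen_def FS_intros)
  qed
  then show ?thesis
    unfolding Ui_gens_def by (auto simp: FS_intros bullet_roots)
qed

lemma Ui_pre_gen: "x \<in> Ui_gens m n vs \<Longrightarrow> x \<in> Ui_pre m n vs"
  using Ui_gens_FS unfolding Ui_sigma_def by (auto intro: generate_ring.incl)

lemma Ui_pre_sigma: "eSigma \<in> Ui_pre m n vs"
  unfolding Ui_sigma_def by (auto intro: generate_ring.incl FS_eSigma)

lemma Ui_pre_one: "1 \<in> Ui_pre m n vs"
  unfolding Ui_sigma_def using generate_ring.one[of "U_sigma m n"] by (simp add: FS_one one_U_sigma)

lemma Ui_pre_mult: "x \<in> Ui_pre m n vs \<Longrightarrow> y \<in> Ui_pre m n vs \<Longrightarrow> x * y \<in> Ui_pre m n vs"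
  unfolding Ui_sigma_def by (auto simp: FS_mult ucls_mult intro: generate_ring.eng_mult)

lemma Ui_pre_bullet:
  assumes "j \<in> I_bullet n"
  shows "eE j \<in> Ui_pre m n vs" "eF j \<in> Ui_pre m n vs" "eKi j \<in> Ui_pre m n vs" "eKi' j \<in> Ui_pre m n vs"
  using assms by (intro Ui_pre_gen; auto simp: Ui_gens_def)+

lemma Ui_pre_B: "i \<in> I_circ m n \<Longrightarrow> B_gen vs i \<in> Ui_pre m n vs"
  by (intro Ui_pre_gen) (auto simp: Ui_gens_def)

text \<open>The list \<open>L\<close> does not depend on the two modules, and its left-hand factors lie in the coideal
  subalgebra.\<close>

lemma coproduct_list:
  assumes "x \<in> Ui_gens m n vs \<union> {eSigma}"
  obtains L where "\<forall>(c, u, b, v)\<in>set L. u \<in> Ui_pre m n vs \<and> v \<in> FS m n"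
    and "\<And>l r p \<rho>. tensor_rep m n l r p \<Longrightarrow> tensor_rep.agrees m n l r p \<rho> \<Longrightarrow> evalg \<rho> x = csum l r p L"
proof -
  note FSs = FS_intros
  consider i where "i \<in> I_circ m n" "x = B_gen vs i"
    | j where "j \<in> I_bullet n" "x = eE j" | j where "j \<in> I_bullet n" "x = eF j"
    | j where "j \<in> I_bullet n" "x = eKi j" | j where "j \<in> I_bullet n" "x = eKi' j" | "x = eSigma"
    using assms unfolding Ui_gens_def by blast
  then show thesis
  proof cases
    case (1 i)
    show ?thesis
    proof (rule that[of "cop_B vs i"])
      have B: "B_gen vs i \<in> Ui_pre m n vs" using Ui_pre_B 1 by blast
      from 1(1) show "\<forall>(c, u, b, v)\<in>set (cop_B vs i). u \<in> Ui_pre m n vs \<and> v \<in> FS m n"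
      proof (cases rule: circ_cases)
        case 1
        then show ?thesis using B Ui_pre_one by (auto simp: cop_B_def FSs)
      next
        case 2
        then show ?thesis
          using B Ui_pre_one Ui_pre_bullet[OF 2(3), of m vs] bullet_roots[OF 2(3), of m]
          by (auto simp: cop_B_def FSs)
      next
        case 3
        note b = Ui_pre_bullet[OF 3(3), of m vs] Ui_pre_bullet[OF 3(4), of m vs]
        note e = Ui_pre_mult[OF b(1) b(5)] Ui_pre_mult[OF b(1) b(7)] Ui_pre_mult[OF b(5) b(3)] Ui_pre_mult[OF b(3) b(7)]
        have r: "brac (i + 1) i * eKi' i \<in> FS m n" "brac (i - 1) i * eKi' i \<in> FS m n" "brac3 i * eKi' i \<in> FS m n"
          "eE i * eKi' i \<in> FS m n" "eF i \<in> FS m n" "eKi' i \<in> FS m n"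
          using 3(2) bullet_roots[OF 3(3), of m] bullet_roots[OF 3(4), of m] by (simp_all add: FSs)
        show ?thesis
          using 3(1) B Ui_pre_one e r by (simp add: cop_B_def)
      qed
      fix l r p \<rho> assume T: "tensor_rep m n l r p" "tensor_rep.agrees m n l r p \<rho>"
      from 1(1) show "evalg \<rho> x = csum l r p (cop_B vs i)"
        unfolding 1(2)
        by (cases rule: circ_cases)
          (simp_all add: tensor_rep.evalg_B_pos[OF T] tensor_rep.evalg_B_zero[OF T] tensor_rep.evalg_B_neg[OF T] bullet_roots)
    qed
  next
    case (2 j)
    then have "j \<noteq> 0" "j \<in> I_roots m n" by (auto simp: I_bullet_iff bullet_roots)
    then show ?thesis
      using Ui_pre_bullet[OF 2(1), of m vs]
      by (intro that[of "[(1, eE j, False, 1), (1, eKi j, False, eE j)]"])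
        (auto simp: 2 FSs tensor_rep.ag_E tensor_rep.tens.simps tensor_rep.P_def csum_def
          endo_rep.h_one[OF tensor_rep.axioms(2)])
  next
    case (3 j)
    then have "j \<noteq> 0" "j \<in> I_roots m n" by (auto simp: I_bullet_iff bullet_roots)
    then show ?thesis
      using Ui_pre_bullet[OF 3(1), of m vs] Ui_pre_one[of m n vs]
      by (intro that[of "[(1, eF j, False, eKi' j), (1, 1, False, eF j)]"])
        (auto simp: 3 FSs tensor_rep.ag_F tensor_rep.tens.simps tensor_rep.P_def csum_def
          endo_rep.h_one[OF tensor_rep.axioms(1)])
  next
    case (4 j)
    then have "j \<in> I_roots m n" by (auto simp: bullet_roots)
    then show ?thesis
      using Ui_pre_bullet[OF 4(1), of m vs]
      by (intro that[of "[(1, eKi j, False, eKi j)]"]) (auto simp: 4 FSs tensor_rep.ag_Ki csum_def)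
  next
    case (5 j)
    then have "j \<in> I_roots m n" by (auto simp: bullet_roots)
    then show ?thesis
      using Ui_pre_bullet[OF 5(1), of m vs]
      by (intro that[of "[(1, eKi' j, False, eKi' j)]"]) (auto simp: 5 FSs tensor_rep.ag_Ki' csum_def)
  next
    case 6
    show ?thesis
      using Ui_pre_sigma[of m n vs]
      by (intro that[of "[(1, eSigma, False, eSigma)]"])
        (auto simp: 6 FSs tensor_rep.ag_S tensor_rep.tens.simps csum_def)
  qed
qed

lemma Ui_sigma_subset: "Ui_sigma m n vs \<subseteq> carrier (U_sigma m n)"
  unfolding Ui_sigma_def
  using Ui_gens_FS
  by (intro ring.generate_ring_incl[OF ring_U_sigma]) (auto intro!: ucls_carrier FS_intros)

text \<open>The property Q concerns elements of the free algebra and need not be constant on cosets,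
  so the induction produces one suitable representative.\<close>

lemma Ui_sigma_induct:
  assumes "X \<in> Ui_sigma m n vs"
    and "\<And>c. Q (scal c)" "\<And>x. x \<in> Ui_gens m n vs \<union> {eSigma} \<Longrightarrow> Q x"
    and "\<And>x y. x \<in> FS m n \<Longrightarrow> y \<in> FS m n \<Longrightarrow> Q x \<Longrightarrow> Q y \<Longrightarrow> Q (x + y)"
    and "\<And>x y. x \<in> FS m n \<Longrightarrow> y \<in> FS m n \<Longrightarrow> Q x \<Longrightarrow> Q y \<Longrightarrow> Q (x * y)"
  obtains x where "x \<in> FS m n" "X = ucls m n x" "Q x"
proof -
  from assms(1) have "\<exists>x\<in>FS m n. X = ucls m n x \<and> Q x"
    unfolding Ui_sigma_def
  proof (induction rule: generate_ring.induct)
    case one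
    have "Q 1" using assms(2)[of 1] by (simp add: scal_1)
    then show ?case by (auto simp: one_U_sigma FS_one)
  next
    case (incl h)
    then show ?case using assms(2,3) Ui_gens_FS[of m n vs] by (auto intro: FS_intros)
  next
    case (a_inv h)
    then obtain x where x: "x \<in> FS m n" "h = ucls m n x" "Q x" by blast
    interpret U: ring "U_sigma m n" by (rule ring_U_sigma)
    \<comment> \<open>The negative is taken as a product with a scalar, so that closure under
      products covers it.\<close>
    have "scal (-1) * x + x = 0"
    proof -
      have "scal (-1) = - 1" by (simp add: scal_def single_uminus flip: scal_1[unfolded scal_def])
      then show ?thesis by simp
    qed
    moreover have "ucls m n 0 = \<zero>\<^bsub>U_sigma m n\<^esub>"
      using ucls_add[OF FS_zero FS_zero, of m n] U.add.l_cancel_one'[OF ucls_carrier[OF FS_zero] ucls_carrier[OF FS_zero]]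
      by simp
    ultimately have "ucls m n (scal (-1) * x) \<oplus>\<^bsub>U_sigma m n\<^esub> ucls m n x = \<zero>\<^bsub>U_sigma m n\<^esub>"
      using x by (simp add: FS_intros flip: ucls_add)
    then have "\<ominus>\<^bsub>U_sigma m n\<^esub> h = ucls m n (scal (-1) * x)"
      using x by (simp add: U.minus_equality ucls_carrier FS_intros)
    moreover have "Q (scal (-1) * x)" using x assms(2,5) by (simp add: FS_intros)
    ultimately show ?case using x by (auto intro: FS_intros)
  next
    case (eng_add h1 h2)
    then show ?case using assms(4) ucls_add FS_add by metis
  next
    case (eng_mult h1 h2)
    then show ?case using assms(5) ucls_mult FS_mult by metis
  qed
  then show thesis using that by blast
qed

lemma free_act_intertwine:
  assumes A: "\<And>g. A g \<in> carrier_mat d d" and A': "\<And>g. A' g \<in> carrier_mat d' d'" and f: "f \<in> carrier_mat d' d"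
    and gens: "\<And>x. x \<in> Ui_gens m n vs \<union> {eSigma} \<Longrightarrow> free_act d' A' x * f = f * free_act d A x"
    and X: "X \<in> Ui_sigma m n vs"
  obtains x where "x \<in> FS m n" "X = ucls m n x" "free_act d' A' x * f = f * free_act d A x"
proof (rule Ui_sigma_induct[OF X, of "\<lambda>x. free_act d' A' x * f = f * free_act d A x"])
  note c = free_act_carrier[of d A] free_act_carrier[of d' A']
  show "free_act d' A' (scal c) * f = f * free_act d A (scal c)" for c
    unfolding free_act_scal[OF A] free_act_scal[OF A'] using f by auto
  show "free_act d' A' (x + y) * f = f * free_act d A (x + y)"
    if "free_act d' A' x * f = f * free_act d A x" "free_act d' A' y * f = f * free_act d A y" for x y
    unfolding free_act_add[OF A] free_act_add[OF A'] add_mult_distrib_mat[OF c(2) c(2) f]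
      mult_add_distrib_mat[OF f c(1) c(1)] that ..
  show "free_act d' A' (x * y) * f = f * free_act d A (x * y)"
    if "free_act d' A' x * f = f * free_act d A x" "free_act d' A' y * f = f * free_act d A y" for x y
    unfolding free_act_mult[OF A] free_act_mult[OF A']
      assoc_mult_mat[OF c(2) c(2) f] that(2) assoc_mult_mat[OF c(2) f c(1), symmetric] that(1)
    by (rule assoc_mult_mat[OF f c(1) c(1)])
qed (use gens that in auto)

lemma one_smult: "1 \<cdot>\<^sub>m A = (A :: kk mat)"
  by (rule eq_matI) auto

text \<open>The map f is asked to commute only with the left factors occurring in L; being even, it
  also passes the parity operators. The map g takes care of the right factors.\<close>

lemma msum_intertwine:
  assumes M: "is_module m n (carrier (U_sigma m n)) M" and M': "is_module m n (carrier (U_sigma m n)) M'"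
    and N: "is_module m n (carrier (U_sigma m n)) N" and N': "is_module m n (carrier (U_sigma m n)) N'"
    and f: "f \<in> carrier_mat (mdim M') (mdim M)" and g: "g \<in> carrier_mat (mdim N') (mdim N)"
    and fpar: "has_parity (mpar M') (mpar M) False f"
    and L: "\<forall>(c, u, b, v)\<in>set L. u \<in> FS m n \<and> v \<in> FS m n
        \<and> rp m n M' u * f = f * rp m n M u \<and> rp m n N' v * g = g * rp m n N v"
  shows "msum m n M' N' L * kron f g = kron f g * msum m n M N L"
  using L
proof (induction L)
  case Nil
  show ?case
    unfolding msum_simps[OF M N] msum_simps[OF M' N'] using kron_carrier[OF f g]
    by (simp add: left_mult_zero_mat[of _ _ "mdim M * mdim N"] right_mult_zero_mat[of _ "mdim M' * mdim N'"])
next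
  case (Cons a L)
  obtain c u b v where a: "a = (c, u, b, v)" by (cases a)
  have uv: "u \<in> FS m n" "v \<in> FS m n" "rp m n M' u * f = f * rp m n M u" "rp m n N' v * g = g * rp m n N v"
    using Cons.prems by (auto simp: a)
  note ca = rp_carriers(1,3)[OF M N] rp_carriers(2)[OF M N] note ca' = rp_carriers(1,3)[OF M' N'] rp_carriers(2)[OF M' N']
  have p: "par_mat (mpar M') b * f = f * par_mat (mpar M) b"
    using par_mat_commute[OF _ fpar, of b] f by (simp add: mdim_def one_smult)
  let ?X = "kron (rp m n M u * par_mat (mpar M) b) (rp m n N v)"
    and ?X' = "kron (rp m n M' u * par_mat (mpar M') b) (rp m n N' v)"
  have "?X' * kron f g = kron (rp m n M' u * par_mat (mpar M') b * f) (rp m n N' v * g)"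
    by (rule kron_mult[OF mult_carrier_mat[OF ca'(1)[OF uv(1)] ca'(2)] f ca'(3)[OF uv(2)] g])
  also have "rp m n M' u * par_mat (mpar M') b * f = f * (rp m n M u * par_mat (mpar M) b)"
    unfolding assoc_mult_mat[OF ca'(1)[OF uv(1)] ca'(2) f] p
      assoc_mult_mat[OF ca'(1)[OF uv(1)] f ca(2), symmetric] uv(3)
    by (rule assoc_mult_mat[OF f ca(1)[OF uv(1)] ca(2)])
  also have "kron \<dots> (rp m n N' v * g) = kron f g * ?X"
    unfolding uv(4)
    by (rule kron_mult[OF f mult_carrier_mat[OF ca(1)[OF uv(1)] ca(2)] g ca(3)[OF uv(2)], symmetric])
  finally have e: "?X' * kron f g = kron f g * ?X" .
  note k = kron_carrier[OF f g]
  have kX: "?X \<in> carrier_mat (mdim M * mdim N) (mdim M * mdim N)"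
    "?X' \<in> carrier_mat (mdim M' * mdim N') (mdim M' * mdim N')"
    by (rule kron_carrier[OF mult_carrier_mat[OF ca(1)[OF uv(1)] ca(2)] ca(3)[OF uv(2)]],
      rule kron_carrier[OF mult_carrier_mat[OF ca'(1)[OF uv(1)] ca'(2)] ca'(3)[OF uv(2)]])
  have IH: "msum m n M' N' L * kron f g = kron f g * msum m n M N L"
    using Cons by (auto simp: a)
  have "msum m n M' N' (a # L) * kron f g = c \<cdot>\<^sub>m (?X' * kron f g) + msum m n M' N' L * kron f g"
    unfolding a msum_simps[OF M' N'] add_mult_distrib_mat[OF smult_carrier_mat[OF kX(2)] msum_carrier[OF M' N'] k]
      mult_smult_assoc_mat[OF kX(2) k] ..
  also have "\<dots> = kron f g * msum m n M N (a # L)"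
    unfolding a msum_simps[OF M N] mult_add_distrib_mat[OF k smult_carrier_mat[OF kX(1)] msum_carrier[OF M N]]
      mult_smult_distrib[OF k kX(1)] e IH ..
  finally show ?case .
qed

text \<open>One list from \<open>coproduct_list\<close> describes a generator on both tensor
  products. Its left factors lie in the coideal subalgebra, which is all that f respects, and g
  respects every right factor.\<close>

theorem coideal_intertwine:
  assumes M: "is_module m n (carrier (U_sigma m n)) M" and M': "is_module m n (carrier (U_sigma m n)) M'"
    and N: "is_module m n (carrier (U_sigma m n)) N" and N': "is_module m n (carrier (U_sigma m n)) N'"
    and f: "f \<in> mod_hom (Ui_sigma m n vs) (Res m n vs M) (Res m n vs M')"
    and g: "g \<in> mod_hom (carrier (U_sigma m n)) N N'"
  shows "kron f g \<in> mod_hom (Ui_sigma m n vs) (Res m n vs (tensor_mod m n M N)) (Res m n vs (tensor_mod m n M' N'))"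
proof -
  let ?D = "mdim M * mdim N" and ?D' = "mdim M' * mdim N'"
  have [simp]: "mdim (Res m n vs Z) = mdim Z" "mpar (Res m n vs Z) = mpar Z" for Z
    by (simp_all add: Res_def mdim_def)
  have fc: "f \<in> carrier_mat (mdim M') (mdim M)" and fpar: "has_parity (mpar M') (mpar M) False f"
    using f by (auto simp: mod_hom_def has_parity_def mdim_def)
  have fU: "rp m n M' x * f = f * rp m n M x" if "x \<in> Ui_pre m n vs" for x
    using f that by (auto simp: mod_hom_def rp_def Res_def)
  have gc: "g \<in> carrier_mat (mdim N') (mdim N)" and gpar: "has_parity (mpar N') (mpar N) False g"
    using g by (auto simp: mod_hom_def has_parity_def mdim_def)
  have gU: "rp m n N' x * g = g * rp m n N x" if "x \<in> FS m n" for x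
    using g that by (auto simp: mod_hom_def rp_def ucls_carrier)
  note k = kron_carrier[OF fc gc]
  have gens: "free_act ?D' (tgen m n M' N') x * kron f g = kron f g * free_act ?D (tgen m n M N) x"
    if x: "x \<in> Ui_gens m n vs \<union> {eSigma}" for x
  \<comment> \<open>If either tensor product has dimension 0, the two sides are matrices without
    rows or without columns.\<close>
  proof (cases "?D = 0 \<or> ?D' = 0")
    case True
    then show ?thesis
      using mult_carrier_mat[OF free_act_carrier k] mult_carrier_mat[OF k free_act_carrier] mat_0_0_eq
      by metis
  next
    case False
    from coproduct_list[OF x] obtain L
      where L: "\<forall>(c, u, b, v)\<in>set L. u \<in> Ui_pre m n vs \<and> v \<in> FS m n"
        and e: "\<And>l r p \<rho>. tensor_rep m n l r p \<Longrightarrow> tensor_rep.agrees m n l r p \<rho> \<Longrightarrow> evalg \<rho> x = csum l r p L"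
      by blast
    have eq: "free_act (mdim K * mdim J) (tgen m n K J) x = msum m n K J L"
      if K: "is_module m n (carrier (U_sigma m n)) K" and J: "is_module m n (carrier (U_sigma m n)) J"
        and d: "mdim K * mdim J > 0" for K J
    proof (rule free_act_eqI)
      have L': "\<forall>(c, u, b, v)\<in>set L. u \<in> FS m n \<and> v \<in> FS m n" using L by auto
      show "evalg (\<lambda>g. mat_endo (mdim K * mdim J) (tgen m n K J g)) x = mat_endo (mdim K * mdim J) (msum m n K J L)"
        unfolding mat_endo_msum[OF K J d L'] by (rule e[OF tensor_rep_modules[OF K J d] tgen_agrees[OF K J d]])
    qed (auto intro: tgen_carrier msum_carrier[OF K J])
    have "msum m n M' N' L * kron f g = kron f g * msum m n M N L"
      by (rule msum_intertwine[OF M M' N N' fc gc fpar]) (use L fU gU in auto)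
    then show ?thesis using False eq[OF M N] eq[OF M' N'] by simp
  qed
  have act: "mact (tensor_mod m n M' N') X * kron f g = kron f g * mact (tensor_mod m n M N) X"
    if X: "X \<in> Ui_sigma m n vs" for X
  proof -
    obtain x where "x \<in> FS m n" "X = ucls m n x"
      "free_act ?D' (tgen m n M' N') x * kron f g = kron f g * free_act ?D (tgen m n M N) x"
      by (rule free_act_intertwine[OF tgen_carrier tgen_carrier k gens X]) auto
    then show ?thesis
      using rp_tensor_mod[OF M N, of x] rp_tensor_mod[OF M' N', of x] by (simp add: rp_def)
  qed
  have par: "tpar (mpar M') (mpar N') ! i = tpar (mpar M) (mpar N) ! j"
    if "i < ?D'" "j < ?D" "kron f g $$ (i, j) \<noteq> 0" for i j
  proof -
    have "f $$ (i div mdim N', j div mdim N) \<noteq> 0" "g $$ (i mod mdim N', j mod mdim N) \<noteq> 0"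
      using that fc gc by (auto simp: index_kron)
    then have "mpar M' ! (i div mdim N') = mpar M ! (j div mdim N)" "mpar N' ! (i mod mdim N') = mpar N ! (j mod mdim N)"
      using fpar gpar div_mod_bounds[OF that(1)] div_mod_bounds[OF that(2)] by (auto simp: has_parity_def mdim_def)
    then show ?thesis using that by (simp add: nth_tpar mdim_def)
  qed
  show ?thesis
    using k act par by (auto simp: mod_hom_def) (simp add: Res_def)
qed

section \<open>The natural module, its dual, and the map between them\<close>

lemma qq_square_neq_one: "qq * qq \<noteq> 1"
  unfolding qq_def One_fract_def by (simp add: eq_fract one_pCons)

lemma qq_diff_nonzero: "qq - inverse qq \<noteq> 0"
  using qq_square_neq_one by (auto simp: divide_simps inverse_eq_divide)

lemma I_roots_V: "i \<in> I_roots m n \<Longrightarrow> i \<in> I_V m n" "i \<in> I_roots m n \<Longrightarrow> i + 1 \<in> I_V m n"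
  by (auto simp: I_roots_def I_V_def)

lemma idx_inj: "idx n r = idx n s \<longleftrightarrow> r = s"
  by (simp add: idx_def)

lemma idx_in_V: "r < m + 2 * n \<Longrightarrow> idx n r \<in> I_V m n"
  by (simp add: idx_def I_V_def)

lemma idx_surj: "i \<in> I_V m n \<Longrightarrow> \<exists>r<m + 2 * n. idx n r = i"
  by (rule exI[of _ "nat (i - 1 + 2 * int n)"]) (auto simp: idx_def I_V_def)

text \<open>The map sending v_j to c_j v_{\<pi>(j)}, which covers matrix units, diagonal matrices
  and \<phi> alike. A value of \<pi> outside \<open>I_V m n\<close> yields a zero column.\<close>

definition mono_mat :: "nat \<Rightarrow> nat \<Rightarrow> (int \<Rightarrow> int) \<Rightarrow> (int \<Rightarrow> kk) \<Rightarrow> kk mat" where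
  "mono_mat m n \<pi> c = mat (m + 2 * n) (m + 2 * n) (\<lambda>(r, s). if idx n r = \<pi> (idx n s) then c (idx n s) else 0)"

lemma mono_mat_carrier [simp]: "mono_mat m n \<pi> c \<in> carrier_mat (m + 2 * n) (m + 2 * n)"
  by (simp add: mono_mat_def)

lemma mono_mat_mult:
  assumes "\<And>j. j \<in> I_V m n \<Longrightarrow> c' j \<noteq> 0 \<Longrightarrow> \<pi>' j \<in> I_V m n"
  shows "mono_mat m n \<pi> c * mono_mat m n \<pi>' c' = mono_mat m n (\<lambda>j. \<pi> (\<pi>' j)) (\<lambda>j. c (\<pi>' j) * c' j)"
proof (rule eq_matI)
  let ?N = "m + 2 * n"
  fix r s assume "r < dim_row (mono_mat m n (\<lambda>j. \<pi> (\<pi>' j)) (\<lambda>j. c (\<pi>' j) * c' j))"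
    "s < dim_col (mono_mat m n (\<lambda>j. \<pi> (\<pi>' j)) (\<lambda>j. c (\<pi>' j) * c' j))"
  then have rs: "r < ?N" "s < ?N" by (auto simp: mono_mat_def)
  have e: "(mono_mat m n \<pi> c * mono_mat m n \<pi>' c') $$ (r, s)
      = (\<Sum>k<?N. (if idx n r = \<pi> (idx n k) then c (idx n k) else 0) * (if idx n k = \<pi>' (idx n s) then c' (idx n s) else 0))"
    using rs by (simp add: mono_mat_def scalar_prod_def atLeast0LessThan)
  show "(mono_mat m n \<pi> c * mono_mat m n \<pi>' c') $$ (r, s)
      = mono_mat m n (\<lambda>j. \<pi> (\<pi>' j)) (\<lambda>j. c (\<pi>' j) * c' j) $$ (r, s)"
  proof (cases "c' (idx n s) = 0")
    case True
    then have "(\<Sum>k<?N. (if idx n r = \<pi> (idx n k) then c (idx n k) else 0)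
        * (if idx n k = \<pi>' (idx n s) then c' (idx n s) else 0)) = 0"
      by (intro sum.neutral) auto
    with True show ?thesis unfolding e using rs by (simp add: mono_mat_def)
  next
    case False
    then obtain k where k: "k < ?N" "idx n k = \<pi>' (idx n s)"
      using assms[OF idx_in_V[OF rs(2)]] idx_surj by metis
    have "(\<Sum>l<?N. (if idx n r = \<pi> (idx n l) then c (idx n l) else 0) * (if idx n l = \<pi>' (idx n s) then c' (idx n s) else 0))
        = (\<Sum>l<?N. if l = k then (if idx n r = \<pi> (idx n l) then c (idx n l) else 0) * c' (idx n s) else 0)"
      by (intro sum.cong) (auto simp: idx_inj simp flip: k(2))
    then show ?thesis unfolding e using rs k by (simp add: mono_mat_def)
  qed
qed (auto simp: mono_mat_def)

lemma mono_mat_eqI: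
  assumes "\<And>j. j \<in> I_V m n \<Longrightarrow> c j = c' j" "\<And>j. j \<in> I_V m n \<Longrightarrow> c j \<noteq> 0 \<Longrightarrow> \<pi> j = \<pi>' j"
  shows "mono_mat m n \<pi> c = mono_mat m n \<pi>' c'"
proof (rule eq_matI)
  fix r s assume "r < dim_row (mono_mat m n \<pi>' c')" "s < dim_col (mono_mat m n \<pi>' c')"
  then have "r < m + 2 * n" "s < m + 2 * n" by (auto simp: mono_mat_def)
  then show "mono_mat m n \<pi> c $$ (r, s) = mono_mat m n \<pi>' c' $$ (r, s)"
    using assms(1)[OF idx_in_V, of s] assms(2)[OF idx_in_V, of s]
    by (cases "c' (idx n s) = 0") (auto simp: mono_mat_def)
qed (auto simp: mono_mat_def)

lemma mono_mat_id: "mono_mat m n (\<lambda>j. j) (\<lambda>j. 1) = 1\<^sub>m (m + 2 * n)"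
  by (rule eq_matI) (auto simp: mono_mat_def idx_inj)

lemma mono_mat_zero: "mono_mat m n \<pi> (\<lambda>j. 0) = 0\<^sub>m (m + 2 * n) (m + 2 * n)"
  by (rule eq_matI) (auto simp: mono_mat_def)

lemma mono_mat_smult: "a \<cdot>\<^sub>m mono_mat m n \<pi> c = mono_mat m n \<pi> (\<lambda>j. a * c j)"
  by (rule eq_matI) (auto simp: mono_mat_def)

text \<open>The matrix unit sending v_b to v_a.\<close>

definition mun :: "nat \<Rightarrow> nat \<Rightarrow> int \<Rightarrow> int \<Rightarrow> endo" where
  "mun m n a b = mat_endo (m + 2 * n) (mono_mat m n (\<lambda>j. a) (\<lambda>j. if j = b then 1 else 0))"

definition mdiag :: "nat \<Rightarrow> nat \<Rightarrow> (int \<Rightarrow> kk) \<Rightarrow> endo" where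
  "mdiag m n c = mat_endo (m + 2 * n) (mono_mat m n (\<lambda>j. j) c)"

definition mono :: "nat \<Rightarrow> nat \<Rightarrow> (int \<Rightarrow> int) \<Rightarrow> (int \<Rightarrow> kk) \<Rightarrow> endo" where
  "mono m n \<pi> c = mat_endo (m + 2 * n) (mono_mat m n \<pi> c)"

lemma mono_mult:
  "(\<And>j. j \<in> I_V m n \<Longrightarrow> c' j \<noteq> 0 \<Longrightarrow> \<pi>' j \<in> I_V m n) \<Longrightarrow>
    mono m n \<pi> c * mono m n \<pi>' c' = mono m n (\<lambda>j. \<pi> (\<pi>' j)) (\<lambda>j. c (\<pi>' j) * c' j)"
  unfolding mono_def by (simp add: mono_mat_mult flip: mat_endo_mult)

lemma mono_eqI:
  "(\<And>j. j \<in> I_V m n \<Longrightarrow> c j = c' j) \<Longrightarrow> (\<And>j. j \<in> I_V m n \<Longrightarrow> c j \<noteq> 0 \<Longrightarrow> \<pi> j = \<pi>' j) \<Longrightarrow>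
    mono m n \<pi> c = mono m n \<pi>' c'"
  unfolding mono_def by (rule arg_cong[where f = "mat_endo (m + 2 * n)"], rule mono_mat_eqI)

lemma mono_zero: "mono m n \<pi> (\<lambda>j. 0) = 0"
  by (simp add: mono_def mono_mat_zero mat_endo_zero)

lemma sk_mono: "a \<odot> mono m n \<pi> c = mono m n \<pi> (\<lambda>j. a * c j)"
  unfolding mono_def by (simp add: mono_mat_smult flip: mat_endo_smult)

lemma mun_mono: "mun m n a b = mono m n (\<lambda>j. a) (\<lambda>j. if j = b then 1 else 0)"
  by (simp add: mun_def mono_def)

lemma mdiag_mono: "mdiag m n c = mono m n (\<lambda>j. j) c"
  by (simp add: mdiag_def mono_def)

lemma mun_mun:
  assumes "c \<in> I_V m n"
  shows "mun m n a b * mun m n c d = (if b = c then mun m n a d else 0)"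
  unfolding mun_mono
  by (subst mono_mult) (use assms in \<open>auto intro: mono_eqI simp flip: mono_zero[of m n "\<lambda>j. a"]\<close>)

lemma mdiag_mun: "a \<in> I_V m n \<Longrightarrow> mdiag m n c * mun m n a b = c a \<odot> mun m n a b"
  unfolding mun_mono mdiag_mono sk_mono by (subst mono_mult) (auto intro: mono_eqI)

lemma mun_mdiag: "mun m n a b * mdiag m n c = c b \<odot> mun m n a b"
  unfolding mun_mono mdiag_mono sk_mono by (subst mono_mult) (auto intro: mono_eqI)

lemma mdiag_mdiag: "mdiag m n c * mdiag m n c' = mdiag m n (\<lambda>j. c j * c' j)"
  unfolding mdiag_mono by (subst mono_mult) auto

lemma mdiag_one: "m + 2 * n > 0 \<Longrightarrow> mdiag m n (\<lambda>j. 1) = 1"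
  by (simp add: mdiag_def mono_mat_id mat_endo_one)

text \<open>Made for the relation between E_i and F_i: K_i - K_i^-1 kills all basis vectors except
  those numbered i and i + 1.\<close>

lemma mdiag_diff_mun:
  assumes "\<And>j. j \<in> I_V m n \<Longrightarrow> a * (c j - c' j) = (if j = i then x else if j = k then y else 0)" and "i \<noteq> k"
  shows "a \<odot> (mdiag m n c - mdiag m n c') = x \<odot> mun m n i i + y \<odot> mun m n k k"
proof -
  have "a \<cdot>\<^sub>m (mono_mat m n (\<lambda>j. j) c - mono_mat m n (\<lambda>j. j) c')
      = x \<cdot>\<^sub>m mono_mat m n (\<lambda>j. i) (\<lambda>j. if j = i then 1 else 0) + y \<cdot>\<^sub>m mono_mat m n (\<lambda>j. k) (\<lambda>j. if j = k then 1 else 0)"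
    (is "?A = ?B")
  proof (rule eq_matI)
    fix r s assume "r < dim_row ?B" "s < dim_col ?B"
    then have "r < m + 2 * n" "s < m + 2 * n" by (auto simp: mono_mat_def)
    then show "?A $$ (r, s) = ?B $$ (r, s)"
      using assms(1)[OF idx_in_V[of s m n]] assms(2) by (auto simp: mono_mat_def idx_inj)
  qed (auto simp: mono_mat_def)
  then have "mat_endo (m + 2 * n) ?A = mat_endo (m + 2 * n) ?B" by simp
  then show ?thesis
    by (simp add: mdiag_def mun_def mat_endo_smult mat_endo_diff mat_endo_add minus_carrier_mat
        smult_carrier_mat[OF mono_mat_carrier])
qed

section \<open>The relators on the natural module and on its dual\<close>

definition Vplus_mat :: "nat \<Rightarrow> nat \<Rightarrow> ugen \<Rightarrow> kk mat" where
  "Vplus_mat m n g = mat (m + 2 * n) (m + 2 * n) (\<lambda>(r, s). Vplus_coeff m g (idx n s) (idx n r))"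

definition Vminus_mat :: "nat \<Rightarrow> nat \<Rightarrow> ugen \<Rightarrow> kk mat" where
  "Vminus_mat m n g = mat (m + 2 * n) (m + 2 * n) (\<lambda>(r, s). Vminus_coeff m g (idx n s) (idx n r))"

definition V_sigma :: "nat \<Rightarrow> int \<Rightarrow> kk" where
  "V_sigma m j = (if j = int m \<and> m > 0 then -1 else 1)"

lemma Vplus_endo:
  "mat_endo (m + 2 * n) (Vplus_mat m n (GE i)) = mun m n i (i + 1)"
  "mat_endo (m + 2 * n) (Vplus_mat m n (GF i)) = mun m n (i + 1) i"
  "mat_endo (m + 2 * n) (Vplus_mat m n (GK h)) = mdiag m n (\<lambda>j. qq powi h j)"
  "mat_endo (m + 2 * n) (Vplus_mat m n GSigma) = mdiag m n (V_sigma m)"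
  unfolding mun_def mdiag_def
  by (rule arg_cong[where f = "mat_endo (m + 2 * n)"], rule eq_matI,
      auto simp: Vplus_mat_def mono_mat_def V_sigma_def)+

lemma Vminus_endo:
  "mat_endo (m + 2 * n) (Vminus_mat m n (GE i)) = mun m n (i + 1) i"
  "mat_endo (m + 2 * n) (Vminus_mat m n (GF i)) = psgn i i \<odot> mun m n i (i + 1)"
  "mat_endo (m + 2 * n) (Vminus_mat m n (GK h)) = mdiag m n (\<lambda>j. qq powi (- h j))"
  "mat_endo (m + 2 * n) (Vminus_mat m n GSigma) = mdiag m n (V_sigma m)"
  unfolding mun_def mdiag_def mat_endo_smult[OF mono_mat_carrier, symmetric]
  by (rule arg_cong[where f = "mat_endo (m + 2 * n)"], rule eq_matI,
      auto simp: Vminus_mat_def mono_mat_def V_sigma_def)+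

lemma cartan_eq_0: "cartan i j = 0 \<Longrightarrow> j \<noteq> i + 1 \<and> i \<noteq> j + 1 \<and> (i = j \<longrightarrow> i = 0)"
  by (cases "i = 0") (auto simp: cartan_0 cartan_nonzero split: if_splits)

lemma hh_simps: "hh i i = 1" "hh i (i + 1) = (if i = 0 then 1 else -1)" "j \<noteq> i \<Longrightarrow> j \<noteq> i + 1 \<Longrightarrow> hh i j = 0"
  by (auto simp: hh_def)

lemma q_i_diff: "inverse (q_i i - inverse (q_i i)) * (q_i i - inverse (q_i i)) = 1"
  using qq_diff_nonzero by (auto simp: q_i_def dd_def power_int_minus)

lemma V_sigma_sign:
  assumes "i \<in> I_roots m n"
  shows "V_sigma m i * V_sigma m (i + 1) = sigma_sign m i" "V_sigma m (i + 1) * V_sigma m i = sigma_sign m i"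
  using assms by (auto simp: V_sigma_def sigma_sign_def I_roots_def)

context
  fixes m n :: nat and E F :: "int \<Rightarrow> endo" and e :: int and \<rho> :: "ugen \<Rightarrow> endo"
  assumes N: "m + 2 * n > 0"
    and e: "e = 1 \<and> E = (\<lambda>i. mun m n i (i + 1)) \<and> F = (\<lambda>i. mun m n (i + 1) i)
      \<or> e = -1 \<and> E = (\<lambda>i. mun m n (i + 1) i) \<and> F = (\<lambda>i. psgn i i \<odot> mun m n i (i + 1))"
    and \<rho>: "\<And>i. \<rho> (GE i) = E i" "\<And>i. \<rho> (GF i) = F i" "\<And>h. \<rho> (GK h) = mdiag m n (\<lambda>j. qq powi (e * h j))"
      "\<rho> GSigma = mdiag m n (V_sigma m)"
begin

text \<open>Both modules are treated at once: e is 1 for V^+ and -1 for V^-, and in both the E_i and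
  F_i are matrix units up to sign, so every relation reduces to products of matrix units with
  diagonal matrices.\<close>

lemma V_relator:
  assumes "x \<in> U_relators m n \<union> sigma_relators m n"
  shows "evalg \<rho> x = 0"
  using assms
proof (induction rule: relator_induct)
  case 1
  show ?case by (simp add: \<rho> mdiag_one[OF N])
next
  case (2 h h')
  show ?case by (simp add: \<rho> mdiag_mdiag distrib_left power_int_add)
next
  case (3 h i)
  have "qq powi h i = qq powi (pair_alpha h i) * qq powi h (i + 1)"
    "qq powi (- h (i + 1)) = qq powi (pair_alpha h i) * qq powi (- h i)"
    by (simp_all add: pair_alpha_def flip: power_int_add)
  then show ?case using I_roots_V[OF 3(2)] e
    by (auto simp: \<rho> mdiag_mun mun_mdiag)
next
  case (4 h i)
  have "qq powi h (i + 1) = qq powi (- pair_alpha h i) * qq powi h i"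
    "qq powi (- h i) = qq powi (- pair_alpha h i) * qq powi (- h (i + 1))"
    by (simp_all add: pair_alpha_def flip: power_int_add)
  then show ?case using I_roots_V[OF 4(2)] e
    by (auto simp: \<rho> mdiag_mun mun_mdiag mult.commute)
next
  case (5 i j)
  show ?case
  proof (cases "i = j")
    case False
    then show ?thesis
      using e I_roots_V[OF 5(1)] I_roots_V[OF 5(2)] by (auto simp: scomm_def \<rho> mun_mun)
  next
    case True
    let ?c = "inverse (q_i i - inverse (q_i i))"
    have k: "?c \<odot> (mdiag m n (\<lambda>j. qq powi (e * (dd i * hh i j))) - mdiag m n (\<lambda>j. qq powi (e * (- dd i * hh i j))))
      = of_int e \<odot> mun m n i i + (- of_int e * psgn i i) \<odot> mun m n (i + 1) (i + 1)"
    proof (rule mdiag_diff_mun)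
      fix j
      have q: "qq powi (dd k) = q_i k" "qq powi (- dd k) = inverse (q_i k)" for k
        by (simp_all add: q_i_def power_int_minus)
      have h01: "hh 0 1 = 1" by (simp add: hh_def)
      have n: "?c * (inverse (q_i i) - q_i i) = -1"
        using q_i_diff[of i] by (simp add: algebra_simps)
      consider "j = i" | "j = i + 1" | "j \<noteq> i" "j \<noteq> i + 1" by blast
      then show "?c * (qq powi (e * (dd i * hh i j)) - qq powi (e * (- dd i * hh i j)))
         = (if j = i then of_int e else if j = i + 1 then - of_int e * psgn i i else 0)"
        by cases (use e q_i_diff[of i] n in \<open>auto simp: hh_simps h01 q\<close>)
    qed simp
    show ?thesis
      using e I_roots_V[OF 5(1)] k unfolding True[symmetric]
      by (cases "i = 0") (auto simp: scomm_def \<rho> mun_mun eKi_def eKi'_def)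
  qed
next
  case (6 X i j)
  then show ?case
    using e I_roots_V[of i m n] I_roots_V[of j m n] cartan_eq_0[of i j]
    by (auto simp: scomm_def \<rho> mun_mun)
next
  case (7 X i j)
  then show ?case
    using e I_roots_V[of i m n] I_roots_V[of j m n] by (auto simp: serre_def \<rho> mun_mun)
next
  case (8 X)
  then show ?case
    using e I_roots_V[of "-1" m n] I_roots_V[of 0 m n] I_roots_V[of 1 m n]
    by (auto simp: deg4_def scomm_def \<rho> mun_mun algebra_simps)
next
  case 9
  have "V_sigma m j * V_sigma m j = 1" for j by (simp add: V_sigma_def)
  then show ?case by (simp add: \<rho> mdiag_mdiag mdiag_one[OF N])
next
  case (10 i)
  then show ?case using e I_roots_V[OF 10] V_sigma_sign[OF 10] by (auto simp: \<rho> mdiag_mun mun_mdiag mult.commute)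
next
  case (11 i)
  then show ?case using e I_roots_V[OF 11] V_sigma_sign[OF 11] by (auto simp: \<rho> mdiag_mun mun_mdiag mult_ac)
next
  case (12 h)
  have "(\<lambda>j. V_sigma m j * qq powi (e * h j) * V_sigma m j) = (\<lambda>j. qq powi (e * h j))"
    by (auto simp: V_sigma_def)
  then show ?case by (simp add: \<rho> mdiag_mdiag)
qed

end

lemma Vplus_relator:
  assumes "x \<in> U_relators m n \<union> sigma_relators m n"
  shows "free_act (m + 2 * n) (Vplus_mat m n) x = 0\<^sub>m (m + 2 * n) (m + 2 * n)"
proof (rule free_act_eqI)
  assume N: "m + 2 * n > 0"
  show "evalg (\<lambda>g. mat_endo (m + 2 * n) (Vplus_mat m n g)) x = mat_endo (m + 2 * n) (0\<^sub>m (m + 2 * n) (m + 2 * n))"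
    unfolding mat_endo_zero by (rule V_relator[OF N _ _ _ _ _ assms, where e = 1]) (auto simp: Vplus_endo)
qed (auto simp: Vplus_mat_def)

lemma Vminus_relator:
  assumes "x \<in> U_relators m n \<union> sigma_relators m n"
  shows "free_act (m + 2 * n) (Vminus_mat m n) x = 0\<^sub>m (m + 2 * n) (m + 2 * n)"
proof (rule free_act_eqI)
  assume N: "m + 2 * n > 0"
  show "evalg (\<lambda>g. mat_endo (m + 2 * n) (Vminus_mat m n g)) x = mat_endo (m + 2 * n) (0\<^sub>m (m + 2 * n) (m + 2 * n))"
    unfolding mat_endo_zero by (rule V_relator[OF N _ _ _ _ _ assms, where e = "-1"]) (auto simp: Vminus_endo)
qed (auto simp: Vminus_mat_def)

lemma length_V_par [simp]: "length (V_par m n) = m + 2 * n"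
  by (simp add: V_par_def)

lemma Vplus_eq: "Vplus m n = module_of m n (V_par m n) (Vplus_mat m n)"
  and Vminus_eq: "Vminus m n = module_of m n (V_par m n) (Vminus_mat m n)"
  by (simp_all add: Vplus_def Vminus_def Vplus_mat_def[abs_def] Vminus_mat_def[abs_def])

lemma rp_Vplus: "x \<in> FS m n \<Longrightarrow> rp m n (Vplus m n) x = free_act (m + 2 * n) (Vplus_mat m n) x"
  unfolding rp_def Vplus_eq
  using mact_module_of[of "Vplus_mat m n" "V_par m n" m n x] Vplus_relator by (simp add: Vplus_mat_def)

lemma rp_Vminus: "x \<in> FS m n \<Longrightarrow> rp m n (Vminus m n) x = free_act (m + 2 * n) (Vminus_mat m n) x"
  unfolding rp_def Vminus_eq
  using mact_module_of[of "Vminus_mat m n" "V_par m n" m n x] Vminus_relator by (simp add: Vminus_mat_def)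

section \<open>The index permutation and the scalars of \<phi>\<close>

lemma phi_index_V: "j \<in> I_V m n \<Longrightarrow> phi_index j \<in> I_V m n"
  unfolding phi_index_def I_V_def by (auto; presburger)

lemma phi_index_invol [simp]: "phi_index (phi_index j) = j"
  unfolding phi_index_def by presburger

lemma phi_index_eq_iff: "phi_index i = j \<longleftrightarrow> i = phi_index j"
  by (metis phi_index_invol)

lemma phi_eq_mono_mat: "phi m n vs = mono_mat m n phi_index (vs_tilde vs)"
  by (simp add: phi_def mono_mat_def)

lemma vs_tilde_1: "vs_tilde vs 1 = 1"
  by (simp add: vs_tilde_def)

lemma vs_tilde_pos:
  assumes "i > 0"
  shows "vs_tilde vs (i + 1) = vs_tilde vs i * inverse (qq * vs i)"
proof -
  have "{1..i + 1 - 1} = insert i {1..i - 1}" using assms by auto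
  then show ?thesis using assms by (simp add: vs_tilde_def)
qed

lemma vs_tilde_zero: "vs_tilde vs 0 = - qq * vs 0"
  by (simp add: vs_tilde_def)

lemma vs_tilde_neg:
  assumes "i < 0" "even i"
  shows "vs_tilde vs i = - qq * vs i * vs_tilde vs (i + 2)"
proof -
  obtain k where k: "i = 2 * k" using assms by (auto elim: evenE)
  have "(2 * k + 1) div 2 = k" "(2 * k + 2 + 1) div 2 = k + 1" by simp_all
  moreover have "{k..0} = insert k {k + 1..0}" using assms k by auto
  ultimately show ?thesis using assms k by (simp add: vs_tilde_def)
qed

text \<open>The lower end \<open>(i + 1) div 2\<close> of the product is the same for 2k - 1 and
  2k.\<close>

lemma vs_tilde_pair:
  assumes "i \<le> 0" "even i"
  shows "vs_tilde vs (i - 1) = vs_tilde vs i"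
proof -
  obtain k where k: "i = 2 * k" using assms by (auto elim: evenE)
  then show ?thesis using assms by (simp add: vs_tilde_def)
qed

text \<open>The one property of these scalars that enters the reflection, cup and cap
  identities.\<close>

lemma vs_tilde_phi_index:
  assumes "i \<le> 0"
  shows "vs_tilde vs (phi_index i) = vs_tilde vs i"
proof (cases "even i")
  case True
  then show ?thesis using assms vs_tilde_pair[of i vs] by (simp add: phi_index_def)
next
  case False
  then have "i + 1 \<le> 0" "even (i + 1)" using assms by presburger+
  then have "vs_tilde vs (i + 1 - 1) = vs_tilde vs (i + 1)" by (rule vs_tilde_pair)
  then show ?thesis using assms False by (simp add: phi_index_def)
qed

context
  fixes m n :: nat and vs :: "int \<Rightarrow> kk"
  assumes vs: "\<And>i. i \<in> I_circ m n \<Longrightarrow> vs i \<noteq> 0" and vs_0: "0 \<in> I_V m n \<Longrightarrow> vs 0 \<noteq> 0"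
begin

lemma vs_tilde_nonzero:
  assumes "i \<in> I_V m n"
  shows "vs_tilde vs i \<noteq> 0"
proof (cases "i > 0")
  case True
  have "vs k \<noteq> 0" if "k \<in> {1..i - 1}" for k
    using that assms by (intro vs) (auto simp: I_circ_def I_bullet_iff I_roots_def I_V_def)
  with True show ?thesis by (auto simp: vs_tilde_def)
next
  case False
  have "vs (2 * k) \<noteq> 0" if k: "k \<in> {(i + 1) div 2..0}" for k
  proof (cases "k = 0")
    case True
    moreover have "0 \<in> I_V m n" using assms False by (auto simp: I_V_def)
    ultimately show ?thesis using vs_0 by simp
  next
    case False
    then show ?thesis
      using k assms by (intro vs) (auto simp: I_circ_def I_bullet_iff I_roots_def I_V_def)
  qed
  with False show ?thesis by (auto simp: vs_tilde_def)
qed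

text \<open>The candidate for the inverse of \<phi>: as \<open>phi_index\<close> is an involution,
  the vector mapped to a multiple of v_j is the one numbered \<open>phi_index j\<close>.\<close>

definition psi :: "kk mat" where
  "psi = mono_mat m n phi_index (\<lambda>j. inverse (vs_tilde vs (phi_index j)))"

lemma psi_carrier: "psi \<in> carrier_mat (m + 2 * n) (m + 2 * n)"
  by (simp add: psi_def)

lemma phi_carrier: "phi m n vs \<in> carrier_mat (m + 2 * n) (m + 2 * n)"
  by (simp add: phi_def)

lemma phi_psi: "phi m n vs * psi = 1\<^sub>m (m + 2 * n)"
  unfolding phi_eq_mono_mat psi_def
  by (subst mono_mat_mult) (auto simp: phi_index_V vs_tilde_nonzero simp flip: mono_mat_id intro!: mono_mat_eqI)

lemma psi_phi: "psi * phi m n vs = 1\<^sub>m (m + 2 * n)"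
  unfolding phi_eq_mono_mat psi_def
  by (subst mono_mat_mult) (auto simp: phi_index_V vs_tilde_nonzero simp flip: mono_mat_id intro!: mono_mat_eqI)

lemma mat_inv_phi: "mat_inv (phi m n vs) = psi"
  unfolding mat_inv_def
proof (rule the_equality)
  show "psi \<in> carrier_mat (dim_col (phi m n vs)) (dim_row (phi m n vs)) \<and>
      inverts_mat (phi m n vs) psi \<and> inverts_mat psi (phi m n vs)"
    using phi_psi psi_phi psi_carrier by (simp add: inverts_mat_def phi_def)
next
  fix B assume "B \<in> carrier_mat (dim_col (phi m n vs)) (dim_row (phi m n vs)) \<and>
      inverts_mat (phi m n vs) B \<and> inverts_mat B (phi m n vs)"
  then have B: "B \<in> carrier_mat (m + 2 * n) (m + 2 * n)" "B * phi m n vs = 1\<^sub>m (m + 2 * n)"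
    using phi_carrier by (auto simp: inverts_mat_def)
  have "B = B * (phi m n vs * psi)" using B by (simp add: phi_psi)
  also have "\<dots> = (B * phi m n vs) * psi"
    by (rule assoc_mult_mat[OF B(1) phi_carrier psi_carrier, symmetric])
  finally show "B = psi" using psi_carrier by (simp add: B)
qed

section \<open>\<phi> commutes with the generators of the coideal subalgebra\<close>

definition Phi :: endo where
  "Phi = mono m n phi_index (vs_tilde vs)"

lemma mun_Phi: "b \<in> I_V m n \<Longrightarrow> mun m n a b * Phi = vs_tilde vs (phi_index b) \<odot> mun m n a (phi_index b)"
  unfolding Phi_def mun_mono sk_mono
  by (subst mono_mult) (auto simp: phi_index_V phi_index_eq_iff intro!: mono_eqI)

lemma Phi_mun: "a \<in> I_V m n \<Longrightarrow> Phi * mun m n a b = vs_tilde vs a \<odot> mun m n (phi_index a) b"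
  unfolding Phi_def mun_mono sk_mono
  by (subst mono_mult) (auto intro!: mono_eqI)

lemma mdiag_Phi: "(\<And>j. j \<in> I_V m n \<Longrightarrow> c (phi_index j) = c' j) \<Longrightarrow> mdiag m n c * Phi = Phi * mdiag m n c'"
  unfolding Phi_def mdiag_mono
  by (subst (1 2) mono_mult) (auto simp: phi_index_V intro!: mono_eqI)

abbreviation "rhop \<equiv> \<lambda>g. mat_endo (m + 2 * n) (Vplus_mat m n g)"
abbreviation "rhom \<equiv> \<lambda>g. mat_endo (m + 2 * n) (Vminus_mat m n g)"

lemma eKi'_V: "rhop (GK (\<lambda>j. - dd i * hh i j)) = mdiag m n (\<lambda>j. qq powi (- dd i * hh i j))"
  "rhom (GK (\<lambda>j. - dd i * hh i j)) = mdiag m n (\<lambda>j. qq powi (dd i * hh i j))"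
  by (simp_all add: Vplus_endo Vminus_endo)

text \<open>B_i acts by the same two matrix units on V^+ and V^-, but the factor q
  \<open>vs i\<close> sits on different ones. Commuting with \<phi> is the recursion
  \<open>vs_tilde vs i = vs i * (qq * vs_tilde vs (i + 1))\<close>.\<close>

lemma Phi_B_pos:
  assumes i: "i > 0" "i \<in> I_roots m n"
  shows "evalg rhop (B_gen vs i) * Phi = Phi * evalg rhom (B_gen vs i)"
proof -
  note I = I_roots_V[OF i(2)]
  have d: "dd i = 1" using i by (simp add: dd_def)
  have p: "phi_index i = i" "phi_index (i + 1) = i + 1" using i by (simp_all add: phi_index_def)
  have "i \<in> I_circ m n" using i by (auto simp: I_circ_def I_bullet_iff)
  then have s: "vs_tilde vs i = vs i * (qq * vs_tilde vs (i + 1))"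
    unfolding vs_tilde_pos[OF i(1)] using i vs[of i] by (simp add: field_simps)
  have 1: "evalg rhop (B_gen vs i) = mun m n (i + 1) i + (vs i * qq) \<odot> mun m n i (i + 1)"
    using i I by (simp add: B_gen_def eKi'_def eKi'_V[simplified] Vplus_endo mun_mdiag hh_simps d)
  have 2: "evalg rhom (B_gen vs i) = (vs i * qq) \<odot> mun m n (i + 1) i + mun m n i (i + 1)"
    using i I by (simp add: B_gen_def eKi'_def eKi'_V[simplified] Vminus_endo mun_mdiag hh_simps d)
  show ?thesis
    unfolding 1 2 using I by (simp add: distrib_left distrib_right mun_Phi Phi_mun p s mult.assoc)
qed

text \<open>One product of the bracket survives on V^+ and the other one, with its factor -q, on
  V^-. On V^+ the missing q comes from K_0^-1. The sign of F_0 on V^- makes both scalars of the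
  block {-1, 0} equal to -q \<open>vs 0\<close>.\<close>

lemma Phi_B_zero:
  assumes i: "0 \<in> I_roots m n" "-1 \<in> I_roots m n"
  shows "evalg rhop (B_gen vs 0) * Phi = Phi * evalg rhom (B_gen vs 0)"
proof -
  note I = I_roots_V[OF i(1)] I_roots_V[OF i(2)]
  have p: "phi_index 0 = -1" "phi_index 1 = 1" "phi_index (-1) = 0" by (simp_all add: phi_index_def)
  have s: "vs_tilde vs (-1) = - (vs 0 * qq)" "vs_tilde vs 0 = - (vs 0 * qq)" "vs_tilde vs 1 = 1"
    using vs_tilde_pair[of 0 vs] by (simp_all add: vs_tilde_zero vs_tilde_1 mult.commute)
  have h: "hh 0 1 = 1" "hh 0 (-1) = 0" "dd 0 = -1" by (simp_all add: hh_def dd_def)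
  have 1: "evalg rhop (B_gen vs 0) = mun m n 1 0 + (vs 0 * qq) \<odot> mun m n (-1) 1"
    using I by (simp add: B_gen_def eKi'_def eKi'_V[simplified] Vplus_endo mun_mdiag mun_mun h mult.commute[of qq])
  have 2: "evalg rhom (B_gen vs 0) = (-1) \<odot> mun m n 0 1 + (- (vs 0 * qq)) \<odot> mun m n 1 (-1)"
    using I by (simp add: B_gen_def eKi'_def eKi'_V[simplified] Vminus_endo mun_mdiag mun_mun h mult.commute[of qq])
  show ?thesis
    unfolding 1 2 using I by (simp add: distrib_left distrib_right mun_Phi Phi_mun p s
        add.commute right_diff_distrib left_diff_distrib)
qed

text \<open>Of the four products in B_i only E_{i-1} E_i E_{i+1} is nonzero on V^+ and only E_{i+1}
  E_i E_{i-1} on V^-. Both carry the coefficient -q, which is the step from the block of i + 2 to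
  that of i in \<open>vs_tilde\<close>.\<close>

lemma Phi_B_neg:
  assumes i: "i < -1" "i \<in> I_roots m n" "i - 1 \<in> I_roots m n" "i + 1 \<in> I_roots m n" "even i"
  shows "evalg rhop (B_gen vs i) * Phi = Phi * evalg rhom (B_gen vs i)"
proof -
  have "i + 1 + 1 = i + 2" by simp
  then have I: "i - 1 \<in> I_V m n" "i \<in> I_V m n" "i + 1 \<in> I_V m n" "i + 2 \<in> I_V m n"
    using I_roots_V[OF i(2)] I_roots_V[OF i(3)] I_roots_V(2)[OF i(4)] by (simp_all only:)
  have p: "phi_index (i - 1) = i" "phi_index i = i - 1" "phi_index (i + 1) = i + 2" "phi_index (i + 2) = i + 1"
    using i by (simp_all add: phi_index_def)
  have s: "vs_tilde vs (i - 1) = - (vs i * qq) * vs_tilde vs (i + 2)" "vs_tilde vs i = - (vs i * qq) * vs_tilde vs (i + 2)"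
    using vs_tilde_pair[of i vs] vs_tilde_neg[of i vs] i by (simp_all add: mult.commute[of qq])
  have "vs_tilde vs (i + 2 - 1) = vs_tilde vs (i + 2)" using i by (intro vs_tilde_pair) auto
  moreover have "i + 2 - 1 = i + 1" by simp
  ultimately have s': "vs_tilde vs (i + 1) = vs_tilde vs (i + 2)" by (simp only:)
  have h: "hh i (i - 1) = 0" "hh i (i + 2) = 0" by (simp_all add: hh_def)
  have "i - 1 + 1 = i" "i + 1 + 1 = i + 2" by simp_all
  then have E: "rhop (GE (i - 1)) = mun m n (i - 1) i" "rhop (GE i) = mun m n i (i + 1)"
      "rhop (GE (i + 1)) = mun m n (i + 1) (i + 2)" "rhop (GF i) = mun m n (i + 1) i"
    and E': "rhom (GE (i - 1)) = mun m n i (i - 1)" "rhom (GE i) = mun m n (i + 1) i"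
      "rhom (GE (i + 1)) = mun m n (i + 2) (i + 1)" "rhom (GF i) = mun m n i (i + 1)"
    using Vplus_endo(1)[of m n "i - 1"] Vplus_endo(1,2)[of m n i] Vplus_endo(1)[of m n "i + 1"]
      Vminus_endo(1)[of m n "i - 1"] Vminus_endo(1,2)[of m n i] Vminus_endo(1)[of m n "i + 1"] i(1)
    by (simp_all only:) simp
  have 1: "evalg rhop (B_gen vs i) = mun m n (i + 1) i + (- (vs i * qq)) \<odot> mun m n (i - 1) (i + 2)"
    using I i by (simp add: B_gen_def eKi'_def eKi'_V[simplified] E mun_mdiag mun_mun h mult.commute[of qq])
  have 2: "evalg rhom (B_gen vs i) = (- (vs i * qq)) \<odot> mun m n (i + 2) (i - 1) + mun m n i (i + 1)"
    using I i by (simp add: B_gen_def eKi'_def eKi'_V[simplified] E' mun_mdiag mun_mun h mult.commute[of qq])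
  show ?thesis
    unfolding 1 2 using I
    by (simp add: distrib_left distrib_right mun_Phi Phi_mun p s s' mult.assoc right_diff_distrib left_diff_distrib)
qed

lemma Phi_intertwine:
  assumes "x \<in> Ui_gens m n vs \<union> {eSigma}"
  shows "evalg rhop x * Phi = Phi * evalg rhom x"
proof -
  consider i where "i \<in> I_circ m n" "x = B_gen vs i"
    | j where "j \<in> I_bullet n" "x \<in> {eE j, eF j, eKi j, eKi' j}" | "x = eSigma"
    using assms unfolding Ui_gens_def by blast
  then show ?thesis
  proof cases
    case (1 i)
    from 1(1) show ?thesis
    proof (cases rule: circ_cases)
      case 1
      then show ?thesis using Phi_B_pos \<open>x = _\<close> by simp
    next
      case 2
      then show ?thesis using Phi_B_zero bullet_roots \<open>x = _\<close> by simp
    next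
      case 3
      then have "even i" by (simp add: I_bullet_iff)
      then show ?thesis using 3 Phi_B_neg bullet_roots \<open>x = _\<close> by simp
    qed
  next
    case (2 j)
    then have j: "j \<le> -1" "odd j" "j \<in> I_roots m n" by (auto simp: I_bullet_iff bullet_roots)
    note I = I_roots_V[OF j(3)]
    have p: "phi_index j = j + 1" "phi_index (j + 1) = j" using j by (auto simp: phi_index_def)
    have s: "vs_tilde vs (j + 1) = vs_tilde vs j" using vs_tilde_phi_index[of j vs] j p by simp
    \<comment> \<open>Exchanging j and j + 1 negates h_j, which compensates the negated weights of
      V^-.\<close>
    have h: "hh j (phi_index k) = - hh j k" for k
      using j p by (auto simp: hh_def phi_index_eq_iff)
    have "evalg rhop (eK (\<lambda>k. a * hh j k)) * Phi = Phi * evalg rhom (eK (\<lambda>k. a * hh j k))" for a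
      by (simp add: Vplus_endo Vminus_endo) (intro mdiag_Phi, simp add: h)
    from this[of "dd j"] this[of "- dd j"] show ?thesis
      using 2(2) j I by (auto simp: Vplus_endo Vminus_endo mun_Phi Phi_mun p s eKi_def eKi'_def)
  next
    case 3
    have "V_sigma m (phi_index j) = V_sigma m j" if "j \<in> I_V m n" for j
      using that by (auto simp: V_sigma_def phi_index_def elim!: evenE oddE)
    then show ?thesis unfolding 3 by (simp add: Vplus_endo Vminus_endo mdiag_Phi)
  qed
qed

lemma phi_free_act:
  assumes "x \<in> Ui_gens m n vs \<union> {eSigma}"
  shows "free_act (m + 2 * n) (Vplus_mat m n) x * phi m n vs = phi m n vs * free_act (m + 2 * n) (Vminus_mat m n) x"
    (is "?a * _ = _ * ?b")
proof (cases "m + 2 * n = 0")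
  case True
  have "?a * phi m n vs \<in> carrier_mat 0 0" "phi m n vs * ?b \<in> carrier_mat 0 0"
    using mult_carrier_mat[OF free_act_carrier phi_carrier] mult_carrier_mat[OF phi_carrier free_act_carrier]
    unfolding True by blast+
  then show ?thesis by (rule mat_0_0_eq)
next
  case False
  have P: "mat_endo (m + 2 * n) (phi m n vs) = Phi"
    unfolding Phi_def mono_def phi_eq_mono_mat ..
  have A: "Vplus_mat m n g \<in> carrier_mat (m + 2 * n) (m + 2 * n)"
    "Vminus_mat m n g \<in> carrier_mat (m + 2 * n) (m + 2 * n)" for g
    by (simp_all add: Vplus_mat_def Vminus_mat_def)
  have N: "m + 2 * n > 0" using False by simp
  have "mat_endo (m + 2 * n) ?a = evalg rhop x" "mat_endo (m + 2 * n) ?b = evalg rhom x"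
    by (rule mat_endo_free_act[OF N A(1)], rule mat_endo_free_act[OF N A(2)])
  then have "mat_endo (m + 2 * n) (?a * phi m n vs) = mat_endo (m + 2 * n) (phi m n vs * ?b)"
    unfolding mat_endo_mult[OF free_act_carrier phi_carrier] mat_endo_mult[OF phi_carrier free_act_carrier] P
    using Phi_intertwine[OF assms] by simp
  then show ?thesis
    by (rule mat_endo_inj[rotated 2])
      (rule mult_carrier_mat[OF free_act_carrier phi_carrier], rule mult_carrier_mat[OF phi_carrier free_act_carrier])
qed

lemma mpar_V [simp]: "mpar (Vplus m n) = V_par m n" "mpar (Vminus m n) = V_par m n"
  "mdim (Vplus m n) = m + 2 * n" "mdim (Vminus m n) = m + 2 * n"
  by (simp_all add: Vplus_def Vminus_def module_of_def mdim_def)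

lemma pV_phi_index: "pV (phi_index j) = pV j"
  unfolding pV_def phi_index_def by presburger

lemma mono_phi_parity:
  assumes "i < m + 2 * n" "j < m + 2 * n" "mono_mat m n phi_index c $$ (i, j) \<noteq> 0"
  shows "V_par m n ! i = V_par m n ! j"
  using assms pV_phi_index[of "idx n j"] by (simp add: mono_mat_def V_par_def split: if_splits)

theorem phi_mod_hom: "phi m n vs \<in> mod_hom (Ui_sigma m n vs) (Res m n vs (Vminus m n)) (Res m n vs (Vplus m n))"
proof -
  have "mact (Vplus m n) X * phi m n vs = phi m n vs * mact (Vminus m n) X" if X: "X \<in> Ui_sigma m n vs" for X
  proof -
    obtain x where "x \<in> FS m n" "X = ucls m n x"
      "free_act (m + 2 * n) (Vplus_mat m n) x * phi m n vs = phi m n vs * free_act (m + 2 * n) (Vminus_mat m n) x"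
      by (rule free_act_intertwine[OF _ _ phi_carrier phi_free_act X]) (auto simp: Vplus_mat_def Vminus_mat_def)
    then show ?thesis using rp_Vplus[of x m n] rp_Vminus[of x m n] by (simp add: rp_def)
  qed
  then show ?thesis
    using phi_carrier mono_phi_parity
    by (auto simp: mod_hom_def Res_def mdim_def phi_eq_mono_mat)
qed

theorem psi_mod_hom: "psi \<in> mod_hom (Ui_sigma m n vs) (Res m n vs (Vplus m n)) (Res m n vs (Vminus m n))"
proof -
  have "mact (Vminus m n) X * psi = psi * mact (Vplus m n) X" if X: "X \<in> Ui_sigma m n vs" for X
  proof -
    obtain x where x: "x \<in> FS m n" "X = ucls m n x"
      using X Ui_sigma_subset carrier_U_sigma by blast
    then have c: "mact (Vplus m n) X \<in> carrier_mat (m + 2 * n) (m + 2 * n)"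
      "mact (Vminus m n) X \<in> carrier_mat (m + 2 * n) (m + 2 * n)"
      using rp_Vplus[of x m n] rp_Vminus[of x m n] by (simp_all add: rp_def)
    have "mact (Vplus m n) X * phi m n vs = phi m n vs * mact (Vminus m n) X"
      using phi_mod_hom X by (auto simp: mod_hom_def Res_def)
    then have "psi * (mact (Vplus m n) X * phi m n vs) * psi = psi * (phi m n vs * mact (Vminus m n) X) * psi"
      by simp
    moreover have "psi * (mact (Vplus m n) X * phi m n vs) * psi = psi * mact (Vplus m n) X"
      using c psi_carrier phi_carrier phi_psi
      by (simp add: assoc_mult_mat[of _ "m + 2 * n" "m + 2 * n" _ "m + 2 * n" _ "m + 2 * n"] mult_carrier_mat[of _ "m + 2 * n" "m + 2 * n"])
    moreover have "psi * (phi m n vs * mact (Vminus m n) X) * psi = mact (Vminus m n) X * psi"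
      using c psi_carrier phi_carrier psi_phi
      by (simp flip: assoc_mult_mat[of _ "m + 2 * n" "m + 2 * n" _ "m + 2 * n" _ "m + 2 * n"])
    ultimately show ?thesis by simp
  qed
  then show ?thesis
    using psi_carrier mono_phi_parity
    by (auto simp: mod_hom_def Res_def mdim_def psi_def)
qed

end

section \<open>The matrix identities behind the skein relations\<close>

lemma if_mult: "(if b then x else 0) * y = (if b then x * y else (0 :: kk))"
  "y * (if b then x else 0) = (if b then y * x else (0 :: kk))"
  by simp_all

lemma kron_entry:
  assumes "A \<in> carrier_mat a b" "B \<in> carrier_mat c d" "i < a" "k < c" "j < b" "l < d"
  shows "kron A B $$ (i * c + k, j * d + l) = A $$ (i, j) * B $$ (k, l)"
proof -
  have "i * c + k < a * c" "j * d + l < b * d" using assms by (simp_all add: index_bound)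
  then show ?thesis using assms by (simp add: index_kron)
qed

lemma mult_entry:
  assumes "A \<in> carrier_mat x (a * b)" "B \<in> carrier_mat (a * b) y" "i < x" "j < y"
  shows "(A * B) $$ (i, j) = (\<Sum>k<a. \<Sum>l<b. A $$ (i, k * b + l) * B $$ (k * b + l, j))"
proof -
  have "(A * B) $$ (i, j) = (\<Sum>k<a * b. A $$ (i, k) * B $$ (k, j))"
    using assms by (simp add: scalar_prod_def atLeast0LessThan)
  then show ?thesis by (simp only: sum_mult_index)
qed

lemma sum_delta2:
  fixes F :: "nat \<Rightarrow> nat \<Rightarrow> 'a::comm_monoid_add"
  assumes "l < a" "k < b"
  shows "(\<Sum>x<a. \<Sum>y<b. if x = l \<and> y = k then F x y else 0) = F l k"
proof -
  have "(\<Sum>y<b. if x = l \<and> y = k then F x y else 0) = (if x = l then F x k else 0)" for x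
    using assms by (cases "x = l") auto
  then show ?thesis using assms by simp
qed

lemma pair_mat_eqI:
  assumes "A \<in> carrier_mat (a * b) (c * d)" "B \<in> carrier_mat (a * b) (c * d)"
    and "\<And>i j k l. i < a \<Longrightarrow> j < b \<Longrightarrow> k < c \<Longrightarrow> l < d \<Longrightarrow> A $$ (i * b + j, k * d + l) = B $$ (i * b + j, k * d + l)"
  shows "A = B"
proof (rule eq_matI)
  fix x y assume "x < dim_row B" "y < dim_col B"
  then have xy: "x < a * b" "y < c * d" using assms by auto
  show "A $$ (x, y) = B $$ (x, y)"
    using assms(3)[OF div_mod_bounds[OF xy(1)] div_mod_bounds[OF xy(2)]] by simp
qed (use assms in auto)

text \<open>The coefficient (-1)^(p(i) p(j)) q^p(i,j) of the exchanged vector in the braiding, with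
  the exponents worked out.\<close>

definition braid_coeff :: "int \<Rightarrow> int \<Rightarrow> kk" where
  "braid_coeff i j = (if i = j then (if i \<le> 0 then - inverse qq else qq) else if i \<le> 0 \<and> j \<le> 0 then -1 else 1)"

definition zz :: kk where
  "zz = qq - inverse qq"

definition ev_coeff :: "int \<Rightarrow> kk" where
  "ev_coeff i = (- qq) powi \<bar>i\<bar>"

definition coev_coeff :: "int \<Rightarrow> kk" where
  "coev_coeff i = (- qq) powi (- \<bar>i\<bar>)"

lemma coev_ev_coeff: "coev_coeff i * ev_coeff i = 1"
  by (simp add: ev_coeff_def coev_coeff_def power_int_minus)

text \<open>The matrix \<open>X\<close> turned by a right angle: \<open>rot_mat\<close> is the shape that \<open>R\<^sub>\<plusminus>\<close> and \<open>D\<^sub>\<plusminus>\<close> share.\<close>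

definition rot_mat :: "nat \<Rightarrow> nat \<Rightarrow> kk mat \<Rightarrow> kk mat" where
  "rot_mat m n X = kron (1\<^sub>m ((m + 2 * n) * (m + 2 * n))) (ev_plus m n) *
     (kron (kron (1\<^sub>m (m + 2 * n)) X) (1\<^sub>m (m + 2 * n)) * kron (coev_plus m n) (1\<^sub>m ((m + 2 * n) * (m + 2 * n))))"

context
  fixes m n N :: nat
  assumes N: "N = m + 2 * n"
begin

lemma T_mat_carrier: "T_mat m n \<in> carrier_mat (N * N) (N * N)"
  and ev_plus_carrier: "ev_plus m n \<in> carrier_mat 1 (N * N)"
  and ev_minus_carrier: "ev_minus m n \<in> carrier_mat 1 (N * N)"
  and coev_plus_carrier: "coev_plus m n \<in> carrier_mat (N * N) 1"
  by (simp_all add: T_mat_def ev_plus_def ev_minus_def coev_plus_def Let_def N)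

lemma T_entry:
  assumes "k < N" "l < N" "i < N" "j < N"
  shows "T_mat m n $$ (k * N + l, i * N + j)
    = (if i = l \<and> j = k then braid_coeff (idx n i) (idx n j) else 0) + (if i = k \<and> j = l then (if i < j then zz else 0) else 0)"
proof -
  have lt: "idx n i < idx n j \<longleftrightarrow> i < j" by (simp add: idx_def)
  have d: "(k * N + l) div N = k" "(k * N + l) mod N = l" "(i * N + j) div N = i" "(i * N + j) mod N = j"
    using assms by auto
  have b: "k * N + l < N * N" "i * N + j < N * N" using assms by (simp_all add: index_bound)
  have "T_mat m n $$ (k * N + l, i * N + j)
    = (if k = j \<and> l = i then (-1) ^ (pV (idx n i) * pV (idx n j)) * qq powi (if i = j then 1 - 2 * int (pV (idx n i)) else 0) else 0)
      + (if k = i \<and> l = j \<and> i < j then qq - inverse qq else 0)"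
    unfolding T_mat_def Let_def N[symmetric] index_mat(1)[OF b] prod.case d idx_inj lt ..
  also have "(-1) ^ (pV (idx n i) * pV (idx n j)) * qq powi (if i = j then 1 - 2 * int (pV (idx n i)) else 0)
      = braid_coeff (idx n i) (idx n j)"
    by (simp add: braid_coeff_def pV_def power_int_minus idx_inj)
  finally show ?thesis
    by (cases "i = l"; cases "j = k"; cases "i = k"; cases "j = l"; simp add: zz_def)
qed

lemma T_entry':
  assumes "k < N" "l < N" "i < N" "j < N"
  shows "T_mat m n $$ (k * N + l, i * N + j)
    = (if k = j \<and> l = i then braid_coeff (idx n i) (idx n j) else 0) + (if k = i \<and> l = j then (if i < j then zz else 0) else 0)"
  unfolding T_entry[OF assms] by (simp only: eq_commute[of i] eq_commute[of j] conj_commute)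

lemma ev_plus_entry: "i < N \<Longrightarrow> j < N \<Longrightarrow> ev_plus m n $$ (0, i * N + j) = (if j = i then ev_coeff (idx n i) else 0)"
  using index_bound[of i N j N] by (auto simp: ev_plus_def ev_coeff_def Let_def idx_inj simp flip: N)

lemma coev_plus_entry: "i < N \<Longrightarrow> j < N \<Longrightarrow> coev_plus m n $$ (i * N + j, 0) = (if j = i then coev_coeff (idx n i) else 0)"
  using index_bound[of i N j N] by (auto simp: coev_plus_def coev_coeff_def Let_def idx_inj simp flip: N)

definition evm_coeff :: "int \<Rightarrow> kk" where
  "evm_coeff j = (-1) powi (j + int (pV j)) * qq powi (int m + 2 * int n - \<bar>j - 1\<bar>)"

lemma ev_minus_entry: "i < N \<Longrightarrow> j < N \<Longrightarrow> ev_minus m n $$ (0, i * N + j) = (if j = i then evm_coeff (idx n j) else 0)"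
  using index_bound[of i N j N] by (auto simp: ev_minus_def Let_def idx_inj evm_coeff_def simp flip: N)

lemma T_mult_entry:
  assumes Y: "Y \<in> carrier_mat (N * N) c" and kl: "k < N" "l < N" "y < c"
  shows "(T_mat m n * Y) $$ (k * N + l, y) = braid_coeff (idx n l) (idx n k) * Y $$ (l * N + k, y)
    + (if k < l then zz else 0) * Y $$ (k * N + l, y)"
proof -
  have "(T_mat m n * Y) $$ (k * N + l, y) = (\<Sum>i<N. \<Sum>j<N. T_mat m n $$ (k * N + l, i * N + j) * Y $$ (i * N + j, y))"
    using mult_entry[OF T_mat_carrier Y index_bound[OF kl(1,2)] kl(3)] .
  also have "\<dots> = (\<Sum>i<N. \<Sum>j<N. (if i = l \<and> j = k then braid_coeff (idx n i) (idx n j) * Y $$ (i * N + j, y) else 0)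
      + (if i = k \<and> j = l then (if i < j then zz else 0) * Y $$ (i * N + j, y) else 0))"
  proof (intro sum.cong HOL.refl)
    fix i j assume "i \<in> {..<N}" "j \<in> {..<N}"
    then have ij: "i < N" "j < N" by simp_all
    show "T_mat m n $$ (k * N + l, i * N + j) * Y $$ (i * N + j, y)
      = (if i = l \<and> j = k then braid_coeff (idx n i) (idx n j) * Y $$ (i * N + j, y) else 0)
      + (if i = k \<and> j = l then (if i < j then zz else 0) * Y $$ (i * N + j, y) else 0)"
      unfolding T_entry[OF kl(1,2) ij] by (simp only: distrib_right if_mult mult_zero_left)
  qed
  also have "\<dots> = braid_coeff (idx n l) (idx n k) * Y $$ (l * N + k, y) + (if k < l then zz else 0) * Y $$ (k * N + l, y)"
    using kl by (simp only: sum.distrib sum_delta2)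
  finally show ?thesis .
qed

lemma mult_T_entry:
  assumes Y: "Y \<in> carrier_mat c (N * N)" and ij: "x < c" "i < N" "j < N"
  shows "(Y * T_mat m n) $$ (x, i * N + j) = Y $$ (x, j * N + i) * braid_coeff (idx n i) (idx n j)
    + Y $$ (x, i * N + j) * (if i < j then zz else 0)"
proof -
  have "(Y * T_mat m n) $$ (x, i * N + j) = (\<Sum>k<N. \<Sum>l<N. Y $$ (x, k * N + l) * T_mat m n $$ (k * N + l, i * N + j))"
    using mult_entry[OF Y T_mat_carrier ij(1) index_bound[OF ij(2,3)]] .
  also have "\<dots> = (\<Sum>k<N. \<Sum>l<N. (if k = j \<and> l = i then Y $$ (x, k * N + l) * braid_coeff (idx n i) (idx n j) else 0)
      + (if k = i \<and> l = j then Y $$ (x, k * N + l) * (if i < j then zz else 0) else 0))"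
  proof (intro sum.cong HOL.refl)
    fix k l assume "k \<in> {..<N}" "l \<in> {..<N}"
    then have kl: "k < N" "l < N" by simp_all
    show "Y $$ (x, k * N + l) * T_mat m n $$ (k * N + l, i * N + j)
      = (if k = j \<and> l = i then Y $$ (x, k * N + l) * braid_coeff (idx n i) (idx n j) else 0)
      + (if k = i \<and> l = j then Y $$ (x, k * N + l) * (if i < j then zz else 0) else 0)"
      unfolding T_entry'[OF kl ij(2,3)] by (simp only: distrib_left if_mult mult_zero_right)
  qed
  also have "\<dots> = Y $$ (x, j * N + i) * braid_coeff (idx n i) (idx n j) + Y $$ (x, i * N + j) * (if i < j then zz else 0)"
    using ij by (simp only: sum.distrib sum_delta2)
  finally show ?thesis .
qed

lemma rot_mat_carrier: "X \<in> carrier_mat (N * N) (N * N) \<Longrightarrow> rot_mat m n X \<in> carrier_mat (N * N) (N * N)"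
  unfolding rot_mat_def N[symmetric]
  using ev_plus_carrier coev_plus_carrier by (intro carrier_matI) auto

text \<open>The cup puts a pair (d, d) in front of (i, j), X sends the middle pair (d, i) to (b, c),
  and the cap joins c to j. Since d remains as the first output, d = a and c = j, so a single entry
  of X is left.\<close>

lemma rot_mat_entry:
  assumes X: "X \<in> carrier_mat (N * N) (N * N)" and ab: "a < N" "b < N" "i < N" "j < N"
  shows "rot_mat m n X $$ (a * N + b, i * N + j)
    = coev_coeff (idx n a) * ev_coeff (idx n j) * X $$ (b * N + j, a * N + i)"
proof -
  let ?M = "N * N"
  define P where "P = kron (1\<^sub>m ?M) (ev_plus m n)"
  define Q where "Q = kron (kron (1\<^sub>m N) X) (1\<^sub>m N)"
  define S where "S = kron (coev_plus m n) (1\<^sub>m ?M)"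
  have P: "P \<in> carrier_mat (?M * 1) (?M * ?M)"
    unfolding P_def using ev_plus_carrier by (rule kron_carrier[OF one_carrier_mat])
  have S: "S \<in> carrier_mat (?M * ?M) (1 * ?M)"
    unfolding S_def using coev_plus_carrier by (rule kron_carrier[OF _ one_carrier_mat])
  have "Q \<in> carrier_mat (N * ?M * N) (N * ?M * N)"
    unfolding Q_def by (intro kron_carrier one_carrier_mat X)
  then have Q: "Q \<in> carrier_mat (?M * ?M) (?M * ?M)" by (simp add: mult.assoc)
  let ?x = "a * N + b" and ?y = "i * N + j"
  have x: "?x < ?M" and y: "?y < ?M" using ab by (simp_all add: index_bound)
  \<comment> \<open>The row stands for the four tensor indices (a, b, c, c) and the column for (d,
    d, i, j); X acts on the two middle ones.\<close>
  have Qe: "Q $$ (?x * ?M + (c * N + c), (d * N + d) * ?M + ?y) = (if d = a \<and> c = j then X $$ (b * N + c, d * N + i) else 0)"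
    if cd: "c < N" "d < N" for c d
  proof -
    have e: "?x * ?M + (c * N + c) = (a * ?M + (b * N + c)) * N + c"
      "(d * N + d) * ?M + ?y = (d * ?M + (d * N + i)) * N + j" by (simp_all add: algebra_simps)
    have b: "b * N + c < ?M" "d * N + i < ?M" using ab cd by (simp_all add: index_bound)
    have "Q $$ (?x * ?M + (c * N + c), (d * N + d) * ?M + ?y)
        = kron (1\<^sub>m N) X $$ (a * ?M + (b * N + c), d * ?M + (d * N + i)) * 1\<^sub>m N $$ (c, j)"
      unfolding Q_def e using ab cd b X
      by (intro kron_entry[of _ "N * ?M" "N * ?M"]) (auto intro: index_bound kron_carrier)
    also have "kron (1\<^sub>m N) X $$ (a * ?M + (b * N + c), d * ?M + (d * N + i)) = 1\<^sub>m N $$ (a, d) * X $$ (b * N + c, d * N + i)"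
      using ab cd b X by (intro kron_entry) auto
    finally show ?thesis using ab cd by auto
  qed
  have QS: "(Q * S) $$ (u, ?y) = (\<Sum>d<N. coev_coeff (idx n d) * Q $$ (u, (d * N + d) * ?M + ?y))" if u: "u < ?M * ?M" for u
  proof -
    have "(Q * S) $$ (u, ?y) = (\<Sum>v<?M. \<Sum>w<?M. Q $$ (u, v * ?M + w) * S $$ (v * ?M + w, ?y))"
      using mult_entry[OF Q S u] y by simp
    also have "\<dots> = (\<Sum>v<?M. \<Sum>w<?M. if w = ?y then Q $$ (u, v * ?M + w) * coev_plus m n $$ (v, 0) else 0)"
    proof (intro sum.cong HOL.refl)
      fix v w assume "v \<in> {..<?M}" "w \<in> {..<?M}"
      then have "S $$ (v * ?M + w, 0 * ?M + ?y) = coev_plus m n $$ (v, 0) * 1\<^sub>m ?M $$ (w, ?y)"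
        unfolding S_def using y coev_plus_carrier by (intro kron_entry) auto
      then show "Q $$ (u, v * ?M + w) * S $$ (v * ?M + w, ?y) = (if w = ?y then Q $$ (u, v * ?M + w) * coev_plus m n $$ (v, 0) else 0)"
        using \<open>w \<in> _\<close> y by auto
    qed
    also have "\<dots> = (\<Sum>v<?M. Q $$ (u, v * ?M + ?y) * coev_plus m n $$ (v, 0))"
      using y by simp
    also have "\<dots> = (\<Sum>d<N. \<Sum>e<N. Q $$ (u, (d * N + e) * ?M + ?y) * coev_plus m n $$ (d * N + e, 0))"
      by (rule sum_mult_index)
    also have "\<dots> = (\<Sum>d<N. \<Sum>e<N. if e = d then coev_coeff (idx n d) * Q $$ (u, (d * N + e) * ?M + ?y) else 0)"
      by (intro sum.cong HOL.refl) (auto simp: coev_plus_entry)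
    also have "\<dots> = (\<Sum>d<N. coev_coeff (idx n d) * Q $$ (u, (d * N + d) * ?M + ?y))"
      by (intro sum.cong HOL.refl) simp
    finally show ?thesis .
  qed
  have "(P * (Q * S)) $$ (?x, ?y) = (\<Sum>v<?M. \<Sum>w<?M. P $$ (?x, v * ?M + w) * (Q * S) $$ (v * ?M + w, ?y))"
    using mult_entry[OF P mult_carrier_mat[OF Q S]] x y by simp
  also have "\<dots> = (\<Sum>v<?M. \<Sum>w<?M. if v = ?x then ev_plus m n $$ (0, w) * (Q * S) $$ (v * ?M + w, ?y) else 0)"
  proof (intro sum.cong HOL.refl)
    fix v w assume vw: "v \<in> {..<?M}" "w \<in> {..<?M}"
    then have "P $$ (?x * 1 + 0, v * ?M + w) = 1\<^sub>m ?M $$ (?x, v) * ev_plus m n $$ (0, w)"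
      unfolding P_def using x ev_plus_carrier by (intro kron_entry) auto
    then show "P $$ (?x, v * ?M + w) * (Q * S) $$ (v * ?M + w, ?y)
        = (if v = ?x then ev_plus m n $$ (0, w) * (Q * S) $$ (v * ?M + w, ?y) else 0)"
      using vw x by auto
  qed
  also have "\<dots> = (\<Sum>v<?M. if v = ?x then \<Sum>w<?M. ev_plus m n $$ (0, w) * (Q * S) $$ (v * ?M + w, ?y) else 0)"
    by (intro sum.cong HOL.refl) auto
  also have "\<dots> = (\<Sum>w<?M. ev_plus m n $$ (0, w) * (Q * S) $$ (?x * ?M + w, ?y))"
    using x by simp
  also have "\<dots> = (\<Sum>c<N. \<Sum>e<N. ev_plus m n $$ (0, c * N + e) * (Q * S) $$ (?x * ?M + (c * N + e), ?y))"
    by (rule sum_mult_index)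
  also have "\<dots> = (\<Sum>c<N. \<Sum>e<N. if e = c then ev_coeff (idx n c) * (Q * S) $$ (?x * ?M + (c * N + e), ?y) else 0)"
    by (intro sum.cong HOL.refl) (auto simp: ev_plus_entry)
  also have "\<dots> = (\<Sum>c<N. ev_coeff (idx n c) * (Q * S) $$ (?x * ?M + (c * N + c), ?y))"
    by (intro sum.cong HOL.refl) simp
  also have "\<dots> = (\<Sum>c<N. ev_coeff (idx n c) * (\<Sum>d<N. coev_coeff (idx n d) * (if d = a \<and> c = j then X $$ (b * N + c, d * N + i) else 0)))"
  proof (intro sum.cong HOL.refl)
    fix c assume "c \<in> {..<N}"
    then have u: "?x * ?M + (c * N + c) < ?M * ?M" using x by (auto intro!: index_bound)
    then show "ev_coeff (idx n c) * (Q * S) $$ (?x * ?M + (c * N + c), ?y)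
      = ev_coeff (idx n c) * (\<Sum>d<N. coev_coeff (idx n d) * (if d = a \<and> c = j then X $$ (b * N + c, d * N + i) else 0))"
      unfolding QS[OF u] using \<open>c \<in> _\<close>
      by (intro arg_cong2[where f = "(*)"] HOL.refl sum.cong) (simp add: Qe)
  qed
  also have "\<dots> = (\<Sum>c<N. \<Sum>d<N. if c = j \<and> d = a then ev_coeff (idx n c) * (coev_coeff (idx n d) * X $$ (b * N + c, d * N + i)) else 0)"
    unfolding sum_distrib_left by (intro sum.cong HOL.refl) auto
  also have "\<dots> = ev_coeff (idx n j) * (coev_coeff (idx n a) * X $$ (b * N + j, a * N + i))"
    using ab by (intro sum_delta2) auto
  finally show ?thesis
    unfolding rot_mat_def N[symmetric] P_def Q_def S_def by simp
qed

end

section \<open>Coefficient identities on blocks\<close>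

lemma braid_coeff_sym: "braid_coeff i j = braid_coeff j i"
  by (auto simp: braid_coeff_def)

lemma phi_index_nonpos: "phi_index i \<le> 0 \<longleftrightarrow> i \<le> 0"
  unfolding phi_index_def by presburger

lemma phi_index_inj: "phi_index i = phi_index j \<longleftrightarrow> i = j"
  by (metis phi_index_invol)

lemma braid_coeff_phi_index: "braid_coeff (phi_index i) (phi_index j) = braid_coeff i j"
  by (simp add: braid_coeff_def phi_index_nonpos phi_index_inj)

lemma braid_coeff_phi_index_swap: "j \<noteq> phi_index i \<Longrightarrow> braid_coeff j (phi_index i) = braid_coeff i (phi_index j)"
  using phi_index_eq_iff[of i j] by (auto simp: braid_coeff_def phi_index_nonpos)

text \<open>Blocks {2k - 1, 2k} with k \<le> 0 are intervals of integers and positive indices are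
  fixed, so an order relation can change only inside one block.\<close>

lemma phi_index_less: "j \<noteq> phi_index i \<Longrightarrow> phi_index j < phi_index i \<longleftrightarrow> j < i"
  unfolding phi_index_def by (auto split: if_splits; presburger)

text \<open>The number e is the top of a block. Its partner e - 1 has absolute value larger by one,
  whence the factors -q and -1/q.\<close>

lemma even_nonpos_facts:
  fixes e :: int
  assumes "even e" "e \<le> 0"
  shows "phi_index e = e - 1" "phi_index (e - 1) = e"
    and "ev_coeff (e - 1) = - qq * ev_coeff e" "coev_coeff (e - 1) = - inverse qq * coev_coeff e"
proof -
  show "phi_index e = e - 1" "phi_index (e - 1) = e" using assms by (auto simp: phi_index_def)
  have a: "\<bar>e - 1\<bar> = 1 + \<bar>e\<bar>" using assms by simp
  have "(- qq) powi (1 + \<bar>e\<bar>) = (- qq) powi 1 * (- qq) powi \<bar>e\<bar>" by (rule power_int_add) simp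
  then have p: "(- qq) powi (1 + \<bar>e\<bar>) = - qq * (- qq) powi \<bar>e\<bar>" by (simp only: power_int_1_right)
  show "ev_coeff (e - 1) = - qq * ev_coeff e" "coev_coeff (e - 1) = - inverse qq * coev_coeff e"
    unfolding ev_coeff_def coev_coeff_def power_int_minus a p
    by (simp_all only: inverse_mult_distrib inverse_minus_eq)
qed

lemma nonpos_cases:
  fixes i :: int
  assumes "i \<le> 0"
  obtains e where "even e" "e \<le> 0" "i = e" | e where "even e" "e \<le> 0" "i = e - 1"
proof (cases "even i")
  case False
  then have "even (i + 1)" "i + 1 \<le> 0" using assms by presburger+
  then show ?thesis using that(2)[of "i + 1"] by simp
qed (use assms that in auto)

text \<open>The coefficients of \<open>(\<phi> \<otimes> 1) R\<^sub>- (\<phi> \<otimes> 1)\<close>.\<close>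

definition refl_coeff :: "(int \<Rightarrow> kk) \<Rightarrow> int \<Rightarrow> int \<Rightarrow> int \<Rightarrow> int \<Rightarrow> kk" where
  "refl_coeff s k l i j = (if l = phi_index i \<and> k = phi_index j then s j * s i * braid_coeff j (phi_index i) else 0)
    - (if l = phi_index k \<and> j = phi_index i \<and> j \<le> l then s l * s i * (coev_coeff l * ev_coeff j) * zz else 0)"

text \<open>If j differs from \<open>phi_index i\<close>, the terms with \<open>zz\<close> in
  \<open>refl_coeff\<close> are absent; the rest follows from invariance of
  \<open>braid_coeff\<close> and of the order under \<open>phi_index\<close>. Otherwise i and j make
  up one block, a positive index counting as a block by itself, and all terms vanish unless k and l
  do so too. What then remains depends on the signs and the relative position of two blocks.\<close>

lemma reflection_coeff:
  assumes s: "\<And>i. i \<le> 0 \<Longrightarrow> s (phi_index i) = s i"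
  shows "braid_coeff l k * refl_coeff s l k i j + (if k < l then zz else 0) * refl_coeff s k l i j
    = refl_coeff s k l j i * braid_coeff i j + refl_coeff s k l i j * (if j < i then zz else 0)"
proof (cases "j = phi_index i")
  case False
  then have j: "i \<noteq> phi_index j" by auto
  have 1: "refl_coeff s l k i j = (if k = phi_index i \<and> l = phi_index j then s j * s i * braid_coeff j (phi_index i) else 0)"
    "refl_coeff s k l i j = (if l = phi_index i \<and> k = phi_index j then s j * s i * braid_coeff j (phi_index i) else 0)"
    "refl_coeff s k l j i = (if l = phi_index j \<and> k = phi_index i then s i * s j * braid_coeff i (phi_index j) else 0)"
    by (simp_all only: refl_coeff_def False j simp_thms if_False diff_0_right)
  have A: "braid_coeff l k * (if k = phi_index i \<and> l = phi_index j then c else 0)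
      = (if l = phi_index j \<and> k = phi_index i then c else 0) * braid_coeff i j" for c
  proof (cases "l = phi_index j \<and> k = phi_index i")
    case True
    then have "braid_coeff l k = braid_coeff i j" by (metis braid_coeff_phi_index braid_coeff_sym)
    with True show ?thesis by (simp only: simp_thms if_True mult.commute)
  next
    case False
    then have "\<not> (k = phi_index i \<and> l = phi_index j)" by blast
    with False show ?thesis by (simp only: if_False mult_zero_left mult_zero_right)
  qed
  have B: "(if k < l then zz else 0) * (if l = phi_index i \<and> k = phi_index j then c else 0)
      = (if l = phi_index i \<and> k = phi_index j then c else 0) * (if j < i then zz else 0)" for c
  proof (cases "l = phi_index i \<and> k = phi_index j")
    case True
    then have "k < l \<longleftrightarrow> j < i" using phi_index_less[OF False] by simp
    then show ?thesis by (simp only: mult.commute)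
  next
    case False
    then show ?thesis by (simp only: if_False mult_zero_left mult_zero_right)
  qed
  show ?thesis
    unfolding 1 braid_coeff_phi_index_swap[OF False] A B by (simp only: mult.commute[of "s i" "s j"])
next
  case True
  then have ij: "i = phi_index j" by simp
  show ?thesis
  proof (cases "l = phi_index k")
    case False
    then have "\<not> (l = j \<and> k = i)" "\<not> (k = j \<and> l = i)" "k \<noteq> phi_index l" using True ij by auto
    then show ?thesis using False True by (auto simp: refl_coeff_def)
  next
    case l: True
    have qi: "inverse qq * qq = 1" "qq * inverse qq = 1" by simp_all
    consider "i > 0" "k > 0" | "i > 0" "k \<le> 0" | "i \<le> 0" "k > 0" | "i \<le> 0" "k \<le> 0" by linarith
    then show ?thesis
    proof cases
      case 1
      then have "phi_index i = i" "phi_index k = k" by (simp_all add: phi_index_def)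
      then show ?thesis using True l 1 by (simp add: braid_coeff_def)
    next
      case 2
      then have "phi_index i = i" by (simp add: phi_index_def)
      moreover have "l \<le> 0" using l 2 phi_index_nonpos by simp
      ultimately show ?thesis using True l 2 by (auto simp: refl_coeff_def)
    next
      case 3
      have k: "phi_index k = k" "k \<noteq> i" "i \<le> k" "\<not> k \<le> 0" using 3 by (simp_all add: phi_index_def)
      from 3(1) show ?thesis
      proof (cases rule: nonpos_cases)
        case (1 e)
        note f = even_nonpos_facts[OF 1(1,2)] s[OF 1(2), unfolded even_nonpos_facts(1)[OF 1(1,2)]]
        show ?thesis using True l 3 k 1(2)
          by (simp add: 1(3) f refl_coeff_def braid_coeff_def zz_def; simp add: field_simps)
      next
        case (2 e)
        note f = even_nonpos_facts[OF 2(1,2)] s[OF 2(2), unfolded even_nonpos_facts(1)[OF 2(1,2)]]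
        show ?thesis using True l 3 k 2(2)
          by (simp add: 2(3) f refl_coeff_def braid_coeff_def zz_def; simp add: field_simps)
      qed
    next
      case 4
      obtain e where e: "even e" "e \<le> 0" "i = e \<or> i = e - 1" using nonpos_cases[OF 4(1)] by metis
      obtain h where h: "even h" "h \<le> 0" "k = h \<or> k = h - 1" using nonpos_cases[OF 4(2)] by metis
      note f = even_nonpos_facts[OF e(1,2)] s[OF e(2), unfolded even_nonpos_facts(1)[OF e(1,2)]]
        even_nonpos_facts[OF h(1,2)] s[OF h(2), unfolded even_nonpos_facts(1)[OF h(1,2)]]
      have c: "coev_coeff e * (ev_coeff e * x) = x" for x
        using coev_ev_coeff[of e] by (metis mult.assoc mult_1)
      have "e \<le> h - 2 \<or> h = e \<or> h \<le> e - 2" using e(1) h(1) by presburger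
      then consider "e \<le> h - 2" | "h = e" | "h \<le> e - 2" by blast
      then show ?thesis
      proof cases
        case 1
        then show ?thesis
          using e(3) h(3) True l e(2) h(2)
          by (elim disjE; simp add: f refl_coeff_def braid_coeff_def zz_def; simp add: field_simps)
      next
        case 2
        then show ?thesis
          using e(3) h(3) True l e(2) h(2) coev_ev_coeff[of e]
          by (elim disjE; simp add: f refl_coeff_def braid_coeff_def zz_def; simp add: field_simps)
      next
        case 3
        then show ?thesis
          using e(3) h(3) True l e(2) h(2)
          by (elim disjE; simp add: f refl_coeff_def braid_coeff_def zz_def)
      qed
    qed
  qed
qed

text \<open>On the two vectors of a nonpositive block the braiding has diagonal 0, q - 1/q and
  off-diagonal entries -1, hence eigenvalues q and -1/q; the ratio -1/q of the cup scalars picks the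
  first. A positive index has the eigenvalue q at once.\<close>

lemma cup_coeff:
  assumes s: "\<And>i. i \<le> 0 \<Longrightarrow> s (phi_index i) = s i" and l: "l = phi_index k"
  shows "braid_coeff l k * (s k * coev_coeff k) + (if k < l then zz else 0) * (s l * coev_coeff l)
    = qq * (s l * coev_coeff l)"
proof (cases "k > 0")
  case True
  then show ?thesis using l by (simp add: phi_index_def braid_coeff_def)
next
  case False
  then have "k \<le> 0" by simp
  then show ?thesis
  proof (cases rule: nonpos_cases)
    case (1 e)
    note f = even_nonpos_facts[OF 1(1,2)] s[OF 1(2), unfolded even_nonpos_facts(1)[OF 1(1,2)]]
    show ?thesis using l 1(2) by (simp add: 1(3) f braid_coeff_def zz_def)
  next
    case (2 e)
    note f = even_nonpos_facts[OF 2(1,2)] s[OF 2(2), unfolded even_nonpos_facts(1)[OF 2(1,2)]]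
    show ?thesis using l 2(2) by (simp add: 2(3) f braid_coeff_def zz_def; simp add: algebra_simps)
  qed
qed

text \<open>Going from e to e - 1 changes the sign, as both indices have the same parity p, and
  lowers the exponent of q by one.\<close>

lemma evm_coeff_pair:
  assumes "even e" "e \<le> 0"
  shows "evm_coeff m n (e - 1) = - inverse qq * evm_coeff m n e"
proof -
  have "int m + 2 * int n - \<bar>e - 1 - 1\<bar> = -1 + (int m + 2 * int n - \<bar>e - 1\<bar>)" using assms by simp
  moreover have "e - 1 + int (pV (e - 1)) = -1 + (e + int (pV e))" using assms by (simp add: pV_def)
  moreover have "qq powi (-1 + x) = inverse qq * qq powi x" for x
    by (simp only: power_int_add qq_nonzero disj_not1 not_False_eq_True simp_thms) (simp add: power_int_minus)
  moreover have "(-1 :: kk) powi (-1 + x) = - ((-1) powi x)" for x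
    using power_int_add[of "-1 :: kk" "-1" x] by simp
  ultimately show ?thesis
    unfolding evm_coeff_def[OF HOL.refl] by (simp only: mult_minus_left mult_minus_right mult.left_commute)
qed

lemma cap_coeff:
  assumes s: "\<And>i. i \<le> 0 \<Longrightarrow> s (phi_index i) = s i" and j: "j = phi_index i"
  shows "s i * evm_coeff m n i * braid_coeff i j + s j * evm_coeff m n j * (if i < j then zz else 0)
    = qq * (s j * evm_coeff m n j)"
proof (cases "i > 0")
  case True
  then show ?thesis using j by (simp add: phi_index_def braid_coeff_def)
next
  case False
  then have "i \<le> 0" by simp
  then show ?thesis
  proof (cases rule: nonpos_cases)
    case (1 e)
    note f = even_nonpos_facts(1,2)[OF 1(1,2)] s[OF 1(2), unfolded even_nonpos_facts(1)[OF 1(1,2)]] evm_coeff_pair[OF 1(1,2)]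
    show ?thesis using j 1(2) by (simp add: 1(3) f braid_coeff_def zz_def)
  next
    case (2 e)
    note f = even_nonpos_facts(1,2)[OF 2(1,2)] s[OF 2(2), unfolded even_nonpos_facts(1)[OF 2(1,2)]] evm_coeff_pair[OF 2(1,2)]
    show ?thesis using j 2(2) by (simp add: 2(3) f braid_coeff_def zz_def; simp add: algebra_simps)
  qed
qed

section \<open>From coefficients back to matrices\<close>

context
  fixes m n N :: nat
  assumes N: "N = m + 2 * n"
begin

text \<open>The permutation \<open>phi_index\<close> carried over to the positions of the basis
  vectors, counted from 0.\<close>

definition nx :: "nat \<Rightarrow> nat" where
  "nx r = nat (phi_index (idx n r) - 1 + 2 * int n)"

lemma nx:
  assumes "r < N"
  shows "nx r < N" "idx n (nx r) = phi_index (idx n r)"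
  using phi_index_V[OF idx_in_V[of r m n]] assms by (auto simp: nx_def idx_def I_V_def N)

lemma eq_nx: "l < N \<Longrightarrow> k < N \<Longrightarrow> l = nx k \<longleftrightarrow> idx n l = phi_index (idx n k)"
  using nx[of k] idx_inj by metis

lemma mono_mat_carrier_N: "mono_mat m n \<pi> c \<in> carrier_mat N N"
  by (simp add: N)

lemma mono_mat_entry:
  assumes "k < N" "a < N"
  shows "mono_mat m n phi_index c $$ (k, a) = (if a = nx k then c (phi_index (idx n k)) else 0)"
    and "mono_mat m n phi_index c $$ (k, a) = (if k = nx a then c (idx n a) else 0)"
  using assms eq_nx[of a k] eq_nx[of k a] by (auto simp: mono_mat_def N)

lemma kron_mono_mult_entry:
  assumes Y: "Y \<in> carrier_mat (N * N) c" and kl: "k < N" "l < N" "y < c"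
  shows "(kron (mono_mat m n phi_index s) (1\<^sub>m N) * Y) $$ (k * N + l, y) = s (phi_index (idx n k)) * Y $$ (nx k * N + l, y)"
proof -
  have K: "kron (mono_mat m n phi_index s) (1\<^sub>m N) \<in> carrier_mat (N * N) (N * N)"
    by (intro kron_carrier mono_mat_carrier_N one_carrier_mat)
  have "(kron (mono_mat m n phi_index s) (1\<^sub>m N) * Y) $$ (k * N + l, y)
      = (\<Sum>a<N. \<Sum>b<N. kron (mono_mat m n phi_index s) (1\<^sub>m N) $$ (k * N + l, a * N + b) * Y $$ (a * N + b, y))"
    using mult_entry[OF K Y index_bound[OF kl(1,2)] kl(3)] .
  also have "\<dots> = (\<Sum>a<N. \<Sum>b<N. if a = nx k \<and> b = l then s (phi_index (idx n k)) * Y $$ (a * N + b, y) else 0)"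
  proof (intro sum.cong HOL.refl)
    fix a b assume ab: "a \<in> {..<N}" "b \<in> {..<N}"
    have "kron (mono_mat m n phi_index s) (1\<^sub>m N) $$ (k * N + l, a * N + b)
        = mono_mat m n phi_index s $$ (k, a) * 1\<^sub>m N $$ (l, b)"
      using ab kl by (intro kron_entry[OF mono_mat_carrier_N one_carrier_mat]) auto
    then show "kron (mono_mat m n phi_index s) (1\<^sub>m N) $$ (k * N + l, a * N + b) * Y $$ (a * N + b, y)
        = (if a = nx k \<and> b = l then s (phi_index (idx n k)) * Y $$ (a * N + b, y) else 0)"
      using ab kl by (auto simp: mono_mat_entry(1))
  qed
  also have "\<dots> = s (phi_index (idx n k)) * Y $$ (nx k * N + l, y)"
    using kl nx by (intro sum_delta2) auto
  finally show ?thesis .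
qed

lemma mult_kron_mono_entry:
  assumes Y: "Y \<in> carrier_mat c (N * N)" and ij: "x < c" "i < N" "j < N"
  shows "(Y * kron (mono_mat m n phi_index s) (1\<^sub>m N)) $$ (x, i * N + j) = Y $$ (x, nx i * N + j) * s (idx n i)"
proof -
  have K: "kron (mono_mat m n phi_index s) (1\<^sub>m N) \<in> carrier_mat (N * N) (N * N)"
    by (intro kron_carrier mono_mat_carrier_N one_carrier_mat)
  have "(Y * kron (mono_mat m n phi_index s) (1\<^sub>m N)) $$ (x, i * N + j)
      = (\<Sum>a<N. \<Sum>b<N. Y $$ (x, a * N + b) * kron (mono_mat m n phi_index s) (1\<^sub>m N) $$ (a * N + b, i * N + j))"
    using mult_entry[OF Y K ij(1) index_bound[OF ij(2,3)]] .
  also have "\<dots> = (\<Sum>a<N. \<Sum>b<N. if a = nx i \<and> b = j then Y $$ (x, a * N + b) * s (idx n i) else 0)"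
  proof (intro sum.cong HOL.refl)
    fix a b assume ab: "a \<in> {..<N}" "b \<in> {..<N}"
    have "kron (mono_mat m n phi_index s) (1\<^sub>m N) $$ (a * N + b, i * N + j)
        = mono_mat m n phi_index s $$ (a, i) * 1\<^sub>m N $$ (b, j)"
      using ab ij by (intro kron_entry[OF mono_mat_carrier_N one_carrier_mat]) auto
    then show "Y $$ (x, a * N + b) * kron (mono_mat m n phi_index s) (1\<^sub>m N) $$ (a * N + b, i * N + j)
        = (if a = nx i \<and> b = j then Y $$ (x, a * N + b) * s (idx n i) else 0)"
      using ab ij by (auto simp: mono_mat_entry(2))
  qed
  also have "\<dots> = Y $$ (x, nx i * N + j) * s (idx n i)"
    using ij nx by (intro sum_delta2) auto
  finally show ?thesis .
qed

text \<open>By the skein relation T - z is the image of X_-. Subtracting z from the coefficient of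
  the unexchanged vector replaces z for i < j by -z for j \<le> i.\<close>

lemma Tinv_entry:
  assumes "k < N" "l < N" "i < N" "j < N"
  shows "(T_mat m n - zz \<cdot>\<^sub>m 1\<^sub>m (N * N)) $$ (k * N + l, i * N + j)
    = (if k = j \<and> l = i then braid_coeff (idx n i) (idx n j) else 0) - (if k = i \<and> l = j \<and> j \<le> i then zz else 0)"
proof -
  have b: "k * N + l < N * N" "i * N + j < N * N" using assms by (simp_all add: index_bound)
  have "k * N + l = i * N + j \<longleftrightarrow> k = i \<and> l = j"
  proof
    assume e: "k * N + l = i * N + j"
    have "(k * N + l) div N = k" "(k * N + l) mod N = l" "(i * N + j) div N = i" "(i * N + j) mod N = j"
      using assms by auto
    then show "k = i \<and> l = j" using e by metis
  qed simp
  then have "(T_mat m n - zz \<cdot>\<^sub>m 1\<^sub>m (N * N)) $$ (k * N + l, i * N + j)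
      = T_mat m n $$ (k * N + l, i * N + j) - (if k = i \<and> l = j then zz else 0)"
    using b T_mat_carrier[OF N] by simp
  then show ?thesis unfolding T_entry'[OF N assms] by (cases "k = i \<and> l = j") auto
qed

abbreviation "phik s \<equiv> kron (mono_mat m n phi_index s) (1\<^sub>m N)"
abbreviation "Rminus \<equiv> rot_mat m n (T_mat m n - zz \<cdot>\<^sub>m 1\<^sub>m (N * N))"
abbreviation "Dplus \<equiv> rot_mat m n (rot_mat m n (T_mat m n))"

lemma phik_carrier: "phik s \<in> carrier_mat (N * N) (N * N)"
  by (intro kron_carrier mono_mat_carrier_N one_carrier_mat)

lemma Rminus_carrier: "Rminus \<in> carrier_mat (N * N) (N * N)"
  by (intro rot_mat_carrier[OF N] minus_carrier_mat smult_carrier_mat one_carrier_mat)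

lemma Dplus_carrier: "Dplus \<in> carrier_mat (N * N) (N * N)"
  by (intro rot_mat_carrier[OF N] T_mat_carrier[OF N])

text \<open>Rotation supplies a cup scalar at \<open>phi_index\<close> of k and a cap scalar at j.
  In the exchanging term these indices coincide and the scalars cancel; in the other term they
  remain, as recorded in \<open>refl_coeff\<close>.\<close>

lemma J_entry:
  assumes kl: "k < N" "l < N" and ij: "i < N" "j < N"
  shows "(phik s * (Rminus * phik s)) $$ (k * N + l, i * N + j) = refl_coeff s (idx n k) (idx n l) (idx n i) (idx n j)"
proof -
  have T: "T_mat m n - zz \<cdot>\<^sub>m 1\<^sub>m (N * N) \<in> carrier_mat (N * N) (N * N)"
    by (intro minus_carrier_mat smult_carrier_mat one_carrier_mat)
  note nk = nx[OF kl(1)] and ni = nx[OF ij(1)]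
  have "(phik s * (Rminus * phik s)) $$ (k * N + l, i * N + j)
      = s (phi_index (idx n k)) * (Rminus $$ (nx k * N + l, nx i * N + j) * s (idx n i))"
    unfolding kron_mono_mult_entry[OF mult_carrier_mat[OF Rminus_carrier phik_carrier] kl index_bound[OF ij]]
      mult_kron_mono_entry[OF Rminus_carrier index_bound[OF nk(1) kl(2)] ij] ..
  also have "Rminus $$ (nx k * N + l, nx i * N + j)
      = coev_coeff (phi_index (idx n k)) * ev_coeff (idx n j) *
        ((if l = nx i \<and> j = nx k then braid_coeff (phi_index (idx n k)) (phi_index (idx n i)) else 0)
          - (if l = nx k \<and> j = nx i \<and> nx i \<le> nx k then zz else 0))"
    unfolding rot_mat_entry[OF N T nk(1) kl(2) ni(1) ij(2)] Tinv_entry[OF kl(2) ij(2) nk(1) ni(1)] nk(2) ni(2) ..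
  also have "l = nx i \<and> j = nx k \<longleftrightarrow> idx n l = phi_index (idx n i) \<and> idx n k = phi_index (idx n j)"
    unfolding eq_nx[OF kl(2) ij(1)] eq_nx[OF ij(2) kl(1)]
    using phi_index_eq_iff[of "idx n k" "idx n j"] by metis
  also have "l = nx k \<and> j = nx i \<and> nx i \<le> nx k \<longleftrightarrow>
      idx n l = phi_index (idx n k) \<and> idx n j = phi_index (idx n i) \<and> idx n j \<le> idx n l"
    using kl ij eq_nx[of l k] eq_nx[of j i] by (auto simp: idx_def)
  finally have e: "(phik s * (Rminus * phik s)) $$ (k * N + l, i * N + j)
      = s (phi_index (idx n k)) * (coev_coeff (phi_index (idx n k)) * ev_coeff (idx n j) *
        ((if idx n l = phi_index (idx n i) \<and> idx n k = phi_index (idx n j)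
            then braid_coeff (phi_index (idx n k)) (phi_index (idx n i)) else 0)
          - (if idx n l = phi_index (idx n k) \<and> idx n j = phi_index (idx n i) \<and> idx n j \<le> idx n l then zz else 0))
        * s (idx n i))" .
  have 1: "s (phi_index (idx n k)) * (coev_coeff (phi_index (idx n k)) * ev_coeff (idx n j)
      * braid_coeff (phi_index (idx n k)) (phi_index (idx n i)) * s (idx n i))
      = s (idx n j) * s (idx n i) * braid_coeff (idx n j) (phi_index (idx n i))"
    if "idx n k = phi_index (idx n j)"
    using coev_ev_coeff[of "idx n j"] that by simp
  have 2: "s (phi_index (idx n k)) * (coev_coeff (phi_index (idx n k)) * ev_coeff (idx n j) * zz * s (idx n i))
      = s (idx n l) * s (idx n i) * (coev_coeff (idx n l) * ev_coeff (idx n j)) * zz"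
    if "idx n l = phi_index (idx n k)"
    using that by (simp add: mult_ac)
  show ?thesis
    unfolding e refl_coeff_def right_diff_distrib left_diff_distrib if_mult
    by (intro arg_cong2[where f = "(-)"] if_cong HOL.refl; elim conjE; rule 1 2; assumption)
qed

text \<open>Two quarter turns make a half turn, which reverses both index pairs and exchanges rows
  with columns. The four scalars cancel on every nonzero entry, because T only keeps or swaps a pair
  of indices.\<close>

lemma Dplus_entry:
  assumes ab: "a < N" "b < N" and ij: "i < N" "j < N"
  shows "Dplus $$ (a * N + b, i * N + j)
    = (if a = j \<and> b = i then braid_coeff (idx n i) (idx n j) else 0) + (if a = i \<and> b = j then (if j < i then zz else 0) else 0)"
proof -
  have c: "coev_coeff (idx n a) * ev_coeff (idx n j) * (coev_coeff (idx n b) * ev_coeff (idx n i) * x) = x"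
    if "a = j \<and> b = i \<or> a = i \<and> b = j" for x
  proof -
    have r: "p * q * (u * v * x) = (p * v) * ((u * q) * x)" for p q u v :: kk
      by (simp only: mult_ac)
    from that show ?thesis
    proof
      assume "a = j \<and> b = i"
      then show ?thesis by (simp only: coev_ev_coeff mult_1_left)
    next
      assume "a = i \<and> b = j"
      then show ?thesis unfolding r by (simp only: coev_ev_coeff mult_1_left)
    qed
  qed
  have "Dplus $$ (a * N + b, i * N + j) = coev_coeff (idx n a) * ev_coeff (idx n j) *
      (coev_coeff (idx n b) * ev_coeff (idx n i) * T_mat m n $$ (j * N + i, b * N + a))"
    unfolding rot_mat_entry[OF N rot_mat_carrier[OF N T_mat_carrier[OF N]] ab ij]
      rot_mat_entry[OF N T_mat_carrier[OF N] ab(2) ij(2) ab(1) ij(1)] ..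
  also have "\<dots> = T_mat m n $$ (j * N + i, b * N + a)"
  proof (cases "a = j \<and> b = i \<or> a = i \<and> b = j")
    case False
    then have "\<not> (j = a \<and> i = b)" "\<not> (j = b \<and> i = a)" by blast+
    then show ?thesis
      unfolding T_entry'[OF N ij(2,1) ab(2,1)] by (simp only: if_False mult_zero_right add_0)
  qed (rule c)
  finally have e: "Dplus $$ (a * N + b, i * N + j) = T_mat m n $$ (j * N + i, b * N + a)" .
  have 1: "(if j = a \<and> i = b then braid_coeff (idx n b) (idx n a) else 0)
      = (if a = j \<and> b = i then braid_coeff (idx n i) (idx n j) else 0)"
    by (rule if_cong) (blast, simp, simp)
  have 2: "(if j = b \<and> i = a then if b < a then zz else 0 else 0)
      = (if a = i \<and> b = j then if j < i then zz else 0 else 0)"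
    by (rule if_cong) (blast, simp, simp)
  show ?thesis
    unfolding e T_entry'[OF N ij(2,1) ab(2,1)] 1 2 ..
qed

lemma mult_Dplus_entry:
  assumes Y: "Y \<in> carrier_mat c (N * N)" and ij: "x < c" "i < N" "j < N"
  shows "(Y * Dplus) $$ (x, i * N + j) = Y $$ (x, j * N + i) * braid_coeff (idx n i) (idx n j)
    + Y $$ (x, i * N + j) * (if j < i then zz else 0)"
proof -
  have "(Y * Dplus) $$ (x, i * N + j) = (\<Sum>a<N. \<Sum>b<N. Y $$ (x, a * N + b) * Dplus $$ (a * N + b, i * N + j))"
    using mult_entry[OF Y Dplus_carrier ij(1) index_bound[OF ij(2,3)]] .
  also have "\<dots> = (\<Sum>a<N. \<Sum>b<N. (if a = j \<and> b = i then Y $$ (x, a * N + b) * braid_coeff (idx n i) (idx n j) else 0)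
      + (if a = i \<and> b = j then Y $$ (x, a * N + b) * (if j < i then zz else 0) else 0))"
  proof (intro sum.cong HOL.refl)
    fix a b assume "a \<in> {..<N}" "b \<in> {..<N}"
    then have ab: "a < N" "b < N" by simp_all
    show "Y $$ (x, a * N + b) * Dplus $$ (a * N + b, i * N + j)
      = (if a = j \<and> b = i then Y $$ (x, a * N + b) * braid_coeff (idx n i) (idx n j) else 0)
      + (if a = i \<and> b = j then Y $$ (x, a * N + b) * (if j < i then zz else 0) else 0)"
      unfolding Dplus_entry[OF ab ij(2,3)] by (simp only: distrib_left if_mult mult_zero_right)
  qed
  also have "\<dots> = Y $$ (x, j * N + i) * braid_coeff (idx n i) (idx n j) + Y $$ (x, i * N + j) * (if j < i then zz else 0)"
    using ij by (simp only: sum.distrib sum_delta2)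
  finally show ?thesis .
qed

lemma zero_less_one_nat: "(0 :: nat) < 1"
  by simp

lemma idx_less: "idx n k < idx n l \<longleftrightarrow> k < l"
  by (simp add: idx_def)

theorem reflection_mat:
  assumes s: "\<And>i. i \<le> 0 \<Longrightarrow> s (phi_index i) = s i"
  shows "phik s * (Rminus * (phik s * Dplus)) = T_mat m n * (phik s * (Rminus * phik s))"
proof -
  let ?J = "phik s * (Rminus * phik s)"
  have J: "?J \<in> carrier_mat (N * N) (N * N)"
    by (intro mult_carrier_mat[OF phik_carrier] mult_carrier_mat[OF Rminus_carrier] phik_carrier)
  have "phik s * (Rminus * (phik s * Dplus)) = ?J * Dplus"
    unfolding assoc_mult_mat[OF phik_carrier mult_carrier_mat[OF Rminus_carrier phik_carrier] Dplus_carrier]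
      assoc_mult_mat[OF Rminus_carrier phik_carrier Dplus_carrier] ..
  also have "\<dots> = T_mat m n * ?J"
  proof (rule pair_mat_eqI[OF mult_carrier_mat[OF J Dplus_carrier] mult_carrier_mat[OF T_mat_carrier[OF N] J]])
    fix k l i j assume kl: "k < N" "l < N" and ij: "i < N" "j < N"
    show "(?J * Dplus) $$ (k * N + l, i * N + j) = (T_mat m n * ?J) $$ (k * N + l, i * N + j)"
      unfolding mult_Dplus_entry[OF J index_bound[OF kl] ij] T_mult_entry[OF N J kl index_bound[OF ij]]
        J_entry[OF kl ij] J_entry[OF kl ij(2,1)] J_entry[OF kl(2,1) ij]
      using reflection_coeff[of s "idx n l" "idx n k" "idx n i" "idx n j", OF s]
      by (simp only: idx_less)
  qed
  finally show ?thesis .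
qed

theorem cup_mat:
  assumes s: "\<And>i. i \<le> 0 \<Longrightarrow> s (phi_index i) = s i"
  shows "T_mat m n * (phik s * coev_plus m n) = qq \<cdot>\<^sub>m (phik s * coev_plus m n)"
proof -
  let ?Y = "phik s * coev_plus m n"
  have Y: "?Y \<in> carrier_mat (N * N) 1"
    by (rule mult_carrier_mat[OF phik_carrier coev_plus_carrier[OF N]])
  have e: "?Y $$ (k * N + l, 0) = (if idx n l = phi_index (idx n k) then s (idx n l) * coev_coeff (idx n l) else 0)"
    if kl: "k < N" "l < N" for k l
    unfolding kron_mono_mult_entry[OF coev_plus_carrier[OF N] kl zero_less_one_nat]
      coev_plus_entry[OF N nx(1)[OF kl(1)] kl(2)] using eq_nx[OF kl(2,1)] nx[OF kl(1)] by auto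
  show ?thesis
  proof (rule pair_mat_eqI[of _ N N 1 1])
    fix k l i j :: nat assume kl: "k < N" "l < N" and "i < 1" "j < 1"
    then have 0: "i * 1 + j = 0" by simp
    have "(T_mat m n * ?Y) $$ (k * N + l, 0) = qq * ?Y $$ (k * N + l, 0)"
    proof (cases "idx n l = phi_index (idx n k)")
      case True
      then have T: "idx n k = phi_index (idx n l)" by simp
      show ?thesis
        unfolding T_mult_entry[OF N Y kl zero_less_one_nat] e[OF kl] e[OF kl(2,1)] if_P[OF True] if_P[OF T]
        by (rule cup_coeff[of s "idx n l" "idx n k", OF s True, unfolded idx_less])
    next
      case False
      then have F: "idx n k \<noteq> phi_index (idx n l)" by auto
      show ?thesis
        unfolding T_mult_entry[OF N Y kl zero_less_one_nat] e[OF kl] e[OF kl(2,1)] if_not_P[OF False] if_not_P[OF F]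
        by simp
    qed
    then show "(T_mat m n * ?Y) $$ (k * N + l, i * 1 + j) = (qq \<cdot>\<^sub>m ?Y) $$ (k * N + l, i * 1 + j)"
      unfolding 0 using Y index_bound[OF kl] by (metis (no_types) carrier_matD index_smult_mat(1) zero_less_one_nat)
  qed (use Y T_mat_carrier[OF N] in auto)
qed

text \<open>The coefficients are written as s after \<open>phi_index\<close> because those of the
  inverse of \<phi> have this form.\<close>

theorem cap_mat:
  assumes s: "\<And>i. i \<le> 0 \<Longrightarrow> s (phi_index i) = s i"
  shows "ev_minus m n * (phik (\<lambda>i. s (phi_index i)) * T_mat m n) = qq \<cdot>\<^sub>m (ev_minus m n * phik (\<lambda>i. s (phi_index i)))"
proof -
  let ?K = "phik (\<lambda>i. s (phi_index i))"
  let ?W = "ev_minus m n * ?K"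
  have W: "?W \<in> carrier_mat 1 (N * N)"
    by (rule mult_carrier_mat[OF ev_minus_carrier[OF N] phik_carrier])
  have e: "?W $$ (0, i * N + j) = (if idx n j = phi_index (idx n i) then s (idx n j) * evm_coeff m n (idx n j) else 0)"
    if ij: "i < N" "j < N" for i j
    unfolding mult_kron_mono_entry[OF ev_minus_carrier[OF N] zero_less_one_nat ij]
      ev_minus_entry[OF N nx(1)[OF ij(1)] ij(2)] using eq_nx[OF ij(2,1)] nx[OF ij(1)] by auto
  have "ev_minus m n * (?K * T_mat m n) = ?W * T_mat m n"
    by (rule assoc_mult_mat[OF ev_minus_carrier[OF N] phik_carrier T_mat_carrier[OF N], symmetric])
  also have "\<dots> = qq \<cdot>\<^sub>m ?W"
  proof (rule pair_mat_eqI[of _ 1 1 N N])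
    fix k l i j :: nat assume ij: "i < N" "j < N" and "k < 1" "l < 1"
    then have 0: "k * 1 + l = 0" by simp
    have "(?W * T_mat m n) $$ (0, i * N + j) = qq * ?W $$ (0, i * N + j)"
    proof (cases "idx n j = phi_index (idx n i)")
      case True
      then have T: "idx n i = phi_index (idx n j)" by simp
      show ?thesis
        unfolding mult_T_entry[OF N W zero_less_one_nat ij] e[OF ij] e[OF ij(2,1)] if_P[OF True] if_P[OF T]
        by (rule cap_coeff[of s "idx n j" "idx n i" m n, OF s True, unfolded idx_less])
    next
      case False
      then have F: "idx n i \<noteq> phi_index (idx n j)" by auto
      show ?thesis
        unfolding mult_T_entry[OF N W zero_less_one_nat ij] e[OF ij] e[OF ij(2,1)] if_not_P[OF False] if_not_P[OF F]
        by simp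
    qed
    then show "(?W * T_mat m n) $$ (k * 1 + l, i * N + j) = (qq \<cdot>\<^sub>m ?W) $$ (k * 1 + l, i * N + j)"
      unfolding 0 using W index_bound[OF ij] by (metis (no_types) carrier_matD index_smult_mat(1) zero_less_one_nat)
  qed (use W T_mat_carrier[OF N] in auto)
  finally show ?thesis .
qed

end

section \<open>Classes of formal expressions\<close>

lemma os_eq_wf:
  "os_eq t f g \<Longrightarrow> os_wf f \<and> os_wf g \<and> os_dom f = os_dom g \<and> os_cod f = os_cod g"
proof (induction rule: os_eq.induct)
  case (rel f g)
  then show ?case by cases (simp_all add: os_R_def os_L_def)
qed auto

lemma os_cls_eq: "os_eq t f g \<Longrightarrow> os_cls t f = os_cls t g"
  unfolding os_cls_def by (blast intro: os_eq.sym os_eq.trans)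

lemma os_cls_self: "os_wf f \<Longrightarrow> f \<in> os_cls t f"
  by (simp add: os_cls_def os_eq.refl)

text \<open>The operations of \<open>OS\<close> and \<open>DS\<close> are unions over
  representatives; by congruence all classes in such a union are equal.\<close>

lemma UN2_const:
  assumes "a \<in> A" "b \<in> B" "\<And>x y. x \<in> A \<Longrightarrow> y \<in> B \<Longrightarrow> F x y = C"
  shows "(\<Union>x\<in>A. \<Union>y\<in>B. F x y) = C"
  using assms by blast

lemma UN1_const:
  assumes "a \<in> A" "\<And>x. x \<in> A \<Longrightarrow> F x = C"
  shows "(\<Union>x\<in>A. F x) = C"
  using assms by blast

lemma OS_simps:
  "Ob (OS t) = UNIV" "Hm (OS t) u v = os_cls t ` {f. os_wf f \<and> os_dom f = u \<and> os_cod f = v}"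
  "idn (OS t) u = os_cls t (OId u)" "unit_ob (OS t) = []" "ten_ob (OS t) u v = u @ v"
  by (simp_all add: OS_def)

lemma OS_cmp: "os_wf (OComp f g) \<Longrightarrow> cmp (OS t) (os_cls t f) (os_cls t g) = os_cls t (OComp f g)"
  unfolding OS_def lincat.simps
  by (rule UN2_const[OF os_cls_self os_cls_self])
    (auto simp: os_cls_def[of t f] os_cls_def[of t g] intro!: os_cls_eq[OF os_eq.sym] os_eq.cong_comp)

lemma OS_plus: "os_wf (OAdd f g) \<Longrightarrow> plus_m (OS t) (os_cls t f) (os_cls t g) = os_cls t (OAdd f g)"
  unfolding OS_def lincat.simps
  by (rule UN2_const[OF os_cls_self os_cls_self])
    (auto simp: os_cls_def[of t f] os_cls_def[of t g] intro!: os_cls_eq[OF os_eq.sym] os_eq.cong_add)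

lemma OS_scale: "os_wf f \<Longrightarrow> scale_m (OS t) c (os_cls t f) = os_cls t (OScale c f)"
  unfolding OS_def lincat.simps
  by (rule UN1_const[OF os_cls_self])
    (auto simp: os_cls_def[of t f] intro!: os_cls_eq[OF os_eq.sym] os_eq.cong_scale)

lemma OS_ten: "os_wf f \<Longrightarrow> os_wf g \<Longrightarrow> ten_mor (OS t) (os_cls t f) (os_cls t g) = os_cls t (OTens f g)"
  unfolding OS_def moncat.simps
  by (rule UN2_const[OF os_cls_self os_cls_self])
    (auto simp: os_cls_def[of t f] os_cls_def[of t g] intro!: os_cls_eq[OF os_eq.sym] os_eq.cong_tens)

lemma os_cls_Hm: "os_wf f \<Longrightarrow> os_cls t f \<in> Hm (OS t) (os_dom f) (os_cod f)"
  by (auto simp: OS_simps)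

lemma Mor_OS: "Mor (OS t) = os_cls t ` {f. os_wf f}"
  by (auto simp: Mor_def OS_simps)

section \<open>Expressions of the disoriented skein category and the right action\<close>

lemma ds_act_wf:
  "ds_wf f \<Longrightarrow> os_wf h \<Longrightarrow> ds_wf (ds_act f h) \<and> ds_dom (ds_act f h) = ds_dom f @ os_dom h
    \<and> ds_cod (ds_act f h) = ds_cod f @ os_cod h"
proof (induction f arbitrary: h)
  case (DComp f g)
  then show ?case using DComp.IH(1)[of "OId (os_cod h)"] DComp.IH(2)[of h] by simp
qed auto

lemma ds_eq_wf:
  "ds_eq t f g \<Longrightarrow> ds_wf f \<and> ds_wf g \<and> ds_dom f = ds_dom g \<and> ds_cod f = ds_cod g"
proof (induction rule: ds_eq.induct)
  case (rel f g)
  then show ?case by cases (simp_all add: os_R_def os_D_def)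
next
  case (cong_act f f' h)
  then show ?case using ds_act_wf by metis
next
  case (emb_cong g h)
  then show ?case using os_eq_wf by auto
next
  case (gen_cong g h x)
  then show ?case using os_eq_wf by auto
qed auto

text \<open>The rule \<open>ds_eq.cong_act\<close> varies only the left argument. The right one
  reaches the leaves of f, where \<open>emb_cong\<close> and \<open>gen_cong\<close> apply; in a
  composite it goes into the second factor, while the first sees only its codomain.\<close>

lemma ds_act_cong_right:
  "ds_wf f \<Longrightarrow> os_eq t h h' \<Longrightarrow> ds_eq t (ds_act f h) (ds_act f h')"
proof (induction f arbitrary: h h')
  case (DEmb g)
  then show ?case by (auto intro!: ds_eq.emb_cong os_eq.cong_tens os_eq.refl)
next
  case (DGen x g)
  then show ?case by (auto intro!: ds_eq.gen_cong os_eq.cong_tens os_eq.refl)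
next
  case (DComp f g)
  have w: "os_wf h" "os_cod h = os_cod h'" using os_eq_wf[OF DComp.prems(2)] by auto
  have "ds_wf (ds_act f (OId (os_cod h)))" "ds_wf (ds_act g h)"
    "ds_dom (ds_act f (OId (os_cod h))) = ds_cod (ds_act g h)"
    using ds_act_wf[of f "OId (os_cod h)"] ds_act_wf[of g h] DComp.prems(1) w by auto
  then show ?case
    using DComp w by (auto intro!: ds_eq.cong_comp ds_eq.refl)
next
  case (DAdd f g)
  then show ?case
    using os_eq_wf[OF DAdd.prems(2)] ds_act_wf[of f h] ds_act_wf[of g h] by (auto intro!: ds_eq.cong_add)
next
  case (DScale c f)
  then show ?case by (auto intro!: ds_eq.cong_scale)
qed

lemma ds_cls_eq: "ds_eq t f g \<Longrightarrow> ds_cls t f = ds_cls t g"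
  unfolding ds_cls_def by (blast intro: ds_eq.sym ds_eq.trans)

lemma ds_cls_self: "ds_wf f \<Longrightarrow> f \<in> ds_cls t f"
  by (simp add: ds_cls_def ds_eq.refl)

lemma DS_simps:
  "Ob (DS t) = UNIV" "Hm (DS t) u v = ds_cls t ` {f. ds_wf f \<and> ds_dom f = u \<and> ds_cod f = v}"
  "idn (DS t) u = ds_cls t (DEmb (OId u))" "act_ob (DS t) u v = u @ v"
  by (simp_all add: DS_def)

lemma DS_cmp: "ds_wf (DComp f g) \<Longrightarrow> cmp (DS t) (ds_cls t f) (ds_cls t g) = ds_cls t (DComp f g)"
  unfolding DS_def lincat.simps
  by (rule UN2_const[OF ds_cls_self ds_cls_self])
    (auto simp: ds_cls_def[of t f] ds_cls_def[of t g] intro!: ds_cls_eq[OF ds_eq.sym] ds_eq.cong_comp)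

lemma DS_plus: "ds_wf (DAdd f g) \<Longrightarrow> plus_m (DS t) (ds_cls t f) (ds_cls t g) = ds_cls t (DAdd f g)"
  unfolding DS_def lincat.simps
  by (rule UN2_const[OF ds_cls_self ds_cls_self])
    (auto simp: ds_cls_def[of t f] ds_cls_def[of t g] intro!: ds_cls_eq[OF ds_eq.sym] ds_eq.cong_add)

lemma DS_scale: "ds_wf f \<Longrightarrow> scale_m (DS t) c (ds_cls t f) = ds_cls t (DScale c f)"
  unfolding DS_def lincat.simps
  by (rule UN1_const[OF ds_cls_self])
    (auto simp: ds_cls_def[of t f] intro!: ds_cls_eq[OF ds_eq.sym] ds_eq.cong_scale)

lemma DS_act:
  assumes "ds_wf f" "os_wf h"
  shows "act_mor (DS t) (ds_cls t f) (os_cls t h) = ds_cls t (ds_act f h)"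
proof -
  have "ds_cls t (ds_act f' h') = ds_cls t (ds_act f h)" if "ds_eq t f f'" "os_eq t h h'" for f' h'
  proof -
    have "ds_eq t (ds_act f h) (ds_act f' h)" by (rule ds_eq.cong_act[OF that(1) assms(2)])
    moreover have "ds_eq t (ds_act f' h) (ds_act f' h')"
      using ds_act_cong_right ds_eq_wf[OF that(1)] that(2) by blast
    ultimately show ?thesis using ds_cls_eq ds_eq.trans by metis
  qed
  then show ?thesis
    unfolding DS_def modcat.simps
    by (intro UN2_const[OF ds_cls_self[OF assms(1)] os_cls_self[OF assms(2)]]) (auto simp: ds_cls_def[of t f] os_cls_def)
qed

lemma Mor_DS: "Mor (DS t) = ds_cls t ` {f. ds_wf f}"
  by (auto simp: Mor_def DS_simps)

section \<open>Homomorphisms of modules\<close>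

lemma mod_hom_carrier: "f \<in> mod_hom S M N \<Longrightarrow> f \<in> carrier_mat (mdim N) (mdim M)"
  by (simp add: mod_hom_def)

lemma mod_hom_iff: "f \<in> mod_hom S M N \<longleftrightarrow> f \<in> carrier_mat (mdim N) (mdim M)
    \<and> has_parity (mpar N) (mpar M) False f \<and> (\<forall>x\<in>S. mact N x * f = f * mact M x)"
  by (auto simp: mod_hom_def has_parity_def mdim_def)

lemma mod_hom_add:
  assumes f: "f \<in> mod_hom S M N" and g: "g \<in> mod_hom S M N"
    and M: "\<And>x. x \<in> S \<Longrightarrow> mact M x \<in> carrier_mat (mdim M) (mdim M)"
    and N: "\<And>x. x \<in> S \<Longrightarrow> mact N x \<in> carrier_mat (mdim N) (mdim N)"
  shows "f + g \<in> mod_hom S M N"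
proof -
  note fc = mod_hom_carrier[OF f] and gc = mod_hom_carrier[OF g]
  have "has_parity (mpar N) (mpar M) False (f + g)"
    using f g gc unfolding mod_hom_iff has_parity_def
    by (auto simp: mdim_def) (metis add.right_neutral add.left_neutral)+
  moreover have "mact N x * (f + g) = (f + g) * mact M x" if "x \<in> S" for x
    using f g that
    unfolding mult_add_distrib_mat[OF N[OF that] fc gc] add_mult_distrib_mat[OF fc gc M[OF that]]
    by (simp add: mod_hom_iff)
  ultimately show ?thesis using fc gc by (simp add: mod_hom_iff)
qed

lemma mod_hom_smult:
  assumes f: "f \<in> mod_hom S M N"
    and M: "\<And>x. x \<in> S \<Longrightarrow> mact M x \<in> carrier_mat (mdim M) (mdim M)"
    and N: "\<And>x. x \<in> S \<Longrightarrow> mact N x \<in> carrier_mat (mdim N) (mdim N)"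
  shows "c \<cdot>\<^sub>m f \<in> mod_hom S M N"
proof -
  note fc = mod_hom_carrier[OF f]
  have "has_parity (mpar N) (mpar M) False (c \<cdot>\<^sub>m f)"
    using f fc unfolding mod_hom_iff has_parity_def by (auto simp: mdim_def)
  moreover have "mact N x * (c \<cdot>\<^sub>m f) = (c \<cdot>\<^sub>m f) * mact M x" if "x \<in> S" for x
    using f that unfolding mult_smult_distrib[OF N[OF that] fc] mult_smult_assoc_mat[OF fc M[OF that]]
    by (simp add: mod_hom_iff)
  ultimately show ?thesis using fc by (simp add: mod_hom_iff)
qed

lemma mod_hom_comp:
  assumes f: "f \<in> mod_hom S N K" and g: "g \<in> mod_hom S M N"
    and M: "\<And>x. x \<in> S \<Longrightarrow> mact M x \<in> carrier_mat (mdim M) (mdim M)"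
    and N: "\<And>x. x \<in> S \<Longrightarrow> mact N x \<in> carrier_mat (mdim N) (mdim N)"
    and K: "\<And>x. x \<in> S \<Longrightarrow> mact K x \<in> carrier_mat (mdim K) (mdim K)"
  shows "f * g \<in> mod_hom S M K"
proof -
  note fc = mod_hom_carrier[OF f] and gc = mod_hom_carrier[OF g]
  have "has_parity (mpar K) (mpar M) False (f * g)"
    unfolding has_parity_def
  proof (intro allI impI)
    fix i j assume ij: "i < length (mpar K)" "j < length (mpar M)" and nz: "(f * g) $$ (i, j) \<noteq> 0"
    have "(f * g) $$ (i, j) = (\<Sum>k<mdim N. f $$ (i, k) * g $$ (k, j))"
      using ij fc gc by (simp add: mdim_def scalar_prod_def atLeast0LessThan)
    then obtain k where k: "k < mdim N" "f $$ (i, k) \<noteq> 0" "g $$ (k, j) \<noteq> 0"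
      using nz by (metis (no_types, lifting) lessThan_iff mult_zero_left mult_zero_right sum.neutral)
    then have "mpar K ! i = mpar N ! k" "mpar N ! k = mpar M ! j"
      using f g ij by (auto simp: mod_hom_iff has_parity_def mdim_def)
    then show "mpar K ! i = (mpar M ! j \<noteq> False)" by simp
  qed
  moreover have "mact K x * (f * g) = (f * g) * mact M x" if "x \<in> S" for x
  proof -
    have e: "mact K x * f = f * mact N x" "mact N x * g = g * mact M x"
      using f g that by (simp_all add: mod_hom_iff)
    show ?thesis
      unfolding assoc_mult_mat[OF K[OF that] fc gc, symmetric] e(1)
        assoc_mult_mat[OF fc N[OF that] gc] e(2) assoc_mult_mat[OF fc gc M[OF that]] ..
  qed
  ultimately show ?thesis using fc gc by (simp add: mod_hom_iff)
qed

lemma mpar_Res [simp]: "mpar (Res m n vs M) = mpar M"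
  and mdim_Res [simp]: "mdim (Res m n vs M) = mdim M"
  and mact_Res: "x \<in> Ui_sigma m n vs \<Longrightarrow> mact (Res m n vs M) x = mact M x"
  by (simp_all add: Res_def mdim_def)

lemma module_act_carrier:
  "is_module m n (carrier (U_sigma m n)) M \<Longrightarrow> x \<in> carrier (U_sigma m n) \<Longrightarrow>
    mact M x \<in> carrier_mat (mdim M) (mdim M)"
  by (auto simp: is_module_def)

lemma Res_act_carrier:
  "is_module m n (carrier (U_sigma m n)) M \<Longrightarrow> x \<in> Ui_sigma m n vs \<Longrightarrow>
    mact (Res m n vs M) x \<in> carrier_mat (mdim (Res m n vs M)) (mdim (Res m n vs M))"
  using module_act_carrier Ui_sigma_subset by (fastforce simp: mact_Res)

lemma mod_hom_Res:
  "f \<in> mod_hom (carrier (U_sigma m n)) M N \<Longrightarrow> f \<in> mod_hom (Ui_sigma m n vs) (Res m n vs M) (Res m n vs N)"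
  using Ui_sigma_subset by (fastforce simp: mod_hom_def mact_Res)

lemma mod_hom_id:
  "(\<And>x. x \<in> S \<Longrightarrow> mact M x \<in> carrier_mat (mdim M) (mdim M)) \<Longrightarrow> 1\<^sub>m (mdim M) \<in> mod_hom S M M"
  by (fastforce simp: mod_hom_def)

text \<open>This makes the description operator in \<open>Ui_tmod\<close> well defined. The identity
  matrix is a homomorphism between the equal restrictions, so \<open>coideal_intertwine\<close>
  shows that an identity matrix intertwines both tensor products, whose actions therefore
  agree.\<close>

lemma Res_tensor_cong:
  assumes M: "is_module m n (carrier (U_sigma m n)) M" and M': "is_module m n (carrier (U_sigma m n)) M'"
    and N: "is_module m n (carrier (U_sigma m n)) N" and eq: "Res m n vs M = Res m n vs M'"
  shows "Res m n vs (tensor_mod m n M N) = Res m n vs (tensor_mod m n M' N)"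
proof -
  have par: "mpar M = mpar M'" using eq by (metis mpar_Res)
  then have d: "mdim M = mdim M'" by (simp add: mdim_def)
  have a: "1\<^sub>m (mdim M) \<in> mod_hom (Ui_sigma m n vs) (Res m n vs M) (Res m n vs M')"
  proof -
    have "1\<^sub>m (mdim (Res m n vs M)) \<in> mod_hom (Ui_sigma m n vs) (Res m n vs M) (Res m n vs M)"
      by (rule mod_hom_id) (rule Res_act_carrier[OF M])
    then show ?thesis by (simp only: mdim_Res eq[symmetric])
  qed
  have b: "1\<^sub>m (mdim N) \<in> mod_hom (carrier (U_sigma m n)) N N"
    by (rule mod_hom_id) (rule module_act_carrier[OF N])
  have k: "1\<^sub>m (mdim M * mdim N)
      \<in> mod_hom (Ui_sigma m n vs) (Res m n vs (tensor_mod m n M N)) (Res m n vs (tensor_mod m n M' N))"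
    using coideal_intertwine[OF M M' N N a b] by (simp only: kron_one)
  have "mact (tensor_mod m n M N) x = mact (tensor_mod m n M' N) x" if x: "x \<in> Ui_sigma m n vs" for x
  proof -
    obtain y where y: "y \<in> FS m n" "x = ucls m n y"
      using x Ui_sigma_subset carrier_U_sigma by blast
    have c: "mact (tensor_mod m n M N) x \<in> carrier_mat (mdim M * mdim N) (mdim M * mdim N)"
      "mact (tensor_mod m n M' N) x \<in> carrier_mat (mdim M * mdim N) (mdim M * mdim N)"
      using rp_tensor_mod[OF M N y(1)] rp_tensor_mod[OF M' N y(1)] d by (simp_all add: rp_def y)
    have "mact (tensor_mod m n M' N) x * 1\<^sub>m (mdim M * mdim N) = 1\<^sub>m (mdim M * mdim N) * mact (tensor_mod m n M N) x"
      using k x by (simp add: mod_hom_def mact_Res)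
    then show ?thesis unfolding right_mult_one_mat[OF c(2)] left_mult_one_mat[OF c(1)] by simp
  qed
  then show ?thesis using par by (simp add: Res_def restrict_def fun_eq_iff)
qed

lemma tmod_is_module: "M \<in> tmod_objects m n \<Longrightarrow> is_module m n (carrier (U_sigma m n)) M"
  by (simp add: tmod_objects_def Let_def)

lemma kron_one_Suc_0 [simp]: "kron A (1\<^sub>m (Suc 0)) = A" "kron (1\<^sub>m (Suc 0)) A = A"
  using kron_one_right kron_one_left by simp_all

section \<open>The functor\<close>

fun gmat :: "nat \<Rightarrow> nat \<Rightarrow> (int \<Rightarrow> kk) \<Rightarrow> ds_gen \<Rightarrow> kk mat" where
  "gmat m n vs Tau = phi m n vs"
| "gmat m n vs TauBar = mat_inv (phi m n vs)"

locale skein_data =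
  fixes m n :: nat and vs :: "int \<Rightarrow> kk" and R :: "(arrow list, os set, smod, kk mat) fctr"
  assumes vs: "\<And>i. i \<in> I_circ m n \<Longrightarrow> vs i \<noteq> 0"
    and vs_0: "0 \<in> I_V m n \<Longrightarrow> vs 0 \<noteq> 0"
    and R: "is_R_OS m n R"
begin

abbreviation "t \<equiv> tt m n"
abbreviation "Ns \<equiv> m + 2 * n"
abbreviation "V u \<equiv> on_ob R u"
abbreviation "RV u \<equiv> Res m n vs (V u)"
abbreviation "Ui \<equiv> Ui_sigma m n vs"
abbreviation "d u \<equiv> mdim (V u)"

definition RR :: "os \<Rightarrow> kk mat" where
  "RR f = on_mor R (os_cls t f)"

lemma R_functor: "linear_functor (OS t) (U_tmod m n) R"
  using R by (simp add: is_R_OS_def strict_monoidal_functor_def)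

lemma V_tmod: "V u \<in> tmod_objects m n"
  using R_functor by (auto simp: linear_functor_def OS_simps U_tmod_def)

lemma V_module: "is_module m n (carrier (U_sigma m n)) (V u)"
  by (rule tmod_is_module[OF V_tmod])

lemma V_simps: "V [] = triv m n" "V (u @ v) = tensor_mod m n (V u) (V v)"
  "V [Up] = Vplus m n" "V [Dn] = Vminus m n"
  using R by (auto simp: is_R_OS_def strict_monoidal_functor_def OS_simps U_tmod_def)

lemma d_simps: "d [] = 1" "d (u @ v) = d u * d v" "d [Up] = Ns" "d [Dn] = Ns"
  unfolding V_simps by (simp_all add: Vplus_def Vminus_def triv_def module_of_def mdim_def)

lemma d_pairs: "d [a, b] = Ns * Ns" "d [a] = Ns"
proof -
  show "d [a] = Ns" for a by (cases a) (simp_all add: d_simps)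
  then show "d [a, b] = Ns * Ns" using d_simps(2)[of "[a]" "[b]"] by simp
qed

lemma RR_cong: "os_eq t f g \<Longrightarrow> RR f = RR g"
  by (simp add: RR_def os_cls_eq)

lemma RR_mod_hom: "os_wf f \<Longrightarrow> RR f \<in> mod_hom (carrier (U_sigma m n)) (V (os_dom f)) (V (os_cod f))"
proof -
  assume "os_wf f"
  from os_cls_Hm[OF this] show ?thesis
    using R_functor unfolding linear_functor_def RR_def by (simp add: OS_simps(1) U_tmod_def)
qed

lemma RR_carrier: "os_wf f \<Longrightarrow> RR f \<in> carrier_mat (d (os_cod f)) (d (os_dom f))"
  using mod_hom_carrier[OF RR_mod_hom] .

lemma RR_id: "RR (OId u) = 1\<^sub>m (d u)"
  using R_functor by (simp add: linear_functor_def RR_def OS_simps U_tmod_def)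

lemma RR_comp:
  assumes "os_wf (OComp f g)"
  shows "RR (OComp f g) = RR f * RR g"
proof -
  have "os_cls t f \<in> Hm (OS t) (os_cod g) (os_cod f)" "os_cls t g \<in> Hm (OS t) (os_dom g) (os_cod g)"
    using assms os_cls_Hm[of f t] os_cls_Hm[of g t] by auto
  then have "on_mor R (cmp (OS t) (os_cls t f) (os_cls t g)) = cmp (U_tmod m n) (RR f) (RR g)"
    using R_functor unfolding linear_functor_def RR_def OS_simps(1) by blast
  then show ?thesis unfolding OS_cmp[OF assms] by (simp add: RR_def U_tmod_def)
qed

lemma RR_add:
  assumes "os_wf (OAdd f g)"
  shows "RR (OAdd f g) = RR f + RR g"
proof -
  have "os_cls t f \<in> Hm (OS t) (os_dom g) (os_cod g)" "os_cls t g \<in> Hm (OS t) (os_dom g) (os_cod g)"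
    using assms os_cls_Hm[of f t] os_cls_Hm[of g t] by auto
  then have "on_mor R (plus_m (OS t) (os_cls t f) (os_cls t g)) = plus_m (U_tmod m n) (RR f) (RR g)"
    using R_functor unfolding linear_functor_def RR_def OS_simps(1) by blast
  then show ?thesis unfolding OS_plus[OF assms] by (simp add: RR_def U_tmod_def)
qed

lemma RR_scale:
  assumes "os_wf f"
  shows "RR (OScale c f) = c \<cdot>\<^sub>m RR f"
proof -
  have "on_mor R (scale_m (OS t) c (os_cls t f)) = scale_m (U_tmod m n) c (RR f)"
    using R_functor os_cls_Hm[OF assms, of t] unfolding linear_functor_def RR_def OS_simps(1) by blast
  then show ?thesis unfolding OS_scale[OF assms] by (simp add: RR_def U_tmod_def)
qed

lemma RR_tens:
  assumes "os_wf f" "os_wf g"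
  shows "RR (OTens f g) = kron (RR f) (RR g)"
proof -
  have "os_cls t f \<in> Mor (OS t)" "os_cls t g \<in> Mor (OS t)" using assms by (auto simp: Mor_OS)
  then have "on_mor R (ten_mor (OS t) (os_cls t f) (os_cls t g)) = ten_mor (U_tmod m n) (RR f) (RR g)"
    using R unfolding is_R_OS_def strict_monoidal_functor_def RR_def by blast
  then show ?thesis unfolding OS_ten[OF assms] by (simp add: RR_def U_tmod_def)
qed

text \<open>Preservation of zero morphisms is not part of \<open>linear_functor\<close>; it follows
  from f + (-1) f = 0.\<close>

lemma RR_zero: "RR (OZero u v) = 0\<^sub>m (d v) (d u)"
proof -
  have "RR (OZero u v) = RR (OAdd (OZero u v) (OScale (-1) (OZero u v)))"
    using RR_cong[OF os_eq.add_neg[of "OZero u v" t]] by simp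
  also have "\<dots> = RR (OZero u v) + (-1) \<cdot>\<^sub>m RR (OZero u v)"
    by (simp add: RR_add RR_scale)
  also have "\<dots> = 0\<^sub>m (d v) (d u)"
    using RR_carrier[of "OZero u v"] by (intro eq_matI) auto
  finally show ?thesis .
qed

lemma RR_gens: "RR (OGen Xp) = T_mat m n" "RR (OGen Cap) = ev_plus m n" "RR (OGen Cup) = coev_plus m n"
  "RR (OGen Cap') = ev_minus m n"
  using R by (simp_all add: is_R_OS_def RR_def)

text \<open>Read off from the skein relation, which R respects, so that \<open>T_mat m n\<close>
  never has to be inverted by hand.\<close>

lemma RR_Xm: "RR (OGen Xm) = T_mat m n - zz \<cdot>\<^sub>m 1\<^sub>m (Ns * Ns)"
proof -
  have "RR (OAdd (OGen Xp) (OScale (-1) (OGen Xm))) = RR (OScale (qq - inverse qq) (OId [Up, Up]))"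
    by (rule RR_cong[OF os_eq.rel[OF os_rel.skein]])
  then have e: "T_mat m n + (-1) \<cdot>\<^sub>m RR (OGen Xm) = zz \<cdot>\<^sub>m 1\<^sub>m (Ns * Ns)"
    by (simp add: RR_add RR_scale RR_id RR_gens d_pairs zz_def)
  have c: "RR (OGen Xm) \<in> carrier_mat (Ns * Ns) (Ns * Ns)"
    using RR_carrier[of "OGen Xm"] by (simp add: d_pairs)
  show ?thesis
  proof (rule eq_matI)
    fix i j assume "i < dim_row (T_mat m n - zz \<cdot>\<^sub>m 1\<^sub>m (Ns * Ns))" "j < dim_col (T_mat m n - zz \<cdot>\<^sub>m 1\<^sub>m (Ns * Ns))"
    then have ij: "i < Ns * Ns" "j < Ns * Ns" by simp_all
    have "(T_mat m n + (-1) \<cdot>\<^sub>m RR (OGen Xm)) $$ (i, j) = T_mat m n $$ (i, j) - RR (OGen Xm) $$ (i, j)"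
      using ij c by simp
    then show "RR (OGen Xm) $$ (i, j) = (T_mat m n - zz \<cdot>\<^sub>m 1\<^sub>m (Ns * Ns)) $$ (i, j)"
      unfolding e using ij c T_mat_carrier[OF HOL.refl, of m n] by (simp add: algebra_simps)
  qed (use c in auto)
qed

text \<open>The two expressions differ only in the arrows on their strands. Since V^+ and V^- have
  the same dimension, they become the same product of matrices.\<close>

lemma RR_rot:
  assumes "os_wf X" "os_dom X = [a, b]" "os_cod X = [b', c]"
  shows "a = Up \<Longrightarrow> b = Up \<Longrightarrow> b' = Up \<Longrightarrow> c = Up \<Longrightarrow> RR (os_R X) = rot_mat m n (RR X)"
    and "a = Up \<Longrightarrow> b = Dn \<Longrightarrow> b' = Dn \<Longrightarrow> c = Up \<Longrightarrow> RR (os_D X) = rot_mat m n (RR X)"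
  using assms by (simp_all add: os_R_def os_D_def rot_mat_def RR_comp RR_tens RR_id RR_gens d_pairs)

fun deval :: "ds \<Rightarrow> kk mat" where
  "deval (DEmb g) = RR g"
| "deval (DGen x g) = kron (gmat m n vs x) (RR g)"
| "deval (DComp f g) = deval f * deval g"
| "deval (DAdd f g) = deval f + deval g"
| "deval (DScale c f) = c \<cdot>\<^sub>m deval f"

lemma mat_inv_phi': "mat_inv (phi m n vs) = psi m n vs"
  using vs vs_0 by (rule mat_inv_phi)

lemma psi_eq: "psi m n vs = mono_mat m n phi_index (\<lambda>i. inverse (vs_tilde vs (phi_index i)))"
  using vs vs_0 by (rule psi_def)

lemma gmat_mod_hom: "gmat m n vs x \<in> mod_hom Ui (RV (ds_gen_dom x)) (RV (ds_gen_cod x))"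
proof (cases x)
  case Tau
  have "phi m n vs \<in> mod_hom Ui (Res m n vs (Vminus m n)) (Res m n vs (Vplus m n))"
    using vs vs_0 by (rule phi_mod_hom)
  then show ?thesis by (simp add: Tau V_simps)
next
  case TauBar
  have "psi m n vs \<in> mod_hom Ui (Res m n vs (Vplus m n)) (Res m n vs (Vminus m n))"
    using vs vs_0 by (rule psi_mod_hom)
  then show ?thesis by (simp add: TauBar V_simps mat_inv_phi')
qed

lemma RV_act: "x \<in> Ui \<Longrightarrow> mact (RV u) x \<in> carrier_mat (mdim (RV u)) (mdim (RV u))"
  by (rule Res_act_carrier[OF V_module])

lemma deval_mod_hom: "ds_wf f \<Longrightarrow> deval f \<in> mod_hom Ui (RV (ds_dom f)) (RV (ds_cod f))"
proof (induction f)
  case (DEmb g)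
  then show ?case using mod_hom_Res[OF RR_mod_hom] by simp
next
  case (DGen x g)
  then show ?case
    using coideal_intertwine[OF V_module V_module V_module V_module gmat_mod_hom RR_mod_hom]
    by (simp add: V_simps(2))
next
  case (DComp f g)
  then show ?case using mod_hom_comp[OF _ _ RV_act RV_act RV_act] by auto
next
  case (DAdd f g)
  then show ?case using mod_hom_add[OF _ _ RV_act RV_act] by auto
next
  case (DScale c f)
  then show ?case using mod_hom_smult[OF _ RV_act RV_act] by auto
qed

lemma deval_carrier: "ds_wf f \<Longrightarrow> deval f \<in> carrier_mat (d (ds_cod f)) (d (ds_dom f))"
  using mod_hom_carrier[OF deval_mod_hom] by simp

lemma gmat_carrier: "gmat m n vs x \<in> carrier_mat (d (ds_gen_cod x)) (d (ds_gen_dom x))"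
  using mod_hom_carrier[OF gmat_mod_hom] by simp

lemma deval_act: "ds_wf f \<Longrightarrow> os_wf h \<Longrightarrow> deval (ds_act f h) = kron (deval f) (RR h)"
proof (induction f arbitrary: h)
  case (DEmb g)
  then show ?case by (simp add: RR_tens)
next
  case (DGen x g)
  then show ?case by (simp add: RR_tens kron_assoc)
next
  case (DComp f g)
  then have "deval (ds_act (DComp f g) h) = kron (deval f) (1\<^sub>m (d (os_cod h))) * kron (deval g) (RR h)"
    by (simp add: RR_id)
  also have "\<dots> = kron (deval f * deval g) (1\<^sub>m (d (os_cod h)) * RR h)"
    using DComp.prems deval_carrier[of f] deval_carrier[of g] RR_carrier[of h] by (intro kron_mult) auto
  finally show ?case using RR_carrier[OF DComp.prems(2)] by simp
next
  case (DAdd f g)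
  then show ?case
    using deval_carrier[of f] deval_carrier[of g]
    by (simp add: kron_add_left[of _ "d (ds_cod g)" "d (ds_dom g)"])
next
  case (DScale c f)
  then show ?case by (simp add: kron_smult_left)
qed

lemma phi_psi_mats:
  shows "phi m n vs * mat_inv (phi m n vs) = 1\<^sub>m Ns" "mat_inv (phi m n vs) * phi m n vs = 1\<^sub>m Ns"
proof -
  show "phi m n vs * mat_inv (phi m n vs) = 1\<^sub>m Ns"
    unfolding mat_inv_phi' using vs vs_0 by (rule phi_psi)
  show "mat_inv (phi m n vs) * phi m n vs = 1\<^sub>m Ns"
    unfolding mat_inv_phi' using vs vs_0 by (rule psi_phi)
qed

lemma deval_rel:
  assumes "ds_rel f g"
  shows "deval f = deval g"
  using assms
proof cases
  case tau_taubar
  then show ?thesis by (simp add: RR_id d_simps(1) kron_one_right phi_psi_mats d_pairs)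
next
  case taubar_tau
  then show ?thesis by (simp add: RR_id d_simps(1) kron_one_right phi_psi_mats d_pairs)
next
  case reflection
  have R: "RR (os_R (OGen Xm)) = rot_mat m n (T_mat m n - zz \<cdot>\<^sub>m 1\<^sub>m (Ns * Ns))"
    using RR_rot(1)[of "OGen Xm"] by (simp add: RR_Xm)
  have D: "RR (os_D (os_R (OGen Xp))) = rot_mat m n (rot_mat m n (T_mat m n))"
    using RR_rot(1)[of "OGen Xp"] RR_rot(2)[of "os_R (OGen Xp)"] by (simp add: RR_gens os_R_def)
  show ?thesis
    unfolding reflection using reflection_mat[OF HOL.refl, of "vs_tilde vs" m n] vs_tilde_phi_index[of _ vs]
    by (simp add: R D RR_gens RR_id d_pairs phi_eq_mono_mat)
next
  case cap
  \<comment> \<open>Here s is the inverse of \<open>vs_tilde vs\<close>, which agrees on blocks just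
    as \<open>vs_tilde vs\<close> does.\<close>
  show ?thesis
    unfolding cap using cap_mat[OF HOL.refl, of "\<lambda>i. inverse (vs_tilde vs i)" m n] vs_tilde_phi_index[of _ vs]
    by (simp add: RR_gens RR_id d_pairs mat_inv_phi' psi_eq)
next
  case cup
  show ?thesis
    unfolding cup using cup_mat[OF HOL.refl, of "vs_tilde vs" m n] vs_tilde_phi_index[of _ vs]
    by (simp add: RR_gens RR_id d_pairs phi_eq_mono_mat)
qed

lemma deval_cong: "ds_eq t f g \<Longrightarrow> deval f = deval g"
proof (induction rule: ds_eq.induct)
  case (rel f g)
  then show ?case by (rule deval_rel)
next
  case (cong_act f f' h)
  then show ?case using ds_eq_wf[OF cong_act(1)] by (simp add: deval_act)
next
  case (id_left f)
  then show ?case using deval_carrier[OF id_left] by (simp add: RR_id)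
next
  case (id_right f)
  then show ?case using deval_carrier[OF id_right] by (simp add: RR_id)
next
  case (comp_assoc f g h)
  then show ?case using deval_carrier[of f] deval_carrier[of g] deval_carrier[of h] by auto
next
  case (add_assoc f g h)
  then show ?case using deval_carrier[of f] deval_carrier[of g] deval_carrier[of h]
    by (auto intro!: assoc_add_mat[of _ "d (ds_cod h)" "d (ds_dom h)"])
next
  case (add_comm f g)
  then show ?case using deval_carrier[of f] deval_carrier[of g]
    by (auto intro!: comm_add_mat[of _ "d (ds_cod g)" "d (ds_dom g)"])
next
  case (add_zero f)
  then show ?case using deval_carrier[OF add_zero] by (simp add: RR_zero)
next
  case (add_neg f)
  then show ?case using deval_carrier[OF add_neg] by (intro eq_matI) (auto simp: RR_zero)
next
  case (scale_one f)
  then show ?case by (simp add: one_smult)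
next
  case (scale_scale f a b)
  then show ?case by (intro eq_matI) auto
next
  case (scale_add f g a)
  then show ?case using deval_carrier[of f] deval_carrier[of g]
    by (intro eq_matI) (auto simp: distrib_left)
next
  case (add_scale f a b)
  then show ?case by (intro eq_matI) (auto simp: distrib_right)
next
  case (comp_add_left f g h)
  then show ?case using deval_carrier[of f] deval_carrier[of g] deval_carrier[of h]
    by (auto intro!: add_mult_distrib_mat)
next
  case (comp_add_right f g h)
  then show ?case using deval_carrier[of f] deval_carrier[of g] deval_carrier[of h]
    by (auto intro!: mult_add_distrib_mat)
next
  case (comp_scale_left f g a)
  then show ?case using deval_carrier[of f] deval_carrier[of g] by (auto intro!: mult_smult_assoc_mat)
next
  case (comp_scale_right f g a)
  then show ?case using deval_carrier[of f] deval_carrier[of g] by (auto intro!: mult_smult_distrib)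
next
  case (emb_cong g h)
  then show ?case by (simp add: RR_cong)
next
  case (emb_comp g h)
  then show ?case by (simp add: RR_comp)
next
  case (emb_add g h)
  then show ?case by (simp add: RR_add)
next
  case (emb_scale g a)
  then show ?case by (simp add: RR_scale)
next
  case (gen_cong g h x)
  then show ?case by (simp add: RR_cong)
next
  case (gen_add g h x)
  then show ?case using RR_carrier[of g] RR_carrier[of h]
    by (simp add: RR_add kron_add_right[of _ "d (os_cod h)" "d (os_dom h)"])
next
  case (gen_scale g x a)
  then show ?case by (simp add: RR_scale kron_smult_right)
next
  case (gen_left g h x)
  have "kron (1\<^sub>m (d (ds_gen_cod x))) (RR g) * kron (gmat m n vs x) (RR h)
      = kron (1\<^sub>m (d (ds_gen_cod x)) * gmat m n vs x) (RR g * RR h)"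
    using gen_left RR_carrier[of g] RR_carrier[of h] gmat_carrier by (intro kron_mult) auto
  then show ?case using gen_left gmat_carrier[of x] by (simp add: RR_tens RR_id RR_comp)
next
  case (gen_right g h x)
  then have c: "RR g \<in> carrier_mat (d (os_cod g)) (d (os_dom g))" "RR h \<in> carrier_mat (d (os_dom g)) (d (os_dom h))"
    using RR_carrier[of g] RR_carrier[of h] by auto
  have "kron (gmat m n vs x) (RR g) * kron (1\<^sub>m (d (ds_gen_dom x))) (RR h)
      = kron (gmat m n vs x * 1\<^sub>m (d (ds_gen_dom x))) (RR g * RR h)"
    by (rule kron_mult[OF gmat_carrier one_carrier_mat c])
  then show ?case using gen_right gmat_carrier[of x] by (simp add: RR_tens RR_id RR_comp)
qed auto

section \<open>The morphism of module categories and its uniqueness\<close>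

definition RDS :: "(arrow list, ds set, smod, kk mat) fctr" where
  "RDS = \<lparr>on_ob = RV, on_mor = restrict (\<lambda>A. deval (SOME f. f \<in> A)) (Mor (DS t))\<rparr>"

lemma RDS_mor: "ds_wf f \<Longrightarrow> on_mor RDS (ds_cls t f) = deval f"
proof -
  assume f: "ds_wf f"
  have "(SOME g. g \<in> ds_cls t f) \<in> ds_cls t f"
    using someI[of "\<lambda>g. g \<in> ds_cls t f" f] ds_cls_self[OF f] .
  then have "deval (SOME g. g \<in> ds_cls t f) = deval f"
    using deval_cong by (metis ds_cls_def mem_Collect_eq)
  then show ?thesis using f by (auto simp: RDS_def Mor_DS)
qed

abbreviation "target \<equiv> pullback_module R (Ui_tmod m n vs)"

lemma target_simps:
  "Ob target = Res m n vs ` tmod_objects m n" "Hm target = mod_hom Ui" "idn target = (\<lambda>M. 1\<^sub>m (mdim M))"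
  "cmp target = (*)" "plus_m target = (+)" "scale_m target = (\<cdot>\<^sub>m)" "act_mor target f A = kron f (on_mor R A)"
  by (simp_all add: pullback_module_def Ui_tmod_def)

text \<open>The object \<open>V u\<close> witnesses existence; \<open>Res_tensor_cong\<close> shows
  that any other module with the same restriction gives the same result.\<close>

lemma target_act_ob: "act_ob target (RV u) v = RV (u @ v)"
proof -
  have "(THE Y. \<exists>M\<in>tmod_objects m n. Res m n vs M = RV u \<and> Y = Res m n vs (tensor_mod m n M (V v))) = RV (u @ v)"
  proof (rule the_equality)
    show "\<exists>M\<in>tmod_objects m n. Res m n vs M = RV u \<and> RV (u @ v) = Res m n vs (tensor_mod m n M (V v))"
      by (rule bexI[OF _ V_tmod[of u]]) (simp add: V_simps(2))
  next
    fix Y assume "\<exists>M\<in>tmod_objects m n. Res m n vs M = RV u \<and> Y = Res m n vs (tensor_mod m n M (V v))"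
    then show "Y = RV (u @ v)"
      using Res_tensor_cong[OF tmod_is_module V_module V_module] by (auto simp: V_simps(2))
  qed
  then show ?thesis by (simp only: pullback_module_def Ui_tmod_def modcat.select_convs)
qed

lemma RDS_morphism: "strict_module_morphism (OS t) (DS t) target RDS"
  unfolding strict_module_morphism_def linear_functor_def
proof (intro conjI ballI allI)
  show "on_ob RDS \<in> Ob (DS t) \<rightarrow>\<^sub>E Ob target"
    by (auto simp: RDS_def DS_simps target_simps V_tmod)
  show "on_mor RDS \<in> extensional (Mor (DS t))"
    by (simp add: RDS_def)
  show "on_mor RDS f \<in> Hm target (on_ob RDS X) (on_ob RDS Y)" if "f \<in> Hm (DS t) X Y" for X Y f
    using that deval_mod_hom by (auto simp: DS_simps RDS_mor target_simps) (auto simp: RDS_def)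
  show "on_mor RDS (idn (DS t) X) = idn target (on_ob RDS X)" for X
    by (simp add: DS_simps RDS_mor target_simps RR_id) (simp add: RDS_def)
  show "on_mor RDS (cmp (DS t) f g) = cmp target (on_mor RDS f) (on_mor RDS g)"
    if "f \<in> Hm (DS t) Y Z" "g \<in> Hm (DS t) X Y" for X Y Z f g
    using that by (auto simp: DS_simps DS_cmp RDS_mor target_simps)
  show "on_mor RDS (plus_m (DS t) f g) = plus_m target (on_mor RDS f) (on_mor RDS g)"
    if "f \<in> Hm (DS t) X Y" "g \<in> Hm (DS t) X Y" for X Y f g
    using that by (auto simp: DS_simps DS_plus RDS_mor target_simps)
  show "on_mor RDS (scale_m (DS t) c f) = scale_m target c (on_mor RDS f)"
    if "f \<in> Hm (DS t) X Y" for X Y c f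
    using that by (auto simp: DS_simps DS_scale RDS_mor target_simps)
  show "on_ob RDS (act_ob (DS t) X C) = act_ob target (on_ob RDS X) C" for X C
    by (simp add: DS_simps RDS_def target_act_ob)
  show "on_mor RDS (act_mor (DS t) f g) = act_mor target (on_mor RDS f) g"
    if "f \<in> Mor (DS t)" "g \<in> Mor (OS t)" for f g
    using that by (auto simp: Mor_DS Mor_OS DS_act RDS_mor ds_act_wf deval_act target_simps RR_def)
qed

text \<open>By strictness the object [] determines all objects, and every morphism is built linearly
  from products of a morphism g with the identity of [], \<tau> or its inverse, on which H is
  prescribed.\<close>

lemma morphism_unique:
  assumes H: "strict_module_morphism (OS t) (DS t) target H"
    and H_ob: "on_ob H [] = RV []" and H_tau: "on_mor H (ds_tau t) = phi m n vs"
    and H_taubar: "on_mor H (ds_taubar t) = mat_inv (phi m n vs)"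
  shows "H = RDS"
proof -
  have lin: "linear_functor (DS t) target H" using H by (simp add: strict_module_morphism_def)
  have "on_ob H w = RV w" for w
  proof -
    have "\<forall>X\<in>Ob (DS t). \<forall>C\<in>Ob (OS t). on_ob H (act_ob (DS t) X C) = act_ob target (on_ob H X) C"
      using H unfolding strict_module_morphism_def by blast
    then have "on_ob H (act_ob (DS t) [] w) = act_ob target (on_ob H []) w"
      unfolding DS_simps(1) OS_simps(1) by blast
    then show ?thesis by (simp add: H_ob target_act_ob DS_simps)
  qed
  then have ob: "on_ob H = on_ob RDS" by (auto simp: RDS_def)
  have act: "on_mor H (ds_cls t (ds_act f g)) = kron (on_mor H (ds_cls t f)) (RR g)"
    if "ds_wf f" "os_wf g" for f g
  proof -
    have "ds_cls t f \<in> Mor (DS t)" "os_cls t g \<in> Mor (OS t)" using that by (auto simp: Mor_DS Mor_OS)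
    then have "on_mor H (act_mor (DS t) (ds_cls t f) (os_cls t g)) = act_mor target (on_mor H (ds_cls t f)) (os_cls t g)"
      using H unfolding strict_module_morphism_def by blast
    then show ?thesis using that by (simp add: DS_act target_simps RR_def)
  qed
  have hm: "ds_cls t f \<in> Hm (DS t) (ds_dom f) (ds_cod f)" if "ds_wf f" for f
    using that by (auto simp: DS_simps)
  have "on_mor H (ds_cls t f) = deval f" if "ds_wf f" for f
    using that
  proof (induction f)
    case (DEmb g)
    \<comment> \<open>An embedded g is the identity of the empty word acted on by g, so its image is
      already fixed by strictness.\<close>
    have "ds_cls t (ds_act (DEmb (OId [])) g) = ds_cls t (DEmb g)"
      using DEmb by (simp add: ds_cls_eq ds_eq.emb_cong os_eq.tens_unit_left)
    moreover have "on_mor H (ds_cls t (DEmb (OId []))) = 1\<^sub>m 1"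
      using lin H_ob d_simps(1) by (simp add: linear_functor_def DS_simps target_simps)
    ultimately show ?case using act[of "DEmb (OId [])" g] DEmb by (simp add: kron_one_left)
  next
    case (DGen x g)
    have "ds_cls t (ds_act (DGen x (OId [])) g) = ds_cls t (DGen x g)"
      using DGen by (simp add: ds_cls_eq ds_eq.gen_cong os_eq.tens_unit_left)
    moreover have "on_mor H (ds_cls t (DGen x (OId []))) = gmat m n vs x"
      using H_tau H_taubar by (cases x) (simp_all add: ds_tau_def ds_taubar_def)
    ultimately show ?case using act[of "DGen x (OId [])" g] DGen by simp
  next
    case (DComp f g)
    then have "on_mor H (cmp (DS t) (ds_cls t f) (ds_cls t g)) = cmp target (on_mor H (ds_cls t f)) (on_mor H (ds_cls t g))"
      using lin hm[of f] hm[of g] unfolding linear_functor_def DS_simps(1) by (metis UNIV_I ds_wf.simps(3))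
    then show ?case using DComp by (simp add: DS_cmp target_simps)
  next
    case (DAdd f g)
    then have "on_mor H (plus_m (DS t) (ds_cls t f) (ds_cls t g)) = plus_m target (on_mor H (ds_cls t f)) (on_mor H (ds_cls t g))"
      using lin hm[of f] hm[of g] unfolding linear_functor_def DS_simps(1) by (metis UNIV_I ds_wf.simps(4))
    then show ?case using DAdd by (simp add: DS_plus target_simps)
  next
    case (DScale c f)
    then have "on_mor H (scale_m (DS t) c (ds_cls t f)) = scale_m target c (on_mor H (ds_cls t f))"
      using lin hm[of f] unfolding linear_functor_def DS_simps(1) by (metis UNIV_I ds_wf.simps(5))
    then show ?case using DScale by (simp add: DS_scale target_simps)
  qed
  then have "on_mor H A = on_mor RDS A" if "A \<in> Mor (DS t)" for A
    using that by (auto simp: Mor_DS RDS_mor)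
  moreover have "on_mor H \<in> extensional (Mor (DS t))" "on_mor RDS \<in> extensional (Mor (DS t))"
    using lin RDS_morphism by (simp_all add: linear_functor_def strict_module_morphism_def)
  ultimately have "on_mor H = on_mor RDS" by (intro extensionalityI)
  with ob show ?thesis by simp
qed

lemma RDS_values: "on_ob RDS [] = RV []" "on_mor RDS (ds_tau t) = phi m n vs"
  "on_mor RDS (ds_taubar t) = mat_inv (phi m n vs)"
  by (simp_all add: ds_tau_def ds_taubar_def RDS_mor RR_id d_simps(1) kron_one_right) (simp add: RDS_def)

end

theorem theorem6p4:
  fixes m n :: nat
    and vs :: "int \<Rightarrow> kk"
    and R :: "(arrow list, os set, smod, kk mat) fctr"
  assumes vs: "\<And>i. i \<in> I_circ m n \<Longrightarrow> vs i \<noteq> 0"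
    and vs_0: "0 \<in> I_V m n \<Longrightarrow> vs 0 \<noteq> 0"
    and R: "is_R_OS m n R"
  shows "\<exists>!H :: (arrow list, ds set, smod, kk mat) fctr.
    strict_module_morphism (OS (tt m n)) (DS (tt m n)) (pullback_module R (Ui_tmod m n vs)) H
    \<and> on_ob H [] = Res m n vs (triv m n)
    \<and> on_mor H (ds_tau (tt m n)) = phi m n vs
    \<and> on_mor H (ds_taubar (tt m n)) = mat_inv (phi m n vs)"
proof -
  interpret skein_data m n vs R
    using assms by unfold_locales
  show ?thesis
  proof (rule ex1I[of _ RDS])
    show "strict_module_morphism (OS t) (DS t) target RDS \<and> on_ob RDS [] = Res m n vs (triv m n)
      \<and> on_mor RDS (ds_tau t) = phi m n vs \<and> on_mor RDS (ds_taubar t) = mat_inv (phi m n vs)"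
      by (intro conjI RDS_morphism RDS_values[unfolded V_simps(1)])
  next
    fix H assume "strict_module_morphism (OS t) (DS t) target H \<and> on_ob H [] = Res m n vs (triv m n)
      \<and> on_mor H (ds_tau t) = phi m n vs \<and> on_mor H (ds_taubar t) = mat_inv (phi m n vs)"
    then show "H = RDS"
      by (elim conjE, intro morphism_unique[unfolded V_simps(1)])
  qed
qed

end
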